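(* The following question has a negative answer in general. Let $A$ be a principal ideal domain with identity element different from the zero element, let $f:M\to N$ be an SGL map from an $m$-dimensional closed connected manifold into an $n$-dimensional manifold without boundary, $m>n\ge1$, with $F$ and all preimages $q_f^{-1}(p)$, $p\in\partial W_f$, connected, and let $\alpha_1,\dots,\alpha_r$ be finitely many curves in $W_f$ along which reference homomorphisms are defined. Suppose that: (a) there are elements of homology groups $H_{d}(F;A)$ of degrees $d\ge1$ which are generators of the kernels of the reference homomorphisms along these curves, and for which one can choose cohomology duals respecting some suitable basis; (b) the set of these cohomology duals generates the cohomology ring $H^*(F;A)$. Question: do these two conditions imply that the reference homomorphisms along the curves between the homology groups (with coefficients in $A$) of degrees at least $1$ are always the zero homomorphisms? That is, there exist cases satisfying (a) and (b) in which some such reference homomorphism of degree at least $1$ is not the zero homomorphism.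
   Context: All manifolds and maps are smooth. For a smooth map $c:X\to Y$, the singular set $S(c)$ is the set of points where the rank of the differential is smaller than $\min(\dim X,\dim Y)$. Smooth manifolds are also regarded as PL manifolds in the canonical way. SGL map: let $m\ge n\ge 1$. A special-generic-like (SGL) map is a smooth map $f:M\to N$ from an $m$-dimensional closed connected manifold into an $n$-dimensional manifold without boundary such that: (1) the image $f(M)$ is the image of some smooth immersion $\bar f:W_f\to N$ of some $n$-dimensional compact connected manifold $W_f$; (2) there is a smooth surjection $q_f:M\to W_f$ with $f=\bar f\circ q_f$, and $q_f$ can be chosen so that its restriction to the singular set $S(f)$ gives a diffeomorphism onto the boundary $\partial W_f$; (3) there is a small collar neighborhood $N(\partial W_f)$ of $\partial W_f$ such that the composition of the restriction of $q_f$ to $q_f^{-1}(N(\partial W_f))$ with the canonical projection $N(\partial W_f)\to\partial W_f$ is the projection of a smooth bundle over $\partial W_f$; (4) around each $p\in\partial W_f$, on $N(\partial W_f)$ and its preimage, $q_f$ is represented, for suitable local coordinates, as the product map of the identity map on a small open neighborhood of $p$ in $\partial W_f$ and a smooth function $\tilde f_p$ on an $(m-n+1)$-dimensional compact connected manifold $E_p$, where: the image of $\tilde f_p$ is an interval $[\min_p,\max_p]$; $\partial E_p$ is the preimage of one of the two end values; the singular set of $\tilde f_p$ lies in $\mathrm{Int}\,E_p$; the preimage of a value contains singular points if and only if the value is the other end value; and the preimage of that other end value is a subpolyhedron of dimension at most $m-n$; (5) the restriction of $q_f$ to $q_f^{-1}(W_f-\mathrm{Int}\,N(\partial W_f))$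 is the projection of a smooth bundle whose fiber is a smooth closed manifold $F$, and each $\partial E_p$ is diffeomorphic to $F$. Reference homomorphism: assume $m>n$ and that $F$ and all $q_f^{-1}(p)$, $p\in\partial W_f$, are connected. Fix $q\in\mathrm{Int}\,W_f$ and identify $F$ with $q_f^{-1}(q)$. Let $\alpha:[0,1]\to W_f$ be a smooth embedding with $\alpha(0)=q$, $\alpha([0,1))\subset\mathrm{Int}\,W_f$, $\alpha(1)\in\partial W_f$, and transverse to $\partial W_f$ at $\alpha(1)$. Then $q_f^{-1}(\alpha([0,1]))$ is regarded as $E_p$, $p=\alpha(1)$. The homomorphisms $\pi_j(F)\to\pi_j(E_p)$ and $H_j(F;A)\to H_j(E_p;A)$ induced by the inclusion of $F$ into $E_p$ are called the reference homomorphisms along $\alpha$. Cohomology dual: let $B$ be an $A$-module having a unique maximal free submodule, of finite rank $l$, with basis $\mathcal B=\{e_j\}_{j=1}^l$ of elements not divisible by non-units of $A$. The dual to $e_{j_1}$ respecting $\mathcal B$ is the homomorphism $B\to A$ determined by $e_{j_1}\mapsto 1$ and $e_{j_2}\mapsto 0$ for $j_2\ne j_1$. When $B$ is a homology group of a topological space, it is called the cohomology dual to $e_{j_1}$ respecting $\mathcal B$.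
   Formalization: In condition (2), q_f on S(f) is only required to map onto the boundary of W_f with local smooth sections through each point of S(f), not to be injective; by (4), injectivity would make every E_p contractible and all reference homomorphisms of degree at least 1 zero. *)

theory Defs
  imports "HOL-Analysis.Analysis" "HOL-Homology.Homology" "HOL-Algebra.Generated_Rings" "HOL-Algebra.Ring_Divisibility"
    "Jordan_Normal_Form.DL_Rank"
begin

section \<open>Smooth maps between subsets of Euclidean spaces\<close>

text \<open>
  The space \<open>\<real>\<^sup>k\<close> is \<^term>\<open>Euclidean_space k\<close>, whose points are the functions \<^typ>\<open>nat \<Rightarrow> real\<close>
  vanishing at all indices \<open>\<ge> k\<close>; so the dimension is a term and can be quantified over.
\<close>

definition partial :: "nat \<Rightarrow> ((nat \<Rightarrow> real) \<Rightarrow> real) \<Rightarrow> (nat \<Rightarrow> real) \<Rightarrow> real" where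
  "partial j g x = deriv (\<lambda>t. g (x(j := t))) (x j)"

text \<open>\<open>C\<^sup>\<infinity>\<close> on an open set: all iterated partial derivatives exist and are continuous.\<close>

definition smooth_fun :: "nat \<Rightarrow> (nat \<Rightarrow> real) set \<Rightarrow> ((nat \<Rightarrow> real) \<Rightarrow> real) \<Rightarrow> bool" where
  "smooth_fun k U g \<longleftrightarrow>
     (\<forall>js \<in> lists {..<k}.
        continuous_map (subtopology (Euclidean_space k) U) euclideanreal (foldr partial js g) \<and>
        (\<forall>x\<in>U. \<forall>j<k. (\<lambda>t. foldr partial js g (x(j := t))) field_differentiable (at (x j))))"

text \<open>A map on an arbitrary subset of \<open>\<real>\<^sup>k\<close> is smooth if it locally extends to a smooth map on an
  open subset of \<open>\<real>\<^sup>k\<close>.\<close>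

definition smooth_on ::
    "nat \<Rightarrow> nat \<Rightarrow> (nat \<Rightarrow> real) set \<Rightarrow> ((nat \<Rightarrow> real) \<Rightarrow> nat \<Rightarrow> real) \<Rightarrow> bool" where
  "smooth_on k l S g \<longleftrightarrow>
     (\<forall>x\<in>S. \<exists>U G. openin (Euclidean_space k) U \<and> x \<in> U \<and>
        (\<forall>i<l. smooth_fun k U (\<lambda>y. G y i)) \<and> (\<forall>y \<in> U \<inter> S. \<forall>i<l. G y i = g y i))"

section \<open>Smooth manifolds, possibly with boundary\<close>

text \<open>The charts are modelled on the half-spaces given by the last coordinate, so that
  the charts of the boundary are restrictions of charts.\<close>

definition half_space :: "nat \<Rightarrow> (nat \<Rightarrow> real) set" where
  "half_space k = {x \<in> topspace (Euclidean_space k). 0 < k \<longrightarrow> 0 \<le> x (k - 1)}"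

record 'a smfd =
  mdim :: nat
  mtop :: "'a topology"
  matlas :: "('a set \<times> ('a \<Rightarrow> nat \<Rightarrow> real)) set"

definition smooth_chart :: "'a smfd \<Rightarrow> 'a set \<Rightarrow> ('a \<Rightarrow> nat \<Rightarrow> real) \<Rightarrow> bool" where
  "smooth_chart X U \<phi> \<longleftrightarrow>
     openin (mtop X) U \<and>
     (openin (Euclidean_space (mdim X)) (\<phi> ` U) \<or>
      openin (subtopology (Euclidean_space (mdim X)) (half_space (mdim X))) (\<phi> ` U)) \<and>
     homeomorphic_map (subtopology (mtop X) U) (subtopology (Euclidean_space (mdim X)) (\<phi> ` U)) \<phi>"

definition smooth_manifold :: "'a smfd \<Rightarrow> bool" where
  "smooth_manifold X \<longleftrightarrow>
     Hausdorff_space (mtop X) \<and> second_countable (mtop X) \<and>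
     \<Union> (fst ` matlas X) = topspace (mtop X) \<and>
     (\<forall>(U, \<phi>) \<in> matlas X. smooth_chart X U \<phi>) \<and>
     (\<forall>(U, \<phi>) \<in> matlas X. \<forall>(V, \<psi>) \<in> matlas X.
        smooth_on (mdim X) (mdim X) (\<phi> ` (U \<inter> V)) (\<psi> \<circ> inv_into U \<phi>))"

definition mfd_interior :: "'a smfd \<Rightarrow> 'a set" where
  "mfd_interior X =
     {x. \<exists>(U, \<phi>) \<in> matlas X. x \<in> U \<and> \<phi> x \<in> Euclidean_space (mdim X) interior_of (\<phi> ` U)}"

definition mfd_boundary :: "'a smfd \<Rightarrow> 'a set" where
  "mfd_boundary X = topspace (mtop X) - mfd_interior X"

definition connected_mfd :: "'a smfd \<Rightarrow> bool" where
  "connected_mfd X \<longleftrightarrow> connected_space (mtop X) \<and> topspace (mtop X) \<noteq> {}"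

definition closed_mfd :: "'a smfd \<Rightarrow> bool" where
  "closed_mfd X \<longleftrightarrow> smooth_manifold X \<and> compact_space (mtop X) \<and> mfd_boundary X = {}"

definition boundary_mfd :: "'a smfd \<Rightarrow> 'a smfd" where
  "boundary_mfd X =
     \<lparr>mdim = mdim X - 1,
      mtop = subtopology (mtop X) (mfd_boundary X),
      matlas = (\<lambda>(U, \<phi>). (U \<inter> mfd_boundary X, \<phi>)) ` matlas X\<rparr>"

definition interior_mfd :: "'a smfd \<Rightarrow> 'a smfd" where
  "interior_mfd X =
     \<lparr>mdim = mdim X,
      mtop = subtopology (mtop X) (mfd_interior X),
      matlas = (\<lambda>(U, \<phi>). (U \<inter> mfd_interior X, \<phi>)) ` matlas X\<rparr>"

definition euclid_mfd :: "nat \<Rightarrow> (nat \<Rightarrow> real) smfd" where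
  "euclid_mfd k =
     \<lparr>mdim = k, mtop = Euclidean_space k, matlas = {(topspace (Euclidean_space k), id)}\<rparr>"

definition real_line :: "real smfd" where
  "real_line =
     \<lparr>mdim = 1, mtop = euclideanreal, matlas = {(UNIV, \<lambda>t i. if i = 0 then t else 0)}\<rparr>"

text \<open>The product is only used when the first factor has empty boundary; the last coordinate of a
  product chart is then the last coordinate of the second factor, so that no corners arise.\<close>

definition prod_mfd :: "'a smfd \<Rightarrow> 'b smfd \<Rightarrow> ('a \<times> 'b) smfd" where
  "prod_mfd X Y =
     \<lparr>mdim = mdim X + mdim Y,
      mtop = prod_topology (mtop X) (mtop Y),
      matlas = (\<lambda>((U, \<phi>), (V, \<psi>)).
          (U \<times> V, \<lambda>(x, y) i. if i < mdim X then \<phi> x i else \<psi> y (i - mdim X)))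
        ` (matlas X \<times> matlas Y)\<rparr>"

text \<open>Smooth maps and diffeomorphisms between arbitrary subsets of manifolds.\<close>

definition smooth_between :: "'a smfd \<Rightarrow> 'a set \<Rightarrow> 'b smfd \<Rightarrow> 'b set \<Rightarrow> ('a \<Rightarrow> 'b) \<Rightarrow> bool" where
  "smooth_between X S Y T g \<longleftrightarrow>
     S \<subseteq> topspace (mtop X) \<and> T \<subseteq> topspace (mtop Y) \<and>
     continuous_map (subtopology (mtop X) S) (subtopology (mtop Y) T) g \<and>
     (\<forall>(U, \<phi>) \<in> matlas X. \<forall>(V, \<psi>) \<in> matlas Y.
        smooth_on (mdim X) (mdim Y) (\<phi> ` (U \<inter> S \<inter> g -` V)) (\<psi> \<circ> g \<circ> inv_into U \<phi>))"

abbreviation smooth_map :: "'a smfd \<Rightarrow> 'b smfd \<Rightarrow> ('a \<Rightarrow> 'b) \<Rightarrow> bool" where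
  "smooth_map X Y g \<equiv> smooth_between X (topspace (mtop X)) Y (topspace (mtop Y)) g"

definition diffeo_between :: "'a smfd \<Rightarrow> 'a set \<Rightarrow> 'b smfd \<Rightarrow> 'b set \<Rightarrow> ('a \<Rightarrow> 'b) \<Rightarrow> bool" where
  "diffeo_between X S Y T g \<longleftrightarrow>
     smooth_between X S Y T g \<and>
     (\<exists>h. smooth_between Y T X S h \<and> (\<forall>x\<in>S. h (g x) = x) \<and> (\<forall>y\<in>T. g (h y) = y))"

definition diffeomorphic_mfd :: "'a smfd \<Rightarrow> 'b smfd \<Rightarrow> bool" where
  "diffeomorphic_mfd X Y \<longleftrightarrow>
     (\<exists>g. diffeo_between X (topspace (mtop X)) Y (topspace (mtop Y)) g)"

text \<open>The derivative within the domain also makes sense at boundary points, where it is one-sided.\<close>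

definition partial_within ::
    "(nat \<Rightarrow> real) set \<Rightarrow> nat \<Rightarrow> ((nat \<Rightarrow> real) \<Rightarrow> real) \<Rightarrow> (nat \<Rightarrow> real) \<Rightarrow> real" where
  "partial_within S j g a = vector_derivative (\<lambda>t. g (a(j := t))) (at (a j) within {t. a(j := t) \<in> S})"

definition differential_rank :: "'a smfd \<Rightarrow> 'b smfd \<Rightarrow> ('a \<Rightarrow> 'b) \<Rightarrow> 'a \<Rightarrow> nat \<Rightarrow> bool" where
  "differential_rank X Y c x r \<longleftrightarrow>
     (\<exists>(U, \<phi>) \<in> matlas X. \<exists>(V, \<psi>) \<in> matlas Y. x \<in> U \<and> c x \<in> V \<and>
        vec_space.rank (mdim Y)
          (Matrix.mat (mdim Y) (mdim X)
            (\<lambda>(i, j). partial_within (\<phi> ` (U \<inter> c -` V)) j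
                        (\<lambda>y. (\<psi> \<circ> c \<circ> inv_into U \<phi>) y i) (\<phi> x))) = r)"

definition singular_set :: "'a smfd \<Rightarrow> 'b smfd \<Rightarrow> ('a \<Rightarrow> 'b) \<Rightarrow> 'a set" where
  "singular_set X Y c =
     {x \<in> topspace (mtop X). \<exists>r < min (mdim X) (mdim Y). differential_rank X Y c x r}"

definition immersion :: "'a smfd \<Rightarrow> 'b smfd \<Rightarrow> ('a \<Rightarrow> 'b) \<Rightarrow> bool" where
  "immersion X Y c \<longleftrightarrow>
     smooth_map X Y c \<and> (\<forall>x \<in> topspace (mtop X). differential_rank X Y c x (mdim X))"

section \<open>Subpolyhedra of compact smooth manifolds\<close>

text \<open>Finite simplicial complexes are given abstractly, by their nonempty vertex sets, and
  realized in barycentric coordinates.\<close>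

definition finite_complex :: "nat \<Rightarrow> nat set set \<Rightarrow> bool" where
  "finite_complex k K \<longleftrightarrow>
     (\<forall>s\<in>K. s \<subseteq> {..<k} \<and> s \<noteq> {}) \<and> (\<forall>s\<in>K. \<forall>t. t \<subseteq> s \<and> t \<noteq> {} \<longrightarrow> t \<in> K)"

definition realization :: "nat set set \<Rightarrow> (nat \<Rightarrow> real) set" where
  "realization K = {x. (\<forall>i. 0 \<le> x i) \<and> {i. x i \<noteq> 0} \<in> K \<and> (\<Sum>i | x i \<noteq> 0. x i) = 1}"

text \<open>The canonical PL structure of a smooth manifold is the one of its smooth triangulations:
  homeomorphisms from polyhedra that are smooth embeddings on every closed simplex.\<close>

definition smooth_triangulation ::
    "'a smfd \<Rightarrow> nat \<Rightarrow> nat set set \<Rightarrow> ((nat \<Rightarrow> real) \<Rightarrow> 'a) \<Rightarrow> bool" where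
  "smooth_triangulation X k K h \<longleftrightarrow>
     finite_complex k K \<and>
     homeomorphic_map (subtopology (Euclidean_space k) (realization K)) (mtop X) h \<and>
     (\<forall>s\<in>K. diffeo_between (euclid_mfd k) (realization (Pow s)) X (h ` realization (Pow s)) h)"

definition subpolyhedron :: "'a smfd \<Rightarrow> nat \<Rightarrow> 'a set \<Rightarrow> bool" where
  "subpolyhedron X d P \<longleftrightarrow>
     (\<exists>k K h L. smooth_triangulation X k K h \<and> finite_complex k L \<and> L \<subseteq> K \<and>
        (\<forall>s\<in>L. card s \<le> d + 1) \<and> P = h ` realization L)"

section \<open>Special-generic-like maps\<close>

text \<open>A collar neighbourhood of the boundary: its interior is the image of
  \<open>\<partial>W \<times> [0,1)\<close>, and \<open>\<kappa> (x, t) \<mapsto> x\<close> is its canonical projection.\<close>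

definition collar :: "'w smfd \<Rightarrow> ('w \<times> real \<Rightarrow> 'w) \<Rightarrow> bool" where
  "collar W \<kappa> \<longleftrightarrow>
     diffeo_between (prod_mfd (boundary_mfd W) real_line) (mfd_boundary W \<times> {0..1})
       W (\<kappa> ` (mfd_boundary W \<times> {0..1})) \<kappa> \<and>
     (\<forall>x \<in> mfd_boundary W. \<kappa> (x, 0) = x) \<and>
     openin (mtop W) (\<kappa> ` (mfd_boundary W \<times> {0..<1}))"

definition collar_proj :: "'w smfd \<Rightarrow> ('w \<times> real \<Rightarrow> 'w) \<Rightarrow> 'w \<Rightarrow> 'w" where
  "collar_proj W \<kappa> w = fst (inv_into (mfd_boundary W \<times> {0..1}) \<kappa> w)"

abbreviation preimage_mfd :: "'m smfd \<Rightarrow> ('m \<Rightarrow> 'w) \<Rightarrow> 'w set \<Rightarrow> 'm set" where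
  "preimage_mfd M q C \<equiv> topspace (mtop M) \<inter> q -` C"

text \<open>Near \<open>b\<close>, the map \<open>\<pi>\<close> from \<open>T \<subseteq> M\<close> to the subset \<open>C\<close> of the boundaryless manifold \<open>Y\<close> is a
  trivial smooth bundle with fibre \<open>E\<close>.\<close>

definition locally_trivial_at ::
    "'m smfd \<Rightarrow> 'm set \<Rightarrow> 'w smfd \<Rightarrow> 'w set \<Rightarrow> ('m \<Rightarrow> 'w) \<Rightarrow> 'e smfd \<Rightarrow> 'w \<Rightarrow> bool" where
  "locally_trivial_at M T Y C \<pi> E b \<longleftrightarrow>
     (\<exists>V \<Phi>. openin (subtopology (mtop Y) C) V \<and> b \<in> V \<and>
        diffeo_between (prod_mfd Y E) (V \<times> topspace (mtop E)) M (T \<inter> \<pi> -` V) \<Phi> \<and>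
        (\<forall>v\<in>V. \<forall>y \<in> topspace (mtop E). \<pi> (\<Phi> (v, y)) = v))"

text \<open>
  How \<open>q\<close> relates the singular set \<open>S\<close> of an SGL map to \<open>\<partial>W\<close>: \<open>q\<close> maps \<open>S\<close> onto \<open>\<partial>W\<close> and every
  point of \<open>S\<close> lies on a local smooth section, inside \<open>S\<close>, of this map. That is, \<open>q\<close> induces a
  diffeomorphism onto \<open>\<partial>W\<close> from \<open>S\<close> with the points of each fibre of \<open>q\<close> identified; if \<open>q\<close> is
  injective on \<open>S\<close>, this says that \<open>q\<close> restricts to a diffeomorphism from \<open>S\<close> onto \<open>\<partial>W\<close>.
  Injectivity on \<open>S\<close> is not required: by the local product form of \<open>q\<close> over the collar, \<open>S\<close> contains
  every fibre over \<open>\<partial>W\<close>, and these fibres are polyhedra which may have positive dimension. If they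
  were single points, every compact manifold \<open>E\<close> in the local form would be contractible, and all
  reference homomorphisms in degrees at least \<open>1\<close> would vanish.
\<close>

definition singular_set_onto_boundary ::
    "'m smfd \<Rightarrow> 'm set \<Rightarrow> 'w smfd \<Rightarrow> ('m \<Rightarrow> 'w) \<Rightarrow> bool" where
  "singular_set_onto_boundary M S W q \<longleftrightarrow>
     q ` S = mfd_boundary W \<and>
     (\<forall>x\<in>S. \<exists>V s. openin (mtop (boundary_mfd W)) V \<and> q x \<in> V \<and>
        smooth_between (boundary_mfd W) V M S s \<and> s (q x) = x \<and> (\<forall>v\<in>V. q (s v) = v))"

text \<open>The form of \<open>q\<close> over the collar around \<open>p \<in> \<partial>W\<close>: the product of the identity of an open
  neighbourhood \<open>U\<close> of \<open>p\<close> in \<open>\<partial>W\<close> and a function \<open>g\<close> on the compact connected manifold \<open>E\<close>, where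
  the coordinates \<open>\<Theta>\<close> on the collar respect its projection. Here \<open>e1\<close> and \<open>e2\<close> are the two ends of
  the interval \<open>g(E) = [a,b]\<close>.\<close>

definition sgl_local_form ::
    "'m smfd \<Rightarrow> 'w smfd \<Rightarrow> ('w \<times> real \<Rightarrow> 'w) \<Rightarrow> ('m \<Rightarrow> 'w) \<Rightarrow> 'e smfd \<Rightarrow> 'w \<Rightarrow> bool" where
  "sgl_local_form M W \<kappa> q E p \<longleftrightarrow>
     smooth_manifold E \<and> mdim E = mdim M - mdim W + 1 \<and> compact_space (mtop E) \<and> connected_mfd E \<and>
     (\<exists>U g a b e1 e2 \<Phi> \<Theta>.
        openin (mtop (boundary_mfd W)) U \<and> p \<in> U \<and>
        smooth_map E real_line g \<and> a < b \<and> {e1, e2} = {a, b} \<and>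
        g ` topspace (mtop E) = {a..b} \<and>
        mfd_boundary E = preimage_mfd E g {e1} \<and>
        singular_set E real_line g \<subseteq> mfd_interior E \<and>
        (\<forall>v. singular_set E real_line g \<inter> g -` {v} \<noteq> {} \<longleftrightarrow> v = e2) \<and>
        subpolyhedron E (mdim M - mdim W) (preimage_mfd E g {e2}) \<and>
        diffeo_between (prod_mfd (boundary_mfd W) E) (U \<times> topspace (mtop E))
          M (preimage_mfd M q (\<kappa> ` (U \<times> {0..1}))) \<Phi> \<and>
        diffeo_between (prod_mfd (boundary_mfd W) real_line) (U \<times> {a..b})
          W (\<kappa> ` (U \<times> {0..1})) \<Theta> \<and>
        (\<forall>u\<in>U. \<forall>t\<in>{a..b}. collar_proj W \<kappa> (\<Theta> (u, t)) = u) \<and>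
        (\<forall>u\<in>U. \<forall>x \<in> topspace (mtop E). q (\<Phi> (u, x)) = \<Theta> (u, g x)))"

text \<open>
  \<open>f : M \<rightarrow> N\<close> is an SGL map, with the data \<open>f = fbar \<circ> q\<close>, where \<open>q\<close> maps \<open>M\<close> onto \<open>W\<close>, and with
  regular fibre \<open>F\<close>. The fibre of the bundle over \<open>\<partial>W\<close> may change from one component of \<open>\<partial>W\<close> to
  another. Every (second countable) manifold has a diffeomorphic copy whose points form a subset of
  the type \<^typ>\<open>nat \<Rightarrow> real\<close>, which is therefore used for the existentially bound fibres.
\<close>

definition sgl_structure ::
    "'m smfd \<Rightarrow> 'n smfd \<Rightarrow> ('m \<Rightarrow> 'n) \<Rightarrow> 'w smfd \<Rightarrow> ('w \<Rightarrow> 'n) \<Rightarrow> ('m \<Rightarrow> 'w) \<Rightarrow> 'f smfd \<Rightarrow> bool" where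
  "sgl_structure M N f W fbar q F \<longleftrightarrow>
     1 \<le> mdim N \<and> mdim N \<le> mdim M \<and>
     closed_mfd M \<and> connected_mfd M \<and>
     smooth_manifold N \<and> mfd_boundary N = {} \<and>
     smooth_map M N f \<and>
     smooth_manifold W \<and> mdim W = mdim N \<and> compact_space (mtop W) \<and> connected_mfd W \<and>
     immersion W N fbar \<and> f ` topspace (mtop M) = fbar ` topspace (mtop W) \<and>
     smooth_map M W q \<and> q ` topspace (mtop M) = topspace (mtop W) \<and>
     (\<forall>x \<in> topspace (mtop M). f x = fbar (q x)) \<and>
     singular_set_onto_boundary M (singular_set M N f) W q \<and>
     closed_mfd F \<and> mdim F = mdim M - mdim N \<and>
     (\<exists>\<kappa>. collar W \<kappa> \<and>
        (\<forall>b \<in> mfd_boundary W. \<exists>E :: (nat \<Rightarrow> real) smfd. smooth_manifold E \<and>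
           locally_trivial_at M (preimage_mfd M q (\<kappa> ` (mfd_boundary W \<times> {0..1})))
             (boundary_mfd W) (mfd_boundary W) (collar_proj W \<kappa> \<circ> q) E b) \<and>
        (\<forall>p \<in> mfd_boundary W. \<exists>E :: (nat \<Rightarrow> real) smfd.
           sgl_local_form M W \<kappa> q E p \<and> diffeomorphic_mfd (boundary_mfd E) F) \<and>
        (let C = topspace (mtop W) - \<kappa> ` (mfd_boundary W \<times> {0..<1})
         in \<forall>b\<in>C. locally_trivial_at M (preimage_mfd M q C) (interior_mfd W) C q F b))"

text \<open>Transversality to \<open>\<partial>W\<close>: in a chart, the last coordinate of the velocity is nonzero.\<close>

definition reference_curve :: "'w smfd \<Rightarrow> 'w \<Rightarrow> (real \<Rightarrow> 'w) \<Rightarrow> bool" where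
  "reference_curve W w0 \<alpha> \<longleftrightarrow>
     diffeo_between real_line {0..1} W (\<alpha> ` {0..1}) \<alpha> \<and>
     \<alpha> 0 = w0 \<and> \<alpha> ` {0..<1} \<subseteq> mfd_interior W \<and> \<alpha> 1 \<in> mfd_boundary W \<and>
     (\<exists>(U, \<phi>) \<in> matlas W. \<alpha> 1 \<in> U \<and>
        vector_derivative (\<lambda>t. \<phi> (\<alpha> t) (mdim W - 1)) (at 1 within {t \<in> {0..1}. \<alpha> t \<in> U}) \<noteq> 0)"

section \<open>Singular homology and cohomology with coefficients in a commutative ring\<close>

definition quotient_module :: "('a, 'b) module \<Rightarrow> 'b set \<Rightarrow> ('a, 'b set) module" where
  "quotient_module M H =
     \<lparr>carrier = a_rcosets\<^bsub>M\<^esub> H, mult = undefined, one = undefined, zero = H, add = set_add M,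
      smult = (\<lambda>r X. \<Union>x\<in>X. H +>\<^bsub>M\<^esub> (r \<odot>\<^bsub>M\<^esub> x))\<rparr>"

text \<open>A chain is the family of its coefficients, indexed by the singular simplices.\<close>

type_synonym ('a, 'r) cochain = "((nat \<Rightarrow> real) \<Rightarrow> 'a) \<Rightarrow> 'r"

definition chain_module :: "'r ring \<Rightarrow> nat \<Rightarrow> 'a topology \<Rightarrow> ('r, ('a, 'r) cochain) module" where
  "chain_module A p X =
     \<lparr>carrier = {c. (\<forall>\<sigma>. c \<sigma> \<in> carrier A) \<and> finite {\<sigma>. c \<sigma> \<noteq> \<zero>\<^bsub>A\<^esub>} \<and>
                    {\<sigma>. c \<sigma> \<noteq> \<zero>\<^bsub>A\<^esub>} \<subseteq> singular_simplex_set p X},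
      mult = undefined, one = undefined,
      zero = (\<lambda>\<sigma>. \<zero>\<^bsub>A\<^esub>), add = (\<lambda>c d \<sigma>. c \<sigma> \<oplus>\<^bsub>A\<^esub> d \<sigma>), smult = (\<lambda>r c \<sigma>. r \<otimes>\<^bsub>A\<^esub> c \<sigma>)\<rparr>"

definition face_sign :: "'r ring \<Rightarrow> nat \<Rightarrow> 'r" where
  "face_sign A k = (\<ominus>\<^bsub>A\<^esub> \<one>\<^bsub>A\<^esub>) [^]\<^bsub>A\<^esub> k"

definition chain_bd :: "'r ring \<Rightarrow> nat \<Rightarrow> ('a, 'r) cochain \<Rightarrow> ('a, 'r) cochain" where
  "chain_bd A p c = (\<lambda>\<tau>. if p = 0 then \<zero>\<^bsub>A\<^esub> else
     (\<Oplus>\<^bsub>A\<^esub>\<sigma> \<in> {\<sigma>. c \<sigma> \<noteq> \<zero>\<^bsub>A\<^esub>}. \<Oplus>\<^bsub>A\<^esub>k \<in> {k. k \<le> p \<and> singular_face p k \<sigma> = \<tau>}.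
        face_sign A k \<otimes>\<^bsub>A\<^esub> c \<sigma>))"

definition cycles :: "'r ring \<Rightarrow> nat \<Rightarrow> 'a topology \<Rightarrow> ('a, 'r) cochain set" where
  "cycles A p X = {c \<in> carrier (chain_module A p X). chain_bd A p c = (\<lambda>\<tau>. \<zero>\<^bsub>A\<^esub>)}"

definition boundaries :: "'r ring \<Rightarrow> nat \<Rightarrow> 'a topology \<Rightarrow> ('a, 'r) cochain set" where
  "boundaries A p X = chain_bd A (Suc p) ` carrier (chain_module A (Suc p) X)"

definition homology_module ::
    "'r ring \<Rightarrow> nat \<Rightarrow> 'a topology \<Rightarrow> ('r, ('a, 'r) cochain set) module" where
  "homology_module A p X =
     quotient_module ((chain_module A p X)\<lparr>carrier := cycles A p X\<rparr>) (boundaries A p X)"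

definition hclass :: "'r ring \<Rightarrow> nat \<Rightarrow> 'a topology \<Rightarrow> ('a, 'r) cochain \<Rightarrow> ('a, 'r) cochain set" where
  "hclass A p X c = boundaries A p X +>\<^bsub>chain_module A p X\<^esub> c"

text \<open>The homomorphism induced by the inclusion of a subspace into \<open>Y\<close>; the chains of the subspace
  are themselves chains of \<open>Y\<close>.\<close>

definition inclusion_hom ::
    "'r ring \<Rightarrow> nat \<Rightarrow> 'a topology \<Rightarrow> ('a, 'r) cochain set \<Rightarrow> ('a, 'r) cochain set" where
  "inclusion_hom A p Y z = (\<Union>c\<in>z. hclass A p Y c)"

text \<open>The cochains of all degrees form a ring under the cup product; its elements are families of
  cochains indexed by the degree, almost all of which are zero.\<close>

definition back_face :: "nat \<Rightarrow> nat \<Rightarrow> ((nat \<Rightarrow> real) \<Rightarrow> 'a) \<Rightarrow> (nat \<Rightarrow> real) \<Rightarrow> 'a" where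
  "back_face n p \<sigma> =
     restrict (\<sigma> \<circ> (\<lambda>x i. if i < p then 0 else x (i - p))) (standard_simplex (n - p))"

definition cochain_ring :: "'r ring \<Rightarrow> 'a topology \<Rightarrow> (nat \<Rightarrow> ('a, 'r) cochain) ring" where
  "cochain_ring A X =
     \<lparr>carrier = {\<phi>. (\<forall>p \<sigma>. \<phi> p \<sigma> \<in> carrier A \<and> (\<not> singular_simplex p X \<sigma> \<longrightarrow> \<phi> p \<sigma> = \<zero>\<^bsub>A\<^esub>)) \<and>
                    finite {p. \<exists>\<sigma>. \<phi> p \<sigma> \<noteq> \<zero>\<^bsub>A\<^esub>}},
      mult = (\<lambda>\<phi> \<psi> n \<sigma>. if singular_simplex n X \<sigma>
                then (\<Oplus>\<^bsub>A\<^esub>p\<in>{..n}. \<phi> p (restrict \<sigma> (standard_simplex p)) \<otimes>\<^bsub>A\<^esub>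
                                    \<psi> (n - p) (back_face n p \<sigma>))
                else \<zero>\<^bsub>A\<^esub>),
      one = (\<lambda>p \<sigma>. if p = 0 \<and> singular_simplex p X \<sigma> then \<one>\<^bsub>A\<^esub> else \<zero>\<^bsub>A\<^esub>),
      zero = (\<lambda>p \<sigma>. \<zero>\<^bsub>A\<^esub>),
      add = (\<lambda>\<phi> \<psi> p \<sigma>. \<phi> p \<sigma> \<oplus>\<^bsub>A\<^esub> \<psi> p \<sigma>)\<rparr>"

definition coboundary ::
    "'r ring \<Rightarrow> 'a topology \<Rightarrow> (nat \<Rightarrow> ('a, 'r) cochain) \<Rightarrow> nat \<Rightarrow> ('a, 'r) cochain" where
  "coboundary A X \<phi> = (\<lambda>n \<sigma>. if n = 0 \<or> \<not> singular_simplex n X \<sigma> then \<zero>\<^bsub>A\<^esub>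
     else (\<Oplus>\<^bsub>A\<^esub>k\<in>{..n}. face_sign A k \<otimes>\<^bsub>A\<^esub> \<phi> (n - 1) (singular_face n k \<sigma>)))"

definition cocycle_ring :: "'r ring \<Rightarrow> 'a topology \<Rightarrow> (nat \<Rightarrow> ('a, 'r) cochain) ring" where
  "cocycle_ring A X =
     (cochain_ring A X)\<lparr>carrier :=
        {\<phi> \<in> carrier (cochain_ring A X). coboundary A X \<phi> = \<zero>\<^bsub>cochain_ring A X\<^esub>}\<rparr>"

definition coboundaries :: "'r ring \<Rightarrow> 'a topology \<Rightarrow> (nat \<Rightarrow> ('a, 'r) cochain) set" where
  "coboundaries A X = coboundary A X ` carrier (cochain_ring A X)"

definition cohomology_ring :: "'r ring \<Rightarrow> 'a topology \<Rightarrow> (nat \<Rightarrow> ('a, 'r) cochain) set ring" where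
  "cohomology_ring A X = cocycle_ring A X Quot coboundaries A X"

definition cohclass ::
    "'r ring \<Rightarrow> 'a topology \<Rightarrow> (nat \<Rightarrow> ('a, 'r) cochain) \<Rightarrow> (nat \<Rightarrow> ('a, 'r) cochain) set" where
  "cohclass A X \<phi> = coboundaries A X +>\<^bsub>cocycle_ring A X\<^esub> \<phi>"

definition scalar_cochain :: "'r ring \<Rightarrow> 'a topology \<Rightarrow> 'r \<Rightarrow> nat \<Rightarrow> ('a, 'r) cochain" where
  "scalar_cochain A X r = (\<lambda>p \<sigma>. if p = 0 \<and> singular_simplex p X \<sigma> then r else \<zero>\<^bsub>A\<^esub>)"

text \<open>Generation of the cohomology ring is generation as an \<open>A\<close>-algebra.\<close>

definition generates_cohomology ::
    "'r ring \<Rightarrow> 'a topology \<Rightarrow> (nat \<Rightarrow> ('a, 'r) cochain) set set \<Rightarrow> bool" where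
  "generates_cohomology A X D \<longleftrightarrow>
     generate_ring (cohomology_ring A X) (cohclass A X ` scalar_cochain A X ` carrier A \<union> D)
       = carrier (cohomology_ring A X)"

section \<open>Duals\<close>

definition free_basis :: "'r ring \<Rightarrow> ('r, 'b) module \<Rightarrow> 'b set \<Rightarrow> 'b set \<Rightarrow> bool" where
  "free_basis A B S L \<longleftrightarrow>
     S \<subseteq> carrier B \<and> \<not> module.lin_dep A B S \<and> module.span A B S = L"

definition maximal_free_submodule :: "'r ring \<Rightarrow> ('r, 'b) module \<Rightarrow> 'b set \<Rightarrow> bool" where
  "maximal_free_submodule A B L \<longleftrightarrow>
     (\<exists>S. free_basis A B S L) \<and> (\<forall>L'. (\<exists>S. free_basis A B S L') \<and> L \<subseteq> L' \<longrightarrow> L' = L)"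

definition suitable_basis :: "'r ring \<Rightarrow> ('r, 'b) module \<Rightarrow> 'b set \<Rightarrow> bool" where
  "suitable_basis A B S \<longleftrightarrow>
     (\<exists>!L. maximal_free_submodule A B L) \<and>
     (\<exists>L. maximal_free_submodule A B L \<and> free_basis A B S L) \<and> finite S \<and>
     (\<forall>e\<in>S. \<forall>r \<in> carrier A. \<forall>x \<in> carrier B. e = r \<odot>\<^bsub>B\<^esub> x \<longrightarrow> r \<in> Units A)"

definition self_module :: "'r ring \<Rightarrow> ('r, 'r) module" where
  "self_module A =
     \<lparr>carrier = carrier A, mult = mult A, one = one A, zero = zero A, add = add A, smult = mult A\<rparr>"

definition dual_respecting ::
    "'r ring \<Rightarrow> ('r, 'b) module \<Rightarrow> 'b set \<Rightarrow> 'b \<Rightarrow> ('b \<Rightarrow> 'r) \<Rightarrow> bool" where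
  "dual_respecting A B S e h \<longleftrightarrow>
     suitable_basis A B S \<and> e \<in> S \<and> h \<in> module_hom A B (self_module A) \<and>
     h e = \<one>\<^bsub>A\<^esub> \<and> (\<forall>e' \<in> S - {e}. h e' = \<zero>\<^bsub>A\<^esub>)"

definition evaluate :: "'r ring \<Rightarrow> ('a, 'r) cochain \<Rightarrow> ('a, 'r) cochain \<Rightarrow> 'r" where
  "evaluate A \<phi> c = (\<Oplus>\<^bsub>A\<^esub>\<sigma> \<in> {\<sigma>. c \<sigma> \<noteq> \<zero>\<^bsub>A\<^esub>}. \<phi> \<sigma> \<otimes>\<^bsub>A\<^esub> c \<sigma>)"

text \<open>The dual to \<open>e\<close> is a homomorphism \<open>H\<^sub>d(X; A) \<rightarrow> A\<close>. In the cohomology ring it is represented by a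
  cocycle, homogeneous of degree \<open>d\<close>, that induces it by evaluation on cycles.\<close>

definition represents_dual ::
    "'r ring \<Rightarrow> 'a topology \<Rightarrow> nat \<Rightarrow> ('a, 'r) cochain set set \<Rightarrow> ('a, 'r) cochain set \<Rightarrow>
     (nat \<Rightarrow> ('a, 'r) cochain) \<Rightarrow> bool" where
  "represents_dual A X d S e \<phi> \<longleftrightarrow>
     \<phi> \<in> carrier (cocycle_ring A X) \<and> (\<forall>p \<sigma>. p \<noteq> d \<longrightarrow> \<phi> p \<sigma> = \<zero>\<^bsub>A\<^esub>) \<and>
     (\<exists>h. dual_respecting A (homology_module A d X) S e h \<and>
          (\<forall>c \<in> cycles A d X. evaluate A (\<phi> d) c = h (hclass A d X c)))"

section \<open>Reference homomorphisms and the two conditions on them\<close>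

definition ref_fibre :: "'m smfd \<Rightarrow> ('m \<Rightarrow> 'w) \<Rightarrow> 'w \<Rightarrow> 'm topology" where
  "ref_fibre M q w0 = subtopology (mtop M) (preimage_mfd M q {w0})"

text \<open>The reference homomorphism along \<open>\<alpha>\<close>, on \<open>H\<^sub>d\<close> of the fibre over \<open>w0 = \<alpha> 0\<close>, with values in
  \<open>H\<^sub>d\<close> of the preimage of the curve.\<close>

definition ref_target :: "'m smfd \<Rightarrow> ('m \<Rightarrow> 'w) \<Rightarrow> (real \<Rightarrow> 'w) \<Rightarrow> 'm topology" where
  "ref_target M q \<alpha> = subtopology (mtop M) (preimage_mfd M q (\<alpha> ` {0..1}))"

definition reference_hom ::
    "'r ring \<Rightarrow> 'm smfd \<Rightarrow> ('m \<Rightarrow> 'w) \<Rightarrow> (real \<Rightarrow> 'w) \<Rightarrow> nat \<Rightarrow>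
     ('m, 'r) cochain set \<Rightarrow> ('m, 'r) cochain set" where
  "reference_hom A M q \<alpha> d = inclusion_hom A d (ref_target M q \<alpha>)"

text \<open>\<open>G i d\<close> is the set of the chosen generators, in degree \<open>d\<close>, of the kernel of the reference
  homomorphism along the \<open>i\<close>-th curve; the chosen generators of degree \<open>d\<close> are elements of one
  basis \<open>S d\<close>, and \<open>\<phi> d e\<close> represents the dual to \<open>e\<close> respecting \<open>S d\<close>.\<close>

definition kernel_generators_with_duals ::
    "'r ring \<Rightarrow> 'm smfd \<Rightarrow> ('m \<Rightarrow> 'w) \<Rightarrow> 'w \<Rightarrow> (real \<Rightarrow> 'w) list \<Rightarrow>
     (nat \<Rightarrow> nat \<Rightarrow> ('m, 'r) cochain set set) \<Rightarrow> (nat \<Rightarrow> ('m, 'r) cochain set set) \<Rightarrow>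
     (nat \<Rightarrow> ('m, 'r) cochain set \<Rightarrow> nat \<Rightarrow> ('m, 'r) cochain) \<Rightarrow> bool" where
  "kernel_generators_with_duals A M q w0 \<alpha>s G S \<phi> \<longleftrightarrow>
     (\<forall>i < length \<alpha>s. \<forall>d\<ge>1.
        (let H = homology_module A d (ref_fibre M q w0) in
         G i d \<subseteq> carrier H \<and>
         module.span A H (G i d) =
           {z \<in> carrier H. reference_hom A M q (\<alpha>s ! i) d z =
              \<zero>\<^bsub>homology_module A d (ref_target M q (\<alpha>s ! i))\<^esub>}) \<and>
        (\<forall>e \<in> G i d. represents_dual A (ref_fibre M q w0) d (S d) e (\<phi> d e)))"

definition duals_generate_cohomology ::
    "'r ring \<Rightarrow> 'm smfd \<Rightarrow> ('m \<Rightarrow> 'w) \<Rightarrow> 'w \<Rightarrow> (real \<Rightarrow> 'w) list \<Rightarrow>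
     (nat \<Rightarrow> nat \<Rightarrow> ('m, 'r) cochain set set) \<Rightarrow>
     (nat \<Rightarrow> ('m, 'r) cochain set \<Rightarrow> nat \<Rightarrow> ('m, 'r) cochain) \<Rightarrow> bool" where
  "duals_generate_cohomology A M q w0 \<alpha>s G \<phi> \<longleftrightarrow>
     generates_cohomology A (ref_fibre M q w0)
       {cohclass A (ref_fibre M q w0) (\<phi> d e) | i d e. i < length \<alpha>s \<and> 1 \<le> d \<and> e \<in> G i d}"

end

theory Submission
  imports Defs
begin

text \<open>
  The counterexample is a function on the real projective plane with values in the line. On points
  \<open>[x : y : z]\<close> with representatives on the unit sphere, let the height be \<open>z\<^sup>2\<close>. Its image is the
  interval from 0 to 1. Every level strictly between 0 and 1 is a circle. The level 1 is a single
  point, the centre of a disk, and the level 0 is a circle along which the height is critical, the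
  core of a Moebius band. The definition of special-generic-like maps permits both ends, as it only
  requires the critical set in the local form to be a polyhedron of dimension at most 1.

  Take real coefficients, the level \<open>1/2\<close> as the fibre \<open>F\<close>, and the two curves from \<open>1/2\<close> to the two
  ends of the interval. The first homology group of \<open>F\<close> is a line, generated by a class \<open>e\<close>. The disk
  kills \<open>e\<close>, so the kernel along the curve to 1 is generated by \<open>e\<close>, and the dual of \<open>e\<close> generates the
  cohomology ring of the circle as an algebra. The boundary circle of the Moebius band winds twice
  around the core, and 2 is invertible in the real numbers. So the kernel along the curve to 0 is
  trivial and is generated by the empty set. Both conditions of the question hold, but the
  reference homomorphism along the second curve is injective and not zero.

  The geometric half of the text realizes the projective plane by the Veronese embedding, so that
  points are real vectors and all charts, bundle charts and triangulations are given by explicit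
  formulas with explicit inverses (\<open>diffeo_betweenI\<close>, \<open>smooth_triangulationI\<close>). The result is
  \<open>height_sgl\<close>. The algebraic half obtains the real homology of a circle from the integral homology of
  the sphere of dimension 1 (\<open>cyc_generated\<close>), computes its cohomology ring from the homology
  (\<open>class_decomposition\<close>), and detects the class \<open>e\<close> by a cocycle that is defined on the whole Moebius
  band: the change of argument of the nowhere zero function \<open>(x + i y)\<^sup>2\<close> (\<open>wind_cocycle\<close>, \<open>wind_loop\<close>).
\<close>

section \<open>Smooth functions given by expressions\<close>

text \<open>Functions that are built from coordinates by field operations and square roots are closed
  under partial derivatives. So a single induction over such expressions shows that they are smooth
  where no division by zero and no root of zero occurs, and every map below is given locally by
  them.\<close>

datatype expr = Cst real | Var nat | Add expr expr | Mul expr expr | Inv expr | Sqt expr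

primrec ev :: "expr \<Rightarrow> (nat \<Rightarrow> real) \<Rightarrow> real" where
 "ev (Cst c) x = c"
| "ev (Var i) x = x i"
| "ev (Add a b) x = ev a x + ev b x"
| "ev (Mul a b) x = ev a x * ev b x"
| "ev (Inv a) x = inverse (ev a x)"
| "ev (Sqt a) x = sqrt (ev a x)"

primrec wd :: "expr \<Rightarrow> (nat \<Rightarrow> real) \<Rightarrow> bool" where
 "wd (Cst c) x = True"
| "wd (Var i) x = True"
| "wd (Add a b) x = (wd a x \<and> wd b x)"
| "wd (Mul a b) x = (wd a x \<and> wd b x)"
| "wd (Inv a) x = (wd a x \<and> ev a x \<noteq> 0)"
| "wd (Sqt a) x = (wd a x \<and> ev a x > 0)"

primrec pd :: "nat \<Rightarrow> expr \<Rightarrow> expr" where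
 "pd j (Cst c) = Cst 0"
| "pd j (Var i) = Cst (if i = j then 1 else 0)"
| "pd j (Add a b) = Add (pd j a) (pd j b)"
| "pd j (Mul a b) = Add (Mul (pd j a) b) (Mul a (pd j b))"
| "pd j (Inv a) = Mul (Cst (-1)) (Mul (pd j a) (Mul (Inv a) (Inv a)))"
| "pd j (Sqt a) = Mul (pd j a) (Mul (Cst (1/2)) (Inv (Sqt a)))"

primrec sbst :: "(nat \<Rightarrow> expr) \<Rightarrow> expr \<Rightarrow> expr" where
 "sbst s (Cst c) = Cst c"
| "sbst s (Var i) = s i"
| "sbst s (Add a b) = Add (sbst s a) (sbst s b)"
| "sbst s (Mul a b) = Mul (sbst s a) (sbst s b)"
| "sbst s (Inv a) = Inv (sbst s a)"
| "sbst s (Sqt a) = Sqt (sbst s a)"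

primrec vars :: "expr \<Rightarrow> nat set" where
 "vars (Cst c) = {}"
| "vars (Var i) = {i}"
| "vars (Add a b) = vars a \<union> vars b"
| "vars (Mul a b) = vars a \<union> vars b"
| "vars (Inv a) = vars a"
| "vars (Sqt a) = vars a"

lemma finite_vars: "finite (vars e)" by (induction e) auto

lemma ev_cong: "(\<And>i. i \<in> vars e \<Longrightarrow> x i = y i) \<Longrightarrow> ev e x = ev e y"
 by (induction e) auto

lemma ev_sbst: "ev (sbst s e) x = ev e (\<lambda>i. ev (s i) x)"
 by (induction e) auto

lemma wd_sbst: "(\<And>i. i \<in> vars e \<Longrightarrow> wd (s i) x) \<Longrightarrow> wd e (\<lambda>i. ev (s i) x) \<Longrightarrow> wd (sbst s e) x"
 by (induction e) (auto simp: ev_sbst)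

lemma isCont_ev: "wd e x \<Longrightarrow> isCont (ev e) x"
proof (induction e)
 case (Var i)
 have "continuous_on UNIV (\<lambda>y::nat\<Rightarrow>real. y i)" by (rule continuous_on_product_coordinates)
 then have "isCont (\<lambda>y::nat\<Rightarrow>real. y i) x" using continuous_on_eq_continuous_at[OF open_UNIV] by blast
 moreover have "ev (Var i) = (\<lambda>y. y i)" by auto
 ultimately show ?case by simp
next
 case (Cst c) have "ev (Cst c) = (\<lambda>y. c)" by auto then show ?case by simp
next
 case (Add a b) have "ev (Add a b) = (\<lambda>y. ev a y + ev b y)" by auto
 then show ?case using Add by simp
next
 case (Mul a b) have "ev (Mul a b) = (\<lambda>y. ev a y * ev b y)" by auto
 then show ?case using Mul by simp
next
 case (Inv a) have "ev (Inv a) = (\<lambda>y. inverse (ev a y))" by auto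
 then show ?case using Inv by (auto intro: continuous_intros)
next
 case (Sqt a) have "ev (Sqt a) = (\<lambda>y. sqrt (ev a y))" by auto
 then show ?case using Sqt by (auto intro: continuous_intros)
qed

lemma eventually_wd: "wd e x \<Longrightarrow> eventually (wd e) (nhds x)"
proof (induction e)
 case (Inv a)
 then have "isCont (ev a) x" by (simp add: isCont_ev)
 moreover have "open (- {0::real})" by auto
 ultimately have "eventually (\<lambda>y. ev a y \<in> - {0}) (nhds x)"
  using Inv.prems topological_tendstoD[of "ev a" "ev a x" "nhds x" "- {0}"]
  by (simp add: isCont_def tendsto_at_iff_tendsto_nhds)
 with Inv show ?case by (simp add: eventually_conj)
next
 case (Sqt a)
 then have "isCont (ev a) x" by (simp add: isCont_ev)
 moreover have "open {0::real<..}" by (rule open_greaterThan)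
 ultimately have "eventually (\<lambda>y. ev a y \<in> {0<..}) (nhds x)"
  using Sqt.prems topological_tendstoD[of "ev a" "ev a x" "nhds x" "{0<..}"]
  by (simp add: isCont_def tendsto_at_iff_tendsto_nhds)
 with Sqt show ?case by (simp add: eventually_conj)
next
 case (Add a b)
 then have "eventually (\<lambda>y. wd a y \<and> wd b y) (nhds x)" by (simp add: eventually_conj)
 then show ?case by (rule eventually_mono) simp
next
 case (Mul a b)
 then have "eventually (\<lambda>y. wd a y \<and> wd b y) (nhds x)" by (simp add: eventually_conj)
 then show ?case by (rule eventually_mono) simp
next
 case (Cst c) show ?case by (rule always_eventually) simp
next
 case (Var i) show ?case by (rule always_eventually) simp
qed

lemma wd_pd: "wd e x \<Longrightarrow> wd (pd j e) x"
 by (induction e) auto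

lemma has_deriv_ev:
 assumes "wd e x" shows "((\<lambda>t. ev e (x(j := t))) has_real_derivative ev (pd j e) x) (at (x j))"
 using assms
proof (induction e)
 case (Var i) then show ?case by (cases "i = j") auto
next
 case (Inv a)
 then have "((\<lambda>t. inverse (ev a (x(j := t)))) has_real_derivative
  - (inverse (ev a (x(j := x j))) * ev (pd j a) x * inverse (ev a (x(j := x j))))) (at (x j))"
  by (intro DERIV_inverse') (simp_all del: fun_upd_apply add: fun_upd_triv)
 then show ?case by (simp add: ac_simps del: fun_upd_apply)
next
 case (Sqt a)
 then have *: "((\<lambda>t. ev a (x(j := t))) has_real_derivative ev (pd j a) x) (at (x j))"
  and pos: "ev a (x(j := x j)) > 0" by (simp_all del: fun_upd_apply add: fun_upd_triv)
 from pos have "((\<lambda>t. sqrt t) has_real_derivative (inverse (sqrt (ev a (x(j := x j)))) / 2)) (at (ev a (x(j := x j))))"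
  by (rule DERIV_real_sqrt)
 from DERIV_chain2[OF this *] show ?case by (simp add: ac_simps del: fun_upd_apply)
qed (auto intro!: derivative_eq_intros)

lemma powertop_euclidean: "powertop_real UNIV = (euclidean :: (nat \<Rightarrow> real) topology)"
 by (simp add: euclidean_product_topology)

lemma Euclidean_space_eq: "Euclidean_space k = top_of_set {x. \<forall>i\<ge>k. x i = 0}"
 by (simp add: Euclidean_space_def powertop_euclidean)

lemma openin_Euclidean_iff:
 "openin (Euclidean_space k) U \<longleftrightarrow> (\<exists>T. open T \<and> U = T \<inter> {x. \<forall>i\<ge>k. x i = 0})"
 by (auto simp: Euclidean_space_eq openin_open)

lemma continuous_line: "continuous_on UNIV (\<lambda>t. (x::nat\<Rightarrow>real)(j := t))"
proof (rule continuous_on_coordinatewise_then_product)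
 fix i show "continuous_on UNIV (\<lambda>t. (x(j := t)) i)" by (cases "i = j") auto
qed

lemma eventually_line:
 assumes "openin (Euclidean_space k) U" "x \<in> U" "j < k"
 shows "eventually (\<lambda>t. x(j := t) \<in> U) (nhds (x j))"
proof -
 obtain T where T: "open T" "U = T \<inter> {x. \<forall>i\<ge>k. x i = 0}"
  using assms by (auto simp: openin_Euclidean_iff)
 have "open ((\<lambda>t. x(j := t)) -` T)"
  using continuous_line T(1) by (simp add: open_vimage continuous_on_eq_continuous_at)
 moreover have "x j \<in> (\<lambda>t. x(j := t)) -` T" using assms T by auto
 moreover have "\<And>t. t \<in> (\<lambda>t. x(j := t)) -` T \<Longrightarrow> x(j := t) \<in> U"
  using T assms by auto
 ultimately show ?thesis unfolding eventually_nhds by blast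
qed

text \<open>The iterated partial derivatives of an expression are again expressions, which are defined
  wherever the first one is. Hence all of them exist and are continuous.\<close>

lemma smooth_fun_ev:
 assumes U: "openin (Euclidean_space k) U"
  and wd: "\<And>x. x \<in> U \<Longrightarrow> wd e x" and eq: "\<And>x. x \<in> U \<Longrightarrow> g x = ev e x"
 shows "smooth_fun k U g"
proof -
 have *: "set js \<subseteq> {..<k} \<Longrightarrow> \<forall>x\<in>U. wd (foldr pd js e) x \<and> foldr partial js g x = ev (foldr pd js e) x" for js
 proof (induction js)
  case Nil then show ?case using wd eq by auto
 next
  case (Cons j js)
  then have IH: "\<forall>x\<in>U. wd (foldr pd js e) x \<and> foldr partial js g x = ev (foldr pd js e) x" and j: "j < k" by auto
  show ?case
  proof
   fix x assume x: "x \<in> U"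
   have "eventually (\<lambda>t. foldr partial js g (x(j := t)) = ev (foldr pd js e) (x(j := t))) (nhds (x j))"
    using eventually_line[OF U x j] by eventually_elim (use IH in auto)
   then have "deriv (\<lambda>t. foldr partial js g (x(j := t))) (x j) = deriv (\<lambda>t. ev (foldr pd js e) (x(j := t))) (x j)"
    by (rule deriv_cong_ev) simp
   also have "\<dots> = ev (pd j (foldr pd js e)) x"
    using has_deriv_ev[of "foldr pd js e" x j] IH x by (auto intro!: DERIV_imp_deriv)
   finally show "wd (foldr pd (j # js) e) x \<and> foldr partial (j # js) g x = ev (foldr pd (j # js) e) x"
    using IH x by (auto simp: partial_def intro: wd_pd)
  qed
 qed
 show ?thesis unfolding smooth_fun_def
 proof (intro ballI conjI allI impI)
  fix js assume "js \<in> lists {..<k}"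
  then have js: "\<forall>x\<in>U. wd (foldr pd js e) x \<and> foldr partial js g x = ev (foldr pd js e) x"
   using * by (metis in_listsD subsetI)
  have US: "U \<subseteq> {x. \<forall>i\<ge>k. x i = 0}" using openin_subset[OF U] by (simp add: topspace_Euclidean_space)
  have "continuous_on U (ev (foldr pd js e))"
   using js by (meson continuous_at_imp_continuous_on isCont_ev)
  then have "continuous_on U (foldr partial js g)"
   using js by (simp cong: continuous_on_cong)
  then show "continuous_map (subtopology (Euclidean_space k) U) euclideanreal (foldr partial js g)"
   using US by (simp add: Euclidean_space_eq subtopology_subtopology Int_absorb1)
  fix x j assume x: "x \<in> U" and j: "j < k"
  have ev: "eventually (\<lambda>t. foldr partial js g (x(j := t)) = ev (foldr pd js e) (x(j := t))) (nhds (x j))"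
   using eventually_line[OF U x j] by eventually_elim (use js in auto)
  have "((\<lambda>t. ev (foldr pd js e) (x(j := t))) has_real_derivative ev (pd j (foldr pd js e)) x) (at (x j))"
   using js x by (intro has_deriv_ev) auto
  then have "((\<lambda>t. foldr partial js g (x(j := t))) has_real_derivative ev (pd j (foldr pd js e)) x) (at (x j))"
   using DERIV_cong_ev[OF refl ev refl] by simp
  then show "(\<lambda>t. foldr partial js g (x(j := t))) field_differentiable at (x j)"
   by (auto simp: field_differentiable_def)
 qed
qed

text \<open>The expression may change from point to point. This makes it possible to restrict, to glue
  over an open cover, and to compose.\<close>

definition sm :: "(nat \<Rightarrow> real) set \<Rightarrow> ((nat \<Rightarrow> real) \<Rightarrow> real) \<Rightarrow> bool" where
 "sm S f \<longleftrightarrow> (\<forall>x\<in>S. \<exists>e. wd e x \<and> eventually (\<lambda>y. y \<in> S \<longrightarrow> f y = ev e y) (nhds x))"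

lemma sm_subset: "sm S f \<Longrightarrow> T \<subseteq> S \<Longrightarrow> sm T f"
 unfolding sm_def
proof
 fix x assume S: "\<forall>x\<in>S. \<exists>e. wd e x \<and> eventually (\<lambda>y. y \<in> S \<longrightarrow> f y = ev e y) (nhds x)"
  and T: "T \<subseteq> S" and "x \<in> T"
 then obtain e where e: "wd e x" "eventually (\<lambda>y. y \<in> S \<longrightarrow> f y = ev e y) (nhds x)" by blast
 from e(2) have "eventually (\<lambda>y. y \<in> T \<longrightarrow> f y = ev e y) (nhds x)"
  by eventually_elim (use T in auto)
 with e show "\<exists>e. wd e x \<and> eventually (\<lambda>y. y \<in> T \<longrightarrow> f y = ev e y) (nhds x)" by blast
qed

lemma sm_cong: "(\<And>x. x \<in> S \<Longrightarrow> f x = g x) \<Longrightarrow> sm S f \<longleftrightarrow> sm S g"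
 unfolding sm_def by (intro ball_cong ex_cong1 conj_cong refl arg_cong[where f = "\<lambda>P. eventually P _"]) auto

lemma sm_ev: "(\<And>x. x \<in> S \<Longrightarrow> wd e x) \<Longrightarrow> sm S (ev e)"
 unfolding sm_def by (auto intro!: exI[of _ e] always_eventually)

lemma sm_const [simp]: "sm S (\<lambda>x. c)"
proof -
 have "sm S (ev (Cst c))" by (rule sm_ev) simp
 then show ?thesis by (subst (asm) sm_cong[of S _ "\<lambda>x. c"]) auto
qed

lemma sm_var [simp]: "sm S (\<lambda>x. x i)"
proof -
 have "sm S (ev (Var i))" by (rule sm_ev) simp
 then show ?thesis by (subst (asm) sm_cong[of S _ "\<lambda>x. x i"]) auto
qed

lemma sm_add: assumes "sm S f" "sm S g" shows "sm S (\<lambda>x. f x + g x)"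
 unfolding sm_def
proof
 fix x assume "x \<in> S"
 then obtain a b where ab: "wd a x" "eventually (\<lambda>y. y \<in> S \<longrightarrow> f y = ev a y) (nhds x)"
  "wd b x" "eventually (\<lambda>y. y \<in> S \<longrightarrow> g y = ev b y) (nhds x)"
  using assms unfolding sm_def by blast
 from ab(2,4) have "eventually (\<lambda>y. y \<in> S \<longrightarrow> f y + g y = ev (Add a b) y) (nhds x)"
  by eventually_elim auto
 then show "\<exists>e. wd e x \<and> eventually (\<lambda>y. y \<in> S \<longrightarrow> f y + g y = ev e y) (nhds x)"
  using ab by (intro exI[of _ "Add a b"]) auto
qed

lemma sm_mult: assumes "sm S f" "sm S g" shows "sm S (\<lambda>x. f x * g x)"
 unfolding sm_def
proof
 fix x assume "x \<in> S"
 then obtain a b where ab: "wd a x" "eventually (\<lambda>y. y \<in> S \<longrightarrow> f y = ev a y) (nhds x)"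
  "wd b x" "eventually (\<lambda>y. y \<in> S \<longrightarrow> g y = ev b y) (nhds x)"
  using assms unfolding sm_def by blast
 from ab(2,4) have "eventually (\<lambda>y. y \<in> S \<longrightarrow> f y * g y = ev (Mul a b) y) (nhds x)"
  by eventually_elim auto
 then show "\<exists>e. wd e x \<and> eventually (\<lambda>y. y \<in> S \<longrightarrow> f y * g y = ev e y) (nhds x)"
  using ab by (intro exI[of _ "Mul a b"]) auto
qed

lemma sm_inverse: assumes "sm S f" "\<And>x. x \<in> S \<Longrightarrow> f x \<noteq> 0" shows "sm S (\<lambda>x. inverse (f x))"
 unfolding sm_def
proof
 fix x assume x: "x \<in> S"
 then obtain a where a: "wd a x" "eventually (\<lambda>y. y \<in> S \<longrightarrow> f y = ev a y) (nhds x)"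
  using assms unfolding sm_def by blast
 then have "f x = ev a x" using x eventually_nhds_x_imp_x by blast
 with a assms(2)[OF x] show "\<exists>e. wd e x \<and> eventually (\<lambda>y. y \<in> S \<longrightarrow> inverse (f y) = ev e y) (nhds x)"
  by (intro exI[of _ "Inv a"]) (auto elim: eventually_mono)
qed

lemma sm_sqrt: assumes "sm S f" "\<And>x. x \<in> S \<Longrightarrow> f x > 0" shows "sm S (\<lambda>x. sqrt (f x))"
 unfolding sm_def
proof
 fix x assume x: "x \<in> S"
 then obtain a where a: "wd a x" "eventually (\<lambda>y. y \<in> S \<longrightarrow> f y = ev a y) (nhds x)"
  using assms unfolding sm_def by blast
 then have "f x = ev a x" using x eventually_nhds_x_imp_x by blast
 with a assms(2)[OF x] show "\<exists>e. wd e x \<and> eventually (\<lambda>y. y \<in> S \<longrightarrow> sqrt (f y) = ev e y) (nhds x)"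
  by (intro exI[of _ "Sqt a"]) (auto elim: eventually_mono)
qed

lemma sm_uminus: assumes "sm S f" shows "sm S (\<lambda>x. - f x)"
 using sm_mult[OF sm_const[of S "-1"] assms] by simp

lemma sm_diff: assumes "sm S f" "sm S g" shows "sm S (\<lambda>x. f x - g x)"
 using sm_add[OF assms(1) sm_uminus[OF assms(2)]] by simp

lemma sm_divide: assumes "sm S f" "sm S g" "\<And>x. x \<in> S \<Longrightarrow> g x \<noteq> 0" shows "sm S (\<lambda>x. f x / g x)"
 using sm_mult[OF assms(1) sm_inverse[OF assms(2,3)]] by (simp add: field_class.field_divide_inverse)

lemma sm_power: assumes "sm S f" shows "sm S (\<lambda>x. f x ^ n)"
 by (induction n) (auto intro: sm_mult assms)

lemmas sm_intros = sm_const sm_var sm_add sm_mult sm_diff sm_uminus sm_divide sm_inverse sm_sqrt sm_power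

lemma sm_isCont:
 assumes "sm S f" shows "continuous_on S f"
 unfolding continuous_on_def
proof
 fix x assume x: "x \<in> S"
 then obtain a where a: "wd a x" "eventually (\<lambda>y. y \<in> S \<longrightarrow> f y = ev a y) (nhds x)"
  using assms unfolding sm_def by blast
 then have fx: "f x = ev a x" using x eventually_nhds_x_imp_x by blast
 have "(ev a \<longlongrightarrow> ev a x) (at x within S)"
  using isCont_ev[OF a(1)] continuous_at_imp_continuous_at_within continuous_within by blast
 moreover have "eventually (\<lambda>y. ev a y = f y) (at x within S)"
  using a(2) by (auto simp: eventually_at_filter elim: eventually_mono)
 ultimately show "(f \<longlongrightarrow> f x) (at x within S)" unfolding fx
  by (rule Lim_transform_eventually)
qed

lemma sm_isCont_vec:
 assumes "\<And>i. sm S (\<lambda>x. f x i)" shows "continuous_on S f"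
 by (rule continuous_on_coordinatewise_then_product) (use assms sm_isCont in auto)

lemma sm_compose:
 assumes f: "\<And>i. sm S (\<lambda>x. f x i)" and g: "sm T g" and fS: "f ` S \<subseteq> T"
 shows "sm S (\<lambda>x. g (f x))"
 unfolding sm_def
proof
 fix x assume x: "x \<in> S"
 then have "f x \<in> T" using fS by auto
 then obtain a where a: "wd a (f x)" "eventually (\<lambda>y. y \<in> T \<longrightarrow> g y = ev a y) (nhds (f x))"
  using g unfolding sm_def by blast
 obtain s where s: "\<And>i. wd (s i) x" "\<And>i. eventually (\<lambda>y. y \<in> S \<longrightarrow> f y i = ev (s i) y) (nhds x)"
 proof -
  have "\<forall>i. \<exists>e. wd e x \<and> eventually (\<lambda>y. y \<in> S \<longrightarrow> f y i = ev e y) (nhds x)"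
   using f x unfolding sm_def by blast
  then show ?thesis using that unfolding choice_iff by blast
 qed
 have sx: "f x = (\<lambda>i. ev (s i) x)"
 proof
  fix i show "f x i = ev (s i) x" using eventually_nhds_x_imp_x[OF s(2)[of i]] x by simp
 qed
 have 1: "wd (sbst s a) x" using a(1) s(1) by (intro wd_sbst) (auto simp: sx)
 have 2: "eventually (\<lambda>y. \<forall>i\<in>vars a. y \<in> S \<longrightarrow> f y i = ev (s i) y) (nhds x)"
  by (rule eventually_ball_finite[OF finite_vars]) (use s(2) in blast)
 have "continuous_on S f" using f by (rule sm_isCont_vec)
 then have "(f \<longlongrightarrow> f x) (at x within S)" using x by (auto simp: continuous_on_def)
 then have "eventually (\<lambda>y. f y \<in> T \<longrightarrow> g (f y) = ev a (f y)) (at x within S)"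
 proof -
  have "filterlim f (nhds (f x)) (at x within S)" by fact
  from this a(2) show ?thesis unfolding filterlim_iff by blast
 qed
 then have "eventually (\<lambda>y. y \<noteq> x \<longrightarrow> y \<in> S \<longrightarrow> f y \<in> T \<longrightarrow> g (f y) = ev a (f y)) (nhds x)"
  by (simp add: eventually_at_filter)
 moreover have "g (f x) = ev a (f x)"
  using a(2) \<open>f x \<in> T\<close> eventually_nhds_x_imp_x by blast
 ultimately have 3: "eventually (\<lambda>y. y \<in> S \<longrightarrow> g (f y) = ev a (f y)) (nhds x)"
  using fS by (auto elim!: eventually_mono)
 from 2 3 have "eventually (\<lambda>y. y \<in> S \<longrightarrow> g (f y) = ev (sbst s a) y) (nhds x)"
 proof eventually_elim
  case (elim y)
  then show ?case by (auto simp: ev_sbst intro!: ev_cong)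
 qed
 with 1 show "\<exists>e. wd e x \<and> eventually (\<lambda>y. y \<in> S \<longrightarrow> g (f y) = ev e y) (nhds x)" by blast
qed

lemma sm_local:
 assumes "\<And>x. x \<in> S \<Longrightarrow> \<exists>U. open U \<and> x \<in> U \<and> sm (S \<inter> U) f"
 shows "sm S f"
 unfolding sm_def
proof
 fix x assume x: "x \<in> S"
 then obtain U where U: "open U" "x \<in> U" "sm (S \<inter> U) f" using assms by blast
 then obtain e where e: "wd e x" "eventually (\<lambda>y. y \<in> S \<inter> U \<longrightarrow> f y = ev e y) (nhds x)"
  using x unfolding sm_def by blast
 have "eventually (\<lambda>y. y \<in> U) (nhds x)" using U eventually_nhds by blast
 with e(2) have "eventually (\<lambda>y. y \<in> S \<longrightarrow> f y = ev e y) (nhds x)" by eventually_elim auto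
 with e show "\<exists>e. wd e x \<and> eventually (\<lambda>y. y \<in> S \<longrightarrow> f y = ev e y) (nhds x)" by blast
qed

text \<open>A function that agrees with an expression on the set near a point is extended by that
  expression to a neighbourhood of the point.\<close>

lemma smooth_on_sm:
 assumes S: "S \<subseteq> {x. \<forall>i\<ge>k. x i = 0}" and f: "\<And>i. i < l \<Longrightarrow> sm S (\<lambda>x. f x i)"
 shows "smooth_on k l S f"
 unfolding smooth_on_def
proof
 fix x assume x: "x \<in> S"
 have "\<forall>i\<in>{..<l}. \<exists>e. wd e x \<and> eventually (\<lambda>y. y \<in> S \<longrightarrow> f y i = ev e y) (nhds x)"
  using f x unfolding sm_def by blast
 then obtain s where s: "\<And>i. i < l \<Longrightarrow> wd (s i) x"
   "\<And>i. i < l \<Longrightarrow> eventually (\<lambda>y. y \<in> S \<longrightarrow> f y i = ev (s i) y) (nhds x)"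
  unfolding bchoice_iff by auto
 then have "\<forall>i\<in>{..<l}. eventually (\<lambda>y. wd (s i) y \<and> (y \<in> S \<longrightarrow> f y i = ev (s i) y)) (nhds x)"
  using eventually_wd by (auto simp: eventually_conj_iff)
 then have "eventually (\<lambda>y. \<forall>i\<in>{..<l}. wd (s i) y \<and> (y \<in> S \<longrightarrow> f y i = ev (s i) y)) (nhds x)"
  by (simp add: eventually_ball_finite_distrib)
 then obtain U where U: "open U" "x \<in> U" "\<And>y i. y \<in> U \<Longrightarrow> i < l \<Longrightarrow> wd (s i) y \<and> (y \<in> S \<longrightarrow> f y i = ev (s i) y)"
  unfolding eventually_nhds by auto
 let ?U = "U \<inter> {x. \<forall>i\<ge>k. x i = 0}"
 have o: "openin (Euclidean_space k) ?U" using U by (auto simp: openin_Euclidean_iff)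
 show "\<exists>U G. openin (Euclidean_space k) U \<and> x \<in> U \<and>
    (\<forall>i<l. smooth_fun k U (\<lambda>y. G y i)) \<and> (\<forall>y \<in> U \<inter> S. \<forall>i<l. G y i = f y i)"
 proof (intro exI[of _ ?U] exI[of _ "\<lambda>y i. ev (s i) y"] conjI)
  show "\<forall>i<l. smooth_fun k ?U (\<lambda>y. ev (s i) y)"
   using U o by (auto intro!: smooth_fun_ev)
 qed (use o x S U in auto)
qed

section \<open>Submanifolds of Euclidean spaces\<close>

abbreviation eucl :: "nat \<Rightarrow> (nat \<Rightarrow> real) set" where
 "eucl k \<equiv> {x. \<forall>i\<ge>k. x i = 0}"

text \<open>A chart is compatible with an embedding into Euclidean space if it and its inverse are both
  given by expressions in the ambient coordinates. Smoothness of a map between embedded manifolds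
  can then be checked in ambient coordinates, without composing charts.\<close>

definition emb_chart :: "'a smfd \<Rightarrow> ('a \<Rightarrow> nat \<Rightarrow> real) \<Rightarrow> 'a set \<Rightarrow> ('a \<Rightarrow> nat \<Rightarrow> real) \<Rightarrow> bool" where
 "emb_chart X \<iota> U \<phi> \<longleftrightarrow> U \<subseteq> topspace (mtop X) \<and> \<phi> ` U \<subseteq> eucl (mdim X) \<and>
  (\<exists>\<psi>. (\<forall>x\<in>U. \<psi> (\<phi> x) = \<iota> x) \<and> (\<forall>i. sm (\<phi> ` U) (\<lambda>y. \<psi> y i))) \<and>
  (\<exists>\<xi>. (\<forall>x\<in>U. \<xi> (\<iota> x) = \<phi> x) \<and> (\<forall>i. sm (\<iota> ` U) (\<lambda>y. \<xi> y i)))"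

definition emb :: "'a smfd \<Rightarrow> nat \<Rightarrow> ('a \<Rightarrow> nat \<Rightarrow> real) \<Rightarrow> bool" where
 "emb X k \<iota> \<longleftrightarrow>
  continuous_map (mtop X) euclidean \<iota> \<and> \<iota> ` topspace (mtop X) \<subseteq> eucl k \<and>
  (\<exists>r. continuous_map (top_of_set (\<iota> ` topspace (mtop X))) (mtop X) r \<and>
     (\<forall>x\<in>topspace (mtop X). r (\<iota> x) = x)) \<and>
  (\<forall>(U, \<phi>) \<in> matlas X. emb_chart X \<iota> U \<phi>)"

lemma emb_chartE:
 assumes "emb X k \<iota>" "(U, \<phi>) \<in> matlas X"
 obtains \<psi> \<xi> where "U \<subseteq> topspace (mtop X)" "\<phi> ` U \<subseteq> eucl (mdim X)"
  "\<And>x. x \<in> U \<Longrightarrow> \<psi> (\<phi> x) = \<iota> x" "\<And>i. sm (\<phi> ` U) (\<lambda>y. \<psi> y i)"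
  "\<And>x. x \<in> U \<Longrightarrow> \<xi> (\<iota> x) = \<phi> x" "\<And>i. sm (\<iota> ` U) (\<lambda>y. \<xi> y i)"
proof -
 have "emb_chart X \<iota> U \<phi>" using assms unfolding emb_def by fast
 then show ?thesis unfolding emb_chart_def by (elim conjE exE) (rule that, auto)
qed

lemma emb_retract:
 assumes "emb X k \<iota>"
 obtains r where "continuous_map (top_of_set (\<iota> ` topspace (mtop X))) (mtop X) r"
  "\<And>x. x \<in> topspace (mtop X) \<Longrightarrow> r (\<iota> x) = x"
 using assms unfolding emb_def by (elim conjE exE) (rule that, auto)

lemma emb_cont: "emb X k \<iota> \<Longrightarrow> continuous_map (mtop X) euclidean \<iota>"
 and emb_eucl: "emb X k \<iota> \<Longrightarrow> \<iota> ` topspace (mtop X) \<subseteq> eucl k"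
 by (simp_all add: emb_def)

lemma embI:
 assumes "continuous_map (mtop X) euclidean \<iota>" "\<iota> ` topspace (mtop X) \<subseteq> eucl k"
  and "continuous_map (top_of_set (\<iota> ` topspace (mtop X))) (mtop X) r"
  and "\<And>x. x \<in> topspace (mtop X) \<Longrightarrow> r (\<iota> x) = x"
  and "\<And>U \<phi>. (U, \<phi>) \<in> matlas X \<Longrightarrow> emb_chart X \<iota> U \<phi>"
 shows "emb X k \<iota>"
 using assms unfolding emb_def by fast

lemma emb_chartI:
 assumes "U \<subseteq> topspace (mtop X)" "\<phi> ` U \<subseteq> eucl (mdim X)"
  "\<And>x. x \<in> U \<Longrightarrow> \<psi> (\<phi> x) = \<iota> x" "\<And>i. sm (\<phi> ` U) (\<lambda>y. \<psi> y i)"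
  "\<And>x. x \<in> U \<Longrightarrow> \<xi> (\<iota> x) = \<phi> x" "\<And>i. sm (\<iota> ` U) (\<lambda>y. \<xi> y i)"
 shows "emb_chart X \<iota> U \<phi>"
 using assms unfolding emb_chart_def by blast

lemma emb_inj:
 assumes "emb X k \<iota>" shows "inj_on \<iota> (topspace (mtop X))"
proof -
 obtain r where "\<And>x. x \<in> topspace (mtop X) \<Longrightarrow> r (\<iota> x) = x" by (rule emb_retract[OF assms]) blast
 then show ?thesis by (intro inj_on_inverseI[of _ r])
qed

lemma emb_chart_inj:
 assumes "emb X k \<iota>" "(U, \<phi>) \<in> matlas X" shows "inj_on \<phi> U"
proof -
 obtain \<psi> \<xi> where *: "U \<subseteq> topspace (mtop X)" "\<And>x. x \<in> U \<Longrightarrow> \<psi> (\<phi> x) = \<iota> x"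
  by (rule emb_chartE[OF assms]) blast
 show ?thesis
 proof (rule inj_onI)
  fix x y assume xy: "x \<in> U" "y \<in> U" "\<phi> x = \<phi> y"
  then have "\<iota> x = \<iota> y" using *(2) by metis
  then show "x = y" using emb_inj[OF assms(1)] *(1) xy unfolding inj_on_def by blast
 qed
qed

text \<open>In charts the map is the composition of the inverse of one chart, the ambient formula, and the
  other chart; all three are given locally by expressions.\<close>

lemma smooth_betweenI:
 assumes X: "emb X k \<iota>" and Y: "emb Y l \<kappa>"
  and S: "S \<subseteq> topspace (mtop X)" and T: "T \<subseteq> topspace (mtop Y)" and gS: "g ` S \<subseteq> T"
  and G: "\<And>x. x \<in> S \<Longrightarrow> \<kappa> (g x) = G (\<iota> x)" and smG: "\<And>i. sm (\<iota> ` S) (\<lambda>y. G y i)"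
 shows "smooth_between X S Y T g"
proof -
 obtain r where r: "continuous_map (top_of_set (\<kappa> ` topspace (mtop Y))) (mtop Y) r"
   "\<And>x. x \<in> topspace (mtop Y) \<Longrightarrow> r (\<kappa> x) = x"
  by (rule emb_retract[OF Y]) blast
 have contI: "continuous_map (subtopology (mtop X) S) (top_of_set (\<iota> ` S)) \<iota>"
  using emb_cont[OF X] S by (auto simp: continuous_map_in_subtopology intro: continuous_map_from_subtopology)
 have "continuous_on (\<iota> ` S) G" using smG by (rule sm_isCont_vec)
 then have "continuous_map (top_of_set (\<iota> ` S)) (top_of_set (\<kappa> ` topspace (mtop Y))) G"
  using gS T G by (auto simp: continuous_map_in_subtopology) (metis image_eqI image_subset_iff subsetD)
 then have "continuous_map (top_of_set (\<iota> ` S)) (mtop Y) (r \<circ> G)"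
  using r(1) by (rule continuous_map_compose)
 then have "continuous_map (subtopology (mtop X) S) (mtop Y) ((r \<circ> G) \<circ> \<iota>)"
  using contI continuous_map_compose by blast
 moreover have "\<And>x. x \<in> S \<Longrightarrow> ((r \<circ> G) \<circ> \<iota>) x = g x"
  using G r(2) gS T by (metis comp_apply image_subset_iff subsetD)
 ultimately have "continuous_map (subtopology (mtop X) S) (mtop Y) g"
  by (rule continuous_map_eq) (use S in auto)
 then have cont: "continuous_map (subtopology (mtop X) S) (subtopology (mtop Y) T) g"
  using gS S by (auto simp: continuous_map_in_subtopology)
 have charts: "smooth_on (mdim X) (mdim Y) (\<phi> ` (U \<inter> S \<inter> g -` V)) (\<psi> \<circ> g \<circ> inv_into U \<phi>)"
  if UV: "(U, \<phi>) \<in> matlas X" "(V, \<psi>) \<in> matlas Y" for U \<phi> V \<psi>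
 proof -
  obtain \<phi>' where \<phi>': "U \<subseteq> topspace (mtop X)" "\<phi> ` U \<subseteq> eucl (mdim X)"
   "\<And>x. x \<in> U \<Longrightarrow> \<phi>' (\<phi> x) = \<iota> x" "\<And>i. sm (\<phi> ` U) (\<lambda>y. \<phi>' y i)"
   by (rule emb_chartE[OF X UV(1)]) blast
  obtain \<xi> where \<xi>: "\<And>x. x \<in> V \<Longrightarrow> \<xi> (\<kappa> x) = \<psi> x" "\<And>i. sm (\<kappa> ` V) (\<lambda>y. \<xi> y i)"
   by (rule emb_chartE[OF Y UV(2)]) blast
  let ?D = "U \<inter> S \<inter> g -` V"
  have inj: "inj_on \<phi> U" by (rule emb_chart_inj[OF X UV(1)])
  have 1: "sm (\<phi> ` ?D) (\<lambda>y. \<phi>' y i)" for i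
   using \<phi>'(4) by (rule sm_subset) auto
  have 2: "\<phi>' ` \<phi> ` ?D \<subseteq> \<iota> ` S" using \<phi>'(3) by auto
  have 3: "sm (\<phi> ` ?D) (\<lambda>y. G (\<phi>' y) i)" for i
   by (rule sm_compose[OF 1 smG 2])
  have 4: "(\<lambda>y. G (\<phi>' y)) ` \<phi> ` ?D \<subseteq> \<kappa> ` V"
  proof (clarsimp)
   fix x assume "x \<in> U" "x \<in> S" "g x \<in> V"
   then show "G (\<phi>' (\<phi> x)) \<in> \<kappa> ` V" using \<phi>'(3) G by (metis imageI)
  qed
  have 5: "sm (\<phi> ` ?D) (\<lambda>y. \<xi> (G (\<phi>' y)) i)" for i
   by (rule sm_compose[OF 3 \<xi>(2) 4])
  have eq: "(\<psi> \<circ> g \<circ> inv_into U \<phi>) y = \<xi> (G (\<phi>' y))" if y: "y \<in> \<phi> ` ?D" for y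
  proof -
   obtain x where x: "x \<in> U" "x \<in> S" "g x \<in> V" "y = \<phi> x" using y by auto
   then have "inv_into U \<phi> y = x" using inj by simp
   then show ?thesis using x \<phi>'(3) G \<xi>(1) by (metis comp_apply)
  qed
  show ?thesis
  proof (rule smooth_on_sm)
   show "\<phi> ` ?D \<subseteq> eucl (mdim X)" using \<phi>'(2) by auto
   fix i
   show "sm (\<phi> ` ?D) (\<lambda>x. (\<psi> \<circ> g \<circ> inv_into U \<phi>) x i)"
    using 5[of i] eq by (subst sm_cong) auto
  qed
 qed
 show ?thesis unfolding smooth_between_def
  using S T cont charts by blast
qed

lemma diffeo_betweenI:
 assumes X: "emb X k \<iota>" and Y: "emb Y l \<kappa>"
  and S: "S \<subseteq> topspace (mtop X)" and T: "T \<subseteq> topspace (mtop Y)"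
  and gS: "\<And>x. x \<in> S \<Longrightarrow> g x \<in> T" and hT: "\<And>y. y \<in> T \<Longrightarrow> h y \<in> S"
  and hg: "\<And>x. x \<in> S \<Longrightarrow> h (g x) = x" and gh: "\<And>y. y \<in> T \<Longrightarrow> g (h y) = y"
  and G: "\<And>x. x \<in> S \<Longrightarrow> \<kappa> (g x) = G (\<iota> x)" and smG: "\<And>i. sm (\<iota> ` S) (\<lambda>y. G y i)"
  and H: "\<And>y. y \<in> T \<Longrightarrow> \<iota> (h y) = H (\<kappa> y)" and smH: "\<And>i. sm (\<kappa> ` T) (\<lambda>y. H y i)"
 shows "diffeo_between X S Y T g"
 unfolding diffeo_between_def
proof (intro conjI exI[of _ h] ballI)
 show "smooth_between X S Y T g"
  by (rule smooth_betweenI[OF X Y S T _ G smG]) (use gS in auto)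
 show "smooth_between Y T X S h"
  by (rule smooth_betweenI[OF Y X T S _ H smH]) (use hT in auto)
qed (use hg gh in auto)

definition good_chart ::
 "(nat \<Rightarrow> real) set \<Rightarrow> nat \<Rightarrow> (nat \<Rightarrow> real) set \<Rightarrow> ((nat \<Rightarrow> real) \<Rightarrow> nat \<Rightarrow> real) \<Rightarrow> bool" where
 "good_chart S m U \<phi> \<longleftrightarrow>
  openin (top_of_set S) U \<and>
  (openin (Euclidean_space m) (\<phi> ` U) \<or>
   openin (subtopology (Euclidean_space m) (half_space m)) (\<phi> ` U)) \<and>
  (\<forall>i. sm U (\<lambda>x. \<phi> x i)) \<and>
  (\<exists>\<psi>. (\<forall>x\<in>U. \<psi> (\<phi> x) = x) \<and> (\<forall>i. sm (\<phi> ` U) (\<lambda>y. \<psi> y i)))"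

lemma good_chartI:
 assumes "openin (top_of_set S) U"
  and "openin (Euclidean_space m) B \<or> openin (subtopology (Euclidean_space m) (half_space m)) B"
  and "\<And>x. x \<in> U \<Longrightarrow> \<phi> x \<in> B" "\<And>y. y \<in> B \<Longrightarrow> \<psi> y \<in> U"
  and "\<And>x. x \<in> U \<Longrightarrow> \<psi> (\<phi> x) = x" "\<And>y. y \<in> B \<Longrightarrow> \<phi> (\<psi> y) = y"
  and "\<And>i. sm U (\<lambda>x. \<phi> x i)" "\<And>i. sm B (\<lambda>y. \<psi> y i)"
 shows "good_chart S m U \<phi>" "\<phi> ` U = B"
proof -
 show B: "\<phi> ` U = B" using assms(3,4,6) by (auto simp: image_iff) metis
 then show "good_chart S m U \<phi>" unfolding good_chart_def B
  using assms by blast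
qed

definition sub_mfd ::
 "nat \<Rightarrow> (nat \<Rightarrow> real) set \<Rightarrow> ((nat \<Rightarrow> real) set \<times> ((nat \<Rightarrow> real) \<Rightarrow> nat \<Rightarrow> real)) set \<Rightarrow> (nat \<Rightarrow> real) smfd" where
 "sub_mfd m S At = \<lparr>mdim = m, mtop = top_of_set S, matlas = At\<rparr>"

lemma sub_mfd_simps [simp]:
 "mdim (sub_mfd m S At) = m" "mtop (sub_mfd m S At) = top_of_set S" "matlas (sub_mfd m S At) = At"
 by (simp_all add: sub_mfd_def)

lemma emb_sub_mfd:
 assumes S: "S \<subseteq> eucl k" and ch: "\<And>U \<phi>. (U, \<phi>) \<in> At \<Longrightarrow> good_chart S m U \<phi>"
 shows "emb (sub_mfd m S At) k id"
proof (rule embI[where r = id])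
 fix U \<phi> assume "(U, \<phi>) \<in> matlas (sub_mfd m S At)"
 then have g: "good_chart S m U \<phi>" using ch by simp
 then obtain \<psi> where \<psi>: "\<forall>x\<in>U. \<psi> (\<phi> x) = x" "\<forall>i. sm (\<phi> ` U) (\<lambda>y. \<psi> y i)"
  unfolding good_chart_def by (elim conjE exE) simp
 have "\<phi> ` U \<subseteq> eucl m"
  using g openin_subset by (fastforce simp: good_chart_def topspace_Euclidean_space half_space_def)
 then show "emb_chart (sub_mfd m S At) id U \<phi>"
  using g \<psi> by (intro emb_chartI[where \<psi> = \<psi> and \<xi> = \<phi>]) (auto simp: good_chart_def dest: openin_imp_subset)
qed (use S in auto)

lemma second_countable_fun: "second_countable (euclidean :: (nat \<Rightarrow> real) topology)"
proof -
 obtain B :: "(nat \<Rightarrow> real) set set" where B: "countable B" "topological_basis B"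
  using ex_countable_basis by blast
 have 1: "\<And>V. V \<in> B \<Longrightarrow> open V" using B(2) by (rule topological_basis_open)
 have 2: "\<exists>V\<in>B. x \<in> V \<and> V \<subseteq> U" if "open U" "x \<in> U" for U x
  using topological_basisE[OF B(2) that] by metis
 show ?thesis unfolding second_countable_def open_openin[symmetric]
  by (rule exI[of _ B]) (simp add: B(1) 1 2)
qed

text \<open>The coordinate changes of charts with explicit inverses are compositions of expressions, so no
  separate computation for pairs of charts is needed.\<close>

lemma smooth_manifold_sub_mfd:
 assumes S: "S \<subseteq> eucl k" and ch: "\<And>U \<phi>. (U, \<phi>) \<in> At \<Longrightarrow> good_chart S m U \<phi>"
  and cover: "S \<subseteq> \<Union> (fst ` At)"
 shows "smooth_manifold (sub_mfd m S At)"
 unfolding smooth_manifold_def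
proof (intro conjI)
 show "Hausdorff_space (mtop (sub_mfd m S At))"
  by (simp add: Hausdorff_space_subtopology)
 show "second_countable (mtop (sub_mfd m S At))"
  by (simp add: second_countable_fun second_countable_subtopology)
 show "\<Union> (fst ` matlas (sub_mfd m S At)) = topspace (mtop (sub_mfd m S At))"
  using cover ch by (fastforce simp: good_chart_def dest: openin_imp_subset)
 show "\<forall>(U, \<phi>)\<in>matlas (sub_mfd m S At). smooth_chart (sub_mfd m S At) U \<phi>"
 proof safe
  fix U \<phi> assume "(U, \<phi>) \<in> matlas (sub_mfd m S At)"
  then have g: "good_chart S m U \<phi>" using ch by simp
  have US: "U \<subseteq> S" using g openin_imp_subset by (auto simp: good_chart_def)
  have UE: "\<phi> ` U \<subseteq> eucl m"
   using g openin_subset by (fastforce simp: good_chart_def topspace_Euclidean_space half_space_def)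
  obtain \<psi> where \<psi>: "\<And>x. x\<in>U \<Longrightarrow> \<psi> (\<phi> x) = x" "\<And>i. sm (\<phi> ` U) (\<lambda>y. \<psi> y i)"
   using g by (auto simp: good_chart_def)
  have "continuous_on U \<phi>" using g by (intro sm_isCont_vec) (auto simp: good_chart_def)
  moreover have "continuous_on (\<phi> ` U) \<psi>" using \<psi>(2) by (rule sm_isCont_vec)
  ultimately have "homeomorphic_maps (top_of_set U) (top_of_set (\<phi> ` U)) \<phi> \<psi>"
   using \<psi>(1) by (auto simp: homeomorphic_maps_def)
  then have "homeomorphic_map (top_of_set U) (top_of_set (\<phi> ` U)) \<phi>"
   by (rule homeomorphic_maps_imp_map)
  moreover have "subtopology (top_of_set S) U = top_of_set U"
   using US by (simp add: subtopology_subtopology Int_absorb1)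
  moreover have "subtopology (Euclidean_space m) (\<phi> ` U) = top_of_set (\<phi> ` U)"
   using UE by (simp add: Euclidean_space_eq subtopology_subtopology Int_absorb1)
  ultimately show "smooth_chart (sub_mfd m S At) U \<phi>"
   using g by (simp add: smooth_chart_def good_chart_def)
 qed
 have E: "emb (sub_mfd m S At) k id" using S ch by (rule emb_sub_mfd)
 show "\<forall>(U, \<phi>)\<in>matlas (sub_mfd m S At). \<forall>(V, \<psi>)\<in>matlas (sub_mfd m S At).
   smooth_on (mdim (sub_mfd m S At)) (mdim (sub_mfd m S At)) (\<phi> ` (U \<inter> V)) (\<psi> \<circ> inv_into U \<phi>)"
 proof safe
  fix U \<phi> V \<psi> assume U: "(U, \<phi>) \<in> matlas (sub_mfd m S At)" and V: "(V, \<psi>) \<in> matlas (sub_mfd m S At)"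
  have "smooth_between (sub_mfd m S At) S (sub_mfd m S At) S id"
   by (rule smooth_betweenI[OF E E, where G = id]) auto
  then have "smooth_on m m (\<phi> ` (U \<inter> S \<inter> id -` V)) (\<psi> \<circ> id \<circ> inv_into U \<phi>)"
   using U V unfolding smooth_between_def by fastforce
  moreover have "U \<inter> S \<inter> id -` V = U \<inter> V"
   using ch[of U \<phi>] U by (auto simp: good_chart_def dest: openin_imp_subset)
  ultimately show "smooth_on (mdim (sub_mfd m S At)) (mdim (sub_mfd m S At)) (\<phi> ` (U \<inter> V)) (\<psi> \<circ> inv_into U \<phi>)"
   by simp
 qed
qed

definition coord :: "real \<Rightarrow> nat \<Rightarrow> real" where "coord t = (\<lambda>i. if i = 0 then t else 0)"

lemma coord_simps [simp]: "coord t 0 = t" "coord t (Suc i) = 0" "i \<noteq> 0 \<Longrightarrow> coord t i = 0"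
 by (simp_all add: coord_def)

lemma coord_eucl: "coord t \<in> eucl 1" by (auto simp: coord_def)

lemma eucl_1: "x \<in> eucl 1 \<Longrightarrow> x = coord (x 0)"
 by (auto simp: coord_def fun_eq_iff)

lemma sm_coord: "sm S f \<Longrightarrow> sm S (\<lambda>x. coord (f x) i)"
 by (cases "i = 0") simp_all

lemma emb_real_line: "emb real_line 1 coord"
proof -
 have c: "continuous_on UNIV coord"
 proof (rule continuous_on_coordinatewise_then_product)
  fix i show "continuous_on UNIV (\<lambda>x. coord x i)" by (cases "i = 0") auto
 qed
 have "continuous_on (range coord) (\<lambda>x::nat\<Rightarrow>real. x 0)"
  by (rule continuous_on_subset[OF continuous_on_product_coordinates]) auto
 moreover have "(\<lambda>t i. if i = 0 then t else 0) = coord" by (auto simp: coord_def)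
 ultimately show ?thesis using c coord_eucl
  by (intro embI[where r = "\<lambda>x. x 0"] emb_chartI[where \<psi> = id and \<xi> = id]) (auto simp: real_line_def)
qed

definition join :: "nat \<Rightarrow> ('a \<Rightarrow> nat \<Rightarrow> real) \<Rightarrow> ('b \<Rightarrow> nat \<Rightarrow> real) \<Rightarrow> 'a \<times> 'b \<Rightarrow> nat \<Rightarrow> real" where
 "join k f g = (\<lambda>(x, y) i. if i < k then f x i else g y (i - k))"

definition p1 :: "nat \<Rightarrow> (nat \<Rightarrow> real) \<Rightarrow> nat \<Rightarrow> real" where "p1 k z = (\<lambda>i. if i < k then z i else 0)"
definition p2 :: "nat \<Rightarrow> (nat \<Rightarrow> real) \<Rightarrow> nat \<Rightarrow> real" where "p2 k z = (\<lambda>i. z (k + i))"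

lemma sm_p1: "sm A (\<lambda>x. p1 k x i)" and sm_p2: "sm A (\<lambda>x. p2 k x i)"
 by (cases "i < k") (simp_all add: p1_def p2_def)

lemma continuous_on_p1: "continuous_on A (p1 k)" and continuous_on_p2: "continuous_on A (p2 k)"
 by (rule sm_isCont_vec, rule sm_p1) (rule sm_isCont_vec, rule sm_p2)

lemma p1_join: "f x \<in> eucl k \<Longrightarrow> p1 k (join k f g (x, y)) = f x"
 by (auto simp: p1_def join_def fun_eq_iff)

lemma p2_join: "p2 k (join k f g (x, y)) = g y"
 by (auto simp: p2_def join_def fun_eq_iff)

text \<open>A product is embedded by concatenation of the coordinates; the two projections of the ambient
  space recover the factors.\<close>

lemma emb_prod:
 assumes X: "emb X k \<iota>" and Y: "emb Y l \<kappa>"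
 shows "emb (prod_mfd X Y) (k + l) (join k \<iota> \<kappa>)"
proof -
 let ?TX = "topspace (mtop X)" and ?TY = "topspace (mtop Y)"
 let ?m = "mdim X" and ?n = "mdim Y"
 obtain r where r: "continuous_map (top_of_set (\<iota> ` ?TX)) (mtop X) r" "\<And>x. x \<in> ?TX \<Longrightarrow> r (\<iota> x) = x"
  by (rule emb_retract[OF X]) blast
 obtain s where s: "continuous_map (top_of_set (\<kappa> ` ?TY)) (mtop Y) s" "\<And>x. x \<in> ?TY \<Longrightarrow> s (\<kappa> x) = x"
  by (rule emb_retract[OF Y]) blast
 have iE: "\<iota> ` ?TX \<subseteq> eucl k" "\<kappa> ` ?TY \<subseteq> eucl l" using emb_eucl[OF X] emb_eucl[OF Y] .
 note c1 = continuous_on_p1 and c2 = continuous_on_p2 and sm1 = sm_p1 and sm2 = sm_p2 and pj1 = p1_join and pj2 = p2_join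
 have T: "topspace (mtop (prod_mfd X Y)) = ?TX \<times> ?TY" by (simp add: prod_mfd_def)
 have cont: "continuous_map (mtop (prod_mfd X Y)) euclidean (join k \<iota> \<kappa>)"
 proof -
  have ci: "continuous_map (prod_topology (mtop X) (mtop Y)) euclidean (\<lambda>z. \<iota> (fst z))"
   using continuous_map_compose[OF continuous_map_fst emb_cont[OF X], unfolded o_def] .
  have ck: "continuous_map (prod_topology (mtop X) (mtop Y)) euclidean (\<lambda>z. \<kappa> (snd z))"
   using continuous_map_compose[OF continuous_map_snd emb_cont[OF Y], unfolded o_def] .
  have "continuous_map (prod_topology (mtop X) (mtop Y)) euclideanreal (\<lambda>z. join k \<iota> \<kappa> z i)" for i
  proof (cases "i < k")
   case True
   then have "(\<lambda>z. join k \<iota> \<kappa> z i) = (\<lambda>y. y i) \<circ> (\<lambda>z. \<iota> (fst z))" by (auto simp: join_def)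
   moreover have "continuous_map euclidean euclideanreal (\<lambda>y::nat\<Rightarrow>real. y i)" by auto
   ultimately show ?thesis using continuous_map_compose[OF ci] by metis
  next
   case False
   then have "(\<lambda>z. join k \<iota> \<kappa> z i) = (\<lambda>y. y (i - k)) \<circ> (\<lambda>z. \<kappa> (snd z))" by (auto simp: join_def)
   moreover have "continuous_map euclidean euclideanreal (\<lambda>y::nat\<Rightarrow>real. y (i - k))" by auto
   ultimately show ?thesis using continuous_map_compose[OF ck] by metis
  qed
  then have "continuous_map (prod_topology (mtop X) (mtop Y)) (powertop_real UNIV) (join k \<iota> \<kappa>)"
   by (simp add: continuous_map_componentwise_UNIV)
  then show ?thesis by (simp add: prod_mfd_def powertop_euclidean)
 qed
 have img: "join k \<iota> \<kappa> ` (?TX \<times> ?TY) \<subseteq> eucl (k + l)"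
 proof clarify
  fix x y i assume "x \<in> ?TX" "y \<in> ?TY" "k + l \<le> i"
  then have "\<kappa> y (i - k) = 0" "\<not> i < k" using iE(2) by (force, simp)
  then show "join k \<iota> \<kappa> (x, y) i = 0" by (simp add: join_def)
 qed
 let ?J = "join k \<iota> \<kappa> ` (?TX \<times> ?TY)"
 have inv: "continuous_map (top_of_set ?J) (prod_topology (mtop X) (mtop Y)) (\<lambda>z. (r (p1 k z), s (p2 k z)))"
 proof (rule continuous_map_pairedI)
  have "p1 k ` ?J \<subseteq> \<iota> ` ?TX"
  proof clarify
   fix x y assume "x \<in> ?TX"
   then have "p1 k (join k \<iota> \<kappa> (x, y)) = \<iota> x" using iE(1) by (intro pj1) auto
   then show "p1 k (join k \<iota> \<kappa> (x, y)) \<in> \<iota> ` ?TX" using \<open>x \<in> ?TX\<close> by auto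
  qed
  then have "continuous_map (top_of_set ?J) (top_of_set (\<iota> ` ?TX)) (p1 k)"
   using c1[of ?J k] by (auto simp: continuous_map_in_subtopology)
  then show "continuous_map (top_of_set ?J) (mtop X) (\<lambda>z. r (p1 k z))"
   using continuous_map_compose[OF _ r(1)] by (metis comp_apply continuous_map_eq)
  have "continuous_map (top_of_set ?J) (top_of_set (\<kappa> ` ?TY)) (p2 k)"
   using c2[of ?J k] by (auto simp: continuous_map_in_subtopology pj2)
  then show "continuous_map (top_of_set ?J) (mtop Y) (\<lambda>z. s (p2 k z))"
   using continuous_map_compose[OF _ s(1)] by (metis comp_apply continuous_map_eq)
 qed
 have charts: "emb_chart (prod_mfd X Y) (join k \<iota> \<kappa>) W \<phi>"
  if Wm: "(W, \<phi>) \<in> matlas (prod_mfd X Y)" for W \<phi>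
 proof -
  obtain U f V g where UV: "(U, f) \<in> matlas X" "(V, g) \<in> matlas Y" "W = U \<times> V" "\<phi> = join ?m f g"
   using Wm by (auto simp: prod_mfd_def join_def)
  obtain f' cf where f: "U \<subseteq> ?TX" "f ` U \<subseteq> eucl ?m"
   "\<And>x. x \<in> U \<Longrightarrow> f' (f x) = \<iota> x" "\<And>i. sm (f ` U) (\<lambda>y. f' y i)"
   "\<And>x. x \<in> U \<Longrightarrow> cf (\<iota> x) = f x" "\<And>i. sm (\<iota> ` U) (\<lambda>y. cf y i)"
   by (rule emb_chartE[OF X UV(1)]) blast
  obtain g' cg where g: "V \<subseteq> ?TY" "g ` V \<subseteq> eucl ?n"
   "\<And>x. x \<in> V \<Longrightarrow> g' (g x) = \<kappa> x" "\<And>i. sm (g ` V) (\<lambda>y. g' y i)"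
   "\<And>x. x \<in> V \<Longrightarrow> cg (\<kappa> x) = g x" "\<And>i. sm (\<kappa> ` V) (\<lambda>y. cg y i)"
   by (rule emb_chartE[OF Y UV(2)]) blast
  have P1: "p1 ?m ` \<phi> ` W \<subseteq> f ` U" and P2: "p2 ?m ` \<phi> ` W \<subseteq> g ` V"
   and Q1: "p1 k ` join k \<iota> \<kappa> ` W \<subseteq> \<iota> ` U" and Q2: "p2 k ` join k \<iota> \<kappa> ` W \<subseteq> \<kappa> ` V"
  proof -
   show "p1 ?m ` \<phi> ` W \<subseteq> f ` U"
   proof (unfold UV(3,4), clarify)
    fix x y assume "x \<in> U"
    then have "p1 ?m (join ?m f g (x, y)) = f x" using f(2) by (intro pj1) auto
    then show "p1 ?m (join ?m f g (x, y)) \<in> f ` U" using \<open>x \<in> U\<close> by auto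
   qed
   show "p1 k ` join k \<iota> \<kappa> ` W \<subseteq> \<iota> ` U"
   proof (unfold UV(3), clarify)
    fix x y assume "x \<in> U"
    then have "p1 k (join k \<iota> \<kappa> (x, y)) = \<iota> x" using f(1) iE(1) by (intro pj1) blast
    then show "p1 k (join k \<iota> \<kappa> (x, y)) \<in> \<iota> ` U" using \<open>x \<in> U\<close> by auto
   qed
  qed (auto simp: UV pj2)
  have "sm (\<phi> ` W) (\<lambda>y. join k (\<lambda>y. f' (p1 ?m y)) (\<lambda>y. g' (p2 ?m y)) (y, y) i)" for i
   using sm_compose[OF sm1 f(4) P1] sm_compose[OF sm2 g(4) P2] by (cases "i < k") (auto simp: join_def)
  moreover have "join k (\<lambda>y. f' (p1 ?m y)) (\<lambda>y. g' (p2 ?m y)) (\<phi> z, \<phi> z) = join k \<iota> \<kappa> z" if zW: "z \<in> W" for z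
  proof -
   obtain x y where z: "z = (x, y)" "x \<in> U" "y \<in> V" using zW UV(3) by auto
   have "f x \<in> eucl ?m" using f(2) z by auto
   then have "p1 ?m (\<phi> z) = f x" "p2 ?m (\<phi> z) = g y" using UV(4) z(1) pj1[of f x ?m g y] pj2[of ?m f g x y] by auto
   then show ?thesis using z by (simp add: join_def f(3) g(3) cong del: if_weak_cong)
  qed
  moreover have "sm (join k \<iota> \<kappa> ` W) (\<lambda>y. join ?m (\<lambda>y. cf (p1 k y)) (\<lambda>y. cg (p2 k y)) (y, y) i)" for i
   using sm_compose[OF sm1 f(6) Q1] sm_compose[OF sm2 g(6) Q2] by (cases "i < ?m") (auto simp: join_def)
  moreover have "join ?m (\<lambda>y. cf (p1 k y)) (\<lambda>y. cg (p2 k y)) (join k \<iota> \<kappa> z, join k \<iota> \<kappa> z) = \<phi> z" if zW: "z \<in> W" for z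
  proof -
   obtain x y where z: "z = (x, y)" "x \<in> U" "y \<in> V" using zW UV(3) by auto
   have "x \<in> ?TX" using f(1) z by blast
   then have "\<iota> x \<in> eucl k" using iE(1) by blast
   then have "p1 k (join k \<iota> \<kappa> z) = \<iota> x" "p2 k (join k \<iota> \<kappa> z) = \<kappa> y" using z(1) pj1[of \<iota> x k \<kappa> y] pj2[of k \<iota> \<kappa> x y] by auto
   then show ?thesis using z UV(4) by (simp add: join_def f(5) g(5) cong del: if_weak_cong)
  qed
  moreover have "\<phi> ` W \<subseteq> eucl (?m + ?n)"
  proof
   fix z assume "z \<in> \<phi> ` W"
   then obtain x y where z: "z = \<phi> (x, y)" "x \<in> U" "y \<in> V" using UV by auto
   show "z \<in> eucl (?m + ?n)"
   proof clarify
    fix i assume "?m + ?n \<le> i"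
    then have "g y (i - ?m) = 0" "\<not> i < ?m" using g(2) z(3) by (force, simp)
    then show "z i = 0" by (simp add: z UV join_def)
   qed
  qed
  ultimately show ?thesis using f(1) g(1) UV(3) T
   by (intro emb_chartI[where \<psi> = "\<lambda>y. join k (\<lambda>y. f' (p1 ?m y)) (\<lambda>y. g' (p2 ?m y)) (y, y)"
     and \<xi> = "\<lambda>y. join ?m (\<lambda>y. cf (p1 k y)) (\<lambda>y. cg (p2 k y)) (y, y)"]) (auto simp: prod_mfd_def)
 qed
 have M: "mdim (prod_mfd X Y) = ?m + ?n" "mtop (prod_mfd X Y) = prod_topology (mtop X) (mtop Y)"
  by (simp_all add: prod_mfd_def)
 have rs: "\<forall>z\<in>?TX \<times> ?TY. (r (p1 k (join k \<iota> \<kappa> z)), s (p2 k (join k \<iota> \<kappa> z))) = z"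
 proof
  fix z assume "z \<in> ?TX \<times> ?TY"
  then obtain x y where xy: "x \<in> ?TX" "y \<in> ?TY" and z: "z = (x, y)" by blast
  then have "p1 k (join k \<iota> \<kappa> (x, y)) = \<iota> x" using iE(1) by (intro pj1) auto
  then show "(r (p1 k (join k \<iota> \<kappa> z)), s (p2 k (join k \<iota> \<kappa> z))) = z"
   using r(2) s(2) xy by (simp add: pj2 z)
 qed
 show ?thesis
 proof (rule embI[where r = "\<lambda>z. (r (p1 k z), s (p2 k z))"])
  show "join k \<iota> \<kappa> ` topspace (mtop (prod_mfd X Y)) \<subseteq> eucl (k + l)" unfolding T by (rule img)
  show "continuous_map (top_of_set (join k \<iota> \<kappa> ` topspace (mtop (prod_mfd X Y)))) (mtop (prod_mfd X Y)) (\<lambda>z. (r (p1 k z), s (p2 k z)))"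
   using inv by (simp add: M)
  show "(r (p1 k (join k \<iota> \<kappa> z)), s (p2 k (join k \<iota> \<kappa> z))) = z" if "z \<in> topspace (mtop (prod_mfd X Y))" for z
   using rs that unfolding T by blast
 qed (rule cont, rule charts)
qed

lemma emb_interior:
 assumes X: "emb X k \<iota>" shows "emb (interior_mfd X) k \<iota>"
proof -
 let ?I = "mfd_interior X"
 obtain r where r: "continuous_map (top_of_set (\<iota> ` topspace (mtop X))) (mtop X) r" "\<And>x. x \<in> topspace (mtop X) \<Longrightarrow> r (\<iota> x) = x"
  by (rule emb_retract[OF X]) blast
 have ID: "?I \<subseteq> topspace (mtop X)"
 proof
  fix x assume "x \<in> ?I"
  then obtain U \<phi> where U: "(U, \<phi>) \<in> matlas X" "x \<in> U" unfolding mfd_interior_def by blast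
  then show "x \<in> topspace (mtop X)" using emb_chartE[OF X U(1)] by blast
 qed
 have T: "topspace (mtop (interior_mfd X)) = ?I" using ID by (auto simp: interior_mfd_def)
 have rI: "continuous_map (top_of_set (\<iota> ` ?I)) (mtop (interior_mfd X)) r"
  using continuous_map_from_subtopology_mono[OF r(1), of "\<iota> ` ?I"] r(2) ID
  by (auto simp: interior_mfd_def continuous_map_in_subtopology image_subset_iff subset_iff)
 show ?thesis
 proof (rule embI[where r = r], unfold T)
  show "continuous_map (mtop (interior_mfd X)) euclidean \<iota>"
   using emb_cont[OF X] by (simp add: interior_mfd_def continuous_map_from_subtopology)
  show "\<iota> ` ?I \<subseteq> eucl k" using emb_eucl[OF X] ID by auto
  show "continuous_map (top_of_set (\<iota> ` ?I)) (mtop (interior_mfd X)) r" by (rule rI)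
  show "r (\<iota> x) = x" if "x \<in> ?I" for x using r(2) ID that by auto
  fix U \<phi> assume "(U, \<phi>) \<in> matlas (interior_mfd X)"
  then obtain V where V: "(V, \<phi>) \<in> matlas X" "U = V \<inter> ?I" by (auto simp: interior_mfd_def)
  obtain f' cf where f: "V \<subseteq> topspace (mtop X)" "\<phi> ` V \<subseteq> eucl (mdim X)"
   "\<And>x. x \<in> V \<Longrightarrow> f' (\<phi> x) = \<iota> x" "\<And>i. sm (\<phi> ` V) (\<lambda>y. f' y i)"
   "\<And>x. x \<in> V \<Longrightarrow> cf (\<iota> x) = \<phi> x" "\<And>i. sm (\<iota> ` V) (\<lambda>y. cf y i)"
   by (rule emb_chartE[OF X V(1)]) blast
  have "sm (\<phi> ` U) (\<lambda>y. f' y i)" "sm (\<iota> ` U) (\<lambda>y. cf y i)" for i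
   using V(2) by (auto intro: sm_subset[OF f(4)] sm_subset[OF f(6)])
  moreover have "\<phi> ` U \<subseteq> eucl (mdim (interior_mfd X))"
   using f(2) V(2) by (auto simp: interior_mfd_def)
  ultimately show "emb_chart (interior_mfd X) \<iota> U \<phi>"
   using f(3,5) V(2) T by (intro emb_chartI[where \<psi> = f' and \<xi> = cf]) auto
 qed
qed

lemma emb_boundary:
 assumes X: "emb X k \<iota>"
  and bd: "\<And>U \<phi> x. (U, \<phi>) \<in> matlas X \<Longrightarrow> x \<in> U \<inter> mfd_boundary X \<Longrightarrow> \<phi> x \<in> eucl (mdim X - 1)"
 shows "emb (boundary_mfd X) k \<iota>"
proof -
 let ?I = "mfd_boundary X"
 obtain r where r: "continuous_map (top_of_set (\<iota> ` topspace (mtop X))) (mtop X) r" "\<And>x. x \<in> topspace (mtop X) \<Longrightarrow> r (\<iota> x) = x"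
  by (rule emb_retract[OF X]) blast
 have ID: "?I \<subseteq> topspace (mtop X)" unfolding mfd_boundary_def by blast
 have T: "topspace (mtop (boundary_mfd X)) = ?I" using ID by (auto simp: boundary_mfd_def)
 have rI: "continuous_map (top_of_set (\<iota> ` ?I)) (mtop (boundary_mfd X)) r"
  using continuous_map_from_subtopology_mono[OF r(1), of "\<iota> ` ?I"] r(2) ID
  by (auto simp: boundary_mfd_def continuous_map_in_subtopology image_subset_iff subset_iff)
 show ?thesis
 proof (rule embI[where r = r], unfold T)
  show "continuous_map (mtop (boundary_mfd X)) euclidean \<iota>"
   using emb_cont[OF X] by (simp add: boundary_mfd_def continuous_map_from_subtopology)
  show "\<iota> ` ?I \<subseteq> eucl k" using emb_eucl[OF X] ID by auto
  show "continuous_map (top_of_set (\<iota> ` ?I)) (mtop (boundary_mfd X)) r" by (rule rI)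
  show "r (\<iota> x) = x" if "x \<in> ?I" for x using r(2) ID that by auto
  fix U \<phi> assume "(U, \<phi>) \<in> matlas (boundary_mfd X)"
  then obtain V where V: "(V, \<phi>) \<in> matlas X" "U = V \<inter> ?I" by (auto simp: boundary_mfd_def)
  obtain f' cf where f: "V \<subseteq> topspace (mtop X)" "\<phi> ` V \<subseteq> eucl (mdim X)"
   "\<And>x. x \<in> V \<Longrightarrow> f' (\<phi> x) = \<iota> x" "\<And>i. sm (\<phi> ` V) (\<lambda>y. f' y i)"
   "\<And>x. x \<in> V \<Longrightarrow> cf (\<iota> x) = \<phi> x" "\<And>i. sm (\<iota> ` V) (\<lambda>y. cf y i)"
   by (rule emb_chartE[OF X V(1)]) blast
  have "sm (\<phi> ` U) (\<lambda>y. f' y i)" "sm (\<iota> ` U) (\<lambda>y. cf y i)" for i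
   using V(2) by (auto intro: sm_subset[OF f(4)] sm_subset[OF f(6)])
  moreover have "\<phi> ` U \<subseteq> eucl (mdim (boundary_mfd X))"
   using bd[OF V(1)] V(2) by (auto simp: boundary_mfd_def)
  ultimately show "emb_chart (boundary_mfd X) \<iota> U \<phi>"
   using f(3,5) V(2) T by (intro emb_chartI[where \<psi> = f' and \<xi> = cf]) auto
 qed
qed

section \<open>The projective plane and its charts\<close>

definition tup :: "real list \<Rightarrow> nat \<Rightarrow> real" where
 "tup xs i = (if i < length xs then xs ! i else 0)"

lemma tup_simps [simp]:
 "tup [] i = 0" "tup (x # xs) 0 = x" "tup (x # xs) (Suc n) = tup xs n"
 "tup (x # xs) 1 = tup xs 0" "tup (x # xs) (numeral k) = tup xs (pred_numeral k)"
 by (simp_all add: tup_def numeral_eq_Suc)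

lemma sm_tup_Nil: "sm S (\<lambda>x. tup [] i)" by simp

lemma sm_tup_Cons:
 assumes "sm S a" "\<And>i. sm S (\<lambda>x. tup (as x) i)" shows "sm S (\<lambda>x. tup (a x # as x) i)"
 using assms by (cases i) auto

lemmas sm_tup = sm_tup_Cons sm_tup_Nil

lemma tup_eucl: "length xs \<le> k \<Longrightarrow> tup xs \<in> eucl k"
 by (auto simp: tup_def)

lemma eucl_2: "y \<in> eucl 2 \<Longrightarrow> y = tup [y 0, y 1]"
proof
 fix i :: nat assume y: "y \<in> eucl 2"
 consider "i = 0" | "i = 1" | "i \<ge> (2::nat)" by linarith
 then show "y i = tup [y 0, y 1] i" using y by cases (auto simp: tup_def)
qed

lemma coord_tup: "coord t = tup [t]"
 by (auto simp: coord_def tup_def fun_eq_iff)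

text \<open>The Veronese map. It takes the same value at antipodal points of the sphere and separates all
  other pairs, so that its image is the projective plane.\<close>

definition ver :: "real \<Rightarrow> real \<Rightarrow> real \<Rightarrow> nat \<Rightarrow> real" where
 "ver x y z = tup [x^2, y^2, z^2, x*y, x*z, y*z]"

lemma ver_simps [simp]:
 "ver x y z 0 = x^2" "ver x y z (Suc 0) = y^2" "ver x y z 1 = y^2" "ver x y z 2 = z^2"
 "ver x y z 3 = x*y" "ver x y z 4 = x*z" "ver x y z 5 = y*z"
 by (simp_all add: ver_def)

lemma ver_minus: "ver (-x) (-y) (-z) = ver x y z" by (simp add: ver_def)

lemma sm_ver: "sm S a \<Longrightarrow> sm S b \<Longrightarrow> sm S c \<Longrightarrow> sm S (\<lambda>x. ver (a x) (b x) (c x) i)"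
 unfolding ver_def by (intro sm_tup sm_intros)

definition RP2 :: "(nat \<Rightarrow> real) set" where
 "RP2 = {ver x y z | x y z. x^2 + y^2 + z^2 = 1}"

text \<open>The part of the projective plane at the given values of the third squared coordinate, which is
  the height.\<close>

definition band :: "real set \<Rightarrow> (nat \<Rightarrow> real) set" where
 "band I = {P \<in> RP2. P 2 \<in> I}"

lemma verI: "x^2 + y^2 + z^2 = 1 \<Longrightarrow> ver x y z \<in> RP2" by (auto simp: RP2_def)

lemma RP2_eucl: "RP2 \<subseteq> eucl 6" using tup_eucl[of _ 6] by (auto simp: RP2_def ver_def)

lemma RP2E:
 assumes "P \<in> RP2" obtains x y z where "P = ver x y z" "x^2 + y^2 + z^2 = 1"
 using assms by (auto simp: RP2_def)

lemma RP2_pos: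
 assumes "P \<in> RP2"
 shows "P 2 > 0 \<Longrightarrow> \<exists>x y z. P = ver x y z \<and> x^2 + y^2 + z^2 = 1 \<and> z > 0"
  and "P 0 > 0 \<Longrightarrow> \<exists>x y z. P = ver x y z \<and> x^2 + y^2 + z^2 = 1 \<and> x > 0"
  and "P 1 > 0 \<Longrightarrow> \<exists>x y z. P = ver x y z \<and> x^2 + y^2 + z^2 = 1 \<and> y > 0"
proof -
 obtain x y z where P: "P = ver x y z" "x^2 + y^2 + z^2 = 1" using RP2E[OF assms] .
 have P': "P = ver (-x) (-y) (-z)" "(-x)^2 + (-y)^2 + (-z)^2 = 1" using P by (simp_all add: ver_minus)
 show "P 2 > 0 \<Longrightarrow> \<exists>x y z. P = ver x y z \<and> x^2 + y^2 + z^2 = 1 \<and> z > 0"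
 proof (cases "z > 0")
  case False assume "P 2 > 0"
  then have "z \<noteq> 0" using P by auto
  then show ?thesis using P' False by (intro exI[of _ "-x"] exI[of _ "-y"] exI[of _ "-z"]) auto
 qed (use P in blast)
 show "P 0 > 0 \<Longrightarrow> \<exists>x y z. P = ver x y z \<and> x^2 + y^2 + z^2 = 1 \<and> x > 0"
 proof (cases "x > 0")
  case False assume "P 0 > 0"
  then have "x \<noteq> 0" using P by auto
  then show ?thesis using P' False by (intro exI[of _ "-x"] exI[of _ "-y"] exI[of _ "-z"]) auto
 qed (use P in blast)
 show "P 1 > 0 \<Longrightarrow> \<exists>x y z. P = ver x y z \<and> x^2 + y^2 + z^2 = 1 \<and> y > 0"
 proof (cases "y > 0")
  case False assume "P 1 > 0"
  then have "y \<noteq> 0" using P by auto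
  then show ?thesis using P' False by (intro exI[of _ "-x"] exI[of _ "-y"] exI[of _ "-z"]) auto
 qed (use P in blast)
qed

lemma RP2_bounds: "P \<in> RP2 \<Longrightarrow> 0 \<le> P 2 \<and> P 2 \<le> 1 \<and> 0 \<le> P 0 \<and> 0 \<le> P 1 \<and> P 0 + P 1 + P 2 = 1"
proof -
 assume "P \<in> RP2"
 then obtain x y z where P: "P = ver x y z" "x^2 + y^2 + z^2 = 1" using RP2E by blast
 have "0 \<le> x^2" "0 \<le> y^2" "0 \<le> z^2" by simp_all
 with P(2) have "0 \<le> z^2 \<and> z^2 \<le> 1 \<and> 0 \<le> x^2 \<and> 0 \<le> y^2 \<and> x^2 + y^2 + z^2 = 1" by linarith
 then show ?thesis by (simp add: P(1))
qed

text \<open>A point of the projective plane at height \<open>v\<close> and with an angle; angles that differ by \<pi> give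
  antipodal points of the circle of radius \<open>sqrt (1 - v)\<close>, which are different points of the plane
  unless \<open>v\<close> is 0 or 1.\<close>

definition polar :: "real \<Rightarrow> real \<Rightarrow> nat \<Rightarrow> real" where
 "polar v t = ver (sqrt (1 - v) * cos t) (sqrt (1 - v) * sin t) (sqrt v)"

lemma polar_in: "0 \<le> v \<Longrightarrow> v \<le> 1 \<Longrightarrow> polar v t \<in> RP2 \<and> polar v t 2 = v"
proof -
 assume v: "0 \<le> v" "v \<le> 1"
 have "(sqrt (1 - v) * cos t)^2 = (1 - v) * (cos t)^2" "(sqrt (1 - v) * sin t)^2 = (1 - v) * (sin t)^2"
  using v by (simp_all add: power_mult_distrib)
 then have "(sqrt (1 - v) * cos t)^2 + (sqrt (1 - v) * sin t)^2 = 1 - v"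
  by (simp only: distrib_left[symmetric] sin_cos_squared_add2 mult_1_right)
 then show ?thesis using v by (auto simp: polar_def intro!: verI)
qed

text \<open>Since the sign of a representative is free, the third coordinate can be taken to be
  nonnegative; the other two are then given by an angle.\<close>

lemma polar_surj:
 assumes "P \<in> RP2" obtains t where "P = polar (P 2) t" "0 \<le> t" "t \<le> 2 * pi"
proof -
 obtain x y z where P: "P = ver x y z" "x^2 + y^2 + z^2 = 1" "z \<ge> 0"
 proof -
  obtain x y z where P: "P = ver x y z" "x^2 + y^2 + z^2 = 1" using RP2E[OF assms] .
  show ?thesis
  proof (cases "z \<ge> 0")
   case True with P that show ?thesis by blast
  next
   case False then show ?thesis using that[of "-x" "-y" "-z"] P by (simp add: ver_minus)
  qed
 qed
 have z: "sqrt (P 2) = z" using P by simp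
 define r where "r = sqrt (1 - P 2)"
 have "1 - P 2 = x^2 + y^2" using P by simp
 then have r2: "r^2 = x^2 + y^2" "r \<ge> 0" by (simp_all add: r_def)
 show ?thesis
 proof (cases "r = 0")
  case True
  then have "x = 0" "y = 0" using r2 by (simp_all add: sum_power2_eq_zero_iff)
  then have "polar (P 2) 0 = ver x y z" using True unfolding polar_def z r_def[symmetric] by simp
  then have "P = polar (P 2) 0" by (rule trans[OF P(1) sym])
  then show ?thesis using that[of 0] by simp
 next
  case False
  then have "(x / r)^2 + (y / r)^2 = 1" by (simp add: power_divide add_divide_distrib[symmetric] r2(1)[symmetric])
  then obtain t where t: "0 \<le> t" "t < 2 * pi" "x / r = cos t" "y / r = sin t" by (rule sincos_total_2pi)
  then have "x = r * cos t" "y = r * sin t" using False by (auto simp: field_simps)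
  then have "polar (P 2) t = ver x y z" unfolding polar_def z r_def[symmetric] by simp
  then have "P = polar (P 2) t" by (rule trans[OF P(1) sym])
  then show ?thesis using that[of t] t by simp
 qed
qed

lemma band_polar:
 assumes "I \<subseteq> {0..1}" shows "band I = (\<lambda>(v, t). polar v t) ` (I \<times> {0..2*pi})"
proof
 show "band I \<subseteq> (\<lambda>(v, t). polar v t) ` (I \<times> {0..2*pi})"
 proof
  fix P assume "P \<in> band I"
  then have P: "P \<in> RP2" "P 2 \<in> I" by (auto simp: band_def)
  obtain t where "P = polar (P 2) t" "0 \<le> t" "t \<le> 2 * pi" using polar_surj[OF P(1)] .
  then show "P \<in> (\<lambda>(v, t). polar v t) ` (I \<times> {0..2*pi})"
   using P(2) by (intro image_eqI[of _ _ "(P 2, t)"]) auto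
 qed
 show "(\<lambda>(v, t). polar v t) ` (I \<times> {0..2*pi}) \<subseteq> band I"
  using polar_in assms by (auto simp: band_def)
qed

lemma continuous_on_tup_Cons:
 assumes "continuous_on S a" "continuous_on S (\<lambda>x. tup (as x))" shows "continuous_on S (\<lambda>x. tup (a x # as x))"
proof (rule continuous_on_coordinatewise_then_product)
 fix i show "continuous_on S (\<lambda>x. tup (a x # as x) i)"
 proof (cases i)
  case (Suc n)
  have "continuous_on S (\<lambda>x. tup (as x) n)"
   by (rule continuous_on_compose2[OF continuous_on_product_coordinates[of n] assms(2)]) simp
  then show ?thesis using Suc by simp
 qed (use assms in simp)
qed

lemma continuous_on_tup_Nil: "continuous_on S (\<lambda>x. tup [])" by simp

lemma continuous_polar: "continuous_on S (\<lambda>(v, t). polar v t)"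
 unfolding polar_def ver_def case_prod_beta
 by (intro continuous_on_tup_Cons continuous_on_tup_Nil continuous_intros)

lemma compact_band: "compact I \<Longrightarrow> I \<subseteq> {0..1} \<Longrightarrow> compact (band I)"
 by (subst band_polar) (auto intro!: compact_continuous_image continuous_polar compact_Times)

lemma connected_band: "connected I \<Longrightarrow> I \<subseteq> {0..1} \<Longrightarrow> connected (band I)"
 by (subst band_polar) (auto intro!: connected_continuous_image continuous_polar connected_Times)

lemma RP2_band: "RP2 = band {0..1}" using RP2_bounds by (auto simp: band_def)

lemma band_nonempty: "v \<in> I \<Longrightarrow> 0 \<le> v \<Longrightarrow> v \<le> 1 \<Longrightarrow> band I \<noteq> {}"
 using polar_in[of v 0] unfolding band_def by force

text \<open>The quotients of two homogeneous coordinates, written through the quadratic coordinates of the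
  embedding.\<close>

definition aff :: "nat \<Rightarrow> (nat \<Rightarrow> real) \<Rightarrow> nat \<Rightarrow> real" where
 "aff k P = (if k = 0 then tup [P 3 / P 0, P 4 / P 0]
       else if k = 1 then tup [P 3 / P 1, P 5 / P 1] else tup [P 4 / P 2, P 5 / P 2])"

definition aff_inv :: "nat \<Rightarrow> (nat \<Rightarrow> real) \<Rightarrow> nat \<Rightarrow> real" where
 "aff_inv k y = (let n = sqrt (1 + (y 0)^2 + (y 1)^2) in
   if k = 0 then ver (1 / n) (y 0 / n) (y 1 / n)
   else if k = 1 then ver (y 0 / n) (1 / n) (y 1 / n) else ver (y 0 / n) (y 1 / n) (1 / n))"

definition aff_height :: "nat \<Rightarrow> (nat \<Rightarrow> real) \<Rightarrow> real" where
 "aff_height k y = (if k = 2 then 1 else (y 1)^2) / (1 + (y 0)^2 + (y 1)^2)"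

lemma one_plus_pos: "0 < 1 + (a::real)^2 + b^2"
 by (smt (verit) zero_le_power2)

lemma aff_inv_in: "aff_inv k y \<in> RP2"
proof -
 define n where "n = sqrt (1 + (y 0)^2 + (y 1)^2)"
 have n: "n^2 = 1 + (y 0)^2 + (y 1)^2" "n > 0" using one_plus_pos[of "y 0" "y 1"] by (simp_all add: n_def)
 have "(1 / n)^2 + (y 0 / n)^2 + (y 1 / n)^2 = (1 + (y 0)^2 + (y 1)^2) / n^2"
  by (simp add: power_divide add_divide_distrib)
 also have "\<dots> = 1" using n by (simp only: n(1)[symmetric]) simp
 finally have "(1 / n)^2 + (y 0 / n)^2 + (y 1 / n)^2 = 1" .
 then show ?thesis unfolding aff_inv_def Let_def n_def[symmetric] by (auto intro!: verI)
qed

lemma aff_inv_height: "k \<in> {0,1,2} \<Longrightarrow> aff_inv k y 2 = aff_height k y \<and> aff_inv k y k > 0"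
proof -
 define n where "n = sqrt (1 + (y 0)^2 + (y 1)^2)"
 have n: "n^2 = 1 + (y 0)^2 + (y 1)^2" "n > 0" using one_plus_pos[of "y 0" "y 1"] by (simp_all add: n_def)
 have nz: "1 + (y 0)^2 + (y 1)^2 \<noteq> 0" using one_plus_pos[of "y 0" "y 1"] by simp
 show "k \<in> {0,1,2} \<Longrightarrow> ?thesis" using n nz
  unfolding aff_inv_def Let_def n_def[symmetric] aff_height_def n(1)[symmetric] by (auto simp: power_divide)
qed

lemma aff_aff_inv: "y \<in> eucl 2 \<Longrightarrow> aff k (aff_inv k y) = y"
proof -
 assume y: "y \<in> eucl 2"
 define n where "n = sqrt (1 + (y 0)^2 + (y 1)^2)"
 have n: "n > 0" using one_plus_pos[of "y 0" "y 1"] by (simp_all add: n_def)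
 have "aff k (aff_inv k y) = tup [y 0, y 1]" using n
  unfolding aff_inv_def Let_def n_def[symmetric] aff_def by (auto simp: field_simps power2_eq_square)
 also have "\<dots> = y" by (rule eucl_2[OF y, symmetric])
 finally show ?thesis .
qed

lemma sqrt_ratio:
 assumes "x^2 + y^2 + z^2 = 1" "(z::real) > 0"
 shows "sqrt (1 + (x/z)^2 + (y/z)^2) = 1 / z"
proof -
 have "1 + (x/z)^2 + (y/z)^2 = (x^2 + y^2 + z^2) / z^2" using assms(2) by (simp add: field_simps)
 then show ?thesis using assms by (simp add: real_sqrt_divide)
qed

lemma aff_inv_aff:
 assumes "P \<in> RP2" "k \<in> {0,1,2}" "P k > 0" shows "aff_inv k (aff k P) = P"
proof -
 consider "k = 0" | "k = 1" | "k = 2" using assms(2) by auto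
 then show ?thesis
 proof cases
  case 1
  then obtain x y z where P: "P = ver x y z" "x^2 + y^2 + z^2 = 1" "x > 0" using RP2_pos(2)[OF assms(1)] assms(3) by auto
  have r: "x * y / x^2 = y / x" "x * z / x^2 = z / x" using P by (auto simp: power2_eq_square)
  have "sqrt (1 + (y/x)^2 + (z/x)^2) = 1 / x" using sqrt_ratio[of y z x] P by (simp add: ac_simps)
  then show ?thesis using P 1 by (simp add: aff_def aff_inv_def Let_def r)
 next
  case 2
  then obtain x y z where P: "P = ver x y z" "x^2 + y^2 + z^2 = 1" "y > 0" using RP2_pos(3)[OF assms(1)] assms(3) by auto
  have r: "x * y / y^2 = x / y" "y * z / y^2 = z / y" using P by (auto simp: power2_eq_square)
  have "sqrt (1 + (x/y)^2 + (z/y)^2) = 1 / y" using sqrt_ratio[of x z y] P by (simp add: ac_simps)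
  then show ?thesis using P 2 by (simp add: aff_def aff_inv_def Let_def r)
 next
  case 3
  then obtain x y z where P: "P = ver x y z" "x^2 + y^2 + z^2 = 1" "z > 0" using RP2_pos(1)[OF assms(1)] assms(3) by auto
  have r: "x * z / z^2 = x / z" "y * z / z^2 = y / z" using P by (auto simp: power2_eq_square)
  have "sqrt (1 + (x/z)^2 + (y/z)^2) = 1 / z" using sqrt_ratio[of x y z] P by (simp add: ac_simps)
  then show ?thesis using P 3 by (simp add: aff_def aff_inv_def Let_def r)
 qed
qed

lemma sm_aff: "k \<in> {0,1,2} \<Longrightarrow> (\<And>P. P \<in> S \<Longrightarrow> P k > 0) \<Longrightarrow> sm S (\<lambda>P. aff k P i)"
 unfolding aff_def by (auto intro!: sm_tup sm_intros) fastforce+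

lemma sm_aff_inv: "sm S (\<lambda>y. aff_inv k y i)"
proof -
 have nz: "sqrt (1 + (a::real)^2 + b^2) \<noteq> 0" for a b using one_plus_pos[of a b] by simp
 show ?thesis unfolding aff_inv_def Let_def
  by (cases "k = 0"; cases "k = 1") (auto intro!: sm_ver sm_intros one_plus_pos simp del: real_sqrt_eq_zero_cancel_iff simp: nz)
qed

lemma continuous_aff_height: "continuous_on UNIV (aff_height k)"
proof -
 have "sm UNIV (aff_height k)"
  unfolding aff_height_def using one_plus_pos by (cases "k = 2") (auto intro!: sm_intros simp: less_imp_neq[symmetric])
 then show ?thesis by (rule sm_isCont)
qed

lemma openin_top_of_set_vimage:
 assumes "continuous_on UNIV f" "open T" "{x \<in> A. f x \<in> T} \<subseteq> S" "S \<subseteq> A"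
 shows "openin (top_of_set S) {x \<in> A. f x \<in> T}"
proof -
 have "open (f -` T)" using assms by (simp add: open_vimage)
 moreover have "{x \<in> A. f x \<in> T} = S \<inter> f -` T" using assms by auto
 ultimately show ?thesis by auto
qed

lemma aff_chart:
 assumes T: "open T" and S: "S \<subseteq> RP2" "band T \<subseteq> S" and k: "k \<in> {0,1,2}"
 shows "good_chart S 2 {P \<in> band T. P k > 0} (aff k)"
  and "aff k ` {P \<in> band T. P k > 0} = {y \<in> eucl 2. aff_height k y \<in> T}"
proof -
 let ?U = "{P \<in> band T. P k > 0}" and ?B = "{y \<in> eucl 2. aff_height k y \<in> T}"
 have "open ((\<lambda>P::nat\<Rightarrow>real. P 2) -` T)" "open ((\<lambda>P::nat\<Rightarrow>real. P k) -` {0<..})"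
  using T by (simp_all add: open_vimage continuous_on_product_coordinates)
 moreover have "?U = S \<inter> ((\<lambda>P. P 2) -` T \<inter> (\<lambda>P. P k) -` {0<..})" using S by (auto simp: band_def)
 ultimately have 1: "openin (top_of_set S) ?U" by auto
 have "openin (top_of_set (eucl 2)) ?B"
  by (rule openin_top_of_set_vimage[OF continuous_aff_height T]) auto
 then have 2: "openin (Euclidean_space 2) ?B" by (simp add: Euclidean_space_eq)
 have 3: "aff k P \<in> ?B" if P: "P \<in> ?U" for P
 proof -
  have "aff k P \<in> eucl 2" unfolding aff_def by (auto simp: tup_def)
  moreover have "aff_height k (aff k P) = P 2"
   using aff_inv_aff[of P k] aff_inv_height[OF k, of "aff k P"] P k by (auto simp: band_def)
  ultimately show ?thesis using P by (auto simp: band_def)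
 qed
 have 4: "aff_inv k y \<in> ?U" if "y \<in> ?B" for y
  using aff_inv_in aff_inv_height[OF k] that by (auto simp: band_def)
 have 5: "aff_inv k (aff k P) = P" if "P \<in> ?U" for P
  using aff_inv_aff[OF _ k] that by (auto simp: band_def)
 have 6: "aff k (aff_inv k y) = y" if "y \<in> ?B" for y using aff_aff_inv that by auto
 have 7: "sm ?U (\<lambda>P. aff k P i)" for i by (rule sm_aff[OF k]) auto
 show "good_chart S 2 ?U (aff k)" by (rule good_chartI(1)[OF 1 disjI1[OF 2] 3 4 5 6 7 sm_aff_inv])
 show "aff k ` ?U = ?B" by (rule good_chartI(2)[OF 1 disjI1[OF 2] 3 4 5 6 7 sm_aff_inv])
qed

text \<open>Where the third coordinate and the \<open>k\<close>-th one do not vanish, the sign of their product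
  distinguishes the two points of a level circle that have the same slope. Four such sets cover the
  levels strictly between 0 and 1.\<close>

definition sec :: "nat \<Rightarrow> real \<Rightarrow> (nat \<Rightarrow> real) set" where
 "sec k s = {P \<in> RP2. 0 < s * P (4 + k)}"

definition slope :: "nat \<Rightarrow> (nat \<Rightarrow> real) \<Rightarrow> real" where "slope k P = P 3 / P k"

definition sec_pt :: "nat \<Rightarrow> real \<Rightarrow> real \<Rightarrow> real \<Rightarrow> nat \<Rightarrow> real" where
 "sec_pt k s a v = (let r = sqrt ((1 - v) / (1 + a^2)) in
  if k = 0 then ver r (a * r) (s * sqrt v) else ver (a * r) r (s * sqrt v))"

lemma sec_pt_in:
 assumes "0 < v" "v < 1" "s \<in> {1, -1}" "k \<in> {0, 1}"
 shows "sec_pt k s a v \<in> sec k s" "sec_pt k s a v 2 = v" "slope k (sec_pt k s a v) = a"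
proof -
 define r where "r = sqrt ((1 - v) / (1 + a^2))"
 have a: "0 < 1 + a^2" by (smt (verit) zero_le_power2)
 then have r: "r > 0" "r^2 = (1 - v) / (1 + a^2)" using assms by (simp_all add: r_def)
 have s: "s^2 = 1" "s * s = 1" using assms by auto
 have "r^2 + (a * r)^2 = r^2 * (1 + a^2)" by (simp add: power_mult_distrib distrib_left)
 then have "r^2 + (a * r)^2 = 1 - v" using a by (simp add: r(2))
 then have sum: "r^2 + (a * r)^2 + (s * sqrt v)^2 = 1" using assms s by (simp add: power_mult_distrib)
 then have sum': "(a * r)^2 + r^2 + (s * sqrt v)^2 = 1" by simp
 have pos: "0 < s * (r * (s * sqrt v))"
  using assms(3) r(1) assms(1) by (elim insertE) simp_all
 show "sec_pt k s a v \<in> sec k s"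
  using sum sum' assms(4) unfolding sec_pt_def Let_def r_def[symmetric] sec_def
  by (auto intro!: verI simp: pos)
 show "sec_pt k s a v 2 = v"
  using assms s unfolding sec_pt_def Let_def by (auto simp: power_mult_distrib)
 show "slope k (sec_pt k s a v) = a"
 proof -
  have "r * (a * r) / r^2 = a" "a * r * r / r^2 = a" using r(1) by (simp_all add: power2_eq_square)
  then show ?thesis using assms(4) unfolding sec_pt_def Let_def r_def[symmetric] slope_def by auto
 qed
qed

lemma sec_bounds:
 assumes "P \<in> sec k s" "k \<in> {0, 1}" shows "P k > 0" "0 < P 2" "P 2 < 1"
proof -
 obtain x y z where P: "P = ver x y z" "x^2 + y^2 + z^2 = 1" "0 < s * P (4 + k)"
  using assms unfolding sec_def by (auto elim: RP2E)
 have "x^2 \<ge> 0" "y^2 \<ge> 0" by simp_all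
 moreover have "k = 0 \<and> x \<noteq> 0 \<and> z \<noteq> 0 \<or> k = 1 \<and> y \<noteq> 0 \<and> z \<noteq> 0" using P assms(2) by auto
 moreover have "x \<noteq> 0 \<Longrightarrow> x^2 > 0" "y \<noteq> 0 \<Longrightarrow> y^2 > 0" "z \<noteq> 0 \<Longrightarrow> z^2 > 0" by simp_all
 ultimately show "P k > 0" "0 < P 2" "P 2 < 1" using P(1,2) by (auto, linarith+)
qed

lemma sec_pt_eq:
 assumes P: "P \<in> sec k s" and k: "k \<in> {0, 1}" and s: "s \<in> {1, -1}"
 shows "sec_pt k s (slope k P) (P 2) = P"
proof -
 note b = sec_bounds[OF P k]
 have PR: "P \<in> RP2" and pos: "0 < s * P (4 + k)" using P by (auto simp: sec_def)
 consider "k = 0" | "k = 1" using k by auto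
 then show ?thesis
 proof cases
  case 1
  then obtain x y z where X: "P = ver x y z" "x^2 + y^2 + z^2 = 1" "x > 0" using RP2_pos(2)[OF PR] b by auto
  have "s * sqrt (z^2) = z" using pos 1 X s by (auto simp: zero_less_mult_iff mult_less_0_iff)
  moreover have "(1 - z^2) / (1 + (y/x)^2) = x^2"
  proof -
   have "x^2 * (1 + (y/x)^2) = x^2 + y^2" using X(3) by (simp add: distrib_left power_divide)
   then have "1 - z^2 = x^2 * (1 + (y/x)^2)" using X(2) by simp
   moreover have "1 + (y/x)^2 \<noteq> 0" by (smt (verit) zero_le_power2)
   ultimately show ?thesis by simp
  qed
  moreover have "slope k P = y / x" using 1 X by (simp add: slope_def power2_eq_square)
  ultimately show ?thesis using 1 X by (simp add: sec_pt_def Let_def)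
 next
  case 2
  then obtain x y z where X: "P = ver x y z" "x^2 + y^2 + z^2 = 1" "y > 0" using RP2_pos(3)[OF PR] b by auto
  have "s * sqrt (z^2) = z" using pos 2 X s by (auto simp: zero_less_mult_iff mult_less_0_iff)
  moreover have "(1 - z^2) / (1 + (x/y)^2) = y^2"
  proof -
   have "y^2 * (1 + (x/y)^2) = y^2 + x^2" using X(3) by (simp add: distrib_left power_divide)
   then have "1 - z^2 = y^2 * (1 + (x/y)^2)" using X(2) by simp
   moreover have "1 + (x/y)^2 \<noteq> 0" by (smt (verit) zero_le_power2)
   ultimately show ?thesis by simp
  qed
  moreover have "slope k P = x / y" using 2 X by (simp add: slope_def power2_eq_square)
  ultimately show ?thesis using 2 X by (simp add: sec_pt_def Let_def)
 qed
qed

lemma sm_sec_pt: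
 assumes "sm S a" "sm S v" "\<And>y. y \<in> S \<Longrightarrow> 0 < v y \<and> v y < 1"
 shows "sm S (\<lambda>y. sec_pt k s (a y) (v y) i)"
proof -
 have nz: "0 < 1 + (b::real)^2" for b by (smt (verit) zero_le_power2)
 have "sm S (\<lambda>y. sqrt ((1 - v y) / (1 + (a y)^2)))" "sm S (\<lambda>y. sqrt (v y))"
  using assms nz by (auto intro!: sm_intros divide_pos_pos simp: less_imp_neq[symmetric])
 then show ?thesis unfolding sec_pt_def Let_def using assms(1)
  by (cases "k = 0") (auto intro!: sm_ver sm_intros)
qed

lemma openin_sec: "S \<subseteq> RP2 \<Longrightarrow> openin (top_of_set S) (S \<inter> sec k s)"
proof -
 assume S: "S \<subseteq> RP2"
 have "open ((\<lambda>P::nat\<Rightarrow>real. s * P (4 + k)) -` {0<..})"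
  by (rule open_vimage[OF open_greaterThan]) (intro continuous_intros continuous_on_product_coordinates)
 moreover have "S \<inter> sec k s = S \<inter> ((\<lambda>P. s * P (4 + k)) -` {0<..})" using S by (auto simp: sec_def)
 ultimately show ?thesis by auto
qed

lemma sec_cover:
 assumes "P \<in> RP2" "0 < P 2" "P 2 < 1" shows "\<exists>k\<in>{0,1}. \<exists>s\<in>{1,-1}. P \<in> sec k s"
proof -
 obtain x y z where P: "P = ver x y z" "x^2 + y^2 + z^2 = 1" using assms by (auto elim: RP2E)
 then have "z \<noteq> 0" "x \<noteq> 0 \<or> y \<noteq> 0" using assms by auto
 then have "0 < x * z \<or> 0 < - (x * z) \<or> 0 < y * z \<or> 0 < - (y * z)"
  by (auto simp: zero_less_mult_iff mult_less_0_iff)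
 then show ?thesis using assms(1) P(1) by (auto simp: sec_def)
qed

definition circ_atlas :: "real \<Rightarrow> ((nat \<Rightarrow> real) set \<times> ((nat \<Rightarrow> real) \<Rightarrow> nat \<Rightarrow> real)) set" where
 "circ_atlas c = (\<lambda>(k, s). (band {c} \<inter> sec k s, \<lambda>P. tup [slope k P])) ` ({0,1} \<times> {1,-1})"

definition circ :: "real \<Rightarrow> (nat \<Rightarrow> real) smfd" where
 "circ c = sub_mfd 1 (band {c}) (circ_atlas c)"

lemma sm_slope: "k \<in> {0,1} \<Longrightarrow> S \<subseteq> sec k s \<Longrightarrow> sm S (slope k)"
 unfolding slope_def using sec_bounds(1) by (intro sm_intros) (metis less_irrefl subsetD)

lemma circ_chart:
 assumes c: "0 < c" "c < 1" and ks: "k \<in> {0,1}" "s \<in> {1,-1}"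
 shows "good_chart (band {c}) 1 (band {c} \<inter> sec k s) (\<lambda>P. tup [slope k P])"
  and "(\<lambda>P. tup [slope k P]) ` (band {c} \<inter> sec k s) = eucl 1"
proof -
 have o: "openin (top_of_set (band {c})) (band {c} \<inter> sec k s)"
  by (rule openin_sec) (auto simp: band_def)
 have E: "openin (Euclidean_space 1) (eucl 1)" by (simp add: Euclidean_space_eq)
 have 1: "tup [slope k P] \<in> eucl 1" for P by (rule tup_eucl) simp
 have 2: "sec_pt k s (y 0) c \<in> band {c} \<inter> sec k s" for y
  using sec_pt_in[OF c ks(2,1)] by (auto simp: band_def sec_def)
 have 3: "sec_pt k s (tup [slope k P] 0) c = P" if "P \<in> band {c} \<inter> sec k s" for P
  using sec_pt_eq[OF _ ks, of P] that by (auto simp: band_def)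
 have 4: "tup [slope k (sec_pt k s (y 0) c)] = y" if "y \<in> eucl 1" for y
  using eucl_1[OF that] sec_pt_in(3)[OF c ks(2,1)] by (simp add: coord_tup)
 have 5: "sm (band {c} \<inter> sec k s) (\<lambda>P. tup [slope k P] i)" for i
  by (intro sm_tup sm_slope[OF ks(1), of _ s]) auto
 have 6: "sm (eucl 1) (\<lambda>y. sec_pt k s (y 0) c i)" for i
  using c by (intro sm_sec_pt sm_intros) auto
 show "good_chart (band {c}) 1 (band {c} \<inter> sec k s) (\<lambda>P. tup [slope k P])"
  by (rule good_chartI(1)[where \<psi> = "\<lambda>y. sec_pt k s (y 0) c", OF o disjI1[OF E]]) (rule 1 2 3 4 5 6, assumption?)+
 show "(\<lambda>P. tup [slope k P]) ` (band {c} \<inter> sec k s) = eucl 1"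
  by (rule good_chartI(2)[where \<psi> = "\<lambda>y. sec_pt k s (y 0) c", OF o disjI1[OF E]]) (rule 1 2 3 4 5 6, assumption?)+
qed

text \<open>The last coordinate is the distance from the boundary level, as is required of a chart at the
  boundary.\<close>

definition bchart :: "nat \<Rightarrow> real \<Rightarrow> real \<Rightarrow> (nat \<Rightarrow> real) \<Rightarrow> nat \<Rightarrow> real" where
 "bchart k e c P = tup [slope k P, e * (P 2 - c)]"

definition cap :: "real \<Rightarrow> real \<Rightarrow> real set" where "cap e c = {v. 0 \<le> e * (v - c)}"

definition half_strip :: "(nat \<Rightarrow> real) set" where
 "half_strip = {y \<in> eucl 2. 0 \<le> y 1 \<and> y 1 < 1/5}"

lemma bchart_good:
 assumes ec: "e = 1 \<and> c = 4/5 \<or> e = -1 \<and> c = 1/5" and ks: "k \<in> {0,1}" "s \<in> {1,-1}"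
 shows "good_chart (band (cap e c)) 2 (band (cap e c) \<inter> sec k s) (bchart k e c)"
  and "bchart k e c ` (band (cap e c) \<inter> sec k s) = half_strip"
proof -
 let ?U = "band (cap e c) \<inter> sec k s"
 define h where "h y = sec_pt k s (y 0) (c + e * y 1)" for y :: "nat \<Rightarrow> real"
 have o: "openin (top_of_set (band (cap e c))) ?U" by (rule openin_sec) (auto simp: band_def)
 have "open ((\<lambda>y::nat\<Rightarrow>real. y 1) -` {..<1/5})" by (simp add: open_vimage continuous_on_product_coordinates)
 moreover have "half_strip = ((\<lambda>y. y 1) -` {..<1/5}) \<inter> (eucl 2 \<inter> half_space 2)"
  by (auto simp: half_strip_def half_space_def topspace_Euclidean_space)
 ultimately have E: "openin (subtopology (Euclidean_space 2) (half_space 2)) half_strip"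
  by (auto simp: Euclidean_space_eq subtopology_subtopology openin_open)
 have vb: "0 < c + e * y 1 \<and> c + e * y 1 < 1" if "y \<in> half_strip" for y
  using that ec by (auto simp: half_strip_def)
 have ee: "e * e = 1" using ec by auto
 have 1: "bchart k e c P \<in> half_strip" if P: "P \<in> ?U" for P
 proof -
  have "0 < P 2" "P 2 < 1" using sec_bounds[OF _ ks(1)] P by auto
  then have "e * (P 2 - c) < 1/5" using ec by auto
  then show ?thesis using P by (auto simp: bchart_def half_strip_def band_def cap_def tup_def)
 qed
 have 2: "h y \<in> ?U" if y: "y \<in> half_strip" for y
 proof -
  have "h y \<in> sec k s" "h y 2 = c + e * y 1"
   using sec_pt_in[OF _ _ ks(2,1)] vb[OF y] unfolding h_def by auto
  moreover have "0 \<le> e * (c + e * y 1 - c)" using y ee by (auto simp: half_strip_def mult.assoc[symmetric])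
  ultimately show ?thesis by (auto simp: band_def cap_def sec_def)
 qed
 have 3: "h (bchart k e c P) = P" if P: "P \<in> ?U" for P
 proof -
  have "c + e * (e * (P 2 - c)) = P 2" using ee by (simp add: mult.assoc[symmetric])
  then show ?thesis using sec_pt_eq[OF _ ks, of P] P by (simp add: h_def bchart_def)
 qed
 have 4: "bchart k e c (h y) = y" if y: "y \<in> half_strip" for y
 proof -
  have "slope k (h y) = y 0" "h y 2 = c + e * y 1"
   using sec_pt_in[OF _ _ ks(2,1)] vb[OF y] unfolding h_def by auto
  then have "bchart k e c (h y) = tup [y 0, y 1]" using ee by (simp add: bchart_def mult.assoc[symmetric])
  also have "\<dots> = y" by (rule eucl_2[symmetric]) (use y in \<open>simp add: half_strip_def\<close>)
  finally show ?thesis .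
 qed
 have 5: "sm ?U (\<lambda>P. bchart k e c P i)" for i
  unfolding bchart_def by (intro sm_tup sm_intros sm_slope[OF ks(1), of _ s]) auto
 have 6: "sm half_strip (\<lambda>y. h y i)" for i
  unfolding h_def using vb by (intro sm_sec_pt sm_intros) auto
 show "good_chart (band (cap e c)) 2 ?U (bchart k e c)"
  by (rule good_chartI(1)[OF o disjI2[OF E] 1 2 3 4 5 6])
 show "bchart k e c ` ?U = half_strip"
  by (rule good_chartI(2)[OF o disjI2[OF E] 1 2 3 4 5 6])
qed

section \<open>The interval, the projective plane and its two ends\<close>

text \<open>A point with positive last coordinate has a Euclidean neighbourhood in the half-space.\<close>

lemma interior_of_half:
 assumes B: "openin (subtopology (Euclidean_space m) (half_space m)) B" and m: "0 < m"
  and y: "y \<in> B" "0 < y (m - 1)"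
 shows "y \<in> Euclidean_space m interior_of B"
proof -
 obtain T where T: "openin (Euclidean_space m) T" "B = T \<inter> half_space m"
  using B by (auto simp: openin_subtopology)
 have "open ((\<lambda>y::nat\<Rightarrow>real. y (m - 1)) -` {0<..})"
  by (simp add: open_vimage continuous_on_product_coordinates)
 then have "openin (Euclidean_space m) (eucl m \<inter> (\<lambda>y::nat\<Rightarrow>real. y (m - 1)) -` {0<..})"
  by (auto simp: Euclidean_space_eq)
 then have "openin (Euclidean_space m) (T \<inter> (eucl m \<inter> (\<lambda>y::nat\<Rightarrow>real. y (m - 1)) -` {0<..}))"
  using T(1) by blast
 moreover have "T \<inter> (eucl m \<inter> (\<lambda>y::nat\<Rightarrow>real. y (m - 1)) -` {0<..}) \<subseteq> B"
  unfolding T(2) half_space_def topspace_Euclidean_space by auto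
 moreover have "y \<in> T \<inter> (eucl m \<inter> (\<lambda>y::nat\<Rightarrow>real. y (m - 1)) -` {0<..})"
  using y T by (auto simp: half_space_def topspace_Euclidean_space)
 ultimately show ?thesis unfolding interior_of_def by blast
qed

lemma not_interior_of_half:
 assumes B: "\<And>y. y \<in> B \<Longrightarrow> 0 \<le> y (m - 1)" and m: "0 < m" and y: "y (m - 1) = 0"
 shows "y \<notin> Euclidean_space m interior_of B"
proof
 assume "y \<in> Euclidean_space m interior_of B"
 then obtain T where T: "openin (Euclidean_space m) T" "y \<in> T" "T \<subseteq> B" unfolding interior_of_def by blast
 have "eventually (\<lambda>t. y(m - 1 := t) \<in> T) (nhds (y (m - 1)))"
  by (rule eventually_line[OF T(1,2)]) (use m in simp)
 then obtain d where d: "d > 0" "\<And>t. dist t 0 < d \<Longrightarrow> y(m - 1 := t) \<in> T"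
  unfolding eventually_nhds_metric y by blast
 have "y(m - 1 := - d / 2) \<in> B" using d(2)[of "- d / 2"] d(1) T(3) by auto
 from B[OF this] d(1) show False by simp
qed

lemma mfd_interiorI: "(U, \<phi>) \<in> matlas X \<Longrightarrow> x \<in> U \<Longrightarrow> \<phi> x \<in> Euclidean_space (mdim X) interior_of (\<phi> ` U) \<Longrightarrow> x \<in> mfd_interior X"
 unfolding mfd_interior_def by blast

definition Wset :: "(nat \<Rightarrow> real) set" where "Wset = coord ` {0..1}"

text \<open>The target interval, as a manifold with the two boundary points at 0 and 1.\<close>

definition Wm :: "(nat \<Rightarrow> real) smfd" where
 "Wm = sub_mfd 1 Wset {({x \<in> Wset. x 0 < 1}, id), ({x \<in> Wset. 0 < x 0}, \<lambda>x. coord (1 - x 0))}"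

lemma Wset_iff: "x \<in> Wset \<longleftrightarrow> x = coord (x 0) \<and> 0 \<le> x 0 \<and> x 0 \<le> 1"
 by (auto simp: Wset_def image_iff)

lemma Wset_eucl: "Wset \<subseteq> eucl 1" using coord_eucl by (auto simp: Wset_def)

lemma coord_eq [simp]: "coord s = coord t \<longleftrightarrow> s = t"
 by (metis coord_simps(1))

lemma open_coordinate: "open T \<Longrightarrow> open ((\<lambda>x::nat\<Rightarrow>real. x i) -` T)"
 by (simp add: open_vimage continuous_on_product_coordinates)

lemma W_charts:
 "good_chart Wset 1 {x \<in> Wset. x 0 < 1} id" "id ` {x \<in> Wset. x 0 < 1} = coord ` {0..<1}"
 "good_chart Wset 1 {x \<in> Wset. 0 < x 0} (\<lambda>x. coord (1 - x 0))" "(\<lambda>x. coord (1 - x 0)) ` {x \<in> Wset. 0 < x 0} = coord ` {0..<1}"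
 "openin (subtopology (Euclidean_space 1) (half_space 1)) (coord ` {0..<1})"
proof -
 have "coord ` {0..<1} = (\<lambda>x. x 0) -` {..<1} \<inter> (eucl 1 \<inter> half_space 1)"
 proof safe
  fix x :: "nat \<Rightarrow> real" assume x: "x \<in> half_space 1" "x 0 < 1" "\<forall>i\<ge>1. x i = 0"
  then have "x = coord (x 0)" using eucl_1[of x] by simp
  moreover have "x 0 \<in> {0..<1}" using x by (simp add: half_space_def)
  ultimately show "x \<in> coord ` {0..<1}" by (rule image_eqI)
 qed (auto simp: half_space_def topspace_Euclidean_space)
 then show o: "openin (subtopology (Euclidean_space 1) (half_space 1)) (coord ` {0..<1})"
  using open_coordinate[of "{..<1::real}" 0] by (auto simp: Euclidean_space_eq subtopology_subtopology openin_open)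
 have "{x \<in> Wset. x 0 < 1} = Wset \<inter> (\<lambda>x. x 0) -` {..<1}" "{x \<in> Wset. 0 < x 0} = Wset \<inter> (\<lambda>x. x 0) -` {0<..}" by auto
 then have o1: "openin (top_of_set Wset) {x \<in> Wset. x 0 < 1}" and o2: "openin (top_of_set Wset) {x \<in> Wset. 0 < x 0}"
  using open_coordinate[of "{..<1::real}" 0] open_coordinate[of "{0::real<..}" 0] by auto
 have g1: "id x \<in> coord ` {0..<1}" if "x \<in> {x \<in> Wset. x 0 < 1}" for x
  using that by (auto simp: Wset_def)
 have g2: "id x \<in> {x \<in> Wset. x 0 < 1}" if "x \<in> coord ` {0..<1}" for x
  using that by (auto simp: Wset_def)
 show "good_chart Wset 1 {x \<in> Wset. x 0 < 1} id"
  by (rule good_chartI(1)[OF o1 disjI2[OF o] g1 g2]) (auto intro: sm_var)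
 show "id ` {x \<in> Wset. x 0 < 1} = coord ` {0..<1}"
  by (rule good_chartI(2)[OF o1 disjI2[OF o] g1 g2]) (auto intro: sm_var)
 have h1: "coord (1 - x 0) \<in> coord ` {0..<1}" if "x \<in> {x \<in> Wset. 0 < x 0}" for x
  using that by (auto simp: Wset_def)
 have h2: "coord (1 - x 0) \<in> {x \<in> Wset. 0 < x 0}" if "x \<in> coord ` {0..<1}" for x
  using that by (auto simp: Wset_def)
 have h3: "coord (1 - coord (1 - x 0) 0) = x" if "x \<in> {x \<in> Wset. 0 < x 0}" for x
  using that by (auto simp: Wset_def)
 have h4: "coord (1 - coord (1 - x 0) 0) = x" if "x \<in> coord ` {0..<1}" for x
  using that by auto
 have h5: "sm A (\<lambda>x. coord (1 - x 0) i)" for A i by (intro sm_coord sm_intros)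
 show "good_chart Wset 1 {x \<in> Wset. 0 < x 0} (\<lambda>x. coord (1 - x 0))"
 proof (rule good_chartI(1)[where \<psi> = "\<lambda>x. coord (1 - x 0)", OF o2 disjI2[OF o]], goal_cases)
  case (3 x) then show ?case by (rule h3)
 next case (4 x) then show ?case by (rule h4)
 qed (erule h1 | erule h2 | rule h5)+
 show "(\<lambda>x. coord (1 - x 0)) ` {x \<in> Wset. 0 < x 0} = coord ` {0..<1}"
 proof (rule good_chartI(2)[where \<psi> = "\<lambda>x. coord (1 - x 0)", OF o2 disjI2[OF o]], goal_cases)
  case (3 x) then show ?case by (rule h3)
 next case (4 x) then show ?case by (rule h4)
 qed (erule h1 | erule h2 | rule h5)+
qed

lemma Wm_simps [simp]: "mdim Wm = 1" "mtop Wm = top_of_set Wset"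
 "matlas Wm = {({x \<in> Wset. x 0 < 1}, id), ({x \<in> Wset. 0 < x 0}, \<lambda>x. coord (1 - x 0))}"
 by (simp_all add: Wm_def)

lemma emb_W: "emb Wm 1 id" unfolding Wm_def
 by (rule emb_sub_mfd[OF Wset_eucl]) (use W_charts in auto)

lemma smooth_W: "smooth_manifold Wm" unfolding Wm_def
 by (rule smooth_manifold_sub_mfd[OF Wset_eucl]) (use W_charts in \<open>auto simp: Wset_def\<close>)

lemma W_interior: "mfd_interior Wm = {x \<in> Wset. 0 < x 0 \<and> x 0 < 1}"
proof -
 have n: "coord 0 \<notin> Euclidean_space 1 interior_of (coord ` {0..<1})"
  by (rule not_interior_of_half) auto
 note half = W_charts(5)
 show ?thesis
 proof safe
  fix x assume x: "x \<in> mfd_interior Wm"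
  then show xW: "x \<in> Wset" by (auto simp: mfd_interior_def)
  show "0 < x 0"
  proof (rule ccontr)
   assume "\<not> 0 < x 0"
   then have x0: "x = coord 0" using xW by (auto simp: Wset_def)
   have "id x \<in> Euclidean_space 1 interior_of (coord ` {0..<1})"
    using x unfolding mfd_interior_def using W_charts(2) \<open>\<not> 0 < x 0\<close> by auto
   then show False using n x0 by simp
  qed
  show "x 0 < 1"
  proof (rule ccontr)
   assume "\<not> x 0 < 1"
   then have x0: "x = coord 1" using xW by (auto simp: Wset_def)
   have "coord (1 - x 0) \<in> Euclidean_space 1 interior_of (coord ` {0..<1})"
    using x unfolding mfd_interior_def using W_charts(4) \<open>\<not> x 0 < 1\<close> by auto
   then show False using n x0 by simp
  qed
 next
  fix x assume x: "x \<in> Wset" "0 < x 0" "x 0 < 1"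
  have "id x \<in> Euclidean_space 1 interior_of (coord ` {0..<1})"
   by (rule interior_of_half[OF half]) (use x in \<open>auto simp: Wset_def\<close>)
  then show "x \<in> mfd_interior Wm"
   by (intro mfd_interiorI[of "{x \<in> Wset. x 0 < 1}" id]) (use x W_charts(2) in auto)
 qed
qed

lemma W_boundary: "mfd_boundary Wm = {coord 0, coord 1}"
 unfolding mfd_boundary_def W_interior by (auto simp: Wset_def)

lemma emb_bW: "emb (boundary_mfd Wm) 1 id"
 by (rule emb_boundary[OF emb_W]) (auto simp: W_boundary coord_def)

lemma emb_iW: "emb (interior_mfd Wm) 1 id"
 by (rule emb_interior[OF emb_W])

lemma top_bW: "mtop (boundary_mfd Wm) = top_of_set {coord 0, coord 1}" "mdim (boundary_mfd Wm) = 0"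
proof -
 have "Wset \<inter> {coord 0, coord 1} = {coord 0, coord 1}" by (auto simp: Wset_def)
 then show "mtop (boundary_mfd Wm) = top_of_set {coord 0, coord 1}" "mdim (boundary_mfd Wm) = 0"
  by (simp_all add: boundary_mfd_def W_boundary subtopology_subtopology)
qed

lemma openin_bW: "b \<in> {0,1} \<Longrightarrow> openin (mtop (boundary_mfd Wm)) {coord b}"
proof -
 assume b: "b \<in> {0,1::real}"
 have "{coord b} = {coord 0, coord 1} \<inter> (\<lambda>x. x 0) -` {b - 1 <..< b + 1}" using b by auto
 then show ?thesis unfolding top_bW using open_coordinate[of "{b - 1 <..< b + 1}" 0, OF open_greaterThanLessThan] by (auto simp: openin_open)
qed

definition Mm :: "(nat \<Rightarrow> real) smfd" where
 "Mm = sub_mfd 2 RP2 ((\<lambda>k. ({P \<in> band UNIV. P k > 0}, aff k)) ` {0,1,2})"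

text \<open>The two ends of the projective plane: for \<open>e = 1\<close> the disk of the points above a level
  \<open>c\<close>, for \<open>e = -1\<close> the Moebius band of the points below it.\<close>

definition Em :: "real \<Rightarrow> real \<Rightarrow> (nat \<Rightarrow> real) smfd" where
 "Em e c = sub_mfd 2 (band (cap e c))
  ((\<lambda>k. ({P \<in> band {v. 0 < e * (v - c)}. P k > 0}, aff k)) ` {0,1,2} \<union>
   (\<lambda>(k, s). (band (cap e c) \<inter> sec k s, bchart k e c)) ` ({0,1} \<times> {1,-1}))"

abbreviation end_ok :: "real \<Rightarrow> real \<Rightarrow> bool" where
 "end_ok e c \<equiv> e = 1 \<and> c = 4/5 \<or> e = -1 \<and> c = 1/5"

lemma band_UNIV: "band UNIV = RP2" by (auto simp: band_def)

lemma band_sub: "band I \<subseteq> RP2" by (auto simp: band_def)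

lemma M_chart: "k \<in> {0,1,2} \<Longrightarrow> good_chart RP2 2 {P \<in> band UNIV. P k > 0} (aff k)"
 by (rule aff_chart) (auto simp: band_UNIV)

lemma RP2_chart_cover: "P \<in> RP2 \<Longrightarrow> \<exists>k\<in>{0,1,2}. P k > 0"
proof -
 assume "P \<in> RP2"
 then have "0 \<le> P 2" "0 \<le> P 0" "0 \<le> P 1" "P 0 + P 1 + P 2 = 1" using RP2_bounds by auto
 then have "P 0 > 0 \<or> P 1 > 0 \<or> P 2 > 0" by linarith
 then show ?thesis by blast
qed

lemma emb_M: "emb Mm 6 id" unfolding Mm_def
 by (rule emb_sub_mfd[OF RP2_eucl]) (use M_chart in auto)

lemma smooth_M: "smooth_manifold Mm" unfolding Mm_def
proof (rule smooth_manifold_sub_mfd[OF RP2_eucl])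
 show "RP2 \<subseteq> \<Union> (fst ` (\<lambda>k. ({P \<in> band UNIV. P k > 0}, aff k)) ` {0,1,2})"
 proof
  fix P assume P: "P \<in> RP2"
  from RP2_chart_cover[OF this] obtain k where "k \<in> {0,1,2}" "P k > 0" by blast
  then show "P \<in> \<Union> (fst ` (\<lambda>k. ({P \<in> band UNIV. P k > 0}, aff k)) ` {0,1,2})"
   unfolding image_image fst_conv using P by (intro UN_I[of k]) (simp_all add: band_UNIV)
 qed
qed (use M_chart in auto)

lemma Mm_simps [simp]: "mdim Mm = 2" "mtop Mm = top_of_set RP2" by (simp_all add: Mm_def)
lemma Em_simps [simp]: "mdim (Em e c) = 2" "mtop (Em e c) = top_of_set (band (cap e c))" by (simp_all add: Em_def)

lemma open_cap: "open {v. 0 < e * (v - c::real)}"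
 by (intro open_Collect_less continuous_intros)

lemma E_charts:
 assumes "end_ok e c"
 shows "k \<in> {0,1,2} \<Longrightarrow> good_chart (band (cap e c)) 2 {P \<in> band {v. 0 < e * (v - c)}. P k > 0} (aff k)"
  and "k \<in> {0,1} \<Longrightarrow> s \<in> {1,-1} \<Longrightarrow> good_chart (band (cap e c)) 2 (band (cap e c) \<inter> sec k s) (bchart k e c)"
proof -
 show "k \<in> {0,1,2} \<Longrightarrow> good_chart (band (cap e c)) 2 {P \<in> band {v. 0 < e * (v - c)}. P k > 0} (aff k)"
  by (rule aff_chart(1)[OF open_cap]) (auto simp: band_def cap_def)
qed (rule bchart_good(1)[OF assms])

lemma E_chart_cases:
 assumes "(U, \<phi>) \<in> matlas (Em e c)"
 obtains k where "k \<in> {0,1,2}" "U = {P \<in> band {v. 0 < e * (v - c)}. P k > 0}" "\<phi> = aff k"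
 | k s where "k \<in> {0,1}" "s \<in> {1,-1}" "U = band (cap e c) \<inter> sec k s" "\<phi> = bchart k e c"
proof -
 from assms have "(U, \<phi>) \<in> (\<lambda>k. ({P \<in> band {v. 0 < e * (v - c)}. P k > 0}, aff k)) ` {0,1,2} \<union>
   (\<lambda>(k, s). (band (cap e c) \<inter> sec k s, bchart k e c)) ` ({0,1} \<times> {1,-1})"
  by (simp only: Em_def sub_mfd_simps)
 then show ?thesis
 proof
  assume "(U, \<phi>) \<in> (\<lambda>k. ({P \<in> band {v. 0 < e * (v - c)}. P k > 0}, aff k)) ` {0,1,2}"
  then show ?thesis by (rule imageE) (rule that(1), simp_all)
 next
  assume "(U, \<phi>) \<in> (\<lambda>(k, s). (band (cap e c) \<inter> sec k s, bchart k e c)) ` ({0,1} \<times> {1,-1})"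
  then obtain z where z: "(U, \<phi>) = (\<lambda>(k, s). (band (cap e c) \<inter> sec k s, bchart k e c)) z" "z \<in> {0,1} \<times> {1,-1}"
   by (rule imageE)
  obtain k s where "z = (k, s)" by (cases z)
  then show ?thesis using z by (intro that(2)[of k s]) auto
 qed
qed

lemma emb_E: assumes "end_ok e c" shows "emb (Em e c) 6 id"
 unfolding Em_def
 by (rule emb_sub_mfd[OF subset_trans[OF band_sub RP2_eucl]]) (use E_charts[OF assms] in auto)

lemma E_interior_chart:
 assumes "P \<in> band (cap e c)" "P 2 \<noteq> c" "e \<noteq> 0"
 shows "\<exists>k\<in>{0,1,2}. P \<in> {P \<in> band {v. 0 < e * (v - c)}. P k > 0}"
proof -
 have "P \<in> RP2" "0 < e * (P 2 - c)" using assms by (auto simp: band_def cap_def less_le)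
 then show ?thesis using RP2_chart_cover[of P] by (auto simp: band_def)
qed

lemma smooth_E: assumes "end_ok e c" shows "smooth_manifold (Em e c)"
 unfolding Em_def
proof (rule smooth_manifold_sub_mfd[OF subset_trans[OF band_sub RP2_eucl]])
 show "band (cap e c) \<subseteq> \<Union> (fst ` ((\<lambda>k. ({P \<in> band {v. 0 < e * (v - c)}. P k > 0}, aff k)) ` {0,1,2} \<union>
   (\<lambda>(k, s). (band (cap e c) \<inter> sec k s, bchart k e c)) ` ({0,1} \<times> {1,-1})))"
 proof
  fix P assume P: "P \<in> band (cap e c)"
  show "P \<in> \<Union> (fst ` ((\<lambda>k. ({P \<in> band {v. 0 < e * (v - c)}. P k > 0}, aff k)) ` {0,1,2} \<union>
   (\<lambda>(k, s). (band (cap e c) \<inter> sec k s, bchart k e c)) ` ({0,1} \<times> {1,-1})))"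
  proof (cases "P 2 = c")
   case True
   have "\<exists>k\<in>{0,1}. \<exists>s\<in>{1,-1}. P \<in> sec k s"
    by (rule sec_cover) (use True P assms in \<open>auto simp: band_def\<close>)
   then obtain k s where "k \<in> {0,1}" "s \<in> {1,-1}" "P \<in> sec k s" by blast
   then show ?thesis using P unfolding image_Un Union_Un_distrib image_image
    by (intro UnI2 UN_I[of "(k, s)"]) auto
  next
   case False
   have "e \<noteq> 0" using assms by auto
   then obtain k where "k \<in> {0,1,2}" "P \<in> {P \<in> band {v. 0 < e * (v - c)}. P k > 0}"
    using E_interior_chart[OF P False] by blast
   then show ?thesis unfolding image_Un Union_Un_distrib image_image
    by (intro UnI1 UN_I[of k]) auto
  qed
 qed
qed (use E_charts[OF assms] in auto)

lemma E_interior: assumes ec: "end_ok e c" shows "mfd_interior (Em e c) = {P \<in> band (cap e c). P 2 \<noteq> c}"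
proof (intro equalityI subsetI)
 fix P assume P: "P \<in> mfd_interior (Em e c)"
 then obtain U \<phi> where U: "(U, \<phi>) \<in> matlas (Em e c)" "P \<in> U" "\<phi> P \<in> Euclidean_space 2 interior_of (\<phi> ` U)"
  unfolding mfd_interior_def by auto
 from U(1) have "P \<in> band (cap e c) \<and> P 2 \<noteq> c"
 proof (cases rule: E_chart_cases)
  case (1 k)
  then show ?thesis using U(2) by (auto simp: band_def cap_def)
 next
  case (2 k s)
  have "P 2 \<noteq> c"
  proof
   assume "P 2 = c"
   then have "\<phi> P 1 = 0" using 2 by (simp add: bchart_def)
   moreover have "\<phi> ` U = half_strip" using bchart_good(2)[OF ec 2(1,2)] 2 by simp
   ultimately have "\<phi> P \<notin> Euclidean_space 2 interior_of (\<phi> ` U)"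
    by (intro not_interior_of_half) (auto simp: half_strip_def)
   then show False using U(3) by simp
  qed
  then show ?thesis using U(2) 2 by simp
 qed
 then show "P \<in> {P \<in> band (cap e c). P 2 \<noteq> c}" by blast
next
 fix P assume "P \<in> {P \<in> band (cap e c). P 2 \<noteq> c}"
 then have P: "P \<in> band (cap e c)" "P 2 \<noteq> c" by auto
 have "e \<noteq> 0" using ec by auto
 then obtain k where k: "k \<in> {0,1,2}" "P \<in> {P \<in> band {v. 0 < e * (v - c)}. P k > 0}"
  using E_interior_chart[OF P] by blast
 let ?U = "{P \<in> band {v. 0 < e * (v - c)}. P k > 0}"
 have img: "aff k ` ?U = {y \<in> eucl 2. aff_height k y \<in> {v. 0 < e * (v - c)}}"
  by (rule aff_chart(2)[OF open_cap band_sub subset_refl k(1)])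
 have "openin (Euclidean_space 2) (aff k ` ?U)"
  unfolding img Euclidean_space_eq by (rule openin_top_of_set_vimage[OF continuous_aff_height open_cap]) auto
 then show "P \<in> mfd_interior (Em e c)"
  using k by (intro mfd_interiorI[of ?U "aff k"]) (auto simp: Em_def interior_of_openin)
qed

lemma E_boundary: "end_ok e c \<Longrightarrow> mfd_boundary (Em e c) = band {c}"
 unfolding mfd_boundary_def by (auto simp: E_interior band_def cap_def)

lemma emb_bE: assumes "end_ok e c" shows "emb (boundary_mfd (Em e c)) 6 id"
proof (rule emb_boundary[OF emb_E[OF assms]])
 fix U \<phi> P assume "(U, \<phi>) \<in> matlas (Em e c)" and P: "P \<in> U \<inter> mfd_boundary (Em e c)"
 then show "\<phi> P \<in> eucl (mdim (Em e c) - 1)"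
 proof (cases rule: E_chart_cases)
  case (2 k s)
  then have "\<phi> P = tup [slope k P, 0]" using P assms by (auto simp: bchart_def E_boundary band_def)
  then show ?thesis by (auto simp: tup_def)
 qed (use P assms in \<open>auto simp: E_boundary band_def\<close>)
qed

lemma no_boundaryI:
 assumes "\<And>P. P \<in> topspace (mtop X) \<Longrightarrow> \<exists>(U, \<phi>)\<in>matlas X. P \<in> U \<and> openin (Euclidean_space (mdim X)) (\<phi> ` U)"
 shows "mfd_boundary X = {}"
proof -
 have "topspace (mtop X) \<subseteq> mfd_interior X"
 proof
  fix P assume "P \<in> topspace (mtop X)"
  from assms[OF this] obtain U \<phi> where "(U, \<phi>) \<in> matlas X" "P \<in> U" "openin (Euclidean_space (mdim X)) (\<phi> ` U)" by auto
  then show "P \<in> mfd_interior X" by (intro mfd_interiorI[of U \<phi>]) (auto simp: interior_of_openin)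
 qed
 then show ?thesis by (auto simp: mfd_boundary_def)
qed

lemma closed_M: "closed_mfd Mm"
 unfolding closed_mfd_def
proof (intro conjI smooth_M)
 show "compact_space (mtop Mm)"
  using compact_band[of "{0..1}"] RP2_band by (simp add: compact_space_subtopology)
 show "mfd_boundary Mm = {}"
 proof (rule no_boundaryI)
  fix P assume "P \<in> topspace (mtop Mm)"
  then have P: "P \<in> RP2" by simp
  then obtain k where k: "k \<in> {0,1,2}" "P k > 0" using RP2_chart_cover by blast
  have "aff k ` {P \<in> band UNIV. P k > 0} = {y \<in> eucl 2. aff_height k y \<in> UNIV}"
   by (rule aff_chart(2)[of _ RP2]) (use k in \<open>auto simp: band_UNIV\<close>)
  then have "openin (Euclidean_space 2) (aff k ` {P \<in> band UNIV. P k > 0})"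
   by (simp add: Euclidean_space_eq)
  then show "\<exists>(U, \<phi>)\<in>matlas Mm. P \<in> U \<and> openin (Euclidean_space (mdim Mm)) (\<phi> ` U)"
   using k P by (intro bexI[of _ "({P \<in> band UNIV. P k > 0}, aff k)"]) (auto simp: Mm_def band_UNIV)
 qed
qed

lemma emb_circ: assumes "0 < c" "c < 1" shows "emb (circ c) 6 id" unfolding circ_def
 by (rule emb_sub_mfd[OF subset_trans[OF band_sub RP2_eucl]]) (use circ_chart(1)[OF assms] in \<open>auto simp: circ_atlas_def\<close>)

lemma circ_simps [simp]: "mdim (circ c) = 1" "mtop (circ c) = top_of_set (band {c})" by (simp_all add: circ_def)

lemma closed_circ: assumes "0 < c" "c < 1" shows "closed_mfd (circ c)"
 unfolding closed_mfd_def
proof (intro conjI)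
 have cov: "\<exists>k\<in>{0,1}. \<exists>s\<in>{1,-1}. P \<in> sec k s" if "P \<in> band {c}" for P
  by (rule sec_cover) (use that assms in \<open>auto simp: band_def\<close>)
 show "smooth_manifold (circ c)" unfolding circ_def
 proof (rule smooth_manifold_sub_mfd[OF subset_trans[OF band_sub RP2_eucl]])
  show "band {c} \<subseteq> \<Union> (fst ` circ_atlas c)"
  proof
   fix P assume P: "P \<in> band {c}"
   from cov[OF this] obtain k s where "k \<in> {0,1}" "s \<in> {1,-1}" "P \<in> sec k s" by blast
   then show "P \<in> \<Union> (fst ` circ_atlas c)"
    unfolding circ_atlas_def image_image using P by (intro UN_I[of "(k, s)"]) auto
  qed
 qed (use circ_chart(1)[OF assms] in \<open>auto simp: circ_atlas_def\<close>)
 show "compact_space (mtop (circ c))"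
  using compact_band[of "{c}"] assms by (simp add: compact_space_subtopology)
 show "mfd_boundary (circ c) = {}"
 proof (rule no_boundaryI)
  fix P assume "P \<in> topspace (mtop (circ c))"
  then have P: "P \<in> band {c}" by simp
  from cov[OF this] obtain k s where ks: "k \<in> {0,1}" "s \<in> {1,-1}" "P \<in> sec k s" by blast
  have "openin (Euclidean_space 1) ((\<lambda>P. tup [slope k P]) ` (band {c} \<inter> sec k s))"
   unfolding circ_chart(2)[OF assms ks(1,2)] by (simp add: Euclidean_space_eq)
  moreover have "(band {c} \<inter> sec k s, \<lambda>P. tup [slope k P]) \<in> circ_atlas c"
   unfolding circ_atlas_def using ks(1,2) by (intro image_eqI[of _ _ "(k, s)"]) auto
  ultimately show "\<exists>(U, \<phi>)\<in>matlas (circ c). P \<in> U \<and> openin (Euclidean_space (mdim (circ c))) (\<phi> ` U)"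
   using ks(3) P by (intro bexI[of _ "(band {c} \<inter> sec k s, \<lambda>P. tup [slope k P])"]) (simp_all add: circ_def)
 qed
qed

definition scl :: "real \<Rightarrow> real \<Rightarrow> (nat \<Rightarrow> real) \<Rightarrow> nat \<Rightarrow> real" where
 "scl r s P = tup [r^2 * P 0, r^2 * P 1, s^2 * P 2, r^2 * P 3, r * s * P 4, r * s * P 5]"

lemma scl_ver: "scl r s (ver x y z) = ver (r * x) (r * y) (s * z)"
 by (simp add: scl_def ver_def power_mult_distrib power2_eq_square ac_simps)

lemma sm_scl: "sm S r \<Longrightarrow> sm S s \<Longrightarrow> (\<And>i. sm S (\<lambda>y. P y i)) \<Longrightarrow> sm S (\<lambda>y. scl (r y) (s y) (P y) i)"
 unfolding scl_def by (intro sm_tup sm_mult sm_power)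

text \<open>The stretching of representatives that moves the circle at one height to the circle at another
  one. It trivializes the bundle over the interior of the interval.\<close>

definition lev :: "real \<Rightarrow> real \<Rightarrow> (nat \<Rightarrow> real) \<Rightarrow> nat \<Rightarrow> real" where
 "lev c v P = scl (sqrt ((1 - v) / (1 - c))) (sqrt (v / c)) P"

lemma lev_in:
 assumes c: "0 < c" "c < 1" "0 < v" "v < 1" and P: "P \<in> band {c}"
 shows "lev c v P \<in> band {v}" "lev v c (lev c v P) = P"
proof -
 from P have PR: "P \<in> RP2" and Pc: "P 2 = c" by (simp_all add: band_def)
 from PR obtain x y z where X: "P = ver x y z" "x^2 + y^2 + z^2 = 1" by (rule RP2E)
 from Pc have X3: "z^2 = c" by (simp add: X(1))
 define r where "r = sqrt ((1 - v) / (1 - c))"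
 define s where "s = sqrt (v / c)"
 have r: "r^2 = (1 - v) / (1 - c)" "r > 0" and s: "s^2 = v / c" "s > 0" using c by (simp_all add: r_def s_def)
 have l: "lev c v P = ver (r * x) (r * y) (s * z)" unfolding lev_def r_def[symmetric] s_def[symmetric] X scl_ver ..
 have "(r * x)^2 + (r * y)^2 = r^2 * (1 - c)" using X(2) X3 by (simp add: power_mult_distrib distrib_left[symmetric])
 also have "\<dots> = 1 - v" using c by (simp add: r)
 finally have 1: "(r * x)^2 + (r * y)^2 = 1 - v" .
 have 2: "(s * z)^2 = v" using c by (simp add: power_mult_distrib X3 s)
 have "ver (r * x) (r * y) (s * z) \<in> RP2" by (rule verI) (simp only: 1 2 diff_add_cancel)
 then show "lev c v P \<in> band {v}" unfolding l band_def by (simp only: mem_Collect_eq ver_simps 2 singletonI simp_thms)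
 have "sqrt ((1 - c) / (1 - v)) = 1 / r" "sqrt (c / v) = 1 / s" unfolding r_def s_def by (simp_all add: real_sqrt_divide)
 then show "lev v c (lev c v P) = P" unfolding l unfolding lev_def scl_ver using r(2) s(2) X(1) by simp
qed

lemma sm_lev:
 assumes "sm S c" "sm S v" "\<And>i. sm S (\<lambda>y. P y i)" "\<And>y. y \<in> S \<Longrightarrow> 0 < c y \<and> c y < 1 \<and> 0 < v y \<and> v y < 1"
 shows "sm S (\<lambda>y. lev (c y) (v y) (P y) i)"
proof -
 have "sm S (\<lambda>y. sqrt ((1 - v y) / (1 - c y)))" "sm S (\<lambda>y. sqrt (v y / c y))"
  using assms by (auto intro!: sm_intros divide_pos_pos) force+
 then show ?thesis unfolding lev_def using assms(3) by (rule sm_scl)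
qed

lemma bE_diffeo: assumes ec: "end_ok e c" shows "diffeomorphic_mfd (boundary_mfd (Em e c)) (circ (1/2))"
 unfolding diffeomorphic_mfd_def
proof (rule exI)
 have c: "0 < c" "c < 1" using ec by auto
 have T: "topspace (mtop (boundary_mfd (Em e c))) = band {c}"
  by (auto simp: boundary_mfd_def E_boundary[OF ec] band_def cap_def)
 have S: "sm S (\<lambda>y. lev a b y i)" if "0 < a" "a < 1" "0 < b" "b < 1" for S a b i
  using that by (intro sm_lev) auto
 show "diffeo_between (boundary_mfd (Em e c)) (topspace (mtop (boundary_mfd (Em e c)))) (circ (1/2)) (topspace (mtop (circ (1/2)))) (lev c (1/2))"
  unfolding T
  by (rule diffeo_betweenI[OF emb_bE[OF ec] emb_circ, where h = "lev (1/2) c" and G = "lev c (1/2)" and H = "lev (1/2) c"])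
   (use c lev_in S in \<open>auto simp: T\<close>)
qed

section \<open>Smooth triangulations and the disk\<close>

lemma emb_euclid: "emb (euclid_mfd k) k id"
 by (rule embI[where r = id]; (rule emb_chartI[where \<psi> = id and \<xi> = id])?)
  (auto simp: euclid_mfd_def Euclidean_space_eq intro: sm_var)

lemma topspace_euclid: "topspace (mtop (euclid_mfd k)) = eucl k"
 by (simp add: euclid_mfd_def Euclidean_space_eq)

lemma realization_finite:
 assumes "finite_complex k K" "x \<in> realization K"
 shows "{i. x i \<noteq> 0} \<subseteq> {..<k}" "x \<in> eucl k" "0 \<le> x i" "(\<Sum>i<k. x i) = 1"
proof -
 show 1: "{i. x i \<noteq> 0} \<subseteq> {..<k}" using assms by (auto simp: realization_def finite_complex_def)
 then show "x \<in> eucl k" by (auto simp: not_less[symmetric])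
 show "0 \<le> x i" using assms by (auto simp: realization_def)
 have "(\<Sum>i<k. x i) = (\<Sum>i | x i \<noteq> 0. x i)"
  by (rule sum.mono_neutral_right) (use 1 in auto)
 then show "(\<Sum>i<k. x i) = 1" using assms(2) by (simp add: realization_def)
qed

lemma realizationI:
 assumes "\<And>i. 0 \<le> x i" "x \<in> eucl k" "(\<Sum>i<k. x i) = 1" "{i. x i \<noteq> 0} \<in> K"
 shows "x \<in> realization K"
proof -
 have "(\<Sum>i<k. x i) = (\<Sum>i | x i \<noteq> 0. x i)"
  by (rule sum.mono_neutral_right) (use assms(2) in \<open>auto simp: not_less[symmetric]\<close>)
 then show ?thesis using assms by (simp add: realization_def)
qed

lemma realization_support:
 assumes "x \<in> realization K" shows "{i. x i \<noteq> 0} \<noteq> {}"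
proof -
 have "(\<Sum>i | x i \<noteq> 0. x i) = 1" using assms by (simp add: realization_def)
 then show ?thesis by (metis sum.empty zero_neq_one)
qed

lemma realization_Pow:
 assumes "finite_complex k K" "s \<in> K" shows "realization (Pow s) \<subseteq> realization K"
proof
 fix x assume x: "x \<in> realization (Pow s)"
 then have sub: "{i. x i \<noteq> 0} \<subseteq> s" by (simp add: realization_def)
 have "{i. x i \<noteq> 0} \<in> K"
  using assms(1)[unfolded finite_complex_def, THEN conjunct2, rule_format, OF assms(2) conjI[OF sub realization_support[OF x]]] .
 then show "x \<in> realization K" using x by (simp add: realization_def)
qed

lemma realization_memE:
 assumes "x \<in> realization K" shows "{i. x i \<noteq> 0} \<in> K" "x \<in> realization (Pow {i. x i \<noteq> 0})"
 using assms by (auto simp: realization_def)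

lemma realization_Union:
 assumes "finite_complex k K" shows "realization K = (\<Union>s\<in>K. realization (Pow s))"
proof (intro equalityI subsetI)
 fix x assume "x \<in> realization K"
 from realization_memE[OF this] show "x \<in> (\<Union>s\<in>K. realization (Pow s))" by (rule UN_I)
next
 fix x assume "x \<in> (\<Union>s\<in>K. realization (Pow s))"
 then obtain s where "s \<in> K" "x \<in> realization (Pow s)" by (rule UN_E)
 then show "x \<in> realization K" using realization_Pow[OF assms] by (meson subsetD)
qed

lemma finite_complex_finite: assumes "finite_complex k K" shows "finite K"
proof (rule finite_subset)
 show "K \<subseteq> Pow {..<k}"
 proof
  fix s assume "s \<in> K"
  from assms[unfolded finite_complex_def, THEN conjunct1, rule_format, OF this] show "s \<in> Pow {..<k}" by simp
 qed
qed simp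

lemma compact_realization:
 assumes "finite_complex k K" shows "compact (realization K)"
proof -
 have fin: "finite K" by (rule finite_complex_finite[OF assms])
 have "compact (realization (Pow s))" if s: "s \<in> K" for s
 proof -
  have sk: "s \<subseteq> {..<k}" "finite s" using assms s finite_subset by (auto simp: finite_complex_def)
  have "realization (Pow s) = (UNIV \<rightarrow>\<^sub>E {0..1}) \<inter> (\<Inter>i\<in>-s. {x. x i = 0}) \<inter> {x. (\<Sum>i\<in>s. x i) = 1}"
  proof (intro equalityI subsetI)
   fix x assume x: "x \<in> realization (Pow s)"
   have sub: "{i. x i \<noteq> 0} \<subseteq> s" using x by (auto simp: realization_def)
   then have sum: "(\<Sum>i\<in>s. x i) = 1"
    using x sum.mono_neutral_right[OF sk(2) sub, of x] by (simp add: realization_def)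
   have "x i \<le> 1" for i
   proof (cases "i \<in> s")
    case True
    then have "x i \<le> (\<Sum>i\<in>s. x i)" using x sk(2) by (intro member_le_sum) (auto simp: realization_def)
    then show ?thesis using sum by simp
   next
    case False then have "x i = 0" using sub by blast
    then show ?thesis by simp
   qed
   then show "x \<in> (UNIV \<rightarrow>\<^sub>E {0..1}) \<inter> (\<Inter>i\<in>-s. {x. x i = 0}) \<inter> {x. (\<Sum>i\<in>s. x i) = 1}"
    using x sub sum by (auto simp: realization_def)
  next
   fix x :: "nat \<Rightarrow> real" assume x: "x \<in> (UNIV \<rightarrow>\<^sub>E {0..1}) \<inter> (\<Inter>i\<in>-s. {x. x i = 0}) \<inter> {x. (\<Sum>i\<in>s. x i) = 1}"
   have sub: "{i. x i \<noteq> 0} \<subseteq> s" using x by auto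
   then show "x \<in> realization (Pow s)"
    using x sum.mono_neutral_right[OF sk(2) sub, of x] by (auto simp: realization_def PiE_def Pi_def)
  qed
  moreover have "compact (UNIV \<rightarrow>\<^sub>E {0..1::real} :: (nat \<Rightarrow> real) set)"
   using compactin_PiE[of "\<lambda>_. euclideanreal" UNIV "\<lambda>_. {0..1}"] by (simp add: euclidean_product_topology)
  moreover have "closed (\<Inter>i\<in>-s. {x::nat\<Rightarrow>real. x i = 0})" "closed {x::nat\<Rightarrow>real. (\<Sum>i\<in>s. x i) = 1}"
   by (intro closed_INT ballI closed_Collect_eq continuous_intros continuous_on_product_coordinates)+
  ultimately show ?thesis by (simp add: compact_Int_closed)
 qed
 then show ?thesis unfolding realization_Union[OF assms] using fin by (intro compact_UN) auto
qed

text \<open>The realization of a finite complex is compact, so a continuous injection is a homeomorphism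
  onto its image, and continuity may be checked on the closed simplices.\<close>

lemma smooth_triangulationI:
 assumes K: "finite_complex k K" and X: "emb X l id" "mtop X = top_of_set S"
  and img: "h ` realization K = S" and inj: "inj_on h (realization K)"
  and loc: "\<And>s. s \<in> K \<Longrightarrow> \<exists>G H. (\<forall>x\<in>realization (Pow s). h x = G x \<and> H (h x) = x) \<and>
    (\<forall>i. sm (realization (Pow s)) (\<lambda>x. G x i)) \<and> (\<forall>i. sm (h ` realization (Pow s)) (\<lambda>x. H x i))"
 shows "smooth_triangulation X k K h"
proof -
 have fin: "finite K" by (rule finite_complex_finite[OF K])
 have KE: "realization K \<subseteq> eucl k" using realization_finite(2)[OF K] by blast
 note U = realization_Union[OF K]
 have comp: "finite_complex k {t. t \<subseteq> s \<and> t \<noteq> {}}" if "s \<in> K" for s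
 proof -
  have "s \<subseteq> {..<k}" using K that by (simp add: finite_complex_def)
  then show ?thesis unfolding finite_complex_def by blast
 qed
 have Pow_eq: "realization (Pow s) = realization {t. t \<subseteq> s \<and> t \<noteq> {}}" for s
 proof (intro equalityI subsetI)
  fix x assume x: "x \<in> realization (Pow s)"
  from realization_support[OF this] x show "x \<in> realization {t. t \<subseteq> s \<and> t \<noteq> {}}" unfolding realization_def mem_Collect_eq by simp
 next
  fix x assume "x \<in> realization {t. t \<subseteq> s \<and> t \<noteq> {}}"
  then show "x \<in> realization (Pow s)" unfolding realization_def mem_Collect_eq by simp
 qed
 have closed: "closed (realization (Pow s))" if "s \<in> K" for s
  unfolding Pow_eq by (rule compact_imp_closed[OF compact_realization[OF comp[OF that]]])
 have "continuous_on (realization (Pow s)) h" if s: "s \<in> K" for s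
 proof -
  obtain G where G: "\<forall>x\<in>realization (Pow s). h x = G x" "\<forall>i. sm (realization (Pow s)) (\<lambda>x. G x i)" using loc[OF s] by blast
  have "continuous_on (realization (Pow s)) G" using G(2) by (intro sm_isCont_vec) blast
  then show ?thesis using G(1) by (simp cong: continuous_on_cong)
 qed
 then have cont: "continuous_on (realization K) h"
  unfolding U using fin closed by (intro continuous_on_closed_Union) auto
 obtain g where g: "homeomorphism (realization K) S h g"
  using homeomorphism_compact[OF compact_realization[OF K] cont img inj] by blast
 then have "homeomorphic_maps (top_of_set (realization K)) (top_of_set S) h g"
  by (auto simp: homeomorphism_def homeomorphic_maps_def)
 then have homeo: "homeomorphic_map (subtopology (Euclidean_space k) (realization K)) (mtop X) h"
  using KE by (auto simp: X Euclidean_space_eq subtopology_subtopology Int_absorb1 homeomorphic_map_maps)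
 show ?thesis unfolding smooth_triangulation_def
 proof (intro conjI K homeo ballI)
  fix s assume s: "s \<in> K"
  obtain G H where GH: "\<And>x. x\<in>realization (Pow s) \<Longrightarrow> h x = G x" "\<And>x. x\<in>realization (Pow s) \<Longrightarrow> H (h x) = x"
   "\<And>i. sm (realization (Pow s)) (\<lambda>x. G x i)" "\<And>i. sm (h ` realization (Pow s)) (\<lambda>x. H x i)" using loc[OF s] by blast
  have sub: "realization (Pow s) \<subseteq> realization K" by (rule realization_Pow[OF K s])
  have subS: "h ` realization (Pow s) \<subseteq> S" using image_mono[OF sub, of h] img by simp
  have subE: "realization (Pow s) \<subseteq> eucl k" by (rule subset_trans[OF sub KE])
  show "diffeo_between (euclid_mfd k) (realization (Pow s)) X (h ` realization (Pow s)) h"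
   by (rule diffeo_betweenI[OF emb_euclid X(1), where h = H and G = G and H = H])
    (use GH subS subE in \<open>auto simp: topspace_euclid X(2)\<close>)
 qed
qed

text \<open>The square with the four corners 1, 2, 3, 4 and the centre 0. It is mapped to the affine disk
  by a smooth radial change of scale that takes the square to the round disk: on the boundary of the
  square, where the absolute values of the coordinates add up to 1, the sum of their squares is 1
  minus twice their product.\<close>

definition diskK :: "nat set set" where
 "diskK = {s. s \<subseteq> {..<5} \<and> s \<noteq> {} \<and> \<not> {1,3} \<subseteq> s \<and> \<not> {2,4} \<subseteq> s}"

definition disk_map :: "(nat \<Rightarrow> real) \<Rightarrow> nat \<Rightarrow> real" where
 "disk_map x = (let r = 2 * sqrt (1 - 2 * ((x 1 + x 3) * (x 2 + x 4))) in
  aff_inv 2 (tup [(x 1 - x 3) / r, (x 2 - x 4) / r]))"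

lemma diskK_complex: "finite_complex 5 diskK"
 by (auto simp: finite_complex_def diskK_def)

lemma disk_real:
 assumes "x \<in> realization diskK"
 shows "0 \<le> x i" "x 0 + x 1 + x 2 + x 3 + x 4 = 1" "x 1 = 0 \<or> x 3 = 0" "x 2 = 0 \<or> x 4 = 0" "x \<in> eucl 5"
proof -
 note f = realization_finite[OF diskK_complex assms]
 show "0 \<le> x i" "x \<in> eucl 5" by (rule f)+
 show "x 0 + x 1 + x 2 + x 3 + x 4 = 1" using f(4) by (simp add: eval_nat_numeral)
 have "{i. x i \<noteq> 0} \<in> diskK" by (rule realization_memE(1)[OF assms])
 then show "x 1 = 0 \<or> x 3 = 0" "x 2 = 0 \<or> x 4 = 0" by (auto simp: diskK_def)
qed

lemma eucl_5: "x \<in> eucl 5 \<Longrightarrow> x = tup [x 0, x 1, x 2, x 3, x 4]"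
proof
 fix i :: nat assume x: "x \<in> eucl 5"
 consider "i = 0" | "i = 1" | "i = 2" | "i = 3" | "i = 4" | "i \<ge> 5" by linarith
 then show "x i = tup [x 0, x 1, x 2, x 3, x 4] i" using x by cases (auto simp: tup_def)
qed

lemma four_mult_le_one: "0 \<le> a \<Longrightarrow> 0 \<le> b \<Longrightarrow> a + b \<le> 1 \<Longrightarrow> 4 * (a * b) \<le> (1::real)"
proof -
 assume "0 \<le> a" "0 \<le> b" "a + b \<le> 1"
 then have "(a + b)^2 \<le> 1" by (simp add: power_le_one)
 moreover have "0 \<le> (a - b)^2" by simp
 ultimately show ?thesis by (simp add: power2_eq_square algebra_simps)
qed

lemma disk_inverse:
 assumes "0 \<le> m" "4 * m \<le> (1::real)" "m = \<bar>a\<bar> * \<bar>b\<bar>" "r = 2 * sqrt (1 - 2 * m)" "X = a / r" "Y = b / r"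
 shows "r > 0" "1 + 8 * (\<bar>X\<bar> * \<bar>Y\<bar>) = 1 / (1 - 2 * m)"
  "2 * X / sqrt (1 + 8 * (\<bar>X\<bar> * \<bar>Y\<bar>)) = a" "2 * Y / sqrt (1 + 8 * (\<bar>X\<bar> * \<bar>Y\<bar>)) = b"
proof -
 have q: "1 - 2 * m > 0" using assms by linarith
 then show r: "r > 0" using assms by simp
 have r2: "r * r = 4 * (1 - 2 * m)" using q assms(4) by simp
 have "\<bar>X\<bar> * \<bar>Y\<bar> = m / (r * r)" using r by (simp add: assms(3,5,6) abs_mult)
 also have "\<dots> = m / (4 * (1 - 2 * m))" by (simp only: r2)
 finally have XY: "\<bar>X\<bar> * \<bar>Y\<bar> = m / (4 * (1 - 2 * m))" .
 have "1 + 8 * (m / (4 * (1 - 2 * m))) = 1 / (1 - 2 * m)" using q by (simp add: field_simps)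
 then show w: "1 + 8 * (\<bar>X\<bar> * \<bar>Y\<bar>) = 1 / (1 - 2 * m)" by (simp only: XY)
 have "sqrt (1 + 8 * (\<bar>X\<bar> * \<bar>Y\<bar>)) = 2 / r" unfolding w assms(4) using q by (simp add: real_sqrt_divide)
 then show "2 * X / sqrt (1 + 8 * (\<bar>X\<bar> * \<bar>Y\<bar>)) = a" "2 * Y / sqrt (1 + 8 * (\<bar>X\<bar> * \<bar>Y\<bar>)) = b"
  using r by (simp_all add: assms(5,6))
qed

lemma aff_2: "aff 2 P = tup [P 4 / P 2, P 5 / P 2]" by (simp add: aff_def)

lemma disk_map_data:
 assumes x: "x \<in> realization diskK"
 defines "m \<equiv> (x 1 + x 3) * (x 2 + x 4)" and "X \<equiv> disk_map x 4 / disk_map x 2" and "Y \<equiv> disk_map x 5 / disk_map x 2"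
 shows "0 \<le> m" "4 * m \<le> 1" "disk_map x = aff_inv 2 (tup [X, Y])"
  "2 * X / sqrt (1 + 8 * (\<bar>X\<bar> * \<bar>Y\<bar>)) = x 1 - x 3" "2 * Y / sqrt (1 + 8 * (\<bar>X\<bar> * \<bar>Y\<bar>)) = x 2 - x 4"
  "X = (x 1 - x 3) / (2 * sqrt (1 - 2 * m))" "Y = (x 2 - x 4) / (2 * sqrt (1 - 2 * m))"
proof -
 note d = disk_real[OF x]
 show m: "0 \<le> m" "4 * m \<le> 1"
  using d(1)[of 1] d(1)[of 2] d(1)[of 3] d(1)[of 4] d(1)[of 0] d(2) by (auto simp: m_def intro!: four_mult_le_one)
 have mab: "m = \<bar>x 1 - x 3\<bar> * \<bar>x 2 - x 4\<bar>"
  using d(3,4) d(1)[of 1] d(1)[of 2] d(1)[of 3] d(1)[of 4] by (auto simp: m_def)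
 define r where "r = 2 * sqrt (1 - 2 * m)"
 have h: "disk_map x = aff_inv 2 (tup [(x 1 - x 3) / r, (x 2 - x 4) / r])"
  by (simp add: disk_map_def Let_def r_def m_def)
 have "aff 2 (disk_map x) = tup [(x 1 - x 3) / r, (x 2 - x 4) / r]"
  unfolding h by (rule aff_aff_inv) (auto simp: tup_def)
 then have "tup [X, Y] = tup [(x 1 - x 3) / r, (x 2 - x 4) / r]" by (simp add: aff_2 X_def Y_def)
 then have "tup [X, Y] 0 = tup [(x 1 - x 3) / r, (x 2 - x 4) / r] 0" "tup [X, Y] 1 = tup [(x 1 - x 3) / r, (x 2 - x 4) / r] 1" by simp_all
 then have XY: "X = (x 1 - x 3) / r" "Y = (x 2 - x 4) / r" by simp_all
 show "disk_map x = aff_inv 2 (tup [X, Y])" by (simp add: h XY)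
 show "X = (x 1 - x 3) / (2 * sqrt (1 - 2 * m))" "Y = (x 2 - x 4) / (2 * sqrt (1 - 2 * m))" by (simp_all add: XY r_def)
 note D = disk_inverse[OF m mab r_def XY]
 show "2 * X / sqrt (1 + 8 * (\<bar>X\<bar> * \<bar>Y\<bar>)) = x 1 - x 3" "2 * Y / sqrt (1 + 8 * (\<bar>X\<bar> * \<bar>Y\<bar>)) = x 2 - x 4"
  by (rule D(3), rule D(4))
qed

lemma disk_coords:
 assumes x: "x \<in> realization diskK"
 shows "x = (let a = x 1 - x 3; b = x 2 - x 4 in tup [1 - \<bar>a\<bar> - \<bar>b\<bar>, max a 0, max b 0, max (-a) 0, max (-b) 0])"
proof -
 note d = disk_real[OF x]
 have 1: "x 0 = 1 - \<bar>x 1 - x 3\<bar> - \<bar>x 2 - x 4\<bar>" "x 1 = max (x 1 - x 3) 0" "x 2 = max (x 2 - x 4) 0"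
  "x 3 = max (-(x 1 - x 3)) 0" "x 4 = max (-(x 2 - x 4)) 0"
  using d(2,3,4) d(1)[of 1] d(1)[of 2] d(1)[of 3] d(1)[of 4] by auto
 have "x = tup [x 0, x 1, x 2, x 3, x 4]" by (rule eucl_5[OF d(5)])
 also have "\<dots> = tup [1 - \<bar>x 1 - x 3\<bar> - \<bar>x 2 - x 4\<bar>, max (x 1 - x 3) 0, max (x 2 - x 4) 0, max (-(x 1 - x 3)) 0, max (-(x 2 - x 4)) 0]"
  by (rule arg_cong[where f = tup]) (use 1 in \<open>simp only: list.inject simp_thms\<close>)
 finally show ?thesis by (simp only: Let_def)
qed

lemma cap_disk: "cap 1 (4/5) = {4/5..}" by (auto simp: cap_def)

lemma disk_triangulation: "smooth_triangulation (Em 1 (4/5)) 5 diskK disk_map"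
proof (rule smooth_triangulationI[OF diskK_complex emb_E])
 show "inj_on disk_map (realization diskK)"
 proof (rule inj_onI)
  fix x y assume xy: "x \<in> realization diskK" "y \<in> realization diskK" "disk_map x = disk_map y"
  have "x 1 - x 3 = y 1 - y 3" "x 2 - x 4 = y 2 - y 4"
   using disk_map_data(4,5)[OF xy(1)] disk_map_data(4,5)[OF xy(2)] unfolding xy(3) by (metis, metis)
  then show "x = y" using disk_coords[OF xy(1)] disk_coords[OF xy(2)] by (simp only:)
 qed
 show "disk_map ` realization diskK = band (cap 1 (4/5))"
 proof (intro equalityI subsetI)
  fix P assume "P \<in> disk_map ` realization diskK"
  then obtain x where x: "x \<in> realization diskK" "P = disk_map x" by blast
  note D = disk_map_data[OF x(1), folded x(2)]
  let ?m = "(x 1 + x 3) * (x 2 + x 4)"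
  let ?X = "P 4 / P 2" and ?Y = "P 5 / P 2"
  note d = disk_real[OF x(1)]
  have q: "1 - 2 * ?m > 0" using D(2) by linarith
  have "?X^2 + ?Y^2 = ((x 1 - x 3)^2 + (x 2 - x 4)^2) / (4 * (1 - 2 * ?m))"
   using q unfolding D(6,7) by (simp add: power_divide power_mult_distrib add_divide_distrib)
  also have "(x 1 - x 3)^2 + (x 2 - x 4)^2 = (x 1 + x 3 + (x 2 + x 4))^2 - 2 * ?m"
   using d(3,4) by (auto simp: power2_eq_square algebra_simps)
  also have "\<dots> \<le> 1 - 2 * ?m"
   using d(1)[of 1] d(1)[of 2] d(1)[of 3] d(1)[of 4] d(1)[of 0] d(2) by (simp add: power_le_one)
  finally have "?X^2 + ?Y^2 \<le> (1 - 2 * ?m) / (4 * (1 - 2 * ?m))" using q by (simp add: divide_right_mono)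
  moreover have "D / (4 * D) = 1 / 4" if "D > 0" for D :: real using that by simp
  ultimately have le: "?X^2 + ?Y^2 \<le> 1 / 4" using q by (simp only:)
  have "P \<in> RP2" unfolding x disk_map_def Let_def by (rule aff_inv_in)
  moreover have "P 2 = aff_height 2 (tup [?X, ?Y])" using aff_inv_height[of 2 "tup [?X, ?Y]"] D(3) by simp
  moreover have "aff_height 2 (tup [?X, ?Y]) \<ge> 4 / 5"
   using le one_plus_pos[of ?X ?Y] by (simp add: aff_height_def field_simps)
  ultimately show "P \<in> band (cap 1 (4/5))" by (simp add: band_def cap_disk)
 next
  fix P assume "P \<in> band (cap 1 (4/5))"
  then have P: "P \<in> RP2" "P 2 \<ge> 4/5" by (auto simp: band_def cap_disk)
  define X Y where "X = P 4 / P 2" and "Y = P 5 / P 2"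
  have PXY: "P = aff_inv 2 (tup [X, Y])" using aff_inv_aff[OF P(1), of 2] P(2) by (simp add: aff_2 X_def Y_def)
  have "P 2 = aff_height 2 (tup [X, Y])" unfolding PXY using aff_inv_height[of 2 "tup [X, Y]"] by simp
  then have "P 2 * (1 + X^2 + Y^2) = 1" using one_plus_pos[of X Y] by (simp add: aff_height_def)
  moreover have "4/5 * (1 + X^2 + Y^2) \<le> P 2 * (1 + X^2 + Y^2)"
   using P(2) one_plus_pos[of X Y] by (intro mult_right_mono) simp_all
  ultimately have le: "X^2 + Y^2 \<le> 1 / 4" by simp
  define w where "w = \<bar>X\<bar> * \<bar>Y\<bar>"
  have w: "w \<ge> 0" by (simp add: w_def)
  define s where "s = sqrt (1 + 8 * w)"
  have s: "s > 0" "s^2 = 1 + 8 * w" using w by (simp_all add: s_def)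
  define a b where "a = 2 * X / s" and "b = 2 * Y / s"
  have ab: "\<bar>a\<bar> = 2 * \<bar>X\<bar> / s" "\<bar>b\<bar> = 2 * \<bar>Y\<bar> / s" using s by (simp_all add: a_def b_def abs_mult)
  have "(2 * \<bar>X\<bar> + 2 * \<bar>Y\<bar>)^2 = 4 * (X^2 + Y^2) + 8 * w" by (simp add: power2_sum power_mult_distrib w_def)
  also have "\<dots> \<le> s^2" using le s by simp
  finally have "2 * \<bar>X\<bar> + 2 * \<bar>Y\<bar> \<le> s" using s(1) power2_le_imp_le by fastforce
  then have sum: "\<bar>a\<bar> + \<bar>b\<bar> \<le> 1" using s by (simp add: ab add_divide_distrib[symmetric])
  define x where "x = tup [1 - \<bar>a\<bar> - \<bar>b\<bar>, max a 0, max b 0, max (-a) 0, max (-b) 0]"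
  have xs: "x 0 = 1 - \<bar>a\<bar> - \<bar>b\<bar>" "x 1 = max a 0" "x 2 = max b 0" "x 3 = max (-a) 0" "x 4 = max (-b) 0"
   by (simp_all add: x_def)
  have xE: "x \<in> eucl 5" by (auto simp: x_def tup_def)
  have pos: "0 \<le> x i" for i
  proof -
   have "0 \<le> tup as i" if "\<forall>a\<in>set as. 0 \<le> a" for as :: "real list" using that by (simp add: tup_def)
   then show ?thesis unfolding x_def using sum by simp
  qed
  have xr: "x \<in> realization diskK"
  proof (rule realizationI[OF pos xE])
   show "(\<Sum>i<5. x i) = 1" using xs by (simp add: eval_nat_numeral max_def)
   have "{i. x i \<noteq> 0} \<subseteq> {..<5}" using xE by (auto simp: not_less[symmetric])
   moreover have "{i. x i \<noteq> 0} \<noteq> {}"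
   proof
    assume "{i. x i \<noteq> 0} = {}"
    then have "\<And>i. x i = 0" by blast
    then have "x 0 = 0" "x 1 = 0" "x 2 = 0" "x 3 = 0" "x 4 = 0" by blast+
    then show False unfolding xs by (auto simp: max_def split: if_splits)
   qed
   moreover have "x 1 = 0 \<or> x 3 = 0" "x 2 = 0 \<or> x 4 = 0" unfolding xs by (auto simp: max_def)
   ultimately show "{i. x i \<noteq> 0} \<in> diskK" unfolding diskK_def by auto
  qed
  have m: "(x 1 + x 3) * (x 2 + x 4) = \<bar>a\<bar> * \<bar>b\<bar>" unfolding xs by (auto simp: max_def abs_if)
  have "\<bar>a\<bar> * \<bar>b\<bar> = 4 * w / (1 + 8 * w)" unfolding ab s(2)[symmetric] by (simp add: w_def power2_eq_square)
  then have "1 - 2 * (\<bar>a\<bar> * \<bar>b\<bar>) = 1 / (1 + 8 * w)" using w by (simp add: field_simps)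
  then have "2 * sqrt (1 - 2 * ((x 1 + x 3) * (x 2 + x 4))) = 2 / s"
   unfolding m by (simp add: real_sqrt_divide s_def)
  moreover have "x 1 - x 3 = a" "x 2 - x 4 = b" unfolding xs by (auto simp: max_def)
  ultimately have "disk_map x = aff_inv 2 (tup [X, Y])" using s(1) by (simp add: disk_map_def Let_def a_def b_def)
  then have "P = disk_map x" using PXY by simp
  then show "P \<in> disk_map ` realization diskK" using xr by (rule image_eqI)
 qed
 fix s assume s: "s \<in> diskK"
 define e1 e2 :: real where "e1 = (if 3 \<in> s then -1 else 1)" and "e2 = (if 4 \<in> s then -1 else 1)"
 let ?R = "realization (Pow s)"
 have sub: "?R \<subseteq> realization diskK" by (rule realization_Pow[OF diskK_complex s])
 define w where "w P = 1 + 8 * (e1 * (P 4 / P 2) * (e2 * (P 5 / P 2)))" for P :: "nat \<Rightarrow> real"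
 define A where "A P = e1 * (2 * (P 4 / P 2) / sqrt (w P))" for P :: "nat \<Rightarrow> real"
 define B where "B P = e2 * (2 * (P 5 / P 2) / sqrt (w P))" for P :: "nat \<Rightarrow> real"
 define H where "H P = tup [1 - A P - B P, (1 + e1) / 2 * A P, (1 + e2) / 2 * B P, (1 - e1) / 2 * A P, (1 - e2) / 2 * B P]" for P
 have ee: "e1 * e1 = 1" "e2 * e2 = 1" by (simp_all add: e1_def e2_def)
 have key: "H (disk_map x) = x \<and> w (disk_map x) > 0 \<and> disk_map x 2 > 0" if x: "x \<in> ?R" for x
 proof -
  have xr: "x \<in> realization diskK" using x sub by blast
  note D = disk_map_data[OF xr] and d = disk_real[OF xr]
  let ?P = "disk_map x" and ?X = "disk_map x 4 / disk_map x 2" and ?Y = "disk_map x 5 / disk_map x 2"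
  have z: "x 1 = 0 \<or> 3 \<notin> s" "x 3 = 0 \<or> 3 \<in> s" "x 2 = 0 \<or> 4 \<notin> s" "x 4 = 0 \<or> 4 \<in> s"
   using x s by (auto simp: realization_def diskK_def)
  have q: "1 - 2 * ((x 1 + x 3) * (x 2 + x 4)) > 0" using D(2) by linarith
  then have r: "2 * sqrt (1 - 2 * ((x 1 + x 3) * (x 2 + x 4))) > 0" by simp
  have n: "0 \<le> e1 * (x 1 - x 3)" "0 \<le> e2 * (x 2 - x 4)"
   using z d(1)[of 1] d(1)[of 2] d(1)[of 3] d(1)[of 4] by (auto simp: e1_def e2_def)
  have nn: "0 \<le> a * (b / c)" if "0 \<le> a * b" "0 < c" for a b c :: real
   using divide_nonneg_pos[OF that] by simp
  have e: "e1 = 1 \<or> e1 = -1" "e2 = 1 \<or> e2 = -1" by (auto simp: e1_def e2_def)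
  have ab: "e * y = \<bar>y\<bar>" if "e = 1 \<or> e = -1" "0 \<le> e * y" for e y :: real using that by auto
  have X0: "0 \<le> e1 * ?X" unfolding D(6) by (rule nn[OF n(1) r])
  have Y0: "0 \<le> e2 * ?Y" unfolding D(7) by (rule nn[OF n(2) r])
  have "e1 * ?X = \<bar>?X\<bar>" "e2 * ?Y = \<bar>?Y\<bar>" by (rule ab[OF e(1) X0], rule ab[OF e(2) Y0])
  then have w: "w ?P = 1 + 8 * (\<bar>?X\<bar> * \<bar>?Y\<bar>)" by (simp only: w_def)
  then have wpos: "w ?P > 0" by (smt (verit) mult_nonneg_nonneg abs_ge_zero)
  have AB: "A ?P = e1 * (x 1 - x 3)" "B ?P = e2 * (x 2 - x 4)"
   unfolding A_def B_def w using D(4,5) by simp_all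
  have "H ?P = tup [x 0, x 1, x 2, x 3, x 4]"
   unfolding H_def AB by (rule arg_cong[where f = tup]) (use z d(2) in \<open>auto simp: e1_def e2_def\<close>)
  also have "\<dots> = x" by (rule eucl_5[OF d(5), symmetric])
  finally have "H ?P = x" .
  moreover have "?P 2 > 0" by (subst D(3)) (rule aff_inv_height[THEN conjunct2], simp)
  ultimately show ?thesis using wpos by (intro conjI)
 qed
 have smG: "sm ?R (\<lambda>x. disk_map x i)" for i
 proof -
  have "sm ?R (\<lambda>x. aff_inv 2 (tup [(x 1 - x 3) / (2 * sqrt (1 - 2 * ((x 1 + x 3) * (x 2 + x 4)))), (x 2 - x 4) / (2 * sqrt (1 - 2 * ((x 1 + x 3) * (x 2 + x 4))))]) i)"
  proof (rule sm_compose[OF _ sm_aff_inv subset_UNIV])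
   have "1 - 2 * ((x 1 + x 3) * (x 2 + x 4)) > 0" if "x \<in> ?R" for x
    using disk_map_data(2)[of x] sub that by force
   then show "sm ?R (\<lambda>x. tup [(x 1 - x 3) / (2 * sqrt (1 - 2 * ((x 1 + x 3) * (x 2 + x 4)))), (x 2 - x 4) / (2 * sqrt (1 - 2 * ((x 1 + x 3) * (x 2 + x 4))))] i)" for i
    by (intro sm_tup sm_intros) (auto simp: less_imp_neq[symmetric])
  qed
  then show ?thesis by (simp only: disk_map_def Let_def)
 qed
 have smH: "sm (disk_map ` ?R) (\<lambda>P. H P i)" for i
 proof -
  have pos: "P 2 \<noteq> 0" "w P > 0" if PR: "P \<in> disk_map ` ?R" for P
  proof -
   from PR obtain x where "P = disk_map x" "x \<in> ?R" by (rule imageE)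
   with key[OF this(2)] show "P 2 \<noteq> 0" "w P > 0" by simp_all
  qed
  have w: "sm (disk_map ` ?R) w" unfolding w_def[abs_def] by (intro sm_intros) (use pos in auto)
  have "sm (disk_map ` ?R) A" "sm (disk_map ` ?R) B" unfolding A_def[abs_def] B_def[abs_def]
   by (intro sm_intros w; use pos in force)+
  then show ?thesis unfolding H_def by (intro sm_tup sm_intros)
 qed
 show "\<exists>G H. (\<forall>x\<in>?R. disk_map x = G x \<and> H (disk_map x) = x) \<and>
    (\<forall>i. sm ?R (\<lambda>x. G x i)) \<and> (\<forall>i. sm (disk_map ` ?R) (\<lambda>x. H x i))"
  using key smG smH by (intro exI[of _ disk_map] exI[of _ H]) auto
qed (auto simp: Em_def)

text \<open>The critical set in the disk is a single vertex of the triangulation.\<close>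

lemma disk_subpolyhedron: "subpolyhedron (Em 1 (4/5)) 1 (band {1})"
proof -
 have "band {1} = disk_map ` realization {{0}}"
 proof -
  have "realization {{0}} = {tup [1]}"
  proof (intro equalityI subsetI)
   fix x assume "x \<in> realization {{0}}"
   then have x: "{i. x i \<noteq> 0} = {0}" "(\<Sum>i | x i \<noteq> 0. x i) = 1" by (auto simp: realization_def)
   then have "x 0 = 1" by simp
   moreover have "x i = 0" if "i \<noteq> 0" for i
   proof -
    have "i \<notin> {i. x i \<noteq> 0}" unfolding x(1) using that by simp
    then show ?thesis by simp
   qed
   ultimately have "x = tup [1]" by (auto simp: tup_def fun_eq_iff)
   then show "x \<in> {tup [1]}" by simp
  next
   fix x assume "x \<in> {tup [1::real]}"
   moreover have "{i. tup [1::real] i \<noteq> 0} = {0}" by (auto simp: tup_def)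
   ultimately show "x \<in> realization {{0}}" by (auto simp: realization_def tup_def)
  qed
  moreover have "disk_map (tup [1]) = ver 0 0 1" by (simp add: disk_map_def aff_inv_def Let_def)
  moreover have "band {1} = {ver 0 0 1}"
  proof (intro equalityI subsetI)
   fix P assume "P \<in> band {1}"
   then obtain x y z where P: "P = ver x y z" "x^2 + y^2 + z^2 = 1" "z^2 = 1" by (auto simp: band_def elim: RP2E)
   then have "x = 0" "y = 0" "z = 1 \<or> z = -1" by (auto simp: sum_power2_eq_zero_iff power2_eq_1_iff)
   then show "P \<in> {ver 0 0 1}" using P(1) ver_minus[of 0 0 1] by auto
  qed (auto simp: band_def intro!: verI)
  ultimately show ?thesis by simp
 qed
 moreover have "finite_complex 5 {{0}}" by (auto simp: finite_complex_def)
 moreover have "{{0}} \<subseteq> diskK" by (auto simp: diskK_def)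
 ultimately show ?thesis unfolding subpolyhedron_def using disk_triangulation
  by (intro exI[of _ 5] exI[of _ diskK] exI[of _ disk_map] exI[of _ "{{0}}"]) auto
qed

section \<open>A triangulation of the Moebius band\<close>

text \<open>The corners of a hexagon in the plane, with period 6. Opposite corners are negatives of each
  other, and neighbouring corners form a basis of determinant 1, which keeps the formulas on all
  sectors alike.\<close>

definition hx :: "nat \<Rightarrow> real" where "hx i = [1, 1, 0, -1, -1, 0] ! (i mod 6)"
definition hy :: "nat \<Rightarrow> real" where "hy i = [0, 1, 1, 0, -1, -1] ! (i mod 6)"
text \<open>The core circle has the three vertices 0, 1, 2, because opposite corners of the hexagon are
  the same point of it; the boundary circle has the six vertices 3 to 8. Each of the six sectors
  between neighbouring corners is a rectangle from the core to the boundary and is divided into a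
  lower and an upper triangle.\<close>

definition cv :: "nat \<Rightarrow> nat" where "cv i = i mod 3"
definition ov :: "nat \<Rightarrow> nat" where "ov i = 3 + i mod 6"

definition lowT :: "nat \<Rightarrow> nat set" where "lowT i = {cv i, cv (Suc i), ov (Suc i)}"
definition uppT :: "nat \<Rightarrow> nat set" where "uppT i = {cv i, ov i, ov (Suc i)}"

definition mobK :: "nat set set" where
 "mobK = {s. s \<noteq> {} \<and> (\<exists>i<6. s \<subseteq> lowT i \<or> s \<subseteq> uppT i)}"

lemma less6: "(i::nat) < 6 \<longleftrightarrow> i = 0 \<or> i = 1 \<or> i = 2 \<or> i = 3 \<or> i = 4 \<or> i = 5"
 by auto

lemma mobK_complex: "finite_complex 9 mobK"
proof -
 have "lowT i \<subseteq> {..<9}" "uppT i \<subseteq> {..<9}" for i by (auto simp: lowT_def uppT_def cv_def ov_def)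
 then have "s \<subseteq> {..<9}" "s \<noteq> {}" if "s \<in> mobK" for s using that unfolding mobK_def by blast+
 moreover have "t \<in> mobK" if "s \<in> mobK" "t \<subseteq> s" "t \<noteq> {}" for s t
  using that unfolding mobK_def mem_Collect_eq by (meson subset_trans)
 ultimately show ?thesis unfolding finite_complex_def by blast
qed

definition pc :: "nat \<Rightarrow> (nat \<Rightarrow> real) \<Rightarrow> real" where "pc i x = x (cv i) + x (ov i)"
definition tc :: "nat \<Rightarrow> (nat \<Rightarrow> real) \<Rightarrow> real" where "tc i x = x (ov i) + x (ov (Suc i))"
definition vx :: "nat \<Rightarrow> (nat \<Rightarrow> real) \<Rightarrow> real" where "vx i x = pc i x * hx i + pc (Suc i) x * hx (Suc i)"
definition vy :: "nat \<Rightarrow> (nat \<Rightarrow> real) \<Rightarrow> real" where "vy i x = pc i x * hy i + pc (Suc i) x * hy (Suc i)"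

text \<open>The point of the projective plane in the direction \<open>(a, b)\<close>, at the affine height \<open>t /
  2\<close> over the core. Height 1 is the level 1/5.\<close>

definition mpt :: "real \<Rightarrow> real \<Rightarrow> real \<Rightarrow> nat \<Rightarrow> real" where
 "mpt a b t = (let l = sqrt (a^2 + b^2); n = sqrt (4 + t^2) in ver (2 * a / (l * n)) (2 * b / (l * n)) (t / n))"

definition in_sector :: "nat \<Rightarrow> (nat \<Rightarrow> real) \<Rightarrow> bool" where
 "in_sector i x \<longleftrightarrow> i < 6 \<and> ({j. x j \<noteq> 0} \<subseteq> lowT i \<or> {j. x j \<noteq> 0} \<subseteq> uppT i)"

definition mob_map :: "(nat \<Rightarrow> real) \<Rightarrow> nat \<Rightarrow> real" where
 "mob_map x = (let i = (SOME i. in_sector i x) in mpt (vx i x) (vy i x) (tc i x))"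

lemma hexes [simp]:
 "hx 0 = 1" "hx 1 = 1" "hx (Suc 0) = 1" "hx (Suc (Suc 0)) = 0" "hx 2 = 0" "hx 3 = -1" "hx 4 = -1" "hx 5 = 0" "hx 6 = 1"
 "hy 0 = 0" "hy 1 = 1" "hy (Suc 0) = 1" "hy (Suc (Suc 0)) = 1" "hy 2 = 1" "hy 3 = 0" "hy 4 = -1" "hy 5 = -1" "hy 6 = 0"
 "cv 0 = 0" "cv 1 = 1" "cv (Suc 0) = 1" "cv (Suc (Suc 0)) = 2" "cv 2 = 2" "cv 3 = 0" "cv 4 = 1" "cv 5 = 2" "cv 6 = 0"
 "ov 0 = 3" "ov 1 = 4" "ov (Suc 0) = 4" "ov (Suc (Suc 0)) = 5" "ov 2 = 5" "ov 3 = 6" "ov 4 = 7" "ov 5 = 8" "ov 6 = 3"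
 by (simp_all add: hx_def hy_def cv_def ov_def)

lemma mod_facts: "cv i < 3" "ov i \<ge> 3" "ov i < 9" "cv i \<noteq> cv (Suc i)" "ov i \<noteq> ov (Suc i)" "cv i \<noteq> ov j" "ov j \<noteq> cv i"
proof -
 show "cv i < 3" "ov i \<ge> 3" "ov i < 9" by (auto simp: cv_def ov_def)
 show "cv i \<noteq> cv (Suc i)" unfolding cv_def by presburger
 show "ov i \<noteq> ov (Suc i)" unfolding ov_def by presburger
 have "cv i < 3" "ov j \<ge> 3" by (auto simp: cv_def ov_def)
 then show "cv i \<noteq> ov j" "ov j \<noteq> cv i" by linarith+
qed

lemma mob_real:
 assumes "x \<in> realization mobK"
 shows "0 \<le> x j" "x \<in> eucl 9" "x 0 + x 1 + x 2 + x 3 + x 4 + x 5 + x 6 + x 7 + x 8 = 1" "\<exists>i. in_sector i x"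
proof -
 note f = realization_finite[OF mobK_complex assms]
 show "0 \<le> x j" "x \<in> eucl 9" by (rule f)+
 show "x 0 + x 1 + x 2 + x 3 + x 4 + x 5 + x 6 + x 7 + x 8 = 1" using f(4) by (simp add: eval_nat_numeral)
 show "\<exists>i. in_sector i x" using realization_memE(1)[OF assms] unfolding mobK_def in_sector_def by blast
qed

lemma sector_zero:
 assumes "in_sector i x" "j \<noteq> cv i" "j \<noteq> cv (Suc i)" "j \<noteq> ov i" "j \<noteq> ov (Suc i)"
 shows "x j = 0"
 using assms unfolding in_sector_def lowT_def uppT_def by auto

text \<open>A point that lies in two sectors lies over a common corner, or is on the core. In the second
  case the two directions may be opposite, which does not matter at height 0.\<close>

lemma sector_agree:
 assumes i: "in_sector i x" and j: "in_sector j x"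
 shows "tc i x = tc j x \<and> (vx i x = vx j x \<and> vy i x = vy j x \<or> tc i x = 0 \<and> vx i x = - vx j x \<and> vy i x = - vy j x)"
proof -
 have ij: "i < 6" "j < 6" using i j by (auto simp: in_sector_def)
 note zi = sector_zero[OF i] and zj = sector_zero[OF j]
 note z = zi[of 0] zi[of "Suc 0"] zj[of "Suc 0"] zi[of 2] zi[of 3] zi[of 4] zi[of 5] zi[of 6] zi[of 7] zi[of 8]
  zj[of 0] zj[of 2] zj[of 3] zj[of 4] zj[of 5] zj[of 6] zj[of 7] zj[of 8]
 show ?thesis
  using ij(1)[unfolded less6] ij(2)[unfolded less6]
  by (elim disjE) (simp_all add: z vx_def vy_def tc_def pc_def)
qed

lemma mpt_minus: "mpt (- a) (- b) 0 = mpt a b 0"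
 using ver_minus[of "2 * a / (sqrt (a^2 + b^2) * 2)" "2 * b / (sqrt (a^2 + b^2) * 2)" 0] by (simp add: mpt_def)

lemma mob_map_eq:
 assumes "x \<in> realization mobK" "in_sector i x" shows "mob_map x = mpt (vx i x) (vy i x) (tc i x)"
proof -
 define j where "j = (SOME i. in_sector i x)"
 have j: "in_sector j x" unfolding j_def using assms(2) by (rule someI)
 from sector_agree[OF assms(2) j] have "mpt (vx j x) (vy j x) (tc j x) = mpt (vx i x) (vy i x) (tc i x)"
  using mpt_minus[of "vx j x" "vy j x"] by auto
 then show ?thesis by (simp add: mob_map_def Let_def j_def[symmetric])
qed

text \<open>On its unit circle, the hexagon, at most two of the hat functions are nonzero, and they are
  the coordinates with respect to the two neighbouring corners.\<close>

definition hexn :: "real \<Rightarrow> real \<Rightarrow> real" where "hexn a b = max (max \<bar>a\<bar> \<bar>b\<bar>) \<bar>a - b\<bar>"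

definition hat :: "nat \<Rightarrow> real \<Rightarrow> real \<Rightarrow> real" where
 "hat k a b = (if k = 0 then max 0 (min a (a - b)) else if k = 1 then max 0 (min a b)
  else if k = 2 then max 0 (min b (b - a)) else if k = 3 then max 0 (min (-a) (b - a))
  else if k = 4 then max 0 (min (-a) (-b)) else max 0 (min (-b) (a - b)))"

lemma hat_simps:
 "hat 0 a b = max 0 (min a (a - b))" "hat 1 a b = max 0 (min a b)" "hat (Suc 0) a b = max 0 (min a b)"
 "hat 2 a b = max 0 (min b (b - a))" "hat 3 a b = max 0 (min (-a) (b - a))"
 "hat 4 a b = max 0 (min (-a) (-b))" "hat 5 a b = max 0 (min (-b) (a - b))"
 by (simp_all add: hat_def)

definition oc :: "real \<Rightarrow> real \<Rightarrow> real \<Rightarrow> real" where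
 "oc p q t = min t (p + q) - min t q"

text \<open>The barycentric coordinates of the point in direction \<open>(a, b)\<close> at height \<open>t\<close>, by one formula
  for all sectors: along an edge from one corner to the next, \<open>oc\<close> is the weight of the outer
  vertex. The formula gives a left inverse of the triangulation, so it proves injectivity.\<close>

definition bary :: "real \<Rightarrow> real \<Rightarrow> real \<Rightarrow> nat \<Rightarrow> real" where
 "bary a b t = (let h = (\<lambda>k. hat k a b) in
  tup [h 0 + h 3 - oc (h 0) (h 1) t - oc (h 3) (h 4) t, h 1 + h 4 - oc (h 1) (h 2) t - oc (h 4) (h 5) t,
   h 2 + h 5 - oc (h 2) (h 3) t - oc (h 5) (h 0) t, oc (h 0) (h 1) t, oc (h 1) (h 2) t, oc (h 2) (h 3) t,
   oc (h 3) (h 4) t, oc (h 4) (h 5) t, oc (h 5) (h 0) t])"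

lemma eucl_9: "x \<in> eucl 9 \<Longrightarrow> x = tup [x 0, x 1, x 2, x 3, x 4, x 5, x 6, x 7, x 8]"
proof
 fix i :: nat assume x: "x \<in> eucl 9"
 consider "i = 0" | "i = 1" | "i = 2" | "i = 3" | "i = 4" | "i = 5" | "i = 6" | "i = 7" | "i = 8" | "i \<ge> 9" by linarith
 then show "x i = tup [x 0, x 1, x 2, x 3, x 4, x 5, x 6, x 7, x 8] i" using x by cases (auto simp: tup_def)
qed

lemma hats_sector:
 assumes "i < 6" "0 \<le> p" "0 \<le> q" "p + q = 1"
 shows "hexn (p * hx i + q * hx (Suc i)) (p * hy i + q * hy (Suc i)) = 1"
  and "k < 6 \<Longrightarrow> hat k (p * hx i + q * hx (Suc i)) (p * hy i + q * hy (Suc i)) = (if k = i then p else if k = Suc i mod 6 then q else 0)"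
proof -
 have q: "q = 1 - p" using assms(4) by simp
 have p: "0 \<le> p" "p \<le> 1" using assms by simp_all
 show "hexn (p * hx i + q * hx (Suc i)) (p * hy i + q * hy (Suc i)) = 1"
  using assms(1)[unfolded less6] p unfolding q by (elim disjE) (simp_all add: hexn_def max_def abs_if)
 show "hat k (p * hx i + q * hx (Suc i)) (p * hy i + q * hy (Suc i)) = (if k = i then p else if k = Suc i mod 6 then q else 0)" if "k < 6"
  using assms(1)[unfolded less6] that[unfolded less6] p unfolding q
  by (elim disjE) (simp_all add: hat_simps max_def min_def)
qed

lemma sector_coords:
 assumes x: "x \<in> realization mobK" and i: "in_sector i x"
 shows "i < 6" "0 \<le> pc i x" "0 \<le> pc (Suc i) x" "pc i x + pc (Suc i) x = 1" "0 \<le> tc i x" "tc i x \<le> 1"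
  "{j. x j \<noteq> 0} \<subseteq> lowT i \<Longrightarrow> tc i x \<le> pc (Suc i) x" "{j. x j \<noteq> 0} \<subseteq> uppT i \<Longrightarrow> pc (Suc i) x \<le> tc i x"
proof -
 note m = mob_real[OF x]
 have S: "(\<Sum>j<9. x j) = 1" by (rule realization_finite(4)[OF mobK_complex x])
 show i6: "i < 6" using i by (simp add: in_sector_def)
 show "0 \<le> pc i x" "0 \<le> pc (Suc i) x" "0 \<le> tc i x" using m(1) by (simp_all add: pc_def tc_def)
 have D: "{j. x j \<noteq> 0} \<subseteq> {cv i, cv (Suc i), ov i, ov (Suc i)}"
  using i by (auto simp: in_sector_def lowT_def uppT_def)
 have "(\<Sum>j<9. x j) = (\<Sum>j\<in>{cv i, cv (Suc i), ov i, ov (Suc i)}. x j)"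
  by (rule sum.mono_neutral_right) (use D mod_facts(1)[of i] mod_facts(1)[of "Suc i"] mod_facts(3)[of i] mod_facts(3)[of "Suc i"] in auto)
 also have "\<dots> = x (cv i) + x (cv (Suc i)) + x (ov i) + x (ov (Suc i))"
  using mod_facts[of i] mod_facts(6)[of "Suc i"] by (simp add: add.assoc)
 finally have sum: "x (cv i) + x (cv (Suc i)) + x (ov i) + x (ov (Suc i)) = 1" using S by simp
 then show "pc i x + pc (Suc i) x = 1" by (simp add: pc_def)
 show "tc i x \<le> 1" using sum m(1)[of "cv i"] m(1)[of "cv (Suc i)"] by (simp add: tc_def)
 show "tc i x \<le> pc (Suc i) x" if "{j. x j \<noteq> 0} \<subseteq> lowT i"
 proof -
  have "ov i \<notin> lowT i" using mod_facts(5,6,7)[of i] mod_facts(7)[of i "Suc i"] by (auto simp: lowT_def)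
  then have "x (ov i) = 0" using that by blast
  then show ?thesis using m(1) by (simp add: tc_def pc_def)
 qed
 show "pc (Suc i) x \<le> tc i x" if "{j. x j \<noteq> 0} \<subseteq> uppT i"
 proof -
  have "cv (Suc i) \<notin> uppT i" using mod_facts(4)[of i] mod_facts(6)[of "Suc i"] by (auto simp: uppT_def)
  then have "x (cv (Suc i)) = 0" using that by blast
  then show ?thesis using m(1) by (simp add: tc_def pc_def)
 qed
qed

lemma bary_sector:
 assumes x: "x \<in> realization mobK" and i: "in_sector i x"
 shows "bary (vx i x) (vy i x) (tc i x) = x" "hexn (vx i x) (vy i x) = 1"
proof -
 note c = sector_coords[OF x i]
 show "hexn (vx i x) (vy i x) = 1" unfolding vx_def vy_def by (rule hats_sector(1)[OF c(1-4)])
 define p where "p = pc i x"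
 define q where "q = pc (Suc i) x"
 define t where "t = tc i x"
 define m where "m = min t q"
 have h: "hat k (vx i x) (vy i x) = (if k = i then p else if k = Suc i mod 6 then q else 0)" if "k < 6" for k
  unfolding vx_def vy_def p_def q_def by (rule hats_sector(2)[OF c(1-4) that])
 have o: "oc p q t = t - m" "oc q 0 t = m" "oc 0 p t = 0" "oc 0 0 t = 0"
  using c by (simp_all add: oc_def m_def p_def q_def t_def)
 have ovm: "x (ov (Suc i)) = m"
  using i unfolding in_sector_def
 proof (elim conjE disjE)
  assume s: "{j. x j \<noteq> 0} \<subseteq> lowT i"
  have "ov i \<notin> lowT i" using mod_facts(5,6,7)[of i] mod_facts(7)[of i "Suc i"] by (auto simp: lowT_def)
  then have "x (ov i) = 0" using s by auto
  then show ?thesis using c(7)[OF s] by (simp add: m_def t_def q_def tc_def min_def)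
 next
  assume s: "{j. x j \<noteq> 0} \<subseteq> uppT i"
  have "cv (Suc i) \<notin> uppT i" using mod_facts(4)[of i] mod_facts(6)[of "Suc i"] by (auto simp: uppT_def)
  then have "x (cv (Suc i)) = 0" using s by auto
  then show ?thesis using c(8)[OF s] by (simp add: m_def t_def q_def pc_def min_def)
 qed
 have xs: "x (ov i) = t - m" "x (cv i) = p - (t - m)" "x (cv (Suc i)) = q - m"
  using ovm by (simp_all add: t_def p_def q_def tc_def pc_def)
 note z = sector_zero[OF i]
 note zs = z[of 0] z[of 1] z[of 2] z[of 3] z[of 4] z[of 5] z[of 6] z[of 7] z[of 8]
 have hh: "hat 0 (vx i x) (vy i x) = (if i = 0 then p else if i = 5 then q else 0)"
  "hat 1 (vx i x) (vy i x) = (if i = 1 then p else if i = 0 then q else 0)"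
  "hat 2 (vx i x) (vy i x) = (if i = 2 then p else if i = 1 then q else 0)"
  "hat 3 (vx i x) (vy i x) = (if i = 3 then p else if i = 2 then q else 0)"
  "hat 4 (vx i x) (vy i x) = (if i = 4 then p else if i = 3 then q else 0)"
  "hat 5 (vx i x) (vy i x) = (if i = 5 then p else if i = 4 then q else 0)"
  using c(1)[unfolded less6] by (simp_all add: h, (elim disjE; simp)+)
 have "bary (vx i x) (vy i x) t = tup [x 0, x 1, x 2, x 3, x 4, x 5, x 6, x 7, x 8]"
  unfolding bary_def Let_def hh
  using c(1)[unfolded less6] zs xs ovm o
  by (elim disjE) simp_all
 also have "\<dots> = x" by (rule eucl_9[OF mob_real(2)[OF x], symmetric])
 finally show "bary (vx i x) (vy i x) (tc i x) = x" unfolding t_def .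
qed

lemma bary_minus: "bary (- a) (- b) 0 = bary a b 0"
proof -
 have n: "0 \<le> hat k a b" for k a b by (simp add: hat_def)
 have z: "oc (hat j a b) (hat k a b) 0 = 0" for j k a b using n[of j a b] n[of k a b] by (simp add: oc_def)
 have hs: "hat 0 (-a) (-b) = hat 3 a b" "hat 1 (-a) (-b) = hat 4 a b" "hat 2 (-a) (-b) = hat 5 a b"
  "hat 3 (-a) (-b) = hat 0 a b" "hat 4 (-a) (-b) = hat 1 a b" "hat 5 (-a) (-b) = hat 2 a b"
  by (simp_all only: hat_simps minus_minus diff_minus_eq_add uminus_add_conv_diff)
 show ?thesis unfolding bary_def Let_def z hs by (simp only: add.commute)
qed

lemma hexn_scale: "hexn (m * a) (m * b) = \<bar>m\<bar> * hexn a b"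
proof -
 have "\<bar>m * a - m * b\<bar> = \<bar>m\<bar> * \<bar>a - b\<bar>" by (simp add: right_diff_distrib[symmetric] abs_mult)
 then show ?thesis by (simp add: hexn_def abs_mult max_mult_distrib_left)
qed

lemma hexn_pos: "hexn a b = 1 \<Longrightarrow> a^2 + b^2 > 0"
 by (auto simp: hexn_def sum_power2_gt_zero_iff)

lemma mpt_data:
 fixes t :: real
 assumes "a^2 + b^2 > 0"
 defines "l \<equiv> a^2 + b^2" and "n \<equiv> 4 + t^2"
 shows "mpt a b t 0 = 4 * a^2 / (l * n)" "mpt a b t 1 = 4 * b^2 / (l * n)" "mpt a b t 2 = t^2 / n"
  "mpt a b t 3 = 4 * (a * b) / (l * n)" "mpt a b t 4 = 2 * (a * t) / (sqrt l * n)" "mpt a b t 5 = 2 * (b * t) / (sqrt l * n)"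
  "mpt a b t \<in> RP2"
proof -
 have l: "l > 0" "n > 0" using assms(1) by (simp_all add: l_def n_def add_pos_nonneg)
 define r where "r = sqrt l"
 define m where "m = sqrt n"
 have r: "r > 0" "r^2 = l" "m > 0" "m^2 = n" using l by (simp_all add: r_def m_def)
 have v: "mpt a b t = ver (2 * a / (r * m)) (2 * b / (r * m)) (t / m)"
  by (simp add: mpt_def Let_def r_def m_def l_def n_def)
 show "mpt a b t 0 = 4 * a^2 / (l * n)" "mpt a b t 1 = 4 * b^2 / (l * n)" "mpt a b t 2 = t^2 / n"
  unfolding v r(2)[symmetric] r(4)[symmetric] by (simp_all add: power_divide power_mult_distrib)
 show "mpt a b t 3 = 4 * (a * b) / (l * n)" "mpt a b t 4 = 2 * (a * t) / (sqrt l * n)" "mpt a b t 5 = 2 * (b * t) / (sqrt l * n)"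
  unfolding v r_def[symmetric] unfolding r(2)[symmetric] r(4)[symmetric] by (simp_all add: power2_eq_square)
 have "(2 * a / (r * m))^2 + (2 * b / (r * m))^2 = 4 * (a^2 + b^2) / (r^2 * m^2)"
  by (simp add: power_divide power_mult_distrib add_divide_distrib distrib_left)
 also have "\<dots> = 4 / n" unfolding r using l by (simp add: l_def[symmetric])
 finally have "(2 * a / (r * m))^2 + (2 * b / (r * m))^2 + (t / m)^2 = (4 + t^2) / n"
  by (simp add: power_divide r(4) add_divide_distrib)
 then show "mpt a b t \<in> RP2" unfolding v using l by (intro verI) (simp add: n_def)
qed

lemma mpt_height: "a^2 + b^2 > 0 \<Longrightarrow> 0 \<le> t \<Longrightarrow> t = sqrt (4 * mpt a b t 2 / (1 - mpt a b t 2))"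
proof -
 assume ab: "a^2 + b^2 > 0" and t: "0 \<le> t"
 have n: "4 + t^2 > 0" by (simp add: add_pos_nonneg)
 have "1 - t^2 / (4 + t^2) = 4 / (4 + t^2)" using n by (simp add: field_simps)
 then have "4 * mpt a b t 2 / (1 - mpt a b t 2) = t^2" unfolding mpt_data(3)[OF ab] using n by simp
 then show ?thesis using t by simp
qed

text \<open>The quadratic coordinates determine the direction up to sign, and the hexagon meets each line
  in two opposite points. Away from the core, the products with the third coordinate determine the
  sign.\<close>

lemma mpt_inj:
 assumes ab: "hexn a b = 1" "hexn c d = 1" and t: "0 \<le> t" "0 \<le> s" and eq: "mpt a b t = mpt c d s"
 shows "t = s \<and> (a = c \<and> b = d \<or> t = 0 \<and> a = - c \<and> b = - d)"
proof -
 have pab: "a^2 + b^2 > 0" and pcd: "c^2 + d^2 > 0" using ab hexn_pos by auto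
 have ts: "t = s" using mpt_height[OF pab t(1)] mpt_height[OF pcd t(2)] eq by simp
 define l where "l = a^2 + b^2"
 define k where "k = c^2 + d^2"
 define n where "n = 4 + t^2"
 have lk: "l > 0" "k > 0" "n > 0" using pab pcd by (simp_all add: l_def k_def n_def add_pos_nonneg)
 have e0: "4 * a^2 / (l * n) = 4 * c^2 / (k * n)" and e3: "4 * (a * b) / (l * n) = 4 * (c * d) / (k * n)"
  and e1: "4 * b^2 / (l * n) = 4 * d^2 / (k * n)"
  and e4: "2 * (a * t) / (sqrt l * n) = 2 * (c * t) / (sqrt k * n)" and e5: "2 * (b * t) / (sqrt l * n) = 2 * (d * t) / (sqrt k * n)"
  using mpt_data[OF pab, of t] mpt_data[OF pcd, of t] eq ts unfolding l_def k_def n_def by simp_all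
 define m where "m = (a * c + b * d) / k"
 have q: "a^2 * k = c^2 * l" "(a * b) * k = (c * d) * l" "b^2 * k = d^2 * l"
  using e0 e3 e1 lk by (simp_all add: field_simps)
 have "a * (d * (a * k)) = a * (c * (b * k))"
 proof -
  have "a * (d * (a * k)) = d * (a^2 * k)" by (simp add: power2_eq_square)
  also have "\<dots> = c * ((c * d) * l)" unfolding q(1) by (simp add: power2_eq_square)
  also have "\<dots> = a * (c * (b * k))" unfolding q(2)[symmetric] by simp
  finally show ?thesis .
 qed
 moreover have "b * (d * (a * k)) = b * (c * (b * k))"
 proof -
  have "b * (d * (a * k)) = d * ((a * b) * k)" by simp
  also have "\<dots> = c * (d^2 * l)" unfolding q(2) by (simp add: power2_eq_square)
  also have "\<dots> = b * (c * (b * k))" unfolding q(3)[symmetric] by (simp add: power2_eq_square)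
  finally show ?thesis .
 qed
 moreover have "a \<noteq> 0 \<or> b \<noteq> 0" using pab by auto
 ultimately have cross: "d * a = c * b" using lk by auto
 have "m * c = a" "m * d = b"
 proof -
  have "(a * c + b * d) * c = a * k" using cross by (simp add: k_def power2_eq_square algebra_simps)
  then show "m * c = a" using lk by (simp add: m_def)
  have "(a * c + b * d) * d = b * k" using cross by (simp add: k_def power2_eq_square algebra_simps)
  then show "m * d = b" using lk by (simp add: m_def)
 qed
 moreover from this have "\<bar>m\<bar> = 1" using hexn_scale[of m c d] ab by simp
 then have "m = 1 \<or> m = -1" by linarith
 moreover have "t = 0" if "m = -1"
 proof (rule ccontr)
  assume t0: "t \<noteq> 0"
  have ac: "a = - c" "b = - d" using \<open>m * c = a\<close> \<open>m * d = b\<close> that by auto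
  then have kl: "k = l" by (simp add: k_def l_def)
  have sl: "sqrt l * n \<noteq> 0" using lk by simp
  have "a * t = c * t" "b * t = d * t" using e4 e5 sl unfolding kl by auto
  then have "a = c" "b = d" using t0 by auto
  then show False using ac pab by auto
 qed
 ultimately show ?thesis using ts by auto
qed

lemma mob_inj: "inj_on mob_map (realization mobK)"
proof (rule inj_onI)
 fix x y assume x: "x \<in> realization mobK" and y: "y \<in> realization mobK" and eq: "mob_map x = mob_map y"
 obtain i where i: "in_sector i x" using mob_real(4)[OF x] by blast
 obtain j where j: "in_sector j y" using mob_real(4)[OF y] by blast
 have e: "mpt (vx i x) (vy i x) (tc i x) = mpt (vx j y) (vy j y) (tc j y)"
  using eq mob_map_eq[OF x i] mob_map_eq[OF y j] by simp
 note I = mpt_inj[OF bary_sector(2)[OF x i] bary_sector(2)[OF y j] sector_coords(5)[OF x i] sector_coords(5)[OF y j] e]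
 then have "bary (vx i x) (vy i x) (tc i x) = bary (vx j y) (vy j y) (tc j y)"
  using bary_minus[of "vx j y" "vy j y"] by auto
 then show "x = y" using bary_sector(1)[OF x i] bary_sector(1)[OF y j] by simp
qed

lemma cap_mob: "cap (-1) (1/5) = {..1/5}" by (auto simp: cap_def)

lemma sector_exists:
 assumes "a \<noteq> 0 \<or> b \<noteq> (0::real)"
 obtains i p q where "i < 6" "0 \<le> p" "0 \<le> q" "p + q > 0" "a = p * hx i + q * hx (Suc i)" "b = p * hy i + q * hy (Suc i)"
proof -
 consider "0 \<le> b" "b \<le> a" | "0 \<le> a" "a \<le> b" | "a \<le> 0" "0 \<le> b" | "a \<le> b" "b \<le> 0" | "b \<le> a" "a \<le> 0" | "b \<le> 0" "0 \<le> a" by linarith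
 then show ?thesis
 proof cases
  case 1 show ?thesis by (rule that[of 0 "a - b" b]) (use 1 assms in auto)
 next
  case 2 show ?thesis by (rule that[of 1 a "b - a"]) (use 2 assms in auto)
 next
  case 3 show ?thesis by (rule that[of 2 b "- a"]) (use 3 assms in auto)
 next
  case 4 show ?thesis by (rule that[of 3 "b - a" "- b"]) (use 4 assms in auto)
 next
  case 5 show ?thesis by (rule that[of 4 "- a" "a - b"]) (use 5 assms in auto)
 next
  case 6 show ?thesis by (rule that[of 5 "- b" a]) (use 6 assms in auto)
 qed
qed

lemma mpt_scale: "m > 0 \<Longrightarrow> mpt (m * a) (m * b) t = mpt a b t"
proof -
 assume m: "m > 0"
 have "sqrt ((m * a)^2 + (m * b)^2) = m * sqrt (a^2 + b^2)"
 proof -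
  have "(m * a)^2 + (m * b)^2 = m^2 * (a^2 + b^2)" by (simp add: power_mult_distrib distrib_left)
  then show ?thesis using m by (simp add: real_sqrt_mult)
 qed
 then show ?thesis using m by (simp add: mpt_def Let_def)
qed

lemma mob_point:
 assumes i: "i < 6" and pq: "0 \<le> p" "0 \<le> q" "p + q = 1" and t: "0 \<le> t" "t \<le> 1"
 obtains x where "x \<in> realization mobK" "in_sector i x" "pc i x = p" "pc (Suc i) x = q" "tc i x = t"
proof -
 note mf = mod_facts[of i] mod_facts(6,7)[of "Suc i"] mod_facts(1,2,3)[of "Suc i"]
 define y where "y j = (if j = cv i then p - max 0 (t - q) else if j = cv (Suc i) then q - min t q else if j = ov i then max 0 (t - q) else if j = ov (Suc i) then min t q else 0)" for j
 have ys: "y (cv i) = p - max 0 (t - q)" "y (cv (Suc i)) = q - min t q" "y (ov i) = max 0 (t - q)" "y (ov (Suc i)) = min t q"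
  using mf by (auto simp: y_def)
 have sup: "{j. y j \<noteq> 0} \<subseteq> {cv i, cv (Suc i), ov i, ov (Suc i)}" by (auto simp: y_def)
 have "t \<le> q \<Longrightarrow> y (ov i) = 0" "q \<le> t \<Longrightarrow> y (cv (Suc i)) = 0" using ys by auto
 then have sec: "{j. y j \<noteq> 0} \<subseteq> lowT i \<or> {j. y j \<noteq> 0} \<subseteq> uppT i"
  using sup by (cases "t \<le> q") (auto simp: lowT_def uppT_def subset_iff)
 have nn: "0 \<le> y j" for j using pq t by (auto simp: y_def)
 have E: "y \<in> eucl 9" using sup mf by force
 have "(\<Sum>j<9. y j) = (\<Sum>j\<in>{cv i, cv (Suc i), ov i, ov (Suc i)}. y j)"
  by (rule sum.mono_neutral_right) (use sup mf in auto)
 also have "\<dots> = y (cv i) + y (cv (Suc i)) + y (ov i) + y (ov (Suc i))"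
  using mf by (simp add: add.assoc)
 also have "\<dots> = 1" unfolding ys using pq by simp
 finally have S: "(\<Sum>j<9. y j) = 1" .
 have "{j. y j \<noteq> 0} \<noteq> {}" using S by (metis (mono_tags, lifting) empty_Collect_eq sum.neutral zero_neq_one)
 then have "{j. y j \<noteq> 0} \<in> mobK" using sec i unfolding mobK_def by blast
 then have "y \<in> realization mobK" by (rule realizationI[OF nn E S])
 moreover have "in_sector i y" using i sec by (simp add: in_sector_def)
 moreover have "pc i y = p" "pc (Suc i) y = q" "tc i y = t" unfolding pc_def tc_def ys by (auto simp: max_def min_def)
 ultimately show ?thesis by (rule that)
qed

lemma mob_image: "mob_map ` realization mobK = band (cap (-1) (1/5))"
proof (intro equalityI subsetI)
 fix P assume "P \<in> mob_map ` realization mobK"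
 then obtain x where x: "x \<in> realization mobK" "P = mob_map x" by blast
 obtain i where i: "in_sector i x" using mob_real(4)[OF x(1)] by blast
 note c = sector_coords[OF x(1) i]
 have P: "P = mpt (vx i x) (vy i x) (tc i x)" using x mob_map_eq[OF x(1) i] by simp
 have pos: "(vx i x)^2 + (vy i x)^2 > 0" by (rule hexn_pos[OF bary_sector(2)[OF x(1) i]])
 have "(tc i x)^2 \<le> 1" using c by (simp add: power_le_one)
 then have "(tc i x)^2 / (4 + (tc i x)^2) \<le> 1 / 5" by (simp add: field_simps add_pos_nonneg)
 then show "P \<in> band (cap (-1) (1/5))" unfolding P band_def cap_mob using mpt_data(3,7)[OF pos] by simp
next
 fix P assume "P \<in> band (cap (-1) (1/5))"
 then have P: "P \<in> RP2" "P 2 \<le> 1/5" by (auto simp: band_def cap_mob)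
 have P0: "P 2 \<ge> 0" using RP2_bounds[OF P(1)] by simp
 define t where "t = sqrt (4 * P 2 / (1 - P 2))"
 have h: "0 \<le> 4 * P 2 / (1 - P 2)" "4 * P 2 / (1 - P 2) \<le> 1" using P0 P(2) by (simp_all add: field_simps)
 then have t: "0 \<le> t" "t \<le> 1" "t^2 = 4 * P 2 / (1 - P 2)" by (simp_all add: t_def)
 obtain \<theta> where th: "P = polar (P 2) \<theta>" using polar_surj[OF P(1)] by metis
 have "cos \<theta> \<noteq> 0 \<or> sin \<theta> \<noteq> 0" using sin_zero_abs_cos_one[of \<theta>] by auto
 then obtain i p q where s: "i < 6" "0 \<le> p" "0 \<le> q" "p + q > 0"
  "cos \<theta> = p * hx i + q * hx (Suc i)" "sin \<theta> = p * hy i + q * hy (Suc i)" by (rule sector_exists)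
 define m where "m = 1 / (p + q)"
 have m: "m > 0" "0 \<le> m * p" "0 \<le> m * q" "m * p + m * q = 1" using s by (simp_all add: m_def distrib_left[symmetric] add_divide_distrib[symmetric])
 obtain x where x: "x \<in> realization mobK" "in_sector i x" "pc i x = m * p" "pc (Suc i) x = m * q" "tc i x = t"
  by (rule mob_point[OF s(1) m(2-4) t(1,2)])
 have v: "vx i x = m * cos \<theta>" "vy i x = m * sin \<theta>" unfolding vx_def vy_def x s(5,6) by (simp_all add: distrib_left)
 have "mob_map x = mpt (cos \<theta>) (sin \<theta>) t" unfolding mob_map_eq[OF x(1,2)] v x(5) by (rule mpt_scale[OF m(1)])
 also have "\<dots> = P"
 proof -
  have d: "4 + t^2 = 4 / (1 - P 2)" using P(2) by (simp add: t(3) field_simps)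
  then have n: "sqrt (4 + t^2) = 2 / sqrt (1 - P 2)" by (simp add: real_sqrt_divide)
  have "t = 2 * sqrt (P 2) / sqrt (1 - P 2)" by (simp add: t_def real_sqrt_divide real_sqrt_mult)
  then have "t / (2 / sqrt (1 - P 2)) = sqrt (P 2)" using P(2) by simp
  then have "mpt (cos \<theta>) (sin \<theta>) t = polar (P 2) \<theta>"
   unfolding mpt_def Let_def n polar_def by (simp add: ac_simps)
  then show ?thesis using th by simp
 qed
 finally show "P \<in> mob_map ` realization mobK" using x(1) by blast
qed


lemma mpt_inverse:
 assumes ab: "a^2 + b^2 > 0" and one: "\<alpha> * a + \<beta> * b = 1" and t: "0 \<le> t"
 defines "P \<equiv> mpt a b t"
 defines "Q \<equiv> \<alpha>^2 * P 0 + 2 * \<alpha> * \<beta> * P 3 + \<beta>^2 * P 1"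
 shows "Q > 0" "P 0 + P 1 > 0" "\<gamma> * a + \<delta> * b = (\<gamma> * \<alpha> * P 0 + (\<gamma> * \<beta> + \<delta> * \<alpha>) * P 3 + \<delta> * \<beta> * P 1) / Q"
  "t = 2 * (\<alpha> * P 4 + \<beta> * P 5) / sqrt (Q * (P 0 + P 1))"
proof -
 define l where "l = a^2 + b^2"
 define n where "n = 4 + t^2"
 have ln: "l > 0" "n > 0" using ab by (simp_all add: l_def n_def add_pos_nonneg)
 note D = mpt_data[OF ab, of t, folded l_def n_def P_def]
 define c where "c = 4 / (l * n)"
 have c: "c > 0" using ln by (simp add: c_def)
 have D': "P 0 = c * a^2" "P 1 = c * b^2" "P 3 = c * (a * b)" using D by (simp_all add: c_def)
 have "Q = c * (\<alpha> * a + \<beta> * b)^2" unfolding Q_def D' by (simp add: power2_eq_square algebra_simps)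
 then have Q: "Q = c" using one by simp
 then show "Q > 0" using c by simp
 have S: "P 0 + P 1 = c * l" unfolding D' l_def by (simp add: distrib_left)
 then show "P 0 + P 1 > 0" using c ln by simp
 have "\<gamma> * \<alpha> * P 0 + (\<gamma> * \<beta> + \<delta> * \<alpha>) * P 3 + \<delta> * \<beta> * P 1 = c * ((\<gamma> * a + \<delta> * b) * (\<alpha> * a + \<beta> * b))"
  unfolding D' by (simp add: power2_eq_square algebra_simps)
 then show "\<gamma> * a + \<delta> * b = (\<gamma> * \<alpha> * P 0 + (\<gamma> * \<beta> + \<delta> * \<alpha>) * P 3 + \<delta> * \<beta> * P 1) / Q" using Q c one by simp
 have "\<alpha> * P 4 + \<beta> * P 5 = 2 * t / (sqrt l * n) * (\<alpha> * a + \<beta> * b)"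
  unfolding D by (simp add: algebra_simps add_divide_distrib)
 then have e: "\<alpha> * P 4 + \<beta> * P 5 = 2 * t / (sqrt l * n)" using one by simp
 have "Q * (P 0 + P 1) = (4 / (sqrt l * n))^2"
  unfolding Q S c_def using ln by (simp add: power2_eq_square)
 then have "sqrt (Q * (P 0 + P 1)) = 4 / (sqrt l * n)" using ln by simp
 then show "t = 2 * (\<alpha> * P 4 + \<beta> * P 5) / sqrt (Q * (P 0 + P 1))" unfolding e using ln by simp
qed

lemma sm_If: "(c \<Longrightarrow> sm S f) \<Longrightarrow> (\<not> c \<Longrightarrow> sm S g) \<Longrightarrow> sm S (\<lambda>x. if c then f x else g x)"
 by (cases c) simp_all

lemma hex_det: "i < 6 \<Longrightarrow> hx i * hy (Suc i) - hy i * hx (Suc i) = 1"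
 unfolding less6 by auto

lemma sector_forms:
 assumes "i < 6"
 shows "hy (Suc i) * vx i x + (- hx (Suc i)) * vy i x = pc i x" "(- hy i) * vx i x + hx i * vy i x = pc (Suc i) x"
proof -
 have "hy (Suc i) * vx i x + (- hx (Suc i)) * vy i x = (hx i * hy (Suc i) - hy i * hx (Suc i)) * pc i x"
  by (simp add: vx_def vy_def algebra_simps)
 then show "hy (Suc i) * vx i x + (- hx (Suc i)) * vy i x = pc i x" unfolding hex_det[OF assms] by simp
 have "(- hy i) * vx i x + hx i * vy i x = (hx i * hy (Suc i) - hy i * hx (Suc i)) * pc (Suc i) x"
  by (simp add: vx_def vy_def algebra_simps)
 then show "(- hy i) * vx i x + hx i * vy i x = pc (Suc i) x" unfolding hex_det[OF assms] by simp
qed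

lemma mob_triangulation: "smooth_triangulation (Em (-1) (1/5)) 9 mobK mob_map"
proof (rule smooth_triangulationI[OF mobK_complex emb_E _ mob_image mob_inj])
 fix s assume s: "s \<in> mobK"
 then obtain i where i: "i < 6" "s \<subseteq> lowT i \<or> s \<subseteq> uppT i" unfolding mobK_def mem_Collect_eq by (elim conjE exE)
 let ?R = "realization (Pow s)"
 have R: "x \<in> realization mobK" "in_sector i x" "{j. x j \<noteq> 0} \<subseteq> s" if "x \<in> ?R" for x
 proof -
  show "x \<in> realization mobK" using realization_Pow[OF mobK_complex s] that by (rule subsetD)
  show "{j. x j \<noteq> 0} \<subseteq> s" using that by (simp add: realization_def)
  then show "in_sector i x" using i unfolding in_sector_def by (meson subset_trans)
 qed
 define G where "G x = mpt (vx i x) (vy i x) (tc i x)" for x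
 have G: "mob_map x = G x" if "x \<in> ?R" for x unfolding G_def by (rule mob_map_eq[OF R(1,2)[OF that]])
 have pos: "(vx i x)^2 + (vy i x)^2 > 0" if "x \<in> ?R" for x
  by (rule hexn_pos[OF bary_sector(2)[OF R(1,2)[OF that]]])
 have smv: "sm ?R (vx i)" "sm ?R (vy i)" "sm ?R (tc i)"
  unfolding vx_def[abs_def] vy_def[abs_def] tc_def[abs_def] pc_def by (intro sm_intros)+
 have smG: "sm ?R (\<lambda>x. G x j)" for j
 proof -
  have p4: "4 + (tc i x)^2 > 0" for x by (simp add: add_pos_nonneg)
  have "sqrt ((vx i x)^2 + (vy i x)^2) * sqrt (4 + (tc i x)^2) \<noteq> 0" "sqrt (4 + (tc i x)^2) \<noteq> 0" if "x \<in> ?R" for x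
  proof -
   have "0 < sqrt ((vx i x)^2 + (vy i x)^2)" "0 < sqrt (4 + (tc i x)^2)"
    by (rule real_sqrt_gt_zero[OF pos[OF that]], rule real_sqrt_gt_zero[OF p4])
   then show "sqrt ((vx i x)^2 + (vy i x)^2) * sqrt (4 + (tc i x)^2) \<noteq> 0" "sqrt (4 + (tc i x)^2) \<noteq> 0"
    by (metis less_irrefl mult_pos_pos)+
  qed
  note nz = this
  show ?thesis unfolding G_def mpt_def Let_def
   by (intro sm_ver sm_intros smv) (erule pos, rule p4, erule nz(1), erule pos, rule p4, erule nz(1), rule p4, erule nz(2))
 qed
 define \<alpha> where "\<alpha> = hy (Suc i) - hy i"
 define \<beta> where "\<beta> = hx i - hx (Suc i)"
 define Q where "Q P = \<alpha>^2 * P 0 + 2 * \<alpha> * \<beta> * P 3 + \<beta>^2 * P 1" for P :: "nat \<Rightarrow> real"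
 define L where "L \<gamma> \<delta> P = (\<gamma> * \<alpha> * P 0 + (\<gamma> * \<beta> + \<delta> * \<alpha>) * P 3 + \<delta> * \<beta> * P 1) / Q P" for \<gamma> \<delta> and P :: "nat \<Rightarrow> real"
 define p where "p = L (hy (Suc i)) (- hx (Suc i))"
 define q where "q = L (- hy i) (hx i)"
 define t where "t P = 2 * (\<alpha> * P 4 + \<beta> * P 5) / sqrt (Q P * (P 0 + P 1))" for P :: "nat \<Rightarrow> real"
 have inv: "Q (G x) > 0" "G x 0 + G x 1 > 0" "p (G x) = pc i x" "q (G x) = pc (Suc i) x" "t (G x) = tc i x" if "x \<in> ?R" for x
 proof -
  note c = sector_coords[OF R(1,2)[OF that]]
  note f = sector_forms[OF i(1), of x]
  have one: "\<alpha> * vx i x + \<beta> * vy i x = 1"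
   using f c(4) unfolding \<alpha>_def \<beta>_def by (simp add: algebra_simps)
  note I = mpt_inverse[OF pos[OF that] one c(5), folded G_def, folded Q_def]
  show "Q (G x) > 0" "G x 0 + G x 1 > 0" by (rule I)+
  show "p (G x) = pc i x" unfolding p_def L_def I(3)[symmetric] by (rule f)
  show "q (G x) = pc (Suc i) x" unfolding q_def L_def I(3)[symmetric] by (rule f)
  show "t (G x) = tc i x" unfolding t_def by (rule I(4)[symmetric])
 qed
 define H where "H P j = (if j = cv i then (if s \<subseteq> lowT i then p P else p P - t P + q P)
   else if j = cv (Suc i) then (if s \<subseteq> lowT i then q P - t P else 0)
   else if j = ov i then (if s \<subseteq> lowT i then 0 else t P - q P)
   else if j = ov (Suc i) then (if s \<subseteq> lowT i then t P else q P) else 0)" for P j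
 have H: "H (G x) = x" if x: "x \<in> ?R" for x
 proof
  fix j
  note mf = mod_facts[of i] mod_facts(6,7)[of "Suc i"]
  have D: "x j = 0" if "j \<notin> {cv i, cv (Suc i), ov i, ov (Suc i)}"
   using R(3)[OF x] i(2) that by (auto simp: lowT_def uppT_def)
  have low: "x (ov i) = 0" if "s \<subseteq> lowT i"
  proof -
   have "ov i \<notin> lowT i" using mf by (auto simp: lowT_def)
   then show ?thesis using that R(3)[OF x] by auto
  qed
  have upp: "x (cv (Suc i)) = 0" if "\<not> s \<subseteq> lowT i"
  proof -
   have "cv (Suc i) \<notin> uppT i" using mf by (auto simp: uppT_def)
   then show ?thesis using that i(2) R(3)[OF x] by auto
  qed
  show "H (G x) j = x j"
   unfolding H_def inv(3,4,5)[OF x] using low upp D mf by (simp add: pc_def tc_def)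
 qed
 have smH: "sm (mob_map ` ?R) (\<lambda>P. H P j)" for j
 proof -
  have pQ: "Q P > 0" "P 0 + P 1 > 0" if "P \<in> mob_map ` ?R" for P using that inv(1,2) G by auto
  then have nz: "Q P \<noteq> 0" "Q P * (P 0 + P 1) > 0" "sqrt (Q P * (P 0 + P 1)) \<noteq> 0" if "P \<in> mob_map ` ?R" for P using that by (force+)
  have Qs: "sm (mob_map ` ?R) Q" unfolding Q_def[abs_def] by (intro sm_intros)
  have Ls: "sm (mob_map ` ?R) (L \<gamma> \<delta>)" for \<gamma> \<delta>
   unfolding L_def[abs_def] by (intro sm_intros Qs) (erule nz(1))
  have ts: "sm (mob_map ` ?R) t"
   unfolding t_def[abs_def] by (intro sm_intros Qs) (erule nz(2), erule nz(3))
  show ?thesis unfolding H_def p_def q_def by (intro sm_If sm_intros Ls ts)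
 qed
 show "\<exists>G H. (\<forall>x\<in>?R. mob_map x = G x \<and> H (mob_map x) = x) \<and>
    (\<forall>i. sm ?R (\<lambda>x. G x i)) \<and> (\<forall>i. sm (mob_map ` ?R) (\<lambda>x. H x i))"
  using G H smG smH by (intro exI[of _ G] exI[of _ H]) simp
qed (auto simp: Em_def)

text \<open>The critical set in the Moebius band is the core circle, which is the subcomplex of the first
  three vertices. It has dimension 1, the largest dimension that the definition of
  special-generic-like maps permits here.\<close>

lemma mob_subpolyhedron: "subpolyhedron (Em (-1) (1/5)) 1 (band {0})"
proof -
 define L where "L = {s \<in> mobK. s \<subseteq> {0,1,2}}"
 have LK: "L \<subseteq> mobK" by (auto simp: L_def)
 have ovn: "ov i \<notin> {0,1,2}" for i using mod_facts(2)[of i] by auto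
 have L: "finite_complex 9 L"
  unfolding finite_complex_def
 proof (intro conjI ballI allI impI)
  note m = mobK_complex[unfolded finite_complex_def]
  fix s assume "s \<in> L"
  then have s: "s \<in> mobK" "s \<subseteq> {0,1,2}" by (simp_all add: L_def)
  note c = m[THEN conjunct1, rule_format, OF s(1)]
  show "s \<subseteq> {..<9}" "s \<noteq> {}" by (rule conjunct1[OF c], rule conjunct2[OF c])
  fix t assume t: "t \<subseteq> s \<and> t \<noteq> {}"
  have "t \<subseteq> {0,1,2}" using t s(2) by (elim conjE) (rule subset_trans)
  then show "t \<in> L" using m[THEN conjunct2, rule_format, OF s(1) t] by (simp add: L_def)
 qed
 have sub: "s \<subseteq> {cv i, cv (Suc i)}" if "s \<subseteq> {0,1,2}" "s \<subseteq> lowT i \<or> s \<subseteq> uppT i" for s i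
  using that ovn[of i] ovn[of "Suc i"] unfolding lowT_def uppT_def by blast
 have card: "card s \<le> 1 + 1" if "s \<in> L" for s
 proof -
  have s: "s \<in> mobK" "s \<subseteq> {0,1,2}" using that by (simp_all add: L_def)
  from s(1) obtain i where "s \<subseteq> lowT i \<or> s \<subseteq> uppT i" unfolding mobK_def mem_Collect_eq by (elim conjE exE)
  then have "s \<subseteq> {cv i, cv (Suc i)}" by (rule sub[OF s(2)])
  then have "card s \<le> card {cv i, cv (Suc i)}" by (intro card_mono) auto
  also have "\<dots> \<le> 2" by (simp add: mod_facts)
  finally show ?thesis by simp
 qed
 have zero: "mob_map x 2 = 0 \<longleftrightarrow> tc i x = 0" if "x \<in> realization mobK" "in_sector i x" for x i
 proof -
  have "4 + (tc i x)^2 > 0" by (simp add: add_pos_nonneg)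
  then show ?thesis unfolding mob_map_eq[OF that] mpt_data(3)[OF hexn_pos[OF bary_sector(2)[OF that]]] by simp
 qed
 have "band {0} = mob_map ` realization L"
 proof (intro equalityI subsetI)
  fix P assume P: "P \<in> band {0}"
  then have "P \<in> band (cap (-1) (1/5))" by (auto simp: band_def cap_mob)
  then obtain x where x: "x \<in> realization mobK" "P = mob_map x" unfolding mob_image[symmetric] by (rule imageE)
  obtain i where i: "in_sector i x" using mob_real(4)[OF x(1)] by (rule exE)
  have "tc i x = 0" using zero[OF x(1) i] P x(2) by (simp add: band_def)
  then have o: "x (ov i) = 0" "x (ov (Suc i)) = 0"
   using mob_real(1)[OF x(1), of "ov i"] mob_real(1)[OF x(1), of "ov (Suc i)"] by (simp_all add: tc_def)
  have "{j. x j \<noteq> 0} \<subseteq> {cv i, cv (Suc i)}" using i o unfolding in_sector_def lowT_def uppT_def by auto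
  moreover have "{cv i, cv (Suc i)} \<subseteq> {0,1,2}" using mod_facts(1)[of i] mod_facts(1)[of "Suc i"] by auto
  ultimately have "{j. x j \<noteq> 0} \<in> L" using realization_memE(1)[OF x(1)] unfolding L_def by (simp add: subset_trans)
  then have "x \<in> realization L" using x(1) by (simp add: realization_def)
  then show "P \<in> mob_map ` realization L" unfolding x(2) by (rule imageI)
 next
  fix P assume "P \<in> mob_map ` realization L"
  then obtain x where x: "x \<in> realization L" "P = mob_map x" by (rule imageE)
  have xm: "x \<in> realization mobK" using x(1) LK by (auto simp: realization_def)
  have xs: "{j. x j \<noteq> 0} \<subseteq> {0,1,2}" using realization_memE(1)[OF x(1)] by (simp add: L_def)
  obtain i where i: "in_sector i x" using mob_real(4)[OF xm] by (rule exE)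
  have "x (ov j) = 0" for j using xs ovn[of j] by auto
  then have "tc i x = 0" by (simp add: tc_def)
  then have "mob_map x 2 = 0" using zero[OF xm i] by simp
  moreover have "mob_map x \<in> band (cap (-1) (1/5))" unfolding mob_image[symmetric] by (rule imageI[OF xm])
  ultimately show "P \<in> band {0}" using x(2) by (simp add: band_def)
 qed
 then show ?thesis unfolding subpolyhedron_def using mob_triangulation L LK card
  by (intro exI[of _ 9] exI[of _ mobK] exI[of _ mob_map] exI[of _ L]) auto
qed

section \<open>Critical points of the height\<close>

text \<open>A nonzero entry is an invertible minor of size 1, so its column is linearly independent.\<close>

lemma rank_row_pos:
 fixes f :: "nat \<times> nat \<Rightarrow> real"
 assumes "j < m" "f (0, j) \<noteq> 0" shows "0 < vec_space.rank 1 (Matrix.mat 1 m f)"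
proof -
 interpret V: vec_space "TYPE(real)" 1 .
 define B where "B = Matrix.mat 1 1 (\<lambda>_. f (0, j))"
 have B: "B \<in> carrier_mat 1 1" by (simp add: B_def)
 have "Determinant.det B = f (0, j)" unfolding Determinant.det_single[OF B] by (simp add: B_def)
 then have rB: "V.rank B = 1" using V.det_rank_iff[OF B] assms(2) by simp
 have cB: "cols B = [col B 0]" by (simp add: cols_def B_def)
 then have "V.lin_indpt {col B 0}" using V.full_rank_lin_indpt[OF B rB] by simp
 moreover have "col B 0 = col (Matrix.mat 1 m f) j" using assms(1) by (auto simp: B_def intro!: eq_vecI)
 moreover have "col (Matrix.mat 1 m f) j \<in> set (cols (Matrix.mat 1 m f))"
  using assms(1) by (auto simp: cols_def)
 ultimately have "card {col B 0} \<le> V.rank (Matrix.mat 1 m f)"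
  by (intro V.rank_ge_card_indpt[of _ m]) auto
 then show ?thesis by simp
qed

lemma rank_row_zero:
 fixes f :: "nat \<times> nat \<Rightarrow> real"
 assumes "\<And>j. j < m \<Longrightarrow> f (0, j) = 0" shows "vec_space.rank 1 (Matrix.mat 1 m f) = 0"
proof -
 interpret V: vec_space "TYPE(real)" 1 .
 have "Matrix.mat 1 m f = 0\<^sub>m 1 m" using assms by (intro eq_matI) auto
 then show ?thesis using V.rank_0I by simp
qed

lemma at_within_nontrivial:
 fixes a b :: real
 assumes "a < b" "{a..<b} \<subseteq> S" shows "at a within S \<noteq> bot"
proof -
 have "{a..(a + b) / 2} \<subseteq> S" using assms by (intro subset_trans[OF _ assms(2)]) auto
 then have "at a within {a..(a + b) / 2} \<le> at a within S" by (rule at_le)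
 moreover have "at a within {a..(a + b) / 2} \<noteq> bot" using assms(1) by (simp add: at_within_Icc_at_right)
 ultimately show ?thesis by (auto simp: le_bot)
qed

text \<open>At a boundary point the partial derivative is one-sided, so the set of admissible values of
  the coordinate must accumulate at the given one.\<close>

lemma partial_within_eq:
 assumes a: "a \<in> S" and nt: "at (a j) within {t. a(j := t) \<in> S} \<noteq> bot" and g: "\<And>y. y \<in> S \<Longrightarrow> g y = h y"
  and d: "((\<lambda>t. h (a(j := t))) has_real_derivative D) (at (a j))"
 shows "partial_within S j g a = D"
 unfolding partial_within_def
proof (rule vector_derivative_within[OF nt])
 have "((\<lambda>t. h (a(j := t))) has_vector_derivative D) (at (a j) within {t. a(j := t) \<in> S})"
  using d has_real_derivative_iff_has_vector_derivative has_vector_derivative_at_within by blast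
 then show "((\<lambda>t. g (a(j := t))) has_vector_derivative D) (at (a j) within {t. a(j := t) \<in> S})"
  by (rule has_vector_derivative_transform[rotated 2]) (use a g in simp_all)
qed

definition aff_diff :: "nat \<Rightarrow> nat \<Rightarrow> (nat \<Rightarrow> real) \<Rightarrow> real" where
 "aff_diff k j a = (let D = 1 + (a 0)^2 + (a 1)^2 in
  if k = 2 then - 2 * a j / D^2 else if j = 0 then - 2 * a 0 * (a 1)^2 / D^2 else 2 * a 1 * (1 + (a 0)^2) / D^2)"

lemma aff_diff_deriv:
 assumes "j < 2" shows "((\<lambda>t. aff_height k (a(j := t))) has_real_derivative aff_diff k j a) (at (a j))"
proof -
 have D: "1 + (a 0)^2 + (a 1)^2 \<noteq> 0" using one_plus_pos[of "a 0" "a 1"] by simp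
 consider "k = 2" "j = 0" | "k = 2" "j = 1" | "k \<noteq> 2" "j = 0" | "k \<noteq> 2" "j = 1" using assms by linarith
 then show ?thesis
 proof cases
  case 1
  have "((\<lambda>t. 1 / (1 + t^2 + (a 1)^2)) has_real_derivative - 2 * a 0 / (1 + (a 0)^2 + (a 1)^2)^2) (at (a 0))"
   using D by (auto intro!: derivative_eq_intros simp: power2_eq_square)
  then show ?thesis using 1 by (simp add: aff_height_def aff_diff_def Let_def)
 next
  case 2
  have "((\<lambda>t. 1 / (1 + (a 0)^2 + t^2)) has_real_derivative - 2 * a 1 / (1 + (a 0)^2 + (a 1)^2)^2) (at (a 1))"
   using D by (auto intro!: derivative_eq_intros simp: power2_eq_square)
  then show ?thesis using 2 by (simp add: aff_height_def aff_diff_def Let_def)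
 next
  case 3
  have "((\<lambda>t. (a 1)^2 / (1 + t^2 + (a 1)^2)) has_real_derivative - 2 * a 0 * (a 1)^2 / (1 + (a 0)^2 + (a 1)^2)^2) (at (a 0))"
   using D by (auto intro!: derivative_eq_intros simp: power2_eq_square)
  then show ?thesis using 3 by (simp add: aff_height_def aff_diff_def Let_def)
 next
  case 4
  have "2 * a 1 * (1 + (a 0)^2) / (1 + (a 0)^2 + (a 1)^2)^2 = (2 * a 1 * (1 + (a 0)^2 + (a 1)^2) - (a 1)^2 * (2 * a 1)) / ((1 + (a 0)^2 + (a 1)^2) * (1 + (a 0)^2 + (a 1)^2))"
   by (simp add: power2_eq_square algebra_simps)
  then have "((\<lambda>t. t^2 / (1 + (a 0)^2 + t^2)) has_real_derivative 2 * a 1 * (1 + (a 0)^2) / (1 + (a 0)^2 + (a 1)^2)^2) (at (a 1))"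
   using D by (auto intro!: derivative_eq_intros)
  then show ?thesis using 4 by (simp add: aff_height_def aff_diff_def Let_def)
 qed
qed

text \<open>In the chart around the centre of the disk the height is \<open>1 / (1 + x^2 + y^2)\<close>, critical only
  at the origin; in the other charts it is \<open>y^2 / (1 + x^2 + y^2)\<close>, critical exactly along \<open>y =
  0\<close>, which is the zero level.\<close>

lemma aff_diff_zero:
 "(\<forall>j<2. aff_diff k j a = 0) \<longleftrightarrow> aff_height k a = 0 \<or> aff_height k a = 1"
proof -
 have D: "1 + (a 0)^2 + (a 1)^2 > 0" by (rule one_plus_pos)
 have s: "(a 0)^2 + (a 1)^2 = 0 \<longleftrightarrow> a 0 = 0 \<and> a 1 = 0" by (rule sum_power2_eq_zero_iff)
 have "1 + (a 0)^2 > 0" by (simp add: add_pos_nonneg)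
 moreover have "(\<forall>j<2. aff_diff k j a = 0) \<longleftrightarrow> aff_diff k 0 a = 0 \<and> aff_diff k 1 a = 0"
  by (auto simp: less_2_cases_iff)
 moreover have "(a 1)^2 / (1 + (a 0)^2 + (a 1)^2) \<noteq> 1" using D calculation(1) by (simp add: divide_eq_eq)
 moreover have "1 / (1 + (a 0)^2 + (a 1)^2) = 1 \<longleftrightarrow> a 0 = 0 \<and> a 1 = 0"
  using D s by (simp add: divide_eq_eq add.assoc)
 ultimately show ?thesis using D by (auto simp: aff_diff_def aff_height_def Let_def)
qed

lemma aff_inv_into:
 assumes U: "U \<subseteq> {P \<in> RP2. P k > 0}" and k: "k \<in> {0,1,2}" and y: "y \<in> aff k ` U"
 shows "inv_into U (aff k) y = aff_inv k y"
proof -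
 have "inv_into U (aff k) y \<in> U" "aff k (inv_into U (aff k) y) = y" by (rule inv_into_into[OF y], rule f_inv_into_f[OF y])
 then show ?thesis using aff_inv_aff[OF _ k, of "inv_into U (aff k) y"] U by auto
qed

lemma aff_partial:
 assumes T: "open T" and k: "k \<in> {0,1,2}" and P: "P \<in> band T" "P k > 0" and j: "j < 2"
  and g: "\<And>y. y \<in> aff k ` {P \<in> band T. P k > 0} \<Longrightarrow> g y = aff_inv k y 2"
 shows "partial_within (aff k ` {P \<in> band T. P k > 0}) j g (aff k P) = aff_diff k j (aff k P)"
proof (rule partial_within_eq[OF _ _ _ aff_diff_deriv[OF j]])
 let ?a = "aff k P" and ?S = "aff k ` {P \<in> band T. P k > 0}"
 show a: "?a \<in> ?S" using P by blast
 have S: "?S = {y \<in> eucl 2. aff_height k y \<in> T}" by (rule aff_chart(2)[OF T band_sub subset_refl k])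
 have "{t. ?a(j := t) \<in> ?S} = (\<lambda>t. aff_height k (?a(j := t))) -` T"
  using a j unfolding S by auto
 moreover have "continuous_on UNIV (\<lambda>t. aff_height k (?a(j := t)))"
 proof (rule continuous_on_compose2[OF continuous_aff_height])
  show "continuous_on UNIV (\<lambda>t. ?a(j := t))"
  proof (rule continuous_on_coordinatewise_then_product)
   fix i show "continuous_on UNIV (\<lambda>t. (?a(j := t)) i)" by (cases "i = j") simp_all
  qed
 qed simp
 ultimately have op: "open {t. ?a(j := t) \<in> ?S}" using T by (simp add: open_vimage)
 have "?a j \<in> {t. ?a(j := t) \<in> ?S}" using a by simp
 then show "at (?a j) within {t. ?a(j := t) \<in> ?S} \<noteq> bot" using op by (simp add: at_within_open[of _ "{t. ?a(j := t) \<in> ?S}"])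
 show "g y = aff_height k y" if "y \<in> ?S" for y using g[OF that] aff_inv_height[OF k, of y] by simp
qed

definition ht :: "(nat \<Rightarrow> real) \<Rightarrow> nat \<Rightarrow> real" where "ht P = coord (P 2)"

lemma M_atlas: "(U, \<phi>) \<in> matlas Mm \<longleftrightarrow> (\<exists>k\<in>{0,1,2}. U = {P \<in> band UNIV. P k > 0} \<and> \<phi> = aff k)"
 by (auto simp: Mm_def)

lemma ht_matrix:
 assumes k: "k \<in> {0,1,2}" and P: "P \<in> RP2" "P k > 0"
 defines "U \<equiv> {P \<in> band UNIV. P k > 0}"
 shows "vec_space.rank 1 (Matrix.mat 1 2 (\<lambda>(i, j). partial_within (aff k ` (U \<inter> ht -` eucl 1)) j
   (\<lambda>y. (id \<circ> ht \<circ> inv_into U (aff k)) y i) (aff k P))) = 0 \<longleftrightarrow> P 2 = 0 \<or> P 2 = 1"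
proof -
 have U: "U \<inter> ht -` eucl 1 = U" using coord_eucl by (auto simp: ht_def)
 have e: "partial_within (aff k ` U) j (\<lambda>y. (id \<circ> ht \<circ> inv_into U (aff k)) y 0) (aff k P) = aff_diff k j (aff k P)" if "j < 2" for j
  unfolding U_def
 proof (rule aff_partial[where T = UNIV and k = k and P = P and j = j, OF open_UNIV k _ P(2) that])
  show "P \<in> band UNIV" using P by (simp add: band_UNIV)
  fix y assume y: "y \<in> aff k ` {P \<in> band UNIV. P k > 0}"
  have "inv_into {P \<in> band UNIV. P k > 0} (aff k) y = aff_inv k y" by (rule aff_inv_into[OF _ k y]) (auto simp: band_UNIV)
  then show "(id \<circ> ht \<circ> inv_into {P \<in> band UNIV. P k > 0} (aff k)) y 0 = aff_inv k y 2" by (simp add: ht_def)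
 qed
 have h: "aff_height k (aff k P) = P 2" using aff_inv_height[OF k, of "aff k P"] aff_inv_aff[OF P(1) k P(2)] by simp
 let ?f = "\<lambda>(i, j). partial_within (aff k ` U) j (\<lambda>y. (id \<circ> ht \<circ> inv_into U (aff k)) y i) (aff k P)"
 have f: "?f (0, j) = aff_diff k j (aff k P)" if "j < 2" for j using e[OF that] by simp
 have "vec_space.rank 1 (Matrix.mat 1 2 ?f) = 0 \<longleftrightarrow> (\<forall>j<2. aff_diff k j (aff k P) = 0)"
 proof
  assume r: "vec_space.rank 1 (Matrix.mat 1 2 ?f) = 0"
  show "\<forall>j<2. aff_diff k j (aff k P) = 0"
  proof (intro allI impI)
   fix j :: nat assume j: "j < 2"
   show "aff_diff k j (aff k P) = 0" using rank_row_pos[of j 2 ?f] r f[OF j] j by auto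
  qed
 next
  assume "\<forall>j<2. aff_diff k j (aff k P) = 0"
  then show "vec_space.rank 1 (Matrix.mat 1 2 ?f) = 0" by (intro rank_row_zero) (use f in auto)
 qed
 also have "\<dots> \<longleftrightarrow> P 2 = 0 \<or> P 2 = 1" unfolding aff_diff_zero h ..
 finally show ?thesis unfolding U .
qed

lemma ht_singular: "singular_set Mm (euclid_mfd 1) ht = band {0, 1}"
proof (intro equalityI subsetI)
 fix P assume "P \<in> singular_set Mm (euclid_mfd 1) ht"
 then have P: "P \<in> RP2" and "differential_rank Mm (euclid_mfd 1) ht P 0"
  by (auto simp: singular_set_def euclid_mfd_def)
 then obtain U \<phi> where U: "(U, \<phi>) \<in> matlas Mm" "P \<in> U" and r:
  "vec_space.rank 1 (Matrix.mat 1 2 (\<lambda>(i, j). partial_within (\<phi> ` (U \<inter> ht -` eucl 1)) j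
   (\<lambda>y. (id \<circ> ht \<circ> inv_into U \<phi>) y i) (\<phi> P))) = 0"
  unfolding differential_rank_def by (auto simp: euclid_mfd_def Euclidean_space_eq)
 obtain k where k: "k \<in> {0,1,2}" "U = {P \<in> band UNIV. P k > 0}" "\<phi> = aff k" using U(1) unfolding M_atlas by blast
 have "P k > 0" using U(2) unfolding k(2) by simp
 then show "P \<in> band {0, 1}" using ht_matrix[OF k(1) P, THEN iffD1] r[unfolded k(2,3)] P unfolding band_def by blast
next
 fix P assume "P \<in> band {0, 1}"
 then have P: "P \<in> RP2" "P 2 = 0 \<or> P 2 = 1" by (auto simp: band_def)
 obtain k where k: "k \<in> {0,1,2}" "P k > 0" using RP2_chart_cover[OF P(1)] by blast
 have "differential_rank Mm (euclid_mfd 1) ht P 0"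
  unfolding differential_rank_def
 proof (rule bexI[of _ "({P \<in> band UNIV. P k > 0}, aff k)"], unfold prod.case, rule bexI[of _ "(topspace (Euclidean_space 1), id)"], unfold prod.case)
  show "({P \<in> band UNIV. P k > 0}, aff k) \<in> matlas Mm" unfolding M_atlas using k(1) by blast
  show "(topspace (Euclidean_space 1), id) \<in> matlas (euclid_mfd 1)" by (simp add: euclid_mfd_def)
  have "ht P \<in> eucl 1" using coord_eucl by (simp add: ht_def)
  then show "P \<in> {P \<in> band UNIV. 0 < P k} \<and> ht P \<in> topspace (Euclidean_space 1) \<and>
   vec_space.rank (mdim (euclid_mfd 1)) (Matrix.mat (mdim (euclid_mfd 1)) (mdim Mm) (\<lambda>(i, j). partial_within (aff k ` ({P \<in> band UNIV. 0 < P k} \<inter> ht -` topspace (Euclidean_space 1))) j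
    (\<lambda>y. (id \<circ> ht \<circ> inv_into {P \<in> band UNIV. 0 < P k} (aff k)) y i) (aff k P))) = 0"
   using ht_matrix[OF k(1) P(1) k(2)] P k by (simp add: euclid_mfd_def Euclidean_space_eq band_UNIV)
 qed
 then show "P \<in> singular_set Mm (euclid_mfd 1) ht" using P(1) by (simp add: singular_set_def euclid_mfd_def)
qed

definition rl_chart :: "real \<Rightarrow> nat \<Rightarrow> real" where "rl_chart = (\<lambda>t i. if i = 0 then t else 0)"

lemma real_line_simps: "mdim real_line = 1" "mtop real_line = euclideanreal" "matlas real_line = {(UNIV, rl_chart)}"
 by (simp_all add: real_line_def rl_chart_def)

lemma E_matrix:
 assumes T: "open T" and k: "k \<in> {0,1,2}" and P: "P \<in> band T" "P k > 0"
 defines "U \<equiv> {P \<in> band T. P k > 0}"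
 shows "vec_space.rank 1 (Matrix.mat 1 2 (\<lambda>(i, j). partial_within (aff k ` (U \<inter> (\<lambda>P. P 2) -` UNIV)) j
   (\<lambda>y. (rl_chart \<circ> (\<lambda>P. P 2) \<circ> inv_into U (aff k)) y i) (aff k P))) = 0 \<longleftrightarrow> P 2 = 0 \<or> P 2 = 1"
proof -
 have PR: "P \<in> RP2" using P(1) by (simp add: band_def)
 have U: "U \<inter> (\<lambda>P. P 2) -` UNIV = U" by simp
 have e: "partial_within (aff k ` U) j (\<lambda>y. (rl_chart \<circ> (\<lambda>P. P 2) \<circ> inv_into U (aff k)) y 0) (aff k P) = aff_diff k j (aff k P)" if "j < 2" for j
  unfolding U_def
 proof (rule aff_partial[where T = T and k = k and P = P and j = j, OF T k P that])
  fix y assume y: "y \<in> aff k ` {P \<in> band T. P k > 0}"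
  have "inv_into {P \<in> band T. P k > 0} (aff k) y = aff_inv k y" by (rule aff_inv_into[OF _ k y]) (auto simp: band_def)
  then show "(rl_chart \<circ> (\<lambda>P. P 2) \<circ> inv_into {P \<in> band T. P k > 0} (aff k)) y 0 = aff_inv k y 2" by (simp add: rl_chart_def)
 qed
 have h: "aff_height k (aff k P) = P 2" using aff_inv_height[OF k, of "aff k P"] aff_inv_aff[OF PR k P(2)] by simp
 let ?f = "\<lambda>(i, j). partial_within (aff k ` U) j (\<lambda>y. (rl_chart \<circ> (\<lambda>P. P 2) \<circ> inv_into U (aff k)) y i) (aff k P)"
 have f: "?f (0, j) = aff_diff k j (aff k P)" if "j < 2" for j using e[OF that] by simp
 have "vec_space.rank 1 (Matrix.mat 1 2 ?f) = 0 \<longleftrightarrow> (\<forall>j<2. aff_diff k j (aff k P) = 0)"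
 proof
  assume r: "vec_space.rank 1 (Matrix.mat 1 2 ?f) = 0"
  show "\<forall>j<2. aff_diff k j (aff k P) = 0"
  proof (intro allI impI)
   fix j :: nat assume j: "j < 2"
   show "aff_diff k j (aff k P) = 0" using rank_row_pos[of j 2 ?f] r f[OF j] j by auto
  qed
 next
  assume "\<forall>j<2. aff_diff k j (aff k P) = 0"
  then show "vec_space.rank 1 (Matrix.mat 1 2 ?f) = 0" by (intro rank_row_zero) (use f in auto)
 qed
 also have "\<dots> \<longleftrightarrow> P 2 = 0 \<or> P 2 = 1" unfolding aff_diff_zero h ..
 finally show ?thesis unfolding U .
qed

text \<open>In a chart at the boundary the height is an affine function of the last coordinate.\<close>

lemma E_boundary_matrix:
 assumes ec: "end_ok e c" and ks: "k \<in> {0,1}" "s \<in> {1,-1}" and P: "P \<in> band (cap e c) \<inter> sec k s"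
 defines "U \<equiv> band (cap e c) \<inter> sec k s"
 shows "0 < vec_space.rank 1 (Matrix.mat 1 2 (\<lambda>(i, j). partial_within (bchart k e c ` (U \<inter> (\<lambda>P. P 2) -` UNIV)) j
   (\<lambda>y. (rl_chart \<circ> (\<lambda>P. P 2) \<circ> inv_into U (bchart k e c)) y i) (bchart k e c P)))"
proof (rule rank_row_pos[of 1])
 have U: "U \<inter> (\<lambda>P. P 2) -` UNIV = U" by simp
 have S: "bchart k e c ` U = half_strip" unfolding U_def by (rule bchart_good(2)[OF ec ks])
 let ?a = "bchart k e c P"
 have a: "?a \<in> half_strip" unfolding S[symmetric] using P by (simp add: U_def)
 then have a1: "0 \<le> ?a 1" "?a 1 < 1/5" by (simp_all add: half_strip_def)
 have set: "{t. ?a(1 := t) \<in> half_strip} = {0..<1/5}" using a by (auto simp: half_strip_def)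
 have "partial_within half_strip 1 (\<lambda>y. (rl_chart \<circ> (\<lambda>P. P 2) \<circ> inv_into U (bchart k e c)) y 0) ?a = e"
 proof (rule partial_within_eq[where h = "\<lambda>y. c + e * y 1"])
  show "?a \<in> half_strip" by (rule a)
  show "at (?a 1) within {t. ?a(1 := t) \<in> half_strip} \<noteq> bot"
  proof -
   have "{?a 1..<1/5} \<subseteq> {t. ?a(1 := t) \<in> half_strip}" unfolding set using a1 by auto
   then show ?thesis by (rule at_within_nontrivial[OF a1(2)])
  qed
  show "((\<lambda>t. c + e * (?a(1 := t)) 1) has_real_derivative e) (at (?a 1))" by (auto intro!: derivative_eq_intros)
  fix y assume "y \<in> half_strip"
  then have y: "y \<in> bchart k e c ` U" using S by simp
  have "bchart k e c (inv_into U (bchart k e c) y) = y" using y by (rule f_inv_into_f)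
  then have "bchart k e c (inv_into U (bchart k e c) y) 1 = y 1" by simp
  then have "e * (inv_into U (bchart k e c) y 2 - c) = y 1" by (simp add: bchart_def)
  then have "inv_into U (bchart k e c) y 2 - c = e * y 1" using ec by auto
  then show "(rl_chart \<circ> (\<lambda>P. P 2) \<circ> inv_into U (bchart k e c)) y 0 = c + e * y 1" by (simp add: rl_chart_def)
 qed
 moreover have "e \<noteq> 0" using ec by auto
 ultimately show "(\<lambda>(i, j). partial_within (bchart k e c ` (U \<inter> (\<lambda>P. P 2) -` UNIV)) j
   (\<lambda>y. (rl_chart \<circ> (\<lambda>P. P 2) \<circ> inv_into U (bchart k e c)) y i) ?a) (0, 1) \<noteq> 0" by (simp add: S)
qed simp

lemma E_singular:
 assumes ec: "end_ok e c"
 shows "singular_set (Em e c) real_line (\<lambda>P. P 2) = band (cap e c \<inter> {0, 1})"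
proof (intro equalityI subsetI)
 fix P assume "P \<in> singular_set (Em e c) real_line (\<lambda>P. P 2)"
 then have P: "P \<in> band (cap e c)" and "differential_rank (Em e c) real_line (\<lambda>P. P 2) P 0"
  by (auto simp: singular_set_def real_line_simps)
 then obtain U \<phi> where U: "(U, \<phi>) \<in> matlas (Em e c)" "P \<in> U" and r:
  "vec_space.rank 1 (Matrix.mat 1 2 (\<lambda>(i, j). partial_within (\<phi> ` (U \<inter> (\<lambda>P. P 2) -` UNIV)) j
   (\<lambda>y. (rl_chart \<circ> (\<lambda>P. P 2) \<circ> inv_into U \<phi>) y i) (\<phi> P))) = 0"
  unfolding differential_rank_def by (auto simp: real_line_simps)
 have "P 2 = 0 \<or> P 2 = 1"
  using U(1)
 proof (cases rule: E_chart_cases)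
  case (1 k)
  have P2: "P \<in> band {v. 0 < e * (v - c)}" "P k > 0" using U(2) unfolding 1(2) by simp_all
  show ?thesis using E_matrix[OF open_cap 1(1) P2] r unfolding 1(2,3) by simp
 next
  case (2 k s)
  show ?thesis using E_boundary_matrix[OF ec 2(1,2) U(2)[unfolded 2(3)]] r[unfolded 2(3,4)] by linarith
 qed
 then show "P \<in> band (cap e c \<inter> {0, 1})" using P by (auto simp: band_def)
next
 fix P assume "P \<in> band (cap e c \<inter> {0, 1})"
 then have P: "P \<in> band (cap e c)" "P 2 = 0 \<or> P 2 = 1" by (auto simp: band_def)
 have "P 2 \<noteq> c" "e \<noteq> 0" using P(2) ec by auto
 then obtain k where k: "k \<in> {0,1,2}" "P \<in> {P \<in> band {v. 0 < e * (v - c)}. P k > 0}" using E_interior_chart[OF P(1)] by blast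
 let ?U = "{P \<in> band {v. 0 < e * (v - c)}. P k > 0}"
 have "differential_rank (Em e c) real_line (\<lambda>P. P 2) P 0"
  unfolding differential_rank_def
 proof (rule bexI[of _ "(?U, aff k)"], unfold prod.case, rule bexI[of _ "(UNIV, rl_chart)"], unfold prod.case)
  show "(?U, aff k) \<in> matlas (Em e c)" unfolding Em_def sub_mfd_simps using k(1) by blast
  show "(UNIV, rl_chart) \<in> matlas real_line" by (simp add: real_line_simps)
  show "P \<in> ?U \<and> P 2 \<in> UNIV \<and> vec_space.rank (mdim real_line) (Matrix.mat (mdim real_line) (mdim (Em e c)) (\<lambda>(i, j). partial_within (aff k ` (?U \<inter> (\<lambda>P. P 2) -` UNIV)) j
    (\<lambda>y. (rl_chart \<circ> (\<lambda>P. P 2) \<circ> inv_into ?U (aff k)) y i) (aff k P))) = 0"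
   using E_matrix[OF open_cap k(1)] k(2) P(2) by (simp add: real_line_simps)
 qed
 then show "P \<in> singular_set (Em e c) real_line (\<lambda>P. P 2)" using P(1) by (simp add: singular_set_def real_line_simps)
qed

lemma W_immersion: "immersion Wm (euclid_mfd 1) id"
proof -
 have sm: "smooth_map Wm (euclid_mfd 1) id"
  by (rule smooth_betweenI[OF emb_W emb_euclid, where G = id]) (use Wset_eucl in \<open>auto simp: topspace_euclid\<close>)
 have pos: "0 < vec_space.rank 1 (Matrix.mat 1 1 (\<lambda>(i, j). partial_within (\<phi> ` (U \<inter> id -` eucl 1)) j (\<lambda>y. (id \<circ> id \<circ> inv_into U \<phi>) y i) (\<phi> x)))"
  if U: "\<phi> ` U = coord ` {0..<1}" "U \<subseteq> eucl 1" and x: "x \<in> U" and d: "d \<noteq> 0" "\<And>z. z \<in> U \<Longrightarrow> z 0 = b + d * \<phi> z 0" for U \<phi> x b d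
 proof (rule rank_row_pos[of 0])
  have UE: "U \<inter> id -` eucl 1 = U" using U(2) by auto
  have "\<phi> x \<in> coord ` {0..<1}" unfolding U(1)[symmetric] by (rule imageI[OF x])
  then obtain t where "\<phi> x = coord t" "t \<in> {0..<1}" by (rule imageE)
  then have t: "\<phi> x = coord t" "0 \<le> t" "t < 1" by simp_all
  have set: "{s. (\<phi> x)(0 := s) \<in> \<phi> ` U} = {0..<1}"
  proof -
   have "(coord t)(0 := s) = coord s" for s by (auto simp: coord_def)
   then show ?thesis unfolding U t by auto
  qed
  have "partial_within (\<phi> ` U) 0 (\<lambda>y. (id \<circ> id \<circ> inv_into U \<phi>) y 0) (\<phi> x) = d"
  proof (rule partial_within_eq[where h = "\<lambda>y. b + d * y 0"])
   show "\<phi> x \<in> \<phi> ` U" using x by blast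
   show "at (\<phi> x 0) within {s. (\<phi> x)(0 := s) \<in> \<phi> ` U} \<noteq> bot"
   proof -
    have "at t within {0..<1} \<noteq> bot" by (rule at_within_nontrivial[OF t(3)]) (use t in auto)
    then show ?thesis unfolding set unfolding t by simp
   qed
   show "((\<lambda>s. b + d * ((\<phi> x)(0 := s)) 0) has_real_derivative d) (at (\<phi> x 0))" by (auto intro!: derivative_eq_intros)
   fix y assume y: "y \<in> \<phi> ` U"
   have "inv_into U \<phi> y \<in> U" "\<phi> (inv_into U \<phi> y) = y" by (rule inv_into_into[OF y], rule f_inv_into_f[OF y])
   then show "(id \<circ> id \<circ> inv_into U \<phi>) y 0 = b + d * y 0" using d(2)[of "inv_into U \<phi> y"] by simp
  qed
  then show "(\<lambda>(i, j). partial_within (\<phi> ` (U \<inter> id -` eucl 1)) j (\<lambda>y. (id \<circ> id \<circ> inv_into U \<phi>) y i) (\<phi> x)) (0, 0) \<noteq> 0"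
   using d(1) unfolding UE by simp
 qed simp
 have one: "vec_space.rank 1 (Matrix.mat 1 1 f) = 1" if "0 < vec_space.rank 1 (Matrix.mat 1 1 f)" for f :: "nat \<times> nat \<Rightarrow> real"
 proof -
  interpret V: vec_space "TYPE(real)" 1 .
  have "V.rank (Matrix.mat 1 1 f) \<le> 1" by (rule V.rank_le_nc) simp
  then show ?thesis using that by simp
 qed
 have "differential_rank Wm (euclid_mfd 1) id x 1" if x: "x \<in> Wset" for x
 proof -
  have ex: "\<exists>(U, \<phi>)\<in>matlas Wm. x \<in> U \<and> vec_space.rank 1 (Matrix.mat 1 1 (\<lambda>(i, j). partial_within (\<phi> ` (U \<inter> id -` eucl 1)) j (\<lambda>y. (id \<circ> id \<circ> inv_into U \<phi>) y i) (\<phi> x))) = 1"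
  proof (cases "x 0 < 1")
   case True
   have "x \<in> {x \<in> Wset. x 0 < 1}" using x True by simp
   from one[OF pos[OF W_charts(2) _ this, of 1 0]] show ?thesis
    using Wset_eucl x True by (intro bexI[of _ "({x \<in> Wset. x 0 < 1}, id)"]) auto
  next
   case False
   then have xU: "x \<in> {x \<in> Wset. 0 < x 0}" using x by simp
   from one[OF pos[OF W_charts(4) _ xU, of "-1" 1]] show ?thesis
    using Wset_eucl xU by (intro bexI[of _ "({x \<in> Wset. 0 < x 0}, \<lambda>x. coord (1 - x 0))"]) auto
  qed
  then obtain U \<phi> where "(U, \<phi>) \<in> matlas Wm" "x \<in> U" "vec_space.rank 1 (Matrix.mat 1 1 (\<lambda>(i, j). partial_within (\<phi> ` (U \<inter> id -` eucl 1)) j (\<lambda>y. (id \<circ> id \<circ> inv_into U \<phi>) y i) (\<phi> x))) = 1"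
   by blast
  moreover have "x \<in> eucl 1" using x Wset_eucl by blast
  ultimately show ?thesis unfolding differential_rank_def
   by (intro bexI[of _ "(U, \<phi>)"]) (simp_all add: euclid_mfd_def Euclidean_space_eq)
 qed
 then show ?thesis unfolding immersion_def using sm by simp
qed

section \<open>The height as a special-generic-like map\<close>

text \<open>The collar of length 1/5 at each of the two ends of the interval.\<close>

definition kap :: "(nat \<Rightarrow> real) \<times> real \<Rightarrow> nat \<Rightarrow> real" where
 "kap = (\<lambda>(x, t). coord (x 0 + t * (1 - 2 * x 0) / 5))"

definition kap_inv :: "(nat \<Rightarrow> real) \<Rightarrow> (nat \<Rightarrow> real) \<times> real" where
 "kap_inv w = (if w 0 \<le> 1/2 then (coord 0, 5 * w 0) else (coord 1, 5 * (1 - w 0)))"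

lemma kap_inv_kap: "x \<in> {coord 0, coord 1} \<Longrightarrow> t \<in> {0..1} \<Longrightarrow> kap_inv (kap (x, t)) = (x, t)"
 by (auto simp: kap_def kap_inv_def)

definition nbd :: "real \<Rightarrow> real set" where
 "nbd b = (if b = 1 then {4/5..1} else {0..1/5})"

lemma kap_image:
 "kap ` ({coord 0} \<times> {0..1}) = coord ` nbd 0" "kap ` ({coord 1} \<times> {0..1}) = coord ` nbd 1"
proof -
 show "kap ` ({coord 0} \<times> {0..1}) = coord ` nbd 0"
 proof (intro equalityI subsetI)
  fix w assume "w \<in> coord ` nbd 0"
  then obtain t where t: "w = coord t" "0 \<le> t" "t \<le> 1/5" by (auto simp: nbd_def)
  then have "w = kap (coord 0, 5 * t)" by (simp add: kap_def)
  then show "w \<in> kap ` ({coord 0} \<times> {0..1})" using t by (intro image_eqI[of _ _ "(coord 0, 5 * t)"]) auto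
 qed (auto simp: kap_def nbd_def)
 show "kap ` ({coord 1} \<times> {0..1}) = coord ` nbd 1"
 proof (intro equalityI subsetI)
  fix w assume "w \<in> coord ` nbd 1"
  then obtain t where t: "w = coord t" "4/5 \<le> t" "t \<le> 1" by (auto simp: nbd_def)
  then have "w = kap (coord 1, 5 * (1 - t))" by (simp add: kap_def diff_divide_distrib)
  then show "w \<in> kap ` ({coord 1} \<times> {0..1})" using t by (intro image_eqI[of _ _ "(coord 1, 5 * (1 - t))"]) auto
 qed (auto simp: kap_def nbd_def)
qed

lemma kap_image_all: "kap ` ({coord 0, coord 1} \<times> {0..1}) = coord ` (nbd 0 \<union> nbd 1)"
proof -
 have "{coord 0, coord 1} \<times> {0..1::real} = {coord 0} \<times> {0..1} \<union> {coord 1} \<times> {0..1}" by auto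
 then show ?thesis by (simp only: image_Un kap_image)
qed

lemma kap_image_open: "kap ` ({coord 0, coord 1} \<times> {0..<1}) = {w \<in> Wset. w 0 < 1/5 \<or> 4/5 < w 0}"
proof (intro equalityI subsetI)
 fix w assume "w \<in> {w \<in> Wset. w 0 < 1/5 \<or> 4/5 < w 0}"
 then have w: "w = coord (w 0)" "0 \<le> w 0" "w 0 \<le> 1" "w 0 < 1/5 \<or> 4/5 < w 0" by (auto simp: Wset_iff)
 define s where "s = w 0"
 have w: "w = coord s" "0 \<le> s" "s \<le> 1" "s < 1/5 \<or> 4/5 < s" using w by (simp_all add: s_def)
 show "w \<in> kap ` ({coord 0, coord 1} \<times> {0..<1})"
 proof (cases "s < 1/5")
  case True
  have "w = kap (coord 0, 5 * s)" using w(1) by (simp add: kap_def)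
  then show ?thesis by (rule image_eqI) (use True w in auto)
 next
  case False
  have "w = kap (coord 1, 5 * (1 - s))" using w(1) by (simp add: kap_def diff_divide_distrib)
  then show ?thesis by (rule image_eqI) (use False w in auto)
 qed
qed (auto simp: kap_def Wset_def)

lemma nbd_Wset: "coord ` nbd b \<subseteq> Wset" by (auto simp: nbd_def Wset_def)

lemma kap_collar: "collar Wm kap"
 unfolding collar_def W_boundary
proof (intro conjI ballI)
 let ?B = "{coord 0, coord 1}"
 let ?J = "coord ` (nbd 0 \<union> nbd 1)"
 define G where "G y = coord (y 0 + y 1 * (1 - 2 * y 0) / 5)" for y :: "nat \<Rightarrow> real"
 define H where "H w = tup [if w 0 \<le> 1/2 then 0 else 1, if w 0 \<le> 1/2 then 5 * w 0 else 5 * (1 - w 0)]" for w :: "nat \<Rightarrow> real"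
 have smH: "sm ?J (\<lambda>w. H w i)" for i
 proof (rule sm_local)
  fix w assume w: "w \<in> ?J"
  show "\<exists>U. open U \<and> w \<in> U \<and> sm (?J \<inter> U) (\<lambda>w. H w i)"
  proof (cases "w 0 < 1/2")
   case True
   let ?U = "(\<lambda>x::nat \<Rightarrow> real. x 0) -` {..<1/2}"
   have "sm (?J \<inter> ?U) (\<lambda>w. tup [0, 5 * w 0] i)" by (intro sm_tup sm_intros)
   then have "sm (?J \<inter> ?U) (\<lambda>w. H w i)" by (subst sm_cong[where g = "\<lambda>w. tup [0, 5 * w 0] i"]) (auto simp: H_def)
   then show ?thesis using True open_coordinate[of "{..<1/2}" 0] by (intro exI[of _ ?U]) simp
  next
   case False
   then have F: "w 0 > 1/2" using w by (auto simp: nbd_def)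
   let ?U = "(\<lambda>x::nat \<Rightarrow> real. x 0) -` {1/2<..}"
   have "sm (?J \<inter> ?U) (\<lambda>w. tup [1, 5 * (1 - w 0)] i)" by (intro sm_tup sm_intros)
   then have "sm (?J \<inter> ?U) (\<lambda>w. H w i)" by (subst sm_cong[where g = "\<lambda>w. tup [1, 5 * (1 - w 0)] i"]) (auto simp: H_def)
   then show ?thesis using F open_coordinate[of "{1/2<..}" 0] by (intro exI[of _ ?U]) simp
  qed
 qed
 have JW: "?J \<subseteq> Wset" using nbd_Wset by blast
 show "diffeo_between (prod_mfd (boundary_mfd Wm) real_line) (?B \<times> {0..1}) Wm (kap ` (?B \<times> {0..1})) kap"
  unfolding kap_image_all
 proof (rule diffeo_betweenI[OF emb_prod[OF emb_bW emb_real_line] emb_W, where h = kap_inv and G = G and H = H])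
  show "?B \<times> {0..1} \<subseteq> topspace (mtop (prod_mfd (boundary_mfd Wm) real_line))"
   by (auto simp: prod_mfd_def top_bW real_line_def)
  show "?J \<subseteq> topspace (mtop Wm)" using JW by simp
  show "kap x \<in> ?J" if "x \<in> ?B \<times> {0..1}" for x using imageI[OF that, of kap] by (simp only: kap_image_all)
  show "kap_inv y \<in> ?B \<times> {0..1}" if "y \<in> ?J" for y using that by (auto simp: kap_inv_def nbd_def)
  show "kap_inv (kap x) = x" if "x \<in> ?B \<times> {0..1}" for x using that kap_inv_kap by (cases x) auto
  show "kap (kap_inv y) = y" if "y \<in> ?J" for y using that by (auto simp: kap_inv_def kap_def nbd_def diff_divide_distrib)
  show "id (kap x) = G (join 1 id coord x)" if "x \<in> ?B \<times> {0..1}" for x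
   by (cases x) (simp add: kap_def G_def join_def)
  show "sm (join 1 id coord ` (?B \<times> {0..1})) (\<lambda>y. G y i)" for i unfolding G_def by (intro sm_coord sm_intros) simp
  show "join 1 id coord (kap_inv y) = H (id y)" if "y \<in> ?J" for y
   by (auto simp: kap_inv_def H_def join_def tup_def coord_def fun_eq_iff nth_Cons split: nat.splits)
  show "sm (id ` ?J) (\<lambda>y. H y i)" for i using smH by simp
 qed
 show "kap (x, 0) = x" if "x \<in> ?B" for x using that by (auto simp: kap_def)
 have "kap ` (?B \<times> {0..<1}) = Wset \<inter> (\<lambda>x::nat \<Rightarrow> real. x 0) -` ({..<1/5} \<union> {4/5<..})"
  unfolding kap_image_open by auto
 moreover have "open ((\<lambda>x::nat \<Rightarrow> real. x 0) -` ({..<1/5} \<union> {4/5<..}))" by (rule open_coordinate) (intro open_Un open_lessThan open_greaterThan)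
 ultimately show "openin (mtop Wm) (kap ` (?B \<times> {0..<1}))" by (simp add: openin_open_Int)
qed

lemma collar_proj_kap: "u \<in> {coord 0, coord 1} \<Longrightarrow> t \<in> {0..1} \<Longrightarrow> collar_proj Wm kap (kap (u, t)) = u"
proof -
 assume ut: "u \<in> {coord 0, coord 1}" "t \<in> {0..1}"
 have "inj_on kap ({coord 0, coord 1} \<times> {0..1})" by (rule inj_on_inverseI[where g = kap_inv]) (use kap_inv_kap in auto)
 then show ?thesis using ut by (simp add: collar_proj_def W_boundary inv_into_f_f)
qed

lemma collar_proj_nbd: "b \<in> {0, 1} \<Longrightarrow> v \<in> nbd b \<Longrightarrow> collar_proj Wm kap (coord v) = coord b"
proof -
 assume b: "b \<in> {0, 1}" "v \<in> nbd b"
 then have "coord v \<in> kap ` ({coord b} \<times> {0..1})" using kap_image by auto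
 then obtain t where "coord v = kap (coord b, t)" "t \<in> {0..1}" by auto
 then show ?thesis using collar_proj_kap[of "coord b" t] b(1) by auto
qed

lemma ht_in: "P \<in> RP2 \<Longrightarrow> ht P \<in> Wset" using RP2_bounds by (auto simp: ht_def Wset_def)

lemma smooth_ht: "smooth_map Mm Wm ht" "smooth_map Mm (euclid_mfd 1) ht"
proof -
 have s: "sm A (\<lambda>y. coord (y 2) i)" for A :: "(nat \<Rightarrow> real) set" and i by (intro sm_coord sm_var)
 show "smooth_map Mm Wm ht"
  by (rule smooth_betweenI[OF emb_M emb_W, where G = ht]) (use ht_in s in \<open>auto simp: ht_def\<close>)
 show "smooth_map Mm (euclid_mfd 1) ht"
  by (rule smooth_betweenI[OF emb_M emb_euclid, where G = ht]) (use coord_eucl s in \<open>auto simp: ht_def topspace_euclid\<close>)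
qed

lemma ht_band: "I \<subseteq> {0..1} \<Longrightarrow> ht ` band I = coord ` I"
proof (intro equalityI subsetI)
 assume I: "I \<subseteq> {0..1}"
 fix w assume "w \<in> coord ` I"
 then obtain v where v: "w = coord v" "v \<in> I" by blast
 then have "polar v 0 \<in> band I" "ht (polar v 0) = w" using polar_in[of v 0] I by (auto simp: band_def ht_def)
 then show "w \<in> ht ` band I" by blast
qed (auto simp: band_def ht_def)

lemma preimage_ht: "preimage_mfd Mm ht (coord ` I) = band I"
 by (auto simp: band_def ht_def)

text \<open>The boundary of the interval consists of isolated points, so a constant map is a local section
  through any critical point.\<close>

lemma ht_onto_boundary: "singular_set_onto_boundary Mm (band {0, 1}) Wm ht"
 unfolding singular_set_onto_boundary_def
proof (intro conjI ballI)
 show "ht ` band {0, 1} = mfd_boundary Wm" unfolding W_boundary by (subst ht_band) auto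
 fix x assume x: "x \<in> band {0, 1}"
 then have b: "x 2 \<in> {0, 1}" "x \<in> RP2" by (auto simp: band_def)
 show "\<exists>V s. openin (mtop (boundary_mfd Wm)) V \<and> ht x \<in> V \<and> smooth_between (boundary_mfd Wm) V Mm (band {0, 1}) s \<and>
   s (ht x) = x \<and> (\<forall>v\<in>V. ht (s v) = v)"
 proof (rule exI[of _ "{coord (x 2)}"], rule exI[of _ "\<lambda>_. x"], intro conjI)
  show "openin (mtop (boundary_mfd Wm)) {coord (x 2)}" by (rule openin_bW[OF b(1)])
  show "smooth_between (boundary_mfd Wm) {coord (x 2)} Mm (band {0, 1}) (\<lambda>_. x)"
   by (rule smooth_betweenI[OF emb_bW emb_M, where G = "\<lambda>_. x"])
    (use b x band_sub in \<open>auto simp: top_bW intro: sm_const\<close>)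
 qed (simp_all add: ht_def)
qed

text \<open>Over a collar the boundary of the target contributes one point only, so the local product
  structure is the projection from the product with that point.\<close>

lemma over_collar:
 assumes ec: "end_ok e c" and b: "b = (if e = 1 then 1 else 0)"
 shows "cap e c \<inter> {0..1} = nbd b" "band (cap e c) = band (nbd b)"
  "diffeo_between (prod_mfd (boundary_mfd Wm) (Em e c)) ({coord b} \<times> band (cap e c)) Mm (band (nbd b)) snd"
proof -
 show n: "cap e c \<inter> {0..1} = nbd b" using ec b by (auto simp: cap_def nbd_def)
 then show bb: "band (cap e c) = band (nbd b)" using RP2_bounds by (auto simp: band_def)
 have bW: "coord b \<in> {coord 0, coord 1}" using b by auto
 define H where "H P = join 1 id id (coord b, P)" for P :: "nat \<Rightarrow> real"
 have "sm (id ` band (nbd b)) (\<lambda>P. H P i)" for i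
  by (cases "i < 1") (simp_all add: H_def join_def)
 then show "diffeo_between (prod_mfd (boundary_mfd Wm) (Em e c)) ({coord b} \<times> band (cap e c)) Mm (band (nbd b)) snd"
  by (intro diffeo_betweenI[OF emb_prod[OF emb_bW emb_E[OF ec]] emb_M, where h = "\<lambda>P. (coord b, P)" and G = "p2 1" and H = H])
   (use bW band_sub bb in \<open>auto simp: prod_mfd_def top_bW p2_join H_def sm_p2\<close>)
qed

lemma collar_bundle:
 assumes ec: "end_ok e c" and b: "b = (if e = 1 then 1 else 0)"
 shows "locally_trivial_at Mm (preimage_mfd Mm ht (kap ` (mfd_boundary Wm \<times> {0..1})))
   (boundary_mfd Wm) (mfd_boundary Wm) (collar_proj Wm kap \<circ> ht) (Em e c) (coord b)"
 unfolding locally_trivial_at_def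
proof (rule exI[of _ "{coord b}"], rule exI[of _ snd], intro conjI ballI)
 have b01: "b \<in> {0, 1}" using b by simp
 have pr: "collar_proj Wm kap (ht P) = coord d" if "P \<in> band (nbd d)" "d \<in> {0,1}" for P d
  using that collar_proj_nbd[OF that(2)] by (auto simp: band_def ht_def)
 show "openin (subtopology (mtop (boundary_mfd Wm)) (mfd_boundary Wm)) {coord b}"
  using openin_bW[OF b01] b01 by (auto simp: W_boundary intro: openin_subtopology_Int2 simp: openin_subtopology)
 show "coord b \<in> {coord b}" by simp
 have "preimage_mfd Mm ht (kap ` (mfd_boundary Wm \<times> {0..1})) \<inter> (collar_proj Wm kap \<circ> ht) -` {coord b} = band (nbd b)"
  unfolding W_boundary kap_image_all preimage_ht
 proof (intro equalityI subsetI)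
  fix P assume P: "P \<in> band (nbd 0 \<union> nbd 1) \<inter> (collar_proj Wm kap \<circ> ht) -` {coord b}"
  then consider "P \<in> band (nbd 0)" | "P \<in> band (nbd 1)" by (auto simp: band_def)
  then show "P \<in> band (nbd b)" using P pr[of P 0] pr[of P 1] by cases auto
 next
  fix P assume P: "P \<in> band (nbd b)"
  then have "P \<in> band (nbd 0 \<union> nbd 1)" using b01 by (auto simp: band_def)
  then show "P \<in> band (nbd 0 \<union> nbd 1) \<inter> (collar_proj Wm kap \<circ> ht) -` {coord b}" using pr[OF P b01] by simp
 qed
 then show "diffeo_between (prod_mfd (boundary_mfd Wm) (Em e c)) ({coord b} \<times> topspace (mtop (Em e c))) Mm
   (preimage_mfd Mm ht (kap ` (mfd_boundary Wm \<times> {0..1})) \<inter> (collar_proj Wm kap \<circ> ht) -` {coord b}) snd"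
  using over_collar(3)[OF ec b] by simp
 fix v y assume "v \<in> {coord b}" "y \<in> topspace (mtop (Em e c))"
 then show "(collar_proj Wm kap \<circ> ht) (snd (v, y)) = v" using pr[OF _ b01] over_collar(2)[OF ec b] by simp
qed

lemma local_form:
 assumes ec: "end_ok e c" and b: "b = (if e = 1 then 1 else 0)"
  and sing: "singular_set (Em e c) real_line (\<lambda>P. P 2) = band (cap e c \<inter> {0, 1})"
  and poly: "subpolyhedron (Em e c) 1 (band {b})"
 shows "sgl_local_form Mm Wm kap ht (Em e c) (coord b)"
proof -
 have b01: "b \<in> {0, 1}" using b by simp
 have bB: "coord b \<in> {coord 0, coord 1}" using b01 by auto
 have n: "cap e c \<inter> {0..1} = nbd b" and bn: "band (cap e c) = band (nbd b)" by (rule over_collar[OF ec b])+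
 define l where "l = (if e = 1 then 4/5 else 0 :: real)"
 define u where "u = (if e = 1 then 1 else 1/5 :: real)"
 have lu: "nbd b = {l..u}" "l < u" "{c, b} = {l, u}" "{l..u} \<subseteq> {0..1}" "b \<in> cap e c" "b \<noteq> c"
  using ec b by (auto simp: nbd_def l_def u_def cap_def)
 have capb: "cap e c \<inter> {0, 1} = {b}" using ec b by (auto simp: cap_def)
 have kb: "kap ` ({coord b} \<times> {0..1}) = coord ` {l..u}" using b01 unfolding insert_iff empty_iff
  by (elim disjE FalseE) (simp_all only: lu(1)[symmetric] kap_image)
 have nb: "band (nbd b) \<noteq> {}" by (rule band_nonempty[of b]) (use lu b01 n in auto)
 have comp: "compact_space (mtop (Em e c))" "connected_mfd (Em e c)"
 proof -
  have "compact (band (nbd b))" "connected (band (nbd b))" using lu by (auto intro!: compact_band connected_band)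
  then show "compact_space (mtop (Em e c))" "connected_mfd (Em e c)"
   using nb by (simp_all add: bn connected_mfd_def compact_space_subtopology connected_space_subtopology flip: connectedin_def)
 qed
 have mid: "g ` band (nbd b) = {l..u}" if "g = (\<lambda>P::nat\<Rightarrow>real. P 2)" for g
 proof -
  have "coord ` (\<lambda>P. P 2) ` band (nbd b) = coord ` {l..u}"
   using ht_band[of "nbd b"] lu(1,4) by (simp add: image_image ht_def)
  moreover have "inj coord" by (rule injI) simp
  ultimately show ?thesis unfolding that by (simp add: inj_image_eq_iff)
 qed
 define \<Theta> where "\<Theta> = (\<lambda>(x::nat\<Rightarrow>real, t). coord t)"
 define H where "H w = tup [b, w 0]" for w :: "nat \<Rightarrow> real"
 have smH: "sm (id ` coord ` {l..u}) (\<lambda>w. H w i)" for i unfolding H_def by (intro sm_tup sm_intros)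
 have \<Theta>: "diffeo_between (prod_mfd (boundary_mfd Wm) real_line) ({coord b} \<times> {l..u}) Wm (coord ` {l..u}) \<Theta>"
 proof (rule diffeo_betweenI[OF emb_prod[OF emb_bW emb_real_line] emb_W, where h = "\<lambda>w. (coord b, w 0)" and G = "\<lambda>y. coord (y 1)" and H = H])
  show "{coord b} \<times> {l..u} \<subseteq> topspace (mtop (prod_mfd (boundary_mfd Wm) real_line))"
   using bB by (auto simp: prod_mfd_def top_bW real_line_def)
  show "coord ` {l..u} \<subseteq> topspace (mtop Wm)" using lu(4) by (auto simp: Wset_def)
  show "sm (join 1 id coord ` ({coord b} \<times> {l..u})) (\<lambda>y. coord (y 1) i)" for i by (intro sm_coord sm_var)
  show "join 1 id coord (coord b, y 0) = H (id y)" if "y \<in> coord ` {l..u}" for y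
   by (auto simp: H_def join_def tup_def coord_def fun_eq_iff nth_Cons split: nat.splits)
  show "sm (id ` coord ` {l..u}) (\<lambda>w. H w i)" for i by (rule smH)
 qed (auto simp: \<Theta>_def join_def)
 have smg: "smooth_map (Em e c) real_line (\<lambda>P. P 2)"
  by (rule smooth_betweenI[OF emb_E[OF ec] emb_real_line, where G = "\<lambda>y. coord (y 2)"])
   (auto simp: real_line_def intro!: sm_coord)
 show ?thesis unfolding sgl_local_form_def
 proof (intro conjI; (rule exI[of _ "{coord b}"], rule exI[of _ "\<lambda>P. P 2"], rule exI[of _ l], rule exI[of _ u],
   rule exI[of _ c], rule exI[of _ b], rule exI[of _ snd], rule exI[of _ \<Theta>], intro conjI ballI allI)?)
  show "smooth_manifold (Em e c)" by (rule smooth_E[OF ec])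
  show "mdim (Em e c) = mdim Mm - mdim Wm + 1" by simp
  show "compact_space (mtop (Em e c))" "connected_mfd (Em e c)" by (rule comp)+
  show "openin (mtop (boundary_mfd Wm)) {coord b}" by (rule openin_bW[OF b01])
  show "coord b \<in> {coord b}" by simp
  show "smooth_map (Em e c) real_line (\<lambda>P. P 2)" by (rule smg)
  show "l < u" "{c, b} = {l, u}" by (rule lu)+
  show "(\<lambda>P. P 2) ` topspace (mtop (Em e c)) = {l..u}" using mid bn by simp
  show "mfd_boundary (Em e c) = preimage_mfd (Em e c) (\<lambda>P. P 2) {c}"
   unfolding E_boundary[OF ec] by (auto simp: band_def cap_def)
  show "singular_set (Em e c) real_line (\<lambda>P. P 2) \<subseteq> mfd_interior (Em e c)"
   unfolding sing E_interior[OF ec] capb using lu(5,6) by (auto simp: band_def)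
  show "(singular_set (Em e c) real_line (\<lambda>P. P 2) \<inter> (\<lambda>P. P 2) -` {v} \<noteq> {}) = (v = b)" for v
  proof
   assume "singular_set (Em e c) real_line (\<lambda>P. P 2) \<inter> (\<lambda>P. P 2) -` {v} \<noteq> {}"
   then show "v = b" unfolding sing capb by (auto simp: band_def)
  next
   assume v: "v = b"
   have "band {b} \<noteq> {}" by (rule band_nonempty[of b]) (use b01 in auto)
   then show "singular_set (Em e c) real_line (\<lambda>P. P 2) \<inter> (\<lambda>P. P 2) -` {v} \<noteq> {}" unfolding sing capb v by (auto simp: band_def)
  qed
  have "preimage_mfd (Em e c) (\<lambda>P. P 2) {b} = band {b}" using lu(5) by (auto simp: band_def)
  then show "subpolyhedron (Em e c) (mdim Mm - mdim Wm) (preimage_mfd (Em e c) (\<lambda>P. P 2) {b})" using poly by simp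
  show "diffeo_between (prod_mfd (boundary_mfd Wm) (Em e c)) ({coord b} \<times> topspace (mtop (Em e c))) Mm
    (preimage_mfd Mm ht (kap ` ({coord b} \<times> {0..1}))) snd"
   unfolding kb preimage_ht using over_collar(3)[OF ec b] lu(1) by simp
  show "diffeo_between (prod_mfd (boundary_mfd Wm) real_line) ({coord b} \<times> {l..u}) Wm (kap ` ({coord b} \<times> {0..1})) \<Theta>"
   unfolding kb by (rule \<Theta>)
  show "collar_proj Wm kap (\<Theta> (x, t)) = x" if "x \<in> {coord b}" "t \<in> {l..u}" for x t
   using that collar_proj_nbd[OF b01] lu(1) by (simp add: \<Theta>_def)
  show "ht (snd (x, P)) = \<Theta> (x, P 2)" if "x \<in> {coord b}" for x P by (simp add: ht_def \<Theta>_def)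
 qed
qed

lemma inner_bundle:
 assumes b: "w \<in> coord ` {1/5..4/5}"
 shows "locally_trivial_at Mm (band {1/5..4/5}) (interior_mfd Wm) (coord ` {1/5..4/5}) ht (circ (1/2)) w"
 unfolding locally_trivial_at_def
proof (rule exI[of _ "coord ` {1/5..4/5}"], rule exI[of _ "\<lambda>(v, P). lev (1/2) (v 0) P"], intro conjI ballI)
 let ?C = "coord ` {1/5..4/5::real}"
 have CI: "?C \<subseteq> topspace (mtop (interior_mfd Wm))"
  using W_interior by (auto simp: interior_mfd_def Wset_def)
 show "openin (subtopology (mtop (interior_mfd Wm)) ?C) ?C" using CI by (simp add: openin_subtopology_refl)
 show "w \<in> ?C" by (rule b)
 have pre: "band {1/5..4/5} \<inter> ht -` ?C = band {1/5..4/5}" by (auto simp: band_def ht_def)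
 define G where "G y = lev (1/2) (y 0) (p2 1 y)" for y :: "nat \<Rightarrow> real"
 define H where "H P = join 1 id id (ht P, lev (P 2) (1/2) P)" for P :: "nat \<Rightarrow> real"
 have smG: "sm (join 1 id id ` (?C \<times> band {1/2})) (\<lambda>y. G y i)" for i
  unfolding G_def by (intro sm_lev sm_const sm_var sm_p2) (auto simp: join_def)
 have smL: "sm (id ` band {1/5..4/5}) (\<lambda>P. lev (P 2) (1/2) P j)" for j
  by (intro sm_lev sm_const sm_var) (auto simp: band_def)
 have smH: "sm (id ` band {1/5..4/5}) (\<lambda>P. H P i)" for i
 proof (cases "i < 1")
  case True then show ?thesis by (simp add: H_def join_def ht_def)
 next
  case False then show ?thesis using smL[of "i - 1"] by (simp add: H_def join_def)
 qed
 show "diffeo_between (prod_mfd (interior_mfd Wm) (circ (1/2))) (?C \<times> topspace (mtop (circ (1/2)))) Mm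
   (band {1/5..4/5} \<inter> ht -` ?C) (\<lambda>(v, P). lev (1/2) (v 0) P)"
  unfolding pre
 proof (rule diffeo_betweenI[OF emb_prod[OF emb_iW emb_circ] emb_M, where h = "\<lambda>P. (ht P, lev (P 2) (1/2) P)" and G = G and H = H])
  show "?C \<times> topspace (mtop (circ (1/2))) \<subseteq> topspace (mtop (prod_mfd (interior_mfd Wm) (circ (1/2))))"
   using CI by (auto simp: prod_mfd_def)
  show "band {1/5..4/5} \<subseteq> topspace (mtop Mm)" using band_sub by simp
  fix x assume "x \<in> ?C \<times> topspace (mtop (circ (1/2)))"
  then obtain t P where x: "x = (coord t, P)" "1/5 \<le> t" "t \<le> 4/5" "P \<in> band {1/2}" by auto
  have L: "lev (1/2) t P \<in> band {t}" "lev t (1/2) (lev (1/2) t P) = P" using lev_in[of "1/2" t P] x by auto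
  show "(case x of (v, P) \<Rightarrow> lev (1/2) (v 0) P) \<in> band {1/5..4/5}" using L(1) x by (auto simp: band_def)
  show "(ht (case x of (v, P) \<Rightarrow> lev (1/2) (v 0) P), lev ((case x of (v, P) \<Rightarrow> lev (1/2) (v 0) P) 2) (1/2) (case x of (v, P) \<Rightarrow> lev (1/2) (v 0) P)) = x"
   using L x by (simp add: ht_def band_def)
  show "id (case x of (v, P) \<Rightarrow> lev (1/2) (v 0) P) = G (join 1 id id x)"
   by (simp add: x G_def p2_join) (simp add: join_def)
 next
  fix P assume "P \<in> band {1/5..4/5}"
  then have P: "P \<in> band {P 2}" "1/5 \<le> P 2" "P 2 \<le> 4/5" by (auto simp: band_def)
  have L: "lev (P 2) (1/2) P \<in> band {1/2}" "lev (1/2) (P 2) (lev (P 2) (1/2) P) = P" using lev_in[of "P 2" "1/2" P] P by auto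
  show "(ht P, lev (P 2) (1/2) P) \<in> ?C \<times> topspace (mtop (circ (1/2)))" using L P by (simp add: ht_def)
  show "(case (ht P, lev (P 2) (1/2) P) of (v, P) \<Rightarrow> lev (1/2) (v 0) P) = P" using L by (simp add: ht_def)
  show "join 1 id id (ht P, lev (P 2) (1/2) P) = H (id P)" by (simp add: H_def)
 qed (use smG smH in simp_all)
 fix v P assume "v \<in> ?C" "P \<in> topspace (mtop (circ (1/2)))"
 then obtain t where "v = coord t" "1/5 \<le> t" "t \<le> 4/5" "P \<in> band {1/2}" by auto
 then show "ht (case (v, P) of (v, P) \<Rightarrow> lev (1/2) (v 0) P) = v" using lev_in(1)[of "1/2" t P] by (simp add: ht_def band_def)
qed

lemma euclid_smooth: "smooth_manifold (euclid_mfd 1)" "mfd_boundary (euclid_mfd 1) = {}"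
proof -
 have e: "euclid_mfd 1 = sub_mfd 1 (eucl 1) {(eucl 1, id)}"
  by (simp add: euclid_mfd_def sub_mfd_def Euclidean_space_eq)
 have gc: "good_chart (eucl 1) 1 (eucl 1) id"
  by (rule good_chartI(1)[where B = "eucl 1" and \<psi> = id]) (auto simp: Euclidean_space_eq sm_var)
 show "smooth_manifold (euclid_mfd 1)" unfolding e
  by (rule smooth_manifold_sub_mfd[OF subset_refl]) (use gc in auto)
 show "mfd_boundary (euclid_mfd 1) = {}"
  by (rule no_boundaryI) (auto simp: euclid_mfd_def openin_topspace)
qed

text \<open>The height has all properties of a special-generic-like map: both ends are the pieces over the
  collars, the rest is a circle bundle, and the critical levels are polyhedra of dimensions 0 and 1.\<close>

lemma height_sgl:
 assumes poly: "subpolyhedron (Em 1 (4/5)) 1 (band {1})" "subpolyhedron (Em (-1) (1/5)) 1 (band {0})"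
 shows "sgl_structure Mm (euclid_mfd 1) ht Wm id ht (circ (1/2))"
proof -
 have ok: "end_ok 1 (4/5)" "end_ok (-1) (1/5)" by simp_all
 have lf: "sgl_local_form Mm Wm kap ht (Em 1 (4/5)) (coord 1)" "sgl_local_form Mm Wm kap ht (Em (-1) (1/5)) (coord 0)"
  by (rule local_form[OF ok(1)], simp, rule E_singular[OF ok(1)], rule poly(1))
   (rule local_form[OF ok(2)], simp, rule E_singular[OF ok(2)], rule poly(2))
 have cb: "locally_trivial_at Mm (preimage_mfd Mm ht (kap ` (mfd_boundary Wm \<times> {0..1}))) (boundary_mfd Wm) (mfd_boundary Wm) (collar_proj Wm kap \<circ> ht) (Em 1 (4/5)) (coord 1)"
  "locally_trivial_at Mm (preimage_mfd Mm ht (kap ` (mfd_boundary Wm \<times> {0..1}))) (boundary_mfd Wm) (mfd_boundary Wm) (collar_proj Wm kap \<circ> ht) (Em (-1) (1/5)) (coord 0)"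
  by (rule collar_bundle[OF ok(1)], simp) (rule collar_bundle[OF ok(2)], simp)
 have C: "topspace (mtop Wm) - kap ` (mfd_boundary Wm \<times> {0..<1}) = coord ` {1/5..4/5}"
  unfolding W_boundary kap_image_open by (auto simp: Wset_def)
 have onto: "ht ` RP2 = Wset" using ht_band[of "{0..1}"] by (simp add: RP2_band Wset_def)
 have conM: "connected_mfd Mm" using connected_band[of "{0..1}"] band_nonempty[of 0 "{0..1}"]
  by (simp add: connected_mfd_def RP2_band connected_space_subtopology flip: connectedin_def)
 have "compact Wset" "connected Wset"
 proof -
  have "continuous_on {0..1} coord"
  proof (rule continuous_on_coordinatewise_then_product)
   fix i show "continuous_on {0..1} (\<lambda>t. coord t i)" by (cases "i = 0") (simp_all add: coord_def)
  qed
  then show "compact Wset" "connected Wset" unfolding Wset_def by (auto intro!: compact_continuous_image connected_continuous_image)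
 qed
 then have W: "compact_space (mtop Wm)" "connected_mfd Wm"
  by (auto simp: connected_mfd_def compact_space_subtopology connected_space_subtopology Wset_def simp flip: connectedin_def)
 show ?thesis unfolding sgl_structure_def
 proof (intro conjI exI[of _ kap])
  show "collar Wm kap" by (rule kap_collar)
  show "\<forall>b\<in>mfd_boundary Wm. \<exists>E::(nat \<Rightarrow> real) smfd. smooth_manifold E \<and>
   locally_trivial_at Mm (preimage_mfd Mm ht (kap ` (mfd_boundary Wm \<times> {0..1}))) (boundary_mfd Wm) (mfd_boundary Wm) (collar_proj Wm kap \<circ> ht) E b"
  proof
   fix b assume "b \<in> mfd_boundary Wm"
   then consider "b = coord 0" | "b = coord 1" by (auto simp: W_boundary)
   then show "\<exists>E::(nat \<Rightarrow> real) smfd. smooth_manifold E \<and>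
   locally_trivial_at Mm (preimage_mfd Mm ht (kap ` (mfd_boundary Wm \<times> {0..1}))) (boundary_mfd Wm) (mfd_boundary Wm) (collar_proj Wm kap \<circ> ht) E b"
    using cb smooth_E[OF ok(1)] smooth_E[OF ok(2)] by cases (simp only:, blast)+
  qed
  show "\<forall>p\<in>mfd_boundary Wm. \<exists>E::(nat \<Rightarrow> real) smfd. sgl_local_form Mm Wm kap ht E p \<and> diffeomorphic_mfd (boundary_mfd E) (circ (1/2))"
  proof
   fix b assume "b \<in> mfd_boundary Wm"
   then consider "b = coord 0" | "b = coord 1" by (auto simp: W_boundary)
   then show "\<exists>E::(nat \<Rightarrow> real) smfd. sgl_local_form Mm Wm kap ht E b \<and> diffeomorphic_mfd (boundary_mfd E) (circ (1/2))"
    using lf bE_diffeo[OF ok(1)] bE_diffeo[OF ok(2)] by cases (simp only:, blast)+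
  qed
  show "let C = topspace (mtop Wm) - kap ` (mfd_boundary Wm \<times> {0..<1})
    in \<forall>b\<in>C. locally_trivial_at Mm (preimage_mfd Mm ht C) (interior_mfd Wm) C ht (circ (1/2)) b"
   unfolding C Let_def preimage_ht using inner_bundle by blast
  show "singular_set_onto_boundary Mm (singular_set Mm (euclid_mfd 1) ht) Wm ht"
   unfolding ht_singular by (rule ht_onto_boundary)
 qed (use closed_M conM euclid_smooth smooth_ht smooth_W W W_immersion onto closed_circ[of "1/2"] in \<open>simp_all add: euclid_mfd_def\<close>)
qed

lemma height_curve:
 assumes s: "s = 1 \<or> s = (-1::real)"
 shows "reference_curve Wm (coord (1/2)) (\<lambda>t. coord (1/2 + s * t / 2))"
 unfolding reference_curve_def
proof (intro conjI)
 let ?\<alpha> = "\<lambda>t. coord (1/2 + s * t / 2)"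
 have in01: "0 \<le> 1/2 + s * t / 2 \<and> 1/2 + s * t / 2 \<le> 1" if "t \<in> {0..1}" for t using s that by auto
 have ss: "s * (s * z) = z" for z using s by auto
 show "diffeo_between real_line {0..1} Wm (?\<alpha> ` {0..1}) ?\<alpha>"
 proof (rule diffeo_betweenI[OF emb_real_line emb_W, where h = "\<lambda>w. s * (2 * w 0 - 1)" and G = "\<lambda>y. coord (1/2 + s * y 0 / 2)" and H = "\<lambda>w. coord (s * (2 * w 0 - 1))"])
  show "?\<alpha> ` {0..1} \<subseteq> topspace (mtop Wm)" using in01 by (auto simp: Wset_def)
  show "sm (coord ` {0..1}) (\<lambda>y. coord (1/2 + s * y 0 / 2) i)" for i by (intro sm_coord sm_intros) simp
  show "sm (id ` ?\<alpha> ` {0..1}) (\<lambda>w. coord (s * (2 * w 0 - 1)) i)" for i by (intro sm_coord sm_intros)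
 qed (auto simp: real_line_def ss)
 show "?\<alpha> 0 = coord (1/2)" by simp
 show "?\<alpha> ` {0..<1} \<subseteq> mfd_interior Wm" unfolding W_interior using s by (auto simp: Wset_def)
 show "?\<alpha> 1 \<in> mfd_boundary Wm" unfolding W_boundary using s by auto
 have vd: "vector_derivative (\<lambda>t. 1/2 - t / 2) (at 1 within {0..1::real}) = - 1/2"
 proof (rule vector_derivative_within)
  show "at 1 within {0..1::real} \<noteq> bot" by (simp add: at_within_Icc_at_left)
  show "((\<lambda>t. 1/2 - t / 2) has_vector_derivative - 1/2) (at 1 within {0..1::real})"
   by (auto intro!: derivative_eq_intros simp: has_real_derivative_iff_has_vector_derivative[symmetric])
 qed
 show "\<exists>(U, \<phi>) \<in> matlas Wm. ?\<alpha> 1 \<in> U \<and> vector_derivative (\<lambda>t. \<phi> (?\<alpha> t) (mdim Wm - 1)) (at 1 within {t \<in> {0..1}. ?\<alpha> t \<in> U}) \<noteq> 0"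
  using s
 proof
  assume s: "s = 1"
  have "{t \<in> {0..1}. ?\<alpha> t \<in> {x \<in> Wset. 0 < x 0}} = {0..1}" using s by (auto simp: Wset_def)
  moreover have "(\<lambda>t. coord (1 - ?\<alpha> t 0) 0) = (\<lambda>t. 1/2 - t / 2)" using s by (simp add: fun_eq_iff)
  ultimately show ?thesis using vd s by (intro bexI[of _ "({x \<in> Wset. 0 < x 0}, \<lambda>x. coord (1 - x 0))"]) (auto simp: Wset_def)
 next
  assume s: "s = -1"
  have "{t \<in> {0..1}. ?\<alpha> t \<in> {x \<in> Wset. x 0 < 1}} = {0..1}" using s by (auto simp: Wset_def)
  moreover have "(\<lambda>t. id (?\<alpha> t) 0) = (\<lambda>t. 1/2 - t / 2)" using s by (simp add: fun_eq_iff)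
  ultimately show ?thesis using vd s by (intro bexI[of _ "({x \<in> Wset. x 0 < 1}, id)"]) (auto simp: Wset_def)
 qed
qed

section \<open>Real coefficients and quotients of function spaces\<close>

definition RR :: "real ring" where
 "RR = \<lparr>carrier = UNIV, mult = (*), one = 1, zero = 0, add = (+)\<rparr>"

lemma RR_simps [simp]:
 "carrier RR = UNIV" "x \<otimes>\<^bsub>RR\<^esub> y = x * y" "\<one>\<^bsub>RR\<^esub> = 1" "\<zero>\<^bsub>RR\<^esub> = 0" "x \<oplus>\<^bsub>RR\<^esub> y = x + y"
 by (simp_all add: RR_def)

lemma cring_RR: "cring RR"
proof (rule cringI)
 show "abelian_group RR"
  by (rule abelian_groupI) (auto simp: algebra_simps intro: exI[of _ "- x" for x])
 show "Group.comm_monoid RR"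
  by (rule comm_monoidI) (auto simp: algebra_simps)
qed (auto simp: algebra_simps)

lemma field_RR: "Ring.field RR"
proof (rule cring.cring_fieldI2[OF cring_RR])
 fix a assume "a \<in> carrier RR" "a \<noteq> \<zero>\<^bsub>RR\<^esub>"
 then show "\<exists>b\<in>carrier RR. a \<otimes>\<^bsub>RR\<^esub> b = \<one>\<^bsub>RR\<^esub>" by (intro bexI[of _ "inverse a"]) auto
qed auto

lemma principal_domain_RR: "principal_domain RR"
proof -
 interpret Ring.field RR by (rule field_RR)
 show ?thesis by unfold_locales
qed

interpretation RR: cring RR by (rule cring_RR)

lemma Units_RR: "x \<noteq> 0 \<Longrightarrow> x \<in> Units RR"
 by (auto simp: Units_def intro!: exI[of _ "inverse x"])

lemma finsum_RR [simp]: "finsum RR f S = sum f S"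
proof (cases "finite S")
 case True
 then show ?thesis by (induction S rule: finite_induct) auto
next
 case False
 then show ?thesis by (simp add: RR.finsum_infinite)
qed

lemma a_inv_RR [simp]: "\<ominus>\<^bsub>RR\<^esub> x = - x"
 by (rule RR.minus_equality) auto

lemma pow_RR [simp]: "x [^]\<^bsub>RR\<^esub> (n::nat) = x ^ n"
 by (induction n) (auto simp: ac_simps)

lemma face_sign_RR [simp]: "face_sign RR k = (-1) ^ k"
 by (simp add: face_sign_def)

text \<open>Chains with real coefficients are functions, and so cycles and boundaries are subspaces of a
  space of functions. The homology modules are quotients of this kind.\<close>

definition fn_subspace :: "('b \<Rightarrow> real) set \<Rightarrow> bool" where
 "fn_subspace Z \<longleftrightarrow> (\<lambda>_. 0) \<in> Z \<and> (\<forall>c\<in>Z. \<forall>d\<in>Z. (\<lambda>s. c s + d s) \<in> Z) \<and> (\<forall>r. \<forall>c\<in>Z. (\<lambda>s. r * c s) \<in> Z)"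

lemma fn_subspaceD:
 assumes "fn_subspace Z"
 shows "(\<lambda>_. 0) \<in> Z" "c \<in> Z \<Longrightarrow> d \<in> Z \<Longrightarrow> (\<lambda>s. c s + d s) \<in> Z" "c \<in> Z \<Longrightarrow> (\<lambda>s. r * c s) \<in> Z"
  "c \<in> Z \<Longrightarrow> (\<lambda>s. - c s) \<in> Z" "c \<in> Z \<Longrightarrow> d \<in> Z \<Longrightarrow> (\<lambda>s. c s - d s) \<in> Z"
proof -
 show 1: "(\<lambda>_. 0) \<in> Z" "c \<in> Z \<Longrightarrow> d \<in> Z \<Longrightarrow> (\<lambda>s. c s + d s) \<in> Z" "c \<in> Z \<Longrightarrow> (\<lambda>s. r * c s) \<in> Z" for c d r
  using assms by (auto simp: fn_subspace_def)
 show 2: "c \<in> Z \<Longrightarrow> (\<lambda>s. - c s) \<in> Z" for c using 1(3)[of c "-1"] by simp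
 show "c \<in> Z \<Longrightarrow> d \<in> Z \<Longrightarrow> (\<lambda>s. c s - d s) \<in> Z" using 1(2)[of c "\<lambda>s. - d s"] 2[of d] by simp
qed

lemma fn_subspace_sum:
 assumes "fn_subspace Z" "\<And>i. i \<in> I \<Longrightarrow> f i \<in> Z"
 shows "(\<lambda>s. \<Sum>i\<in>I. r i * f i s) \<in> Z"
proof (cases "finite I")
 case True
 then show ?thesis using assms(2)
 proof (induction I rule: finite_induct)
  case (insert i I)
  then show ?case using fn_subspaceD(2)[OF assms(1) fn_subspaceD(3)[OF assms(1), of "f i" "r i"]] by simp
 qed (simp add: fn_subspaceD(1)[OF assms(1)])
qed (simp add: fn_subspaceD(1)[OF assms(1)])

definition fn_module :: "('b \<Rightarrow> real) set \<Rightarrow> (real, 'b \<Rightarrow> real) module" where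
 "fn_module Z = \<lparr>carrier = Z, mult = undefined, one = undefined, zero = (\<lambda>s. 0),
  add = (\<lambda>c d s. c s + d s), smult = (\<lambda>r c s. r * c s)\<rparr>"

definition coset :: "('b \<Rightarrow> real) set \<Rightarrow> ('b \<Rightarrow> real) \<Rightarrow> ('b \<Rightarrow> real) set" where
 "coset B c = {(\<lambda>s. b s + c s) | b. b \<in> B}"

lemma a_r_coset_fn: "B +>\<^bsub>fn_module Z\<^esub> c = coset B c"
 by (auto simp: a_r_coset_def' coset_def fn_module_def)

locale fn_quotient =
 fixes Z B :: "('b \<Rightarrow> real) set"
 assumes Z: "fn_subspace Z" and B: "fn_subspace B" and BZ: "B \<subseteq> Z"
begin

abbreviation "Q \<equiv> quotient_module (fn_module Z) B"

lemma coset_eq: "coset B c = coset B d \<longleftrightarrow> (\<lambda>s. c s - d s) \<in> B"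
proof
 assume "coset B c = coset B d"
 moreover have "c \<in> coset B c" using fn_subspaceD(1)[OF B] by (force simp: coset_def)
 ultimately obtain b where "b \<in> B" "c = (\<lambda>s. b s + d s)" by (auto simp: coset_def)
 then show "(\<lambda>s. c s - d s) \<in> B" by simp
next
 have *: "coset B c \<subseteq> coset B d" if "(\<lambda>s. c s - d s) \<in> B" for c d
 proof
  fix x assume "x \<in> coset B c"
  then obtain b where b: "b \<in> B" "x = (\<lambda>s. b s + c s)" by (auto simp: coset_def)
  then have "(\<lambda>s. b s + (c s - d s)) \<in> B" using that fn_subspaceD(2)[OF B] by blast
  moreover have "x = (\<lambda>s. (b s + (c s - d s)) + d s)" using b by auto
  ultimately show "x \<in> coset B d" unfolding coset_def
   by (intro CollectI exI[of _ "\<lambda>s. b s + (c s - d s)"] conjI)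
 qed
 assume "(\<lambda>s. c s - d s) \<in> B"
 moreover from this have "(\<lambda>s. d s - c s) \<in> B" using fn_subspaceD(4)[OF B] by fastforce
 ultimately show "coset B c = coset B d" using * by blast
qed

lemma coset_self: "c \<in> coset B c"
 using fn_subspaceD(1)[OF B] by (force simp: coset_def)

lemma mem_coset: "d \<in> coset B c \<Longrightarrow> coset B d = coset B c"
 unfolding coset_eq by (auto simp: coset_def)

lemma coset_zero: "coset B (\<lambda>s. 0) = B"
 by (auto simp: coset_def)

lemma coset_eq_zero: "coset B c = B \<longleftrightarrow> c \<in> B"
 using coset_eq[of c "\<lambda>s. 0"] by (simp add: coset_zero)

lemma Q_carrier: "carrier Q = coset B ` Z"
 unfolding quotient_module_def A_RCOSETS_def' by (simp add: a_r_coset_fn) (auto simp: fn_module_def)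

lemma Q_zero: "\<zero>\<^bsub>Q\<^esub> = coset B (\<lambda>s. 0)"
 by (simp add: quotient_module_def coset_zero)

lemma Q_add: "coset B c \<oplus>\<^bsub>Q\<^esub> coset B d = coset B (\<lambda>s. c s + d s)"
proof -
 have "coset B c \<oplus>\<^bsub>Q\<^esub> coset B d = {(\<lambda>s. x s + y s) | x y. x \<in> coset B c \<and> y \<in> coset B d}"
  by (auto simp: quotient_module_def set_add_def' fn_module_def)
 also have "\<dots> = coset B (\<lambda>s. c s + d s)"
 proof safe
  fix x y assume "x \<in> coset B c" "y \<in> coset B d"
  then obtain a b where "a \<in> B" "b \<in> B" "x = (\<lambda>s. a s + c s)" "y = (\<lambda>s. b s + d s)" by (auto simp: coset_def)
  then show "(\<lambda>s. x s + y s) \<in> coset B (\<lambda>s. c s + d s)"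
   unfolding coset_def using fn_subspaceD(2)[OF B, of a b]
   by (intro CollectI exI[of _ "\<lambda>s. a s + b s"]) auto
 next
  fix x assume "x \<in> coset B (\<lambda>s. c s + d s)"
  then obtain b where b: "b \<in> B" "x = (\<lambda>s. b s + (c s + d s))" by (auto simp: coset_def)
  then have "(\<lambda>s. b s + c s) \<in> coset B c" by (auto simp: coset_def)
  then show "\<exists>y z. x = (\<lambda>s. y s + z s) \<and> y \<in> coset B c \<and> z \<in> coset B d"
   using b coset_self[of d] by (intro exI[of _ "\<lambda>s. b s + c s"] exI[of _ d]) auto
 qed
 finally show ?thesis .
qed

lemma Q_smult: "r \<odot>\<^bsub>Q\<^esub> coset B c = coset B (\<lambda>s. r * c s)"
proof -
 have "r \<odot>\<^bsub>Q\<^esub> coset B c = (\<Union>x\<in>coset B c. coset B (\<lambda>s. r * x s))"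
  by (simp add: quotient_module_def a_r_coset_fn) (simp add: fn_module_def)
 also have "\<dots> = coset B (\<lambda>s. r * c s)"
 proof -
  have "coset B (\<lambda>s. r * x s) = coset B (\<lambda>s. r * c s)" if x: "x \<in> coset B c" for x
  proof -
   obtain b where "b \<in> B" "x = (\<lambda>s. b s + c s)" using x by (auto simp: coset_def)
   then show ?thesis unfolding coset_eq using fn_subspaceD(3)[OF B, of b r] by (simp add: algebra_simps)
  qed
  then show ?thesis using coset_self by blast
 qed
 finally show ?thesis .
qed

lemma Q_module: "module RR Q"
proof (rule moduleI)
 show "cring RR" by (rule cring_RR)
 show "abelian_group Q"
 proof (rule abelian_groupI)
  fix x y z assume "x \<in> carrier Q" "y \<in> carrier Q" "z \<in> carrier Q"
  then show "x \<oplus>\<^bsub>Q\<^esub> y \<oplus>\<^bsub>Q\<^esub> z = x \<oplus>\<^bsub>Q\<^esub> (y \<oplus>\<^bsub>Q\<^esub> z)"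
   unfolding Q_carrier by (auto simp: Q_add add.assoc)
 next
  fix x y assume "x \<in> carrier Q" "y \<in> carrier Q"
  then show "x \<oplus>\<^bsub>Q\<^esub> y = y \<oplus>\<^bsub>Q\<^esub> x" "x \<oplus>\<^bsub>Q\<^esub> y \<in> carrier Q"
   unfolding Q_carrier using fn_subspaceD(2)[OF Z] by (auto simp: Q_add add.commute)
 next
  show "\<zero>\<^bsub>Q\<^esub> \<in> carrier Q" unfolding Q_carrier Q_zero using fn_subspaceD(1)[OF Z] by blast
 next
  fix x assume x: "x \<in> carrier Q"
  then show "\<zero>\<^bsub>Q\<^esub> \<oplus>\<^bsub>Q\<^esub> x = x" unfolding Q_carrier Q_zero by (auto simp: Q_add)
  from x obtain c where c: "c \<in> Z" "x = coset B c" unfolding Q_carrier by blast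
  then have "coset B (\<lambda>s. - c s) \<in> carrier Q" unfolding Q_carrier using fn_subspaceD(4)[OF Z] by blast
  moreover have "coset B (\<lambda>s. - c s) \<oplus>\<^bsub>Q\<^esub> x = \<zero>\<^bsub>Q\<^esub>" unfolding c Q_add Q_zero by simp
  ultimately show "\<exists>y\<in>carrier Q. y \<oplus>\<^bsub>Q\<^esub> x = \<zero>\<^bsub>Q\<^esub>" by blast
 qed
qed (unfold Q_carrier, auto simp: Q_add Q_smult algebra_simps intro: fn_subspaceD(3)[OF Z])

interpretation Q: module RR Q by (rule Q_module)

lemma span_empty: "module.span RR Q {} = {\<zero>\<^bsub>Q\<^esub>}"
 by (auto simp: Q.span_def Q.lincomb_def)

lemma Q_lincomb_single: "x \<in> carrier Q \<Longrightarrow> Q.lincomb a {x} = a x \<odot>\<^bsub>Q\<^esub> x"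
 unfolding Q.lincomb_def by (subst Q.M.finsum_insert) auto

lemma span_single:
 assumes "c \<in> Z" shows "module.span RR Q {coset B c} = {coset B (\<lambda>s. r * c s) | r. True}"
proof -
 have c: "coset B c \<in> carrier Q" using assms by (auto simp: Q_carrier)
 have "Q.span {coset B c} = {Q.lincomb a {coset B c} | a. a \<in> {coset B c} \<rightarrow> carrier RR}"
  by (rule Q.finite_span) (use c in auto)
 also have "\<dots> = {r \<odot>\<^bsub>Q\<^esub> coset B c | r. True}"
  using Q_lincomb_single[OF c] by auto
 finally show ?thesis by (simp add: Q_smult)
qed

lemma lin_indep_single:
 assumes "c \<in> Z" "c \<notin> B" shows "\<not> module.lin_dep RR Q {coset B c}"
proof
 have c: "coset B c \<in> carrier Q" using assms by (auto simp: Q_carrier)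
 assume "module.lin_dep RR Q {coset B c}"
 then obtain A a v where A: "A \<subseteq> {coset B c}" "Q.lincomb a A = \<zero>\<^bsub>Q\<^esub>" "v \<in> A" "a v \<noteq> 0"
  unfolding Q.lin_dep_def by auto
 then have "A = {coset B c}" "v = coset B c" by auto
 with A have "coset B (\<lambda>s. a v * c s) = B" "a v \<noteq> 0"
  using Q_lincomb_single[OF c] by (auto simp: Q_smult Q_zero coset_zero)
 then have "(\<lambda>s. a v * c s) \<in> B" "a v \<noteq> 0" by (auto simp: coset_eq_zero)
 then have "(\<lambda>s. inverse (a v) * (a v * c s)) \<in> B" using fn_subspaceD(3)[OF B] by blast
 with \<open>a v \<noteq> 0\<close> assms(2) show False by (simp add: mult.assoc[symmetric])
qed

text \<open>A line is free, so it is its own unique maximal free submodule; and over a field a nonzero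
  element is divisible by units only.\<close>

lemma suitable_basis_line:
 assumes g: "g \<in> Z" "g \<notin> B" and line: "\<And>c. c \<in> Z \<Longrightarrow> \<exists>r. (\<lambda>s. c s - r * g s) \<in> B"
 shows "suitable_basis RR Q {coset B g}"
  and "module.span RR Q {coset B g} = carrier Q"
proof -
 have gQ: "coset B g \<in> carrier Q" using g by (auto simp: Q_carrier)
 show span: "module.span RR Q {coset B g} = carrier Q"
 proof
  show "module.span RR Q {coset B g} \<subseteq> carrier Q" by (rule Q.span_is_subset2) (use gQ in auto)
  show "carrier Q \<subseteq> module.span RR Q {coset B g}"
  proof
   fix x assume "x \<in> carrier Q"
   then obtain c where c: "c \<in> Z" "x = coset B c" by (auto simp: Q_carrier)
   from line[OF c(1)] obtain r where "(\<lambda>s. c s - r * g s) \<in> B" by blast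
   then have "x = coset B (\<lambda>s. r * g s)" using coset_eq[of c "\<lambda>s. r * g s"] c by simp
   then show "x \<in> module.span RR Q {coset B g}" unfolding span_single[OF g(1)] by blast
  qed
 qed
 have fb: "free_basis RR Q {coset B g} (carrier Q)"
  unfolding free_basis_def using gQ lin_indep_single[OF g] span by simp
 have sub: "L \<subseteq> carrier Q" if "free_basis RR Q S L" for S L
  using that Q.span_is_subset2[of S] unfolding free_basis_def by blast
 have max: "maximal_free_submodule RR Q (carrier Q)"
  unfolding maximal_free_submodule_def using fb sub by blast
 have uniq: "L = carrier Q" if "maximal_free_submodule RR Q L" for L
  using that fb sub unfolding maximal_free_submodule_def by metis
 show "suitable_basis RR Q {coset B g}"
  unfolding suitable_basis_def
 proof (intro conjI ballI impI)
  show "\<exists>!L. maximal_free_submodule RR Q L" using max uniq by blast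
  show "\<exists>L. maximal_free_submodule RR Q L \<and> free_basis RR Q {coset B g} L" using max fb by blast
  fix e r x assume e: "e \<in> {coset B g}" "r \<in> carrier RR" "x \<in> carrier Q" "e = r \<odot>\<^bsub>Q\<^esub> x"
  then obtain c where c: "c \<in> Z" "x = coset B c" by (auto simp: Q_carrier)
  have "r \<noteq> 0"
  proof
   assume "r = 0"
   then have "coset B g = coset B (\<lambda>s. 0)" using e c by (simp add: Q_smult)
   then show False using g(2) coset_eq_zero by (simp add: coset_zero)
  qed
  then show "r \<in> Units RR" by (rule Units_RR)
 qed simp
qed

end

section \<open>From integral to real homology\<close>

interpretation ratvs: vector_space "\<lambda>(q::rat) (r::real). of_rat q * r"
 by unfold_locales (auto simp: algebra_simps of_rat_add of_rat_mult)

lemma common_denominator: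
 fixes u :: "'i \<Rightarrow> rat"
 assumes "finite I"
 shows "\<exists>D::int. D > 0 \<and> (\<forall>i\<in>I. \<exists>n::int. of_int n = of_int D * u i)"
 using assms
proof (induction I rule: finite_induct)
 case empty show ?case by (intro exI[of _ 1]) auto
next
 case (insert i I)
 then obtain D :: int where D: "D > 0" "\<And>j. j \<in> I \<Longrightarrow> \<exists>n::int. of_int n = of_int D * u j" by blast
 obtain a b where q: "quotient_of (u i) = (a, b)" by (cases "quotient_of (u i)")
 then have ab: "u i = of_int a / of_int b" "b > 0"
  using quotient_of_div quotient_of_denom_pos by blast+
 have 1: "\<exists>n::int. of_int n = of_int (D * b) * u j" if j: "j \<in> I" for j
 proof -
  obtain n :: int where "of_int n = of_int D * u j" using D(2)[OF j] by blast
  then show ?thesis by (intro exI[of _ "b * n"]) (simp add: ac_simps)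
 qed
 have 2: "\<exists>n::int. of_int n = of_int (D * b) * u i"
  using ab by (intro exI[of _ "D * a"]) simp
 have 3: "D * b > 0" using D ab by simp
 show ?case using 1 2 3 by blast
qed

text \<open>Choose a maximal subset of the given reals that is linearly independent over the rationals,
  and clear the denominators of the coefficients. An integral relation among the elements of the
  resulting set is trivial.\<close>

lemma real_combination_of_integral:
 fixes T :: "real set"
 assumes "finite T"
 obtains B :: "real set" and n :: "real \<Rightarrow> real \<Rightarrow> int" where "finite B"
  "\<And>t. t \<in> T \<Longrightarrow> t = (\<Sum>b\<in>B. of_int (n t b) * b)"
  "\<And>m :: real \<Rightarrow> int. (\<Sum>b\<in>B. of_int (m b) * b) = 0 \<Longrightarrow> (\<forall>b\<in>B. m b = 0)"
proof -
 obtain B0 where B0: "B0 \<subseteq> T" "ratvs.independent B0" "T \<subseteq> ratvs.span B0"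
  using ratvs.maximal_independent_subset[of T] by blast
 have fB0: "finite B0" using B0(1) assms finite_subset by blast
 have "\<exists>u. t = (\<Sum>b\<in>B0. of_rat (u b) * b)" if "t \<in> T" for t
  using B0(3) that ratvs.span_finite[OF fB0] by auto
 then obtain u where u: "\<And>t. t \<in> T \<Longrightarrow> t = (\<Sum>b\<in>B0. of_rat (u t b) * b)" by metis
 obtain D :: int where D: "D > 0" "\<And>t b. t \<in> T \<Longrightarrow> b \<in> B0 \<Longrightarrow> \<exists>n::int. of_int n = of_int D * u t b"
  using common_denominator[of "T \<times> B0" "\<lambda>(t, b). u t b"] assms fB0 by auto
 then obtain k :: "real \<Rightarrow> real \<Rightarrow> int" where k: "\<And>t b. t \<in> T \<Longrightarrow> b \<in> B0 \<Longrightarrow> of_int (k t b) = of_int D * u t b"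
  by metis
 define sc where "sc b = b / of_int D" for b :: real
 have inj: "inj_on sc B0" using D(1) by (auto simp: sc_def inj_on_def)
 have unsc: "sc b * of_int D = b" for b using D(1) by (simp add: sc_def)
 have kr: "real_of_int (k t b) = of_int D * of_rat (u t b)" if "t \<in> T" "b \<in> B0" for t b
  using arg_cong[OF k[OF that], of "of_rat :: rat \<Rightarrow> real"] by (simp add: of_rat_mult)
 show ?thesis
 proof (rule that[of "sc ` B0" "\<lambda>t b. k t (b * of_int D)"])
  show "finite (sc ` B0)" using fB0 by simp
  fix t assume t: "t \<in> T"
  have "(\<Sum>b\<in>sc ` B0. of_int (k t (b * of_int D)) * b) = (\<Sum>b\<in>B0. of_int (k t b) * sc b)"
   using inj by (simp add: sum.reindex unsc)
  also have "\<dots> = (\<Sum>b\<in>B0. of_rat (u t b) * b)"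
   by (rule sum.cong) (use t kr D(1) in \<open>auto simp: sc_def\<close>)
  finally show "t = (\<Sum>b\<in>sc ` B0. of_int (k t (b * of_int D)) * b)" using u[OF t] by simp
 next
  fix m :: "real \<Rightarrow> int"
  assume "(\<Sum>b\<in>sc ` B0. of_int (m b) * b) = 0"
  then have "(\<Sum>b\<in>B0. of_int (m (sc b)) * sc b) = 0" using inj by (simp add: sum.reindex)
  then have "(\<Sum>b\<in>B0. of_int (m (sc b)) * sc b) * of_int D = 0" by simp
  then have "(\<Sum>b\<in>B0. of_int (m (sc b)) * b) = 0"
   by (simp add: sum_distrib_right mult.assoc unsc)
  then have *: "(\<Sum>b\<in>B0. of_rat (of_int (m (sc b))) * b) = 0" by simp
  have "of_int (m (sc b)) = (0::rat)" if "b \<in> B0" for b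
   using ratvs.independentD[OF B0(2) fB0 subset_refl * that] .
  then show "\<forall>b\<in>sc ` B0. m b = 0" by auto
 qed
qed

section \<open>Singular chains with real coefficients\<close>

abbreviation supp :: "('b \<Rightarrow> real) \<Rightarrow> 'b set" where "supp c \<equiv> {s. c s \<noteq> 0}"

definition chains :: "nat \<Rightarrow> 'a topology \<Rightarrow> ('a, real) cochain set" where
 "chains p X = {c. finite (supp c) \<and> supp c \<subseteq> singular_simplex_set p X}"

lemma carrier_chain_module: "carrier (chain_module RR p X) = chains p X"
 by (auto simp: chain_module_def chains_def)

lemma chain_module_fn: "(chain_module RR p X)\<lparr>carrier := Z\<rparr> = fn_module Z"
 by (simp add: chain_module_def fn_module_def)

lemma chains_sub: "fn_subspace (chains p X)"
 unfolding fn_subspace_def chains_def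
proof (intro conjI ballI allI)
 fix c d :: "('a, real) cochain"
 assume "c \<in> {c. finite (supp c) \<and> supp c \<subseteq> singular_simplex_set p X}" "d \<in> {c. finite (supp c) \<and> supp c \<subseteq> singular_simplex_set p X}"
 moreover have "supp (\<lambda>s. c s + d s) \<subseteq> supp c \<union> supp d" by auto
 ultimately show "(\<lambda>s. c s + d s) \<in> {c. finite (supp c) \<and> supp c \<subseteq> singular_simplex_set p X}"
  by (auto intro: finite_subset)
next
 fix r and c :: "('a, real) cochain"
 assume "c \<in> {c. finite (supp c) \<and> supp c \<subseteq> singular_simplex_set p X}"
 moreover have "supp (\<lambda>s. r * c s) \<subseteq> supp c" by auto
 ultimately show "(\<lambda>s. r * c s) \<in> {c. finite (supp c) \<and> supp c \<subseteq> singular_simplex_set p X}"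
  by (auto intro: finite_subset)
qed simp

lemma chains_mono: "(\<And>\<sigma>. singular_simplex p X \<sigma> \<Longrightarrow> singular_simplex p Y \<sigma>) \<Longrightarrow> chains p X \<subseteq> chains p Y"
 by (auto simp: chains_def)

lemma chain_bd_eq:
 assumes "p > 0" "finite T" "supp c \<subseteq> T"
 shows "chain_bd RR p c \<tau> = (\<Sum>\<sigma>\<in>T. \<Sum>k\<le>p. if singular_face p k \<sigma> = \<tau> then (-1) ^ k * c \<sigma> else 0)"
proof -
 have "chain_bd RR p c \<tau> = (\<Sum>\<sigma>\<in>supp c. \<Sum>k\<in>{k. k \<le> p \<and> singular_face p k \<sigma> = \<tau>}. (-1) ^ k * c \<sigma>)"
  using assms(1) by (simp add: chain_bd_def)
 also have "\<dots> = (\<Sum>\<sigma>\<in>supp c. \<Sum>k\<le>p. if singular_face p k \<sigma> = \<tau> then (-1) ^ k * c \<sigma> else 0)"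
 proof (rule sum.cong[OF refl])
  fix \<sigma>
  have "{k. k \<le> p \<and> singular_face p k \<sigma> = \<tau>} = {k \<in> {..p}. singular_face p k \<sigma> = \<tau>}" by auto
  then show "(\<Sum>k\<in>{k. k \<le> p \<and> singular_face p k \<sigma> = \<tau>}. (-1) ^ k * c \<sigma>) = (\<Sum>k\<le>p. if singular_face p k \<sigma> = \<tau> then (-1) ^ k * c \<sigma> else 0)"
   by (simp only:) (rule sum.inter_filter, simp)
 qed
 also have "\<dots> = (\<Sum>\<sigma>\<in>T. \<Sum>k\<le>p. if singular_face p k \<sigma> = \<tau> then (-1) ^ k * c \<sigma> else 0)"
  by (rule sum.mono_neutral_left) (use assms in auto)
 finally show ?thesis .
qed

lemma chain_bd_0: "chain_bd RR 0 c = (\<lambda>\<tau>. 0)"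
 by (auto simp: chain_bd_def)

lemma chain_bd_add:
 assumes "finite (supp c)" "finite (supp d)"
 shows "chain_bd RR p (\<lambda>s. c s + d s) = (\<lambda>\<tau>. chain_bd RR p c \<tau> + chain_bd RR p d \<tau>)"
proof (cases "p = 0")
 case False
 then have p: "p > 0" by simp
 have T: "finite (supp c \<union> supp d)" using assms by simp
 show ?thesis
 proof
  fix \<tau>
  have "chain_bd RR p (\<lambda>s. c s + d s) \<tau> = (\<Sum>\<sigma>\<in>supp c \<union> supp d. \<Sum>k\<le>p. if singular_face p k \<sigma> = \<tau> then (-1) ^ k * (c \<sigma> + d \<sigma>) else 0)"
   by (rule chain_bd_eq[OF p T]) auto
  also have "\<dots> = chain_bd RR p c \<tau> + chain_bd RR p d \<tau>"
   unfolding chain_bd_eq[OF p T Un_upper1] chain_bd_eq[OF p T Un_upper2] sum.distrib[symmetric]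
   by (intro sum.cong refl) (auto simp: algebra_simps)
  finally show "chain_bd RR p (\<lambda>s. c s + d s) \<tau> = chain_bd RR p c \<tau> + chain_bd RR p d \<tau>" .
 qed
qed (simp add: chain_bd_0)

lemma chain_bd_scale:
 assumes "finite (supp c)"
 shows "chain_bd RR p (\<lambda>s. r * c s) = (\<lambda>\<tau>. r * chain_bd RR p c \<tau>)"
proof (cases "p = 0")
 case False
 then have p: "p > 0" by simp
 show ?thesis
 proof
  fix \<tau>
  have A: "chain_bd RR p (\<lambda>s. r * c s) \<tau> = (\<Sum>\<sigma>\<in>supp c. \<Sum>k\<le>p. if singular_face p k \<sigma> = \<tau> then (-1) ^ k * (r * c \<sigma>) else 0)"
   by (rule chain_bd_eq[OF p assms]) auto
  show "chain_bd RR p (\<lambda>s. r * c s) \<tau> = r * chain_bd RR p c \<tau>"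
   unfolding A chain_bd_eq[OF p assms subset_refl] sum_distrib_left
   by (intro sum.cong refl) auto
 qed
qed (simp add: chain_bd_0)

lemma finite_supp_sum:
 assumes "finite I" "\<And>i. i \<in> I \<Longrightarrow> finite (supp (f i))"
 shows "finite (supp (\<lambda>s. \<Sum>i\<in>I. r i * f i s))"
proof (rule finite_subset)
 show "supp (\<lambda>s. \<Sum>i\<in>I. r i * f i s) \<subseteq> (\<Union>i\<in>I. supp (f i))"
 proof
  fix s assume "s \<in> supp (\<lambda>s. \<Sum>i\<in>I. r i * f i s)"
  then have "(\<Sum>i\<in>I. r i * f i s) \<noteq> 0" by simp
  then obtain i where "i \<in> I" "r i * f i s \<noteq> 0" by (rule sum.not_neutral_contains_not_neutral)
  then show "s \<in> (\<Union>i\<in>I. supp (f i))" by auto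
 qed
qed (use assms in auto)

lemma chain_bd_sum:
 assumes "finite I" "\<And>i. i \<in> I \<Longrightarrow> finite (supp (f i))"
 shows "chain_bd RR p (\<lambda>s. \<Sum>i\<in>I. r i * f i s) = (\<lambda>\<tau>. \<Sum>i\<in>I. r i * chain_bd RR p (f i) \<tau>)"
 using assms
proof (induction I rule: finite_induct)
 case empty
 have "chain_bd RR p (\<lambda>s. 0) = (\<lambda>\<tau>. 0)" by (auto simp: chain_bd_def)
 then show ?case by simp
next
 case (insert i I)
 have "finite (supp (\<lambda>s. \<Sum>i\<in>I. r i * f i s))"
  by (rule finite_supp_sum) (use insert in auto)
 moreover have "finite (supp (\<lambda>s. r i * f i s))"
  by (rule finite_subset[of _ "supp (f i)"]) (use insert in auto)
 ultimately have "chain_bd RR p (\<lambda>s. r i * f i s + (\<Sum>i\<in>I. r i * f i s)) = (\<lambda>\<tau>. r i * chain_bd RR p (f i) \<tau> + (\<Sum>i\<in>I. r i * chain_bd RR p (f i) \<tau>))"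
  using insert by (simp add: chain_bd_add chain_bd_scale)
 then show ?case using insert by simp
qed

definition rl :: "('b \<Rightarrow>\<^sub>0 int) \<Rightarrow> 'b \<Rightarrow> real" where
 "rl z = (\<lambda>s. real_of_int (Poly_Mapping.lookup z s))"

lemma supp_rl: "supp (rl z) = Poly_Mapping.keys z"
 by (auto simp: rl_def in_keys_iff)

lemma rl_chains: "rl z \<in> chains p X \<longleftrightarrow> singular_chain p X z"
 by (auto simp: chains_def supp_rl singular_chain_def)

lemma rl_simps: "rl 0 = (\<lambda>s. 0)" "rl (a + b) = (\<lambda>s. rl a s + rl b s)" "rl (a - b) = (\<lambda>s. rl a s - rl b s)"
 "rl (frag_cmul k a) = (\<lambda>s. of_int k * rl a s)"
 by (auto simp: rl_def lookup_add lookup_minus)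

lemma rl_sum: "rl (\<Sum>i\<in>I. f i) = (\<lambda>s. \<Sum>i\<in>I. rl (f i) s)"
 by (induction I rule: infinite_finite_induct) (auto simp: rl_simps)

lemma rl_of: "rl (frag_of \<sigma>) = (\<lambda>\<tau>. if \<sigma> = \<tau> then 1 else 0)"
 by (auto simp: rl_def lookup_single when_def)

lemma chain_bd_of:
 assumes "p > 0" shows "chain_bd RR p (rl (frag_of \<sigma>)) = rl (chain_boundary p (frag_of \<sigma>))"
proof
 fix \<tau>
 have "supp (rl (frag_of \<sigma>)) \<subseteq> {\<sigma>}" by (auto simp: rl_of)
 then show "chain_bd RR p (rl (frag_of \<sigma>)) \<tau> = rl (chain_boundary p (frag_of \<sigma>)) \<tau>"
  using assms by (subst chain_bd_eq[of p "{\<sigma>}"])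
   (auto simp: chain_boundary_of rl_sum rl_simps rl_of intro!: sum.cong)
qed

lemma chain_eq_sum:
 assumes "finite (supp c)" shows "c = (\<lambda>s. \<Sum>\<sigma>\<in>supp c. c \<sigma> * rl (frag_of \<sigma>) s)"
proof
 fix s
 have "(\<Sum>\<sigma>\<in>supp c. c \<sigma> * rl (frag_of \<sigma>) s) = (\<Sum>\<sigma>\<in>supp c. if \<sigma> = s then c \<sigma> else 0)"
  by (intro sum.cong refl) (simp add: rl_of)
 also have "\<dots> = c s" using assms by (simp add: sum.delta')
 finally show "c s = (\<Sum>\<sigma>\<in>supp c. c \<sigma> * rl (frag_of \<sigma>) s)" by simp
qed

lemma finite_supp_rl: "finite (supp (rl z))" by (simp add: supp_rl)

lemma chain_bd_expand:
 assumes "finite (supp c)" "p > 0"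
 shows "chain_bd RR p c = (\<lambda>\<tau>. \<Sum>\<sigma>\<in>supp c. c \<sigma> * rl (chain_boundary p (frag_of \<sigma>)) \<tau>)"
 by (subst chain_eq_sum[OF assms(1)], subst chain_bd_sum[OF assms(1) finite_supp_rl])
  (simp add: chain_bd_of[OF assms(2)])

lemma rl_chain_boundary: "chain_bd RR p (rl z) = rl (chain_boundary p z)"
proof (cases "p = 0")
 case False
 have z: "z = (\<Sum>\<sigma>\<in>Poly_Mapping.keys z. frag_cmul (Poly_Mapping.lookup z \<sigma>) (frag_of \<sigma>))"
  by (rule frag_expansion[unfolded frag_extend_def, simplified o_def])
 have "rl (chain_boundary p z) = (\<lambda>\<tau>. \<Sum>\<sigma>\<in>supp (rl z). rl z \<sigma> * rl (chain_boundary p (frag_of \<sigma>)) \<tau>)"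
  by (subst z) (simp add: chain_boundary_sum chain_boundary_cmul rl_sum rl_simps supp_rl, simp add: rl_def)
 then show ?thesis using False chain_bd_expand[OF finite_supp_rl[of z], of p] by simp
qed (simp add: chain_bd_0 chain_boundary_def rl_simps)

lemma chain_bd_chains:
 assumes "c \<in> chains p X" shows "chain_bd RR p c \<in> chains (p - 1) X"
proof (cases "p = 0")
 case False
 have c: "finite (supp c)" "supp c \<subseteq> singular_simplex_set p X" using assms by (auto simp: chains_def)
 have "chain_bd RR p c = (\<lambda>\<tau>. \<Sum>\<sigma>\<in>supp c. c \<sigma> * rl (chain_boundary p (frag_of \<sigma>)) \<tau>)"
  using chain_bd_expand[OF c(1)] False by simp
 also have "\<dots> \<in> chains (p - 1) X"
 proof (rule fn_subspace_sum[OF chains_sub])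
  fix \<sigma> assume "\<sigma> \<in> supp c"
  then have "singular_chain p X (frag_of \<sigma>)" using c(2) by (auto simp: singular_chain_of)
  then show "rl (chain_boundary p (frag_of \<sigma>)) \<in> chains (p - 1) X"
   unfolding rl_chains by (simp add: singular_chain_boundary)
 qed
 finally show ?thesis .
qed (simp add: chain_bd_0 fn_subspaceD(1)[OF chains_sub])

text \<open>The real boundary is the linear extension of the boundary of integral chains, for which this
  is known.\<close>

lemma chain_bd_bd:
 assumes "c \<in> chains (Suc p) X" shows "chain_bd RR p (chain_bd RR (Suc p) c) = (\<lambda>\<tau>. 0)"
proof -
 have c: "finite (supp c)" "supp c \<subseteq> singular_simplex_set (Suc p) X" using assms by (auto simp: chains_def)
 have "chain_bd RR p (chain_bd RR (Suc p) c) = (\<lambda>\<tau>. \<Sum>\<sigma>\<in>supp c. c \<sigma> * chain_bd RR p (rl (chain_boundary (Suc p) (frag_of \<sigma>))) \<tau>)"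
  by (subst chain_bd_expand[OF c(1)]) (simp_all add: chain_bd_sum[OF c(1) finite_supp_rl])
 also have "\<dots> = (\<lambda>\<tau>. 0)"
 proof
  fix \<tau>
  have "chain_boundary p (chain_boundary (Suc p) (frag_of \<sigma>)) = 0" if "\<sigma> \<in> supp c" for \<sigma>
   by (rule chain_boundary_boundary_alt[of _ X]) (use that c(2) in \<open>auto simp: singular_chain_of\<close>)
  then show "(\<Sum>\<sigma>\<in>supp c. c \<sigma> * chain_bd RR p (rl (chain_boundary (Suc p) (frag_of \<sigma>))) \<tau>) = 0"
   by (intro sum.neutral) (simp add: rl_chain_boundary rl_simps)
 qed
 finally show ?thesis .
qed

abbreviation cyc :: "nat \<Rightarrow> 'a topology \<Rightarrow> ('a, real) cochain set" where "cyc \<equiv> cycles RR"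
abbreviation bdr :: "nat \<Rightarrow> 'a topology \<Rightarrow> ('a, real) cochain set" where "bdr \<equiv> boundaries RR"

lemma cyc_eq: "cyc p X = {c \<in> chains p X. chain_bd RR p c = (\<lambda>\<tau>. 0)}"
 by (simp add: cycles_def carrier_chain_module)

lemma bdr_eq: "bdr p X = chain_bd RR (Suc p) ` chains (Suc p) X"
 by (simp add: boundaries_def carrier_chain_module)

lemma chains_finite: "c \<in> chains p X \<Longrightarrow> finite (supp c)" by (simp add: chains_def)

lemma cyc_sub: "fn_subspace (cyc p X)"
proof -
 note C = fn_subspaceD[OF chains_sub[of p X]]
 have "chain_bd RR p (\<lambda>_. 0) = (\<lambda>\<tau>. 0)" by (auto simp: chain_bd_def)
 then show ?thesis unfolding fn_subspace_def cyc_eq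
  using C chains_finite[of _ p X] by (auto simp: chain_bd_add chain_bd_scale)
qed

lemma bdr_sub: "fn_subspace (bdr p X)"
 unfolding fn_subspace_def bdr_eq
proof (intro conjI ballI allI)
 note C = fn_subspaceD[OF chains_sub[of "Suc p" X]]
 have "chain_bd RR (Suc p) (\<lambda>_. 0) = (\<lambda>\<tau>. 0)" by (auto simp: chain_bd_def)
 from image_eqI[where f = "chain_bd RR (Suc p)", OF this[symmetric] C(1)] show "(\<lambda>_. 0) \<in> chain_bd RR (Suc p) ` chains (Suc p) X" .
 fix c assume "c \<in> chain_bd RR (Suc p) ` chains (Suc p) X"
 then obtain c' where c': "c' \<in> chains (Suc p) X" "c = chain_bd RR (Suc p) c'" by blast
 show "(\<lambda>s. r * c s) \<in> chain_bd RR (Suc p) ` chains (Suc p) X" for r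
  by (rule image_eqI[of _ _ "\<lambda>s. r * c' s"]) (simp_all add: c' C(3) chain_bd_scale[OF chains_finite[OF c'(1)]])
 fix d assume "d \<in> chain_bd RR (Suc p) ` chains (Suc p) X"
 then obtain d' where d': "d' \<in> chains (Suc p) X" "d = chain_bd RR (Suc p) d'" by blast
 show "(\<lambda>s. c s + d s) \<in> chain_bd RR (Suc p) ` chains (Suc p) X"
  by (rule image_eqI[of _ _ "\<lambda>s. c' s + d' s"]) (simp_all add: c' d' C(2) chain_bd_add[OF chains_finite[OF c'(1)] chains_finite[OF d'(1)]])
qed

lemma bdr_cyc: "bdr p X \<subseteq> cyc p X"
proof
 fix b assume "b \<in> bdr p X"
 then obtain c where c: "c \<in> chains (Suc p) X" "b = chain_bd RR (Suc p) c" unfolding bdr_eq by blast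
 then show "b \<in> cyc p X" unfolding cyc_eq using chain_bd_chains[OF c(1)] chain_bd_bd[OF c(1)] by simp
qed

lemma homology_quotient: "fn_quotient (cyc p X) (bdr p X)"
 by unfold_locales (rule cyc_sub bdr_sub bdr_cyc)+

lemma homology_module_eq: "homology_module RR p X = quotient_module (fn_module (cyc p X)) (bdr p X)"
 by (simp add: homology_module_def chain_module_fn)

lemma hclass_coset: "hclass RR p X c = coset (bdr p X) c"
proof -
 have "add (chain_module RR p X) = add (fn_module (cyc p X))" by (simp add: chain_module_def fn_module_def)
 then show ?thesis unfolding hclass_def using a_r_coset_fn[where B = "bdr p X" and Z = "cyc p X" and c = c]
  by (simp add: a_r_coset_def')
qed

lemma evaluate_eq:
 assumes "finite T" "supp c \<subseteq> T" shows "evaluate RR \<phi> c = (\<Sum>\<sigma>\<in>T. \<phi> \<sigma> * c \<sigma>)"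
proof -
 have "evaluate RR \<phi> c = (\<Sum>\<sigma>\<in>supp c. \<phi> \<sigma> * c \<sigma>)" by (simp add: evaluate_def)
 also have "\<dots> = (\<Sum>\<sigma>\<in>T. \<phi> \<sigma> * c \<sigma>)" by (rule sum.mono_neutral_left) (use assms in auto)
 finally show ?thesis .
qed

lemma evaluate_add:
 assumes "finite (supp c)" "finite (supp d)"
 shows "evaluate RR \<phi> (\<lambda>s. c s + d s) = evaluate RR \<phi> c + evaluate RR \<phi> d"
proof -
 have T: "finite (supp c \<union> supp d)" using assms by simp
 have A: "evaluate RR \<phi> (\<lambda>s. c s + d s) = (\<Sum>\<sigma>\<in>supp c \<union> supp d. \<phi> \<sigma> * (c \<sigma> + d \<sigma>))"
  by (rule evaluate_eq[OF T]) auto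
 show ?thesis
  unfolding A evaluate_eq[OF T Un_upper1] evaluate_eq[OF T Un_upper2]
  by (simp add: sum.distrib distrib_left)
qed

lemma evaluate_scale:
 assumes "finite (supp c)" shows "evaluate RR \<phi> (\<lambda>s. r * c s) = r * evaluate RR \<phi> c"
proof -
 have A: "evaluate RR \<phi> (\<lambda>s. r * c s) = (\<Sum>\<sigma>\<in>supp c. \<phi> \<sigma> * (r * c \<sigma>))"
  by (rule evaluate_eq[OF assms]) auto
 show ?thesis
  unfolding A evaluate_eq[OF assms subset_refl] by (simp add: sum_distrib_left ac_simps)
qed

lemma evaluate_sum:
 assumes "finite I" "\<And>i. i \<in> I \<Longrightarrow> finite (supp (f i))"
 shows "evaluate RR \<phi> (\<lambda>s. \<Sum>i\<in>I. r i * f i s) = (\<Sum>i\<in>I. r i * evaluate RR \<phi> (f i))"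
 using assms
proof (induction I rule: finite_induct)
 case empty then show ?case by (simp add: evaluate_def)
next
 case (insert i I)
 have "finite (supp (\<lambda>s. \<Sum>i\<in>I. r i * f i s))"
  by (rule finite_supp_sum) (use insert in auto)
 moreover have "finite (supp (\<lambda>s. r i * f i s))"
  by (rule finite_subset[of _ "supp (f i)"]) (use insert in auto)
 ultimately have "evaluate RR \<phi> (\<lambda>s. r i * f i s + (\<Sum>i\<in>I. r i * f i s)) = r i * evaluate RR \<phi> (f i) + (\<Sum>i\<in>I. r i * evaluate RR \<phi> (f i))"
  using insert by (simp add: evaluate_add evaluate_scale)
 then show ?case using insert by simp
qed

lemma evaluate_of: "evaluate RR \<phi> (rl (frag_of \<sigma>)) = \<phi> \<sigma>"
 by (subst evaluate_eq[of "{\<sigma>}"]) (auto simp: rl_of)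

definition cobd :: "nat \<Rightarrow> ('a, real) cochain \<Rightarrow> ('a, real) cochain" where
 "cobd n \<phi> \<sigma> = (\<Sum>k\<le>n. (-1) ^ k * \<phi> (singular_face n k \<sigma>))"

lemma evaluate_bd:
 assumes "finite (supp c)" "p > 0"
 shows "evaluate RR \<phi> (chain_bd RR p c) = evaluate RR (cobd p \<phi>) c"
proof -
 have *: "evaluate RR \<phi> (rl (chain_boundary p (frag_of \<sigma>))) = cobd p \<phi> \<sigma>" for \<sigma>
 proof -
  have "rl (chain_boundary p (frag_of \<sigma>)) = (\<lambda>s. \<Sum>k\<le>p. (-1) ^ k * rl (frag_of (singular_face p k \<sigma>)) s)"
   using assms(2) by (simp add: chain_boundary_of rl_sum rl_simps)
  then show ?thesis
   by (simp add: evaluate_sum[OF finite_atMost finite_supp_rl] evaluate_of cobd_def)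
 qed
 have "evaluate RR \<phi> (chain_bd RR p c) = (\<Sum>\<sigma>\<in>supp c. c \<sigma> * cobd p \<phi> \<sigma>)"
  unfolding chain_bd_expand[OF assms] evaluate_sum[OF assms(1) finite_supp_rl] * ..
 then show ?thesis by (simp add: evaluate_def mult.commute)
qed

section \<open>Real homology of the circle and of contractible spaces\<close>

lemma lookup_frag_sum:
 assumes "finite S"
 shows "Poly_Mapping.lookup (\<Sum>\<sigma>\<in>S. frag_cmul (n \<sigma>) (frag_of \<sigma>)) \<tau> = (if \<tau> \<in> S then n \<tau> else 0)"
proof -
 have "Poly_Mapping.lookup (\<Sum>\<sigma>\<in>S. frag_cmul (n \<sigma>) (frag_of \<sigma>)) \<tau> = (\<Sum>\<sigma>\<in>S. n \<sigma> * (if \<sigma> = \<tau> then 1 else 0))"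
  by (auto simp: lookup_sum lookup_single when_def intro!: sum.cong)
 also have "\<dots> = (\<Sum>\<sigma>\<in>S. if \<sigma> = \<tau> then n \<sigma> else 0)" by (rule sum.cong) auto
 also have "\<dots> = (if \<tau> \<in> S then n \<tau> else 0)" using assms by (simp add: sum.delta)
 finally show ?thesis .
qed

text \<open>The coefficients of a real cycle are integral combinations of finitely many reals that are
  independent over the rationals. The boundary of the cycle is the corresponding combination of
  integral boundaries, so independence forces each of these to vanish.\<close>

lemma real_cycle_decomp:
 assumes c: "c \<in> cyc p X"
 shows "\<exists>B z. finite B \<and> (\<forall>b\<in>B. singular_relcycle p X {} (z b)) \<and> c = (\<lambda>s. \<Sum>b\<in>B. b * rl (z b) s)"
proof -
 have c1: "finite (supp c)" "supp c \<subseteq> singular_simplex_set p X" "chain_bd RR p c = (\<lambda>\<tau>. 0)"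
  using c by (auto simp: cyc_eq chains_def)
 obtain B :: "real set" and n :: "real \<Rightarrow> real \<Rightarrow> int" where B: "finite B"
  "\<And>t. t \<in> c ` supp c \<Longrightarrow> t = (\<Sum>b\<in>B. of_int (n t b) * b)"
  "\<And>m :: real \<Rightarrow> int. (\<Sum>b\<in>B. of_int (m b) * b) = 0 \<Longrightarrow> (\<forall>b\<in>B. m b = 0)"
  using real_combination_of_integral[OF finite_imageI[OF c1(1)]] by blast
 define z where "z b = (\<Sum>\<sigma>\<in>supp c. frag_cmul (n (c \<sigma>) b) (frag_of \<sigma>))" for b
 have look: "Poly_Mapping.lookup (z b) \<sigma> = (if c \<sigma> \<noteq> 0 then n (c \<sigma>) b else 0)" for b \<sigma>
  unfolding z_def lookup_frag_sum[OF c1(1)] by simp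
 have eq: "c = (\<lambda>s. \<Sum>b\<in>B. b * rl (z b) s)"
 proof
  fix s show "c s = (\<Sum>b\<in>B. b * rl (z b) s)"
  proof (cases "c s = 0")
   case True then show ?thesis by (simp add: rl_def look)
  next
   case False
   then have "c s = (\<Sum>b\<in>B. of_int (n (c s) b) * b)" by (intro B(2)) auto
   also have "\<dots> = (\<Sum>b\<in>B. b * rl (z b) s)" using False by (intro sum.cong refl) (simp add: rl_def look)
   finally show ?thesis .
  qed
 qed
 have chain: "singular_chain p X (z b)" for b
  unfolding z_def by (intro singular_chain_sum singular_chain_cmul) (use c1(2) in \<open>auto simp: singular_chain_of\<close>)
 have bd: "chain_boundary p (z b) = 0" if b: "b \<in> B" for b
 proof -
  have "(\<lambda>\<tau>. \<Sum>b\<in>B. b * rl (chain_boundary p (z b)) \<tau>) = chain_bd RR p c"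
   unfolding eq by (subst chain_bd_sum[OF B(1) finite_supp_rl]) (simp add: rl_chain_boundary)
  then have s0: "(\<Sum>b\<in>B. b * rl (chain_boundary p (z b)) \<tau>) = 0" for \<tau> unfolding c1(3) by (rule fun_cong)
  have "Poly_Mapping.lookup (chain_boundary p (z b)) \<tau> = 0" for \<tau>
  proof -
   have "(\<Sum>b\<in>B. of_int (Poly_Mapping.lookup (chain_boundary p (z b)) \<tau>) * b) = 0"
    using s0[of \<tau>] by (simp add: rl_def mult.commute)
   from B(3)[OF this] b show ?thesis by blast
  qed
  then show ?thesis by (simp add: poly_mapping_eq_iff fun_eq_iff)
 qed
 show ?thesis
 proof (rule exI[of _ B], rule exI[of _ z], intro conjI ballI)
  show "singular_relcycle p X {} (z b)" if "b \<in> B" for b by (simp add: singular_cycle chain bd[OF that])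
 qed (rule B(1), rule eq)
qed

lemma rl_boundary: "singular_relboundary p X {} z \<Longrightarrow> rl z \<in> bdr p X"
 unfolding singular_boundary bdr_eq by (auto simp: rl_chain_boundary[symmetric] rl_chains intro!: imageI)

lemma rl_cycle: "singular_relcycle p X {} z \<Longrightarrow> rl z \<in> cyc p X"
 unfolding singular_cycle cyc_eq by (simp add: rl_chains rl_chain_boundary rl_simps)

text \<open>A generator of the integral homology also generates the real homology, by the decomposition of
  real cycles into integral ones.\<close>

lemma cyc_generated:
 assumes gen: "\<And>z. singular_relcycle p X {} z \<Longrightarrow> \<exists>k. homologous_rel p X {} z (frag_cmul k g)"
  and c: "c \<in> cyc p X"
 shows "\<exists>r. (\<lambda>s. c s - r * rl g s) \<in> bdr p X"
proof -
 from real_cycle_decomp[OF c] obtain B :: "real set" and z where B0: "finite B" "\<forall>b\<in>B. singular_relcycle p X {} (z b)"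
  "c = (\<lambda>s. \<Sum>b\<in>B. b * rl (z b) s)" by (elim exE conjE)
 note B = B0(1) bspec[OF B0(2)] B0(3)
 obtain k where k: "\<And>b. b \<in> B \<Longrightarrow> homologous_rel p X {} (z b) (frag_cmul (k b) g)"
  using gen[OF B(2)] by metis
 have "(\<lambda>s. \<Sum>b\<in>B. b * rl (z b - frag_cmul (k b) g) s) \<in> bdr p X"
  by (rule fn_subspace_sum[OF bdr_sub]) (use k in \<open>auto simp: homologous_rel_def intro: rl_boundary\<close>)
 moreover have "(\<lambda>s. \<Sum>b\<in>B. b * rl (z b - frag_cmul (k b) g) s) = (\<lambda>s. c s - (\<Sum>b\<in>B. b * of_int (k b)) * rl g s)"
  unfolding B(3) by (simp add: rl_simps right_diff_distrib sum_subtractf sum_distrib_right mult.assoc)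
 ultimately show ?thesis by metis
qed

lemma cyc_trivial:
 assumes triv: "\<And>z. singular_relcycle p X {} z \<Longrightarrow> singular_relboundary p X {} z"
 shows "cyc p X \<subseteq> bdr p X"
proof
 fix c assume c: "c \<in> cyc p X"
 have "\<exists>r. (\<lambda>s. c s - r * rl 0 s) \<in> bdr p X"
  by (rule cyc_generated[OF _ c]) (use triv in \<open>auto simp: homologous_rel_def\<close>)
 then show "c \<in> bdr p X" by (simp add: rl_simps)
qed

lemma trivial_homology_cycles:
 assumes "trivial_group (homology_group (int p) X)" "singular_relcycle p X {} z"
 shows "singular_relboundary p X {} z"
proof -
 have "homologous_rel_set p X {} z \<in> carrier (homology_group (int p) X)"
  using assms(2) by (auto simp: carrier_relative_homology_group)
 then have "homologous_rel_set p X {} z = singular_relboundary_set p X {}"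
  using assms(1) by (auto simp: trivial_group_def)
 moreover have "z \<in> homologous_rel_set p X {} z" by simp
 ultimately show ?thesis by auto
qed

lemma cyclic_homology_cycles:
 assumes "cyclic_group (homology_group (int p) X)"
 obtains g where "singular_relcycle p X {} g"
  "\<And>z. singular_relcycle p X {} z \<Longrightarrow> \<exists>k. homologous_rel p X {} z (frag_cmul k g)"
proof -
 let ?G = "homology_group (int p) X"
 obtain R where R: "R \<in> carrier ?G" "subgroup_generated ?G {R} = ?G"
  using assms unfolding cyclic_group_def by blast
 obtain g where g: "singular_relcycle p X {} g" "R = homologous_rel_set p X {} g"
  using R(1) by (auto simp: carrier_relative_homology_group)
 define P where "P Q \<longleftrightarrow> (\<forall>z\<in>Q. \<exists>k. homologous_rel p X {} z (frag_cmul k g))" for Q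
 have neg: "homologous_rel p X {} (- a) (- b)" if "homologous_rel p X {} a b" for a b
  using that homologous_rel_diff[of p X "{}" 0 0 a b] by simp
 have gR: "\<exists>k. homologous_rel p X {} z (frag_cmul k g)" if "z \<in> R" for z
  using that g(2) by (intro exI[of _ 1]) (auto simp: homologous_rel_sym)
 have "P Q" if "Q \<in> generate ?G {R}" for Q
  using that
 proof (induction rule: generate.induct)
  case one
  show ?case unfolding P_def by (auto simp: homologous_rel_def intro!: exI[of _ 0])
 next
  case (incl h)
  then show ?case unfolding P_def using gR by auto
 next
  case (inv h)
  then have "inv\<^bsub>?G\<^esub> h = uminus ` R" using inv_relative_homology_group[OF R(1)] by auto
  moreover have "\<exists>k. homologous_rel p X {} (- z) (frag_cmul k g)" if z: "z \<in> R" for z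
  proof -
   obtain k where "homologous_rel p X {} z (frag_cmul k g)" using gR[OF z] by blast
   then have "homologous_rel p X {} (- z) (frag_cmul (- k) g)" using neg by fastforce
   then show ?thesis by blast
  qed
  ultimately show ?case unfolding P_def by auto
 next
  case (eng h1 h2)
  show ?case unfolding P_def mult_relative_homology_group
  proof clarsimp
   fix a b assume "a \<in> h1" "b \<in> h2"
   then obtain k l where "homologous_rel p X {} a (frag_cmul k g)" "homologous_rel p X {} b (frag_cmul l g)"
    using eng unfolding P_def by blast
   then have "homologous_rel p X {} (a + b) (frag_cmul k g + frag_cmul l g)" by (rule homologous_rel_add)
   then show "\<exists>k. homologous_rel p X {} (a + b) (frag_cmul k g)"
    by (intro exI[of _ "k + l"]) (simp add: frag_cmul_distrib)
  qed
 qed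
 moreover have "carrier ?G = generate ?G {R}"
  using R by (metis carrier_subgroup_generated Int_absorb1 empty_subsetI insert_subset inf_commute)
 ultimately have all: "P Q" if "Q \<in> carrier ?G" for Q using that by blast
 show ?thesis
 proof (rule that[OF g(1)])
  fix z assume "singular_relcycle p X {} z"
  then have "homologous_rel_set p X {} z \<in> carrier ?G" by (auto simp: carrier_relative_homology_group)
  from all[OF this] show "\<exists>k. homologous_rel p X {} z (frag_cmul k g)"
   unfolding P_def by (metis homologous_rel_refl mem_Collect_eq)
 qed
qed

text \<open>Both statements are transported from the known homology of the sphere of dimension 1.\<close>

lemma circle_homology:
 assumes "X homeomorphic_space (nsphere 1)"
 shows "cyclic_group (homology_group 1 X)" "p \<ge> 2 \<Longrightarrow> trivial_group (homology_group (int p) X)"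
proof -
 have iso: "homology_group q X \<cong> homology_group q (nsphere 1)" for q
  by (rule homeomorphic_space_imp_isomorphic_homology_groups[OF assms])
 have "cyclic_group (homology_group 1 (nsphere 1))"
  using cyclic_reduced_homology_group_nsphere[of 1 1] by (simp add: un_reduced_homology_group)
 then show "cyclic_group (homology_group 1 X)"
  using isomorphic_group_cyclicity[OF iso[of 1]] by simp
 show "trivial_group (homology_group (int p) X)" if "p \<ge> 2"
 proof -
  have "trivial_group (reduced_homology_group (int p) (nsphere 1))"
   by (rule reduced_homology_group_nsphere(2)) (use that in simp)
  then have "trivial_group (homology_group (int p) (nsphere 1))"
   using that by (simp add: un_reduced_homology_group)
  then show ?thesis using isomorphic_group_triviality[OF iso[of "int p"]] by simp
 qed
qed

lemma contractible_cycles: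
 assumes "contractible_space X" "p \<ge> 1" shows "cyc p X \<subseteq> bdr p X"
proof (rule cyc_trivial, rule trivial_homology_cycles)
 show "trivial_group (homology_group (int p) X)"
  using trivial_reduced_homology_group_contractible_space[OF assms(1), of "int p"] assms(2)
  by (simp add: un_reduced_homology_group)
qed

definition pscale :: "real \<Rightarrow> ('b \<Rightarrow>\<^sub>0 real) \<Rightarrow> ('b \<Rightarrow>\<^sub>0 real)" where
 "pscale r c = Poly_Mapping.map ((*) r) c"

lemma lookup_pscale [simp]: "Poly_Mapping.lookup (pscale r c) s = r * Poly_Mapping.lookup c s"
 by (simp add: pscale_def map.rep_eq when_def)

interpretation pvs: vector_space pscale
 by unfold_locales (auto simp: poly_mapping_eq_iff fun_eq_iff lookup_add algebra_simps)

interpretation pvs2: vector_space_pair pscale pscale ..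

interpretation pvsr: vector_space_pair pscale "(*) :: real \<Rightarrow> real \<Rightarrow> real"
 by unfold_locales (auto simp: algebra_simps)

lemma finite_supp_lookup: "finite (supp (Poly_Mapping.lookup c))"
 using finite_lookup by simp

lemma pm_of_chain:
 assumes "finite (supp c)" shows "\<exists>c'. Poly_Mapping.lookup c' = c"
 by (rule exI[of _ "Abs_poly_mapping c"]) (simp add: Abs_poly_mapping_inverse assms)

text \<open>The boundary map has a linear right inverse on its image. Applying the cochain after it gives
  a primitive: the difference between a chain and the lift of its boundary is a cycle, on which the
  cochain vanishes.\<close>

lemma vanishing_cochain_is_coboundary:
 fixes \<phi> :: "('a, real) cochain"
 assumes van: "\<And>c. c \<in> cyc (Suc p) X \<Longrightarrow> evaluate RR \<phi> c = 0"
 obtains \<psi> where "\<And>\<sigma>. singular_simplex (Suc p) X \<sigma> \<Longrightarrow> cobd (Suc p) \<psi> \<sigma> = \<phi> \<sigma>"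
proof -
 have fbd: "finite (supp (chain_bd RR (Suc p) c))" if "finite (supp c)" for c :: "('a, real) cochain"
  unfolding chain_bd_expand[OF that zero_less_Suc] by (rule finite_supp_sum[OF that finite_supp_rl])
 have "\<exists>D. \<forall>c :: ((nat \<Rightarrow> real) \<Rightarrow> 'a) \<Rightarrow>\<^sub>0 real. Poly_Mapping.lookup (D c) = chain_bd RR (Suc p) (Poly_Mapping.lookup c)"
  by (rule choice, rule allI, rule pm_of_chain, rule fbd, rule finite_supp_lookup)
 then obtain D :: "(((nat \<Rightarrow> real) \<Rightarrow> 'a) \<Rightarrow>\<^sub>0 real) \<Rightarrow> (((nat \<Rightarrow> real) \<Rightarrow> 'a) \<Rightarrow>\<^sub>0 real)"
  where D: "\<And>c. Poly_Mapping.lookup (D c) = chain_bd RR (Suc p) (Poly_Mapping.lookup c)" by blast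
 have look_add: "Poly_Mapping.lookup (a + b) = (\<lambda>s. Poly_Mapping.lookup a s + Poly_Mapping.lookup b s)" for a b :: "((nat \<Rightarrow> real) \<Rightarrow> 'a) \<Rightarrow>\<^sub>0 real"
  by (simp add: fun_eq_iff lookup_add)
 have look_scale: "Poly_Mapping.lookup (pscale r a) = (\<lambda>s. r * Poly_Mapping.lookup a s)" for r and a :: "((nat \<Rightarrow> real) \<Rightarrow> 'a) \<Rightarrow>\<^sub>0 real"
  by (simp add: fun_eq_iff)
 have linD: "Vector_Spaces.linear pscale pscale D"
  unfolding Vector_Spaces.linear_iff
  using pvs.vector_space_axioms
  by (simp add: poly_mapping_eq_iff D look_add look_scale chain_bd_add[OF finite_supp_lookup finite_supp_lookup] chain_bd_scale[OF finite_supp_lookup])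
 define V where "V = {c. Poly_Mapping.lookup c \<in> chains (Suc p) X}"
 have sV: "pvs.subspace V"
  unfolding pvs.subspace_def V_def
  using fn_subspaceD[OF chains_sub[of "Suc p" X]] by (simp add: look_add look_scale zero_poly_mapping.rep_eq)
 obtain g where g: "range g \<subseteq> V" "Vector_Spaces.linear pscale pscale g" "\<And>v. v \<in> D ` V \<Longrightarrow> D (g v) = v"
  using pvs2.linear_exists_right_inverse_on[OF linD sV] by (elim exE conjE) (rule that, assumption, assumption, erule bspec)
 define E where "E c = evaluate RR \<phi> (Poly_Mapping.lookup c)" for c
 define \<psi> where "\<psi> \<tau> = E (g (Poly_Mapping.single \<tau> 1))" for \<tau>
 have vsr: "vector_space ((*) :: real \<Rightarrow> real \<Rightarrow> real)" by unfold_locales (simp_all add: algebra_simps)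
 have linE: "Vector_Spaces.linear pscale (*) E"
  unfolding Vector_Spaces.linear_iff
  using pvs.vector_space_axioms vsr
  by (simp add: E_def look_add look_scale evaluate_add[OF finite_supp_lookup finite_supp_lookup] evaluate_scale[OF finite_supp_lookup])
 have linEg: "Vector_Spaces.linear pscale (*) (\<lambda>c. E (g c))"
  using Vector_Spaces.linear_compose[OF g(2) linE] by (simp add: o_def)
 show ?thesis
 proof (rule that)
  fix \<sigma> assume \<sigma>: "singular_simplex (Suc p) X \<sigma>"
  define c where "c = Poly_Mapping.single \<sigma> (1::real)"
  have lc: "Poly_Mapping.lookup c = rl (frag_of \<sigma>)" by (auto simp: c_def rl_of lookup_single when_def)
  have cV: "c \<in> V" using \<sigma> by (simp add: V_def lc rl_chains singular_chain_of)
  have Dc: "D c = (\<Sum>k\<le>Suc p. pscale ((-1) ^ k) (Poly_Mapping.single (singular_face (Suc p) k \<sigma>) 1))"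
  proof (rule poly_mapping_eqI)
   fix \<tau>
   have "Poly_Mapping.lookup (D c) \<tau> = rl (chain_boundary (Suc p) (frag_of \<sigma>)) \<tau>"
    by (simp add: D lc chain_bd_of)
   also have "\<dots> = (\<Sum>k\<le>Suc p. (-1) ^ k * rl (frag_of (singular_face (Suc p) k \<sigma>)) \<tau>)"
    unfolding chain_boundary_of by (simp add: rl_sum rl_simps del: sum.atMost_Suc)
   finally show "Poly_Mapping.lookup (D c) \<tau> = Poly_Mapping.lookup (\<Sum>k\<le>Suc p. pscale ((-1) ^ k) (Poly_Mapping.single (singular_face (Suc p) k \<sigma>) 1)) \<tau>"
    by (simp add: lookup_sum rl_of lookup_single when_def del: sum.atMost_Suc)
  qed
  have "E (g (D c)) = (\<Sum>k\<le>Suc p. (-1) ^ k * E (g (Poly_Mapping.single (singular_face (Suc p) k \<sigma>) 1)))"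
   unfolding Dc by (simp only: pvsr.linear_sum[OF linEg] pvsr.linear_scale[OF linEg])
  then have 1: "cobd (Suc p) \<psi> \<sigma> = E (g (D c))" by (simp add: cobd_def \<psi>_def)
  have "D (c - g (D c)) = 0"
   using g(3)[OF imageI[OF cV]] by (simp add: pvs2.linear_diff[OF linD])
  moreover have "c - g (D c) \<in> V" using pvs.subspace_diff[OF sV cV] g(1) by blast
  ultimately have "Poly_Mapping.lookup (c - g (D c)) \<in> cyc (Suc p) X"
   unfolding cyc_eq V_def using D[of "c - g (D c)"] by (auto simp: fun_eq_iff)
  then have "E (c - g (D c)) = 0" unfolding E_def by (rule van)
  then have "E c = E (g (D c))" by (simp add: pvsr.linear_diff[OF linE])
  moreover have "E c = \<phi> \<sigma>" unfolding E_def lc by (rule evaluate_of)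
  ultimately show "cobd (Suc p) \<psi> \<sigma> = \<phi> \<sigma>" using 1 by simp
 qed
qed

section \<open>The ring of cochains\<close>

abbreviation ssx :: "nat \<Rightarrow> 'a topology \<Rightarrow> ((nat \<Rightarrow> real) \<Rightarrow> 'a) \<Rightarrow> bool" where "ssx \<equiv> singular_simplex"

definition front :: "nat \<Rightarrow> ((nat \<Rightarrow> real) \<Rightarrow> 'a) \<Rightarrow> (nat \<Rightarrow> real) \<Rightarrow> 'a" where
 "front p \<sigma> = restrict \<sigma> (standard_simplex p)"

lemma standard_simplexI: "(\<And>i. 0 \<le> x i) \<Longrightarrow> (\<And>i. i > p \<Longrightarrow> x i = 0) \<Longrightarrow> (\<Sum>i\<le>p. x i) = 1 \<Longrightarrow> x \<in> standard_simplex p"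
proof -
 assume x: "\<And>i. 0 \<le> x i" "\<And>i. i > p \<Longrightarrow> x i = 0" "(\<Sum>i\<le>p. x i) = 1"
 have "x i \<le> 1" for i
 proof (cases "i \<le> p")
  case True
  then have "x i \<le> (\<Sum>i\<le>p. x i)" using x(1) by (intro member_le_sum) auto
  then show ?thesis using x(3) by simp
 next
  case False then show ?thesis using x(2)[of i] by simp
 qed
 then show ?thesis using x by (simp add: standard_simplex_def)
qed

definition shift :: "nat \<Rightarrow> (nat \<Rightarrow> real) \<Rightarrow> nat \<Rightarrow> real" where
 "shift p x = (\<lambda>i. if i < p then 0 else x (i - p))"

lemma shift_in:
 assumes "x \<in> standard_simplex q" shows "shift p x \<in> standard_simplex (p + q)"
proof (rule standard_simplexI)
 have "(\<Sum>i\<le>p + q. shift p x i) = (\<Sum>i\<in>{p..p + q}. shift p x i)"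
  by (rule sum.mono_neutral_right) (auto simp: shift_def)
 also have "\<dots> = (\<Sum>i\<in>{0..q}. x i)"
  by (rule sum.reindex_bij_witness[where i = "\<lambda>i. i + p" and j = "\<lambda>i. i - p"]) (auto simp: shift_def)
 finally show "(\<Sum>i\<le>p + q. shift p x i) = 1" using assms by (simp add: standard_simplex_def atLeast0AtMost)
qed (use assms in \<open>auto simp: standard_simplex_def shift_def\<close>)

lemma back_face_shift: "back_face n p \<sigma> = restrict (\<sigma> \<circ> shift p) (standard_simplex (n - p))"
proof -
 have "shift p = (\<lambda>x i. if i < p then 0 else x (i - p))" by (auto simp: shift_def fun_eq_iff)
 then show ?thesis by (simp add: back_face_def)
qed

lemma ssx_restrict_comp:
 assumes \<sigma>: "ssx n X \<sigma>" and f: "continuous_on UNIV f" "\<And>x. x \<in> standard_simplex q \<Longrightarrow> f x \<in> standard_simplex n"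
 shows "ssx q X (restrict (\<sigma> \<circ> f) (standard_simplex q))"
proof -
 have "continuous_map (top_of_set (standard_simplex n)) X \<sigma>"
  using \<sigma> by (simp add: singular_simplex_def euclidean_product_topology)
 moreover have "continuous_map (top_of_set (standard_simplex q)) (top_of_set (standard_simplex n)) f"
  using f continuous_on_subset[OF f(1) subset_UNIV] by (auto simp: continuous_map_in_subtopology)
 ultimately have "continuous_map (top_of_set (standard_simplex q)) X (\<sigma> \<circ> f)"
  using continuous_map_compose by blast
 then have "continuous_map (top_of_set (standard_simplex q)) X (restrict (\<sigma> \<circ> f) (standard_simplex q))"
  by (rule continuous_map_eq) simp
 then show ?thesis by (simp add: singular_simplex_def euclidean_product_topology)
qed

lemma continuous_shift: "continuous_on UNIV (shift p)"
proof (rule continuous_on_coordinatewise_then_product)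
 fix i show "continuous_on UNIV (\<lambda>x. shift p x i)"
  by (cases "i < p") (simp_all add: shift_def continuous_on_product_coordinates)
qed

lemma front_ssx: "ssx n X \<sigma> \<Longrightarrow> p \<le> n \<Longrightarrow> ssx p X (front p \<sigma>)"
proof -
 assume "ssx n X \<sigma>" "p \<le> n"
 then have "ssx p X (restrict (\<sigma> \<circ> (\<lambda>x. x)) (standard_simplex p))"
  by (intro ssx_restrict_comp[of n]) (use standard_simplex_mono in auto)
 then show "ssx p X (front p \<sigma>)" by (simp add: front_def o_def)
qed

lemma back_ssx: "ssx n X \<sigma> \<Longrightarrow> p \<le> n \<Longrightarrow> ssx (n - p) X (back_face n p \<sigma>)"
 unfolding back_face_shift using shift_in[of _ "n - p" p]
 by (intro ssx_restrict_comp[of n] continuous_shift) simp_all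

lemma front_front: "p \<le> q \<Longrightarrow> front p (front q \<sigma>) = front p \<sigma>"
 using standard_simplex_mono[of p q] by (auto simp: front_def fun_eq_iff)

lemma back_front:
 assumes "p + q \<le> n" shows "back_face (p + q) p (front (p + q) \<sigma>) = front q (back_face n p \<sigma>)"
proof -
 have "standard_simplex q \<subseteq> standard_simplex (n - p)" using assms by (intro standard_simplex_mono) simp
 then show ?thesis using shift_in[of _ q p] by (auto simp: back_face_shift front_def fun_eq_iff)
qed

lemma shift_shift: "shift p (shift q x) = shift (p + q) x"
 by (auto simp: shift_def fun_eq_iff)

lemma back_back: "p + q \<le> n \<Longrightarrow> back_face (n - p) q (back_face n p \<sigma>) = back_face n (p + q) \<sigma>"
 using shift_in[of _ "n - (p + q)" q]
 by (auto simp: back_face_shift fun_eq_iff shift_shift)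

lemma face_in: "x \<in> standard_simplex n \<Longrightarrow> k \<le> Suc n \<Longrightarrow> simplical_face k x \<in> standard_simplex (Suc n)"
 using simplical_face_in_standard_simplex[of "Suc n" k x] by simp

lemma front_face_low: "k \<le> Suc p \<Longrightarrow> p \<le> n \<Longrightarrow> front p (singular_face (Suc n) k \<sigma>) = singular_face (Suc p) k (front (Suc p) \<sigma>)"
 using standard_simplex_mono[of p n] face_in[of _ p k]
 by (auto simp: front_def singular_face_def fun_eq_iff)

lemma face_high_id: "x \<in> standard_simplex p \<Longrightarrow> p < k \<Longrightarrow> simplical_face k x = x"
 by (auto simp: simplical_face_def standard_simplex_def fun_eq_iff)

lemma front_face_high: "p < k \<Longrightarrow> p \<le> n \<Longrightarrow> front p (singular_face (Suc n) k \<sigma>) = front p \<sigma>"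
 using standard_simplex_mono[of p n] by (auto simp: front_def singular_face_def fun_eq_iff face_high_id)

lemma back_face_low:
 assumes "k \<le> p" "p \<le> n" shows "back_face n p (singular_face (Suc n) k \<sigma>) = back_face (Suc n) (Suc p) \<sigma>"
proof -
 have "simplical_face k (shift p x) = shift (Suc p) x" for x
  using assms by (auto simp: simplical_face_def shift_def fun_eq_iff)
 moreover have "shift p x \<in> standard_simplex n" if "x \<in> standard_simplex (n - p)" for x
  using shift_in[OF that, of p] assms by simp
 ultimately show ?thesis by (intro ext) (simp add: back_face_shift singular_face_def restrict_def)
qed

lemma back_face_high:
 assumes "p \<le> k" "p \<le> n" shows "back_face n p (singular_face (Suc n) k \<sigma>) = singular_face (Suc (n - p)) (k - p) (back_face (Suc n) p \<sigma>)"
proof -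
 have "simplical_face k (shift p x) = shift p (simplical_face (k - p) x)" for x
  using assms by (auto simp: simplical_face_def shift_def fun_eq_iff)
 moreover have "shift p x \<in> standard_simplex n" if "x \<in> standard_simplex (n - p)" for x
  using shift_in[OF that, of p] assms by simp
 moreover have "simplical_face (k - p) x \<in> standard_simplex (Suc (n - p))" if x: "x \<in> standard_simplex (n - p)" for x
 proof (cases "k - p \<le> Suc (n - p)")
  case True then show ?thesis by (rule face_in[OF x])
 next
  case False
  then have "simplical_face (k - p) x = x" by (intro face_high_id[OF x]) simp
  then show ?thesis using x standard_simplex_mono[of "n - p" "Suc (n - p)"] by auto
 qed
 ultimately show ?thesis using assms
  by (intro ext) (simp add: back_face_shift singular_face_def restrict_def Suc_diff_le)
qed

type_synonym 'a coch = "nat \<Rightarrow> ((nat \<Rightarrow> real) \<Rightarrow> 'a) \<Rightarrow> real"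

definition cup :: "'a topology \<Rightarrow> 'a coch \<Rightarrow> 'a coch \<Rightarrow> 'a coch" where
 "cup X \<phi> \<psi> n \<sigma> = (if ssx n X \<sigma> then (\<Sum>p\<le>n. \<phi> p (front p \<sigma>) * \<psi> (n - p) (back_face n p \<sigma>)) else 0)"

definition cochs :: "'a topology \<Rightarrow> 'a coch set" where
 "cochs X = {\<phi>. (\<forall>p \<sigma>. \<not> ssx p X \<sigma> \<longrightarrow> \<phi> p \<sigma> = 0) \<and> finite {p. \<exists>\<sigma>. \<phi> p \<sigma> \<noteq> 0}}"

definition unit_coch :: "'a topology \<Rightarrow> 'a coch" where
 "unit_coch X p \<sigma> = (if p = 0 \<and> ssx p X \<sigma> then 1 else 0)"

lemma cochain_ring_simps:
 "carrier (cochain_ring RR X) = cochs X" "\<phi> \<otimes>\<^bsub>cochain_ring RR X\<^esub> \<psi> = cup X \<phi> \<psi>"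
 "\<one>\<^bsub>cochain_ring RR X\<^esub> = unit_coch X" "\<zero>\<^bsub>cochain_ring RR X\<^esub> = (\<lambda>p \<sigma>. 0)"
 "\<phi> \<oplus>\<^bsub>cochain_ring RR X\<^esub> \<psi> = (\<lambda>p \<sigma>. \<phi> p \<sigma> + \<psi> p \<sigma>)"
 by (auto simp: cochain_ring_def cochs_def cup_def unit_coch_def front_def fun_eq_iff)

lemma cochs_zero: "(\<lambda>p \<sigma>. 0) \<in> cochs X" by (simp add: cochs_def)

lemma cochs_add: assumes "\<phi> \<in> cochs X" "\<psi> \<in> cochs X" shows "(\<lambda>p \<sigma>. \<phi> p \<sigma> + \<psi> p \<sigma>) \<in> cochs X"
proof -
 have "{p. \<exists>\<sigma>. \<phi> p \<sigma> + \<psi> p \<sigma> \<noteq> 0} \<subseteq> {p. \<exists>\<sigma>. \<phi> p \<sigma> \<noteq> 0} \<union> {p. \<exists>\<sigma>. \<psi> p \<sigma> \<noteq> 0}" by auto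
 then have "finite {p. \<exists>\<sigma>. \<phi> p \<sigma> + \<psi> p \<sigma> \<noteq> 0}" using assms by (auto simp: cochs_def intro: finite_subset)
 then show ?thesis using assms by (auto simp: cochs_def)
qed

lemma cochs_minus: assumes "\<phi> \<in> cochs X" shows "(\<lambda>p \<sigma>. - \<phi> p \<sigma>) \<in> cochs X"
 using assms by (auto simp: cochs_def)

lemma finite_degrees:
 assumes "\<phi> \<in> cochs X" shows "\<exists>N. \<forall>p \<sigma>. N \<le> p \<longrightarrow> \<phi> p \<sigma> = 0"
proof -
 have "finite {p. \<exists>\<sigma>. \<phi> p \<sigma> \<noteq> 0}" using assms by (simp add: cochs_def)
 then obtain N where "\<forall>p\<in>{p. \<exists>\<sigma>. \<phi> p \<sigma> \<noteq> 0}. p < N" using finite_nat_set_iff_bounded by blast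
 then show ?thesis by (intro exI[of _ N]) (auto simp: not_le[symmetric])
qed

lemma cochsI: "(\<And>p \<sigma>. \<not> ssx p X \<sigma> \<Longrightarrow> \<phi> p \<sigma> = 0) \<Longrightarrow> (\<And>p \<sigma>. N \<le> p \<Longrightarrow> \<phi> p \<sigma> = 0) \<Longrightarrow> \<phi> \<in> cochs X"
proof -
 assume *: "\<And>p \<sigma>. \<not> ssx p X \<sigma> \<Longrightarrow> \<phi> p \<sigma> = 0" "\<And>p \<sigma>. N \<le> p \<Longrightarrow> \<phi> p \<sigma> = 0"
 have "{p. \<exists>\<sigma>. \<phi> p \<sigma> \<noteq> 0} \<subseteq> {..<N}" using *(2) by (auto simp: not_le[symmetric])
 then show "\<phi> \<in> cochs X" using *(1) finite_subset unfolding cochs_def by blast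
qed

lemma cup_closed: assumes "\<phi> \<in> cochs X" "\<psi> \<in> cochs X" shows "cup X \<phi> \<psi> \<in> cochs X"
proof -
 obtain M where M: "\<forall>p \<sigma>. M \<le> p \<longrightarrow> \<phi> p \<sigma> = 0" using finite_degrees[OF assms(1)] ..
 obtain N where N: "\<forall>p \<sigma>. N \<le> p \<longrightarrow> \<psi> p \<sigma> = 0" using finite_degrees[OF assms(2)] ..
 show ?thesis
 proof (rule cochsI[where N = "M + N"])
  fix n \<sigma> assume n: "M + N \<le> n"
  have "\<phi> p (front p \<sigma>) * \<psi> (n - p) (back_face n p \<sigma>) = 0" for p
  proof (cases "M \<le> p")
   case False then have "N \<le> n - p" using n by simp
   then show ?thesis using N by simp
  qed (use M in simp)
  then show "cup X \<phi> \<psi> n \<sigma> = 0" by (simp add: cup_def)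
 qed (simp add: cup_def)
qed

lemma front_id: "ssx n X \<sigma> \<Longrightarrow> front n \<sigma> = \<sigma>"
 by (auto simp: front_def singular_simplex_def extensional_restrict)

lemma back_id: "ssx n X \<sigma> \<Longrightarrow> back_face n 0 \<sigma> = \<sigma>"
proof -
 have "shift 0 x = x" for x by (auto simp: shift_def)
 then show "ssx n X \<sigma> \<Longrightarrow> back_face n 0 \<sigma> = \<sigma>"
  by (simp add: back_face_shift o_def singular_simplex_def extensional_restrict)
qed

lemma unit_closed: "unit_coch X \<in> cochs X"
 by (rule cochsI[where N = 1]) (auto simp: unit_coch_def)

lemma scalar_cup:
 assumes "\<phi> \<in> cochs X"
 shows "cup X (scalar_cochain RR X r) \<phi> = (\<lambda>p \<sigma>. r * \<phi> p \<sigma>)"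
proof (intro ext)
 fix n \<sigma> show "cup X (scalar_cochain RR X r) \<phi> n \<sigma> = r * \<phi> n \<sigma>"
 proof (cases "ssx n X \<sigma>")
  case True
  have "(\<Sum>p\<le>n. scalar_cochain RR X r p (front p \<sigma>) * \<phi> (n - p) (back_face n p \<sigma>)) =
   (\<Sum>p\<in>{0}. scalar_cochain RR X r p (front p \<sigma>) * \<phi> (n - p) (back_face n p \<sigma>))"
   by (rule sum.mono_neutral_right) (auto simp: scalar_cochain_def)
  then show ?thesis using True front_ssx[OF True, of 0] by (simp add: cup_def scalar_cochain_def back_id)
 qed (use assms in \<open>simp add: cup_def cochs_def\<close>)
qed

lemma unit_cup: "\<phi> \<in> cochs X \<Longrightarrow> cup X (unit_coch X) \<phi> = \<phi>"
proof -
 have "unit_coch X = scalar_cochain RR X 1" by (auto simp: unit_coch_def scalar_cochain_def fun_eq_iff)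
 then show "\<phi> \<in> cochs X \<Longrightarrow> cup X (unit_coch X) \<phi> = \<phi>" by (simp add: scalar_cup)
qed

lemma cup_unit:
 assumes "\<phi> \<in> cochs X" shows "cup X \<phi> (unit_coch X) = \<phi>"
proof (intro ext)
 fix n \<sigma> show "cup X \<phi> (unit_coch X) n \<sigma> = \<phi> n \<sigma>"
 proof (cases "ssx n X \<sigma>")
  case True
  have "(\<Sum>p\<le>n. \<phi> p (front p \<sigma>) * unit_coch X (n - p) (back_face n p \<sigma>)) =
   (\<Sum>p\<in>{n}. \<phi> p (front p \<sigma>) * unit_coch X (n - p) (back_face n p \<sigma>))"
   by (rule sum.mono_neutral_right) (auto simp: unit_coch_def)
  then show ?thesis using True back_ssx[OF True, of n] by (simp add: cup_def unit_coch_def front_id)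
 qed (use assms in \<open>simp add: cup_def cochs_def\<close>)
qed

text \<open>Both sides are sums over pairs of splitting vertices, and the faces on which the three factors
  are evaluated agree.\<close>

lemma cup_assoc: "cup X (cup X \<phi> \<psi>) \<xi> = cup X \<phi> (cup X \<psi> \<xi>)"
proof (intro ext)
 fix n \<sigma> show "cup X (cup X \<phi> \<psi>) \<xi> n \<sigma> = cup X \<phi> (cup X \<psi> \<xi>) n \<sigma>"
 proof (cases "ssx n X \<sigma>")
  case True
  define T where "T p q = \<phi> p (front p \<sigma>) * \<psi> q (front q (back_face n p \<sigma>)) * \<xi> (n - (p + q)) (back_face n (p + q) \<sigma>)" for p q
  have 1: "cup X \<phi> \<psi> m (front m \<sigma>) * \<xi> (n - m) (back_face n m \<sigma>) = (\<Sum>p\<le>m. T p (m - p))" if "m \<le> n" for m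
  proof -
   have "\<psi> (m - p) (back_face m p (front m \<sigma>)) = \<psi> (m - p) (front (m - p) (back_face n p \<sigma>))" if "p \<le> m" for p
    using back_front[of p "m - p" n \<sigma>] that \<open>m \<le> n\<close> by simp
   then show ?thesis using front_ssx[OF True that]
    by (auto simp: cup_def T_def sum_distrib_right front_front intro!: sum.cong)
  qed
  have 2: "\<phi> p (front p \<sigma>) * cup X \<psi> \<xi> (n - p) (back_face n p \<sigma>) = (\<Sum>q\<le>n - p. T p q)" if "p \<le> n" for p
   using back_ssx[OF True that] that
   by (auto simp: cup_def T_def sum_distrib_left back_back mult.assoc intro!: sum.cong)
  have "cup X (cup X \<phi> \<psi>) \<xi> n \<sigma> = (\<Sum>m\<le>n. \<Sum>p\<le>m. T p (m - p))"
   using True 1 by (simp add: cup_def[of X "cup X \<phi> \<psi>"])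
  also have "\<dots> = (\<Sum>p\<le>n. \<Sum>q\<le>n - p. T p q)"
   by (simp add: sum.Sigma)
    (rule sum.reindex_bij_witness[where i = "\<lambda>(p, q). (p + q, p)" and j = "\<lambda>(m, p). (p, m - p)"]; auto)
  also have "\<dots> = cup X \<phi> (cup X \<psi> \<xi>) n \<sigma>"
   using True 2 by (simp add: cup_def[of X \<phi>])
  finally show ?thesis .
 qed (simp add: cup_def)
qed

lemma cup_add_left: "cup X (\<lambda>p \<sigma>. \<phi> p \<sigma> + \<psi> p \<sigma>) \<xi> = (\<lambda>p \<sigma>. cup X \<phi> \<xi> p \<sigma> + cup X \<psi> \<xi> p \<sigma>)"
 by (intro ext) (simp add: cup_def sum.distrib distrib_right)

lemma cup_add_right: "cup X \<xi> (\<lambda>p \<sigma>. \<phi> p \<sigma> + \<psi> p \<sigma>) = (\<lambda>p \<sigma>. cup X \<xi> \<phi> p \<sigma> + cup X \<xi> \<psi> p \<sigma>)"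
 by (intro ext) (simp add: cup_def sum.distrib distrib_left)

lemma cochain_ring_ring: "ring (cochain_ring RR X)"
proof (rule ringI)
 show "abelian_group (cochain_ring RR X)"
 proof (rule abelian_groupI, unfold cochain_ring_simps)
  fix x assume "x \<in> cochs X"
  then show "\<exists>y\<in>cochs X. (\<lambda>p \<sigma>. y p \<sigma> + x p \<sigma>) = (\<lambda>p \<sigma>. 0)"
   by (intro bexI[of _ "\<lambda>p \<sigma>. - x p \<sigma>"] cochs_minus) simp_all
 qed (rule cochs_add cochs_zero, assumption+ | rule cochs_zero | simp add: ac_simps)+
 show "Group.monoid (cochain_ring RR X)"
  by (rule monoidI) (simp_all add: cochain_ring_simps cup_closed unit_closed cup_assoc unit_cup cup_unit)
qed (simp_all add: cochain_ring_simps cup_add_left cup_add_right)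

definition dl :: "'a topology \<Rightarrow> 'a coch \<Rightarrow> 'a coch" where
 "dl X \<phi> = coboundary RR X \<phi>"

lemma dl_Suc: "dl X \<phi> (Suc n) \<sigma> = (if ssx (Suc n) X \<sigma> then cobd (Suc n) (\<phi> n) \<sigma> else 0)"
 and dl_0: "dl X \<phi> 0 \<sigma> = 0"
 by (simp_all add: dl_def coboundary_def cobd_def)

definition sgn_coch :: "'a coch \<Rightarrow> 'a coch" where "sgn_coch \<phi> p \<sigma> = (-1) ^ p * \<phi> p \<sigma>"

lemma face_ssx: "ssx (Suc n) X \<sigma> \<Longrightarrow> k \<le> Suc n \<Longrightarrow> ssx n X (singular_face (Suc n) k \<sigma>)"
 using singular_simplex_singular_face[of "Suc n" X \<sigma> k] by simp

text \<open>Each face of a simplex omits a vertex of the front part or of the back part. The two terms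
  that omit the splitting vertex itself occur once on each side and cancel.\<close>

lemma leibniz: "dl X (cup X \<phi> \<psi>) = (\<lambda>p \<sigma>. cup X (dl X \<phi>) \<psi> p \<sigma> + cup X (sgn_coch \<phi>) (dl X \<psi>) p \<sigma>)"
proof (intro ext)
 fix m \<sigma>
 show "dl X (cup X \<phi> \<psi>) m \<sigma> = cup X (dl X \<phi>) \<psi> m \<sigma> + cup X (sgn_coch \<phi>) (dl X \<psi>) m \<sigma>"
 proof (cases m)
  case 0
  then show ?thesis by (simp add: cup_def dl_0)
 next
  case (Suc n)
  show ?thesis
  proof (cases "ssx (Suc n) X \<sigma>")
   case False then show ?thesis by (simp add: Suc dl_Suc cup_def)
  next
   case True
   \<comment> \<open>Cut the simplex after the vertex p; L and R are the terms in which a vertex of the front or the back part is dropped.\<close>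
   define L where "L p k = (-1) ^ k * \<phi> p (singular_face (Suc p) k (front (Suc p) \<sigma>)) * \<psi> (n - p) (back_face (Suc n) (Suc p) \<sigma>)" for p k
   define R where "R p j = (-1) ^ (p + j) * \<phi> p (front p \<sigma>) * \<psi> (n - p) (singular_face (Suc (n - p)) j (back_face (Suc n) p \<sigma>))" for p j
   have tm: "(-1) ^ k * (\<phi> p (front p (singular_face (Suc n) k \<sigma>)) * \<psi> (n - p) (back_face n p (singular_face (Suc n) k \<sigma>)))
     = (if k \<le> p then L p k else R p (k - p))" if "p \<le> n" "k \<le> Suc n" for p k
    using that by (simp add: L_def R_def front_face_low front_face_high back_face_low back_face_high)
   have "dl X (cup X \<phi> \<psi>) (Suc n) \<sigma> = (\<Sum>k\<le>Suc n. (-1) ^ k * cup X \<phi> \<psi> n (singular_face (Suc n) k \<sigma>))"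
    using True by (simp add: dl_Suc cobd_def del: sum.atMost_Suc)
   also have "\<dots> = (\<Sum>k\<le>Suc n. \<Sum>p\<le>n. if k \<le> p then L p k else R p (k - p))"
   proof (rule sum.cong[OF refl])
    fix k assume "k \<in> {..Suc n}"
    then have k: "k \<le> Suc n" by simp
    have "(-1) ^ k * cup X \<phi> \<psi> n (singular_face (Suc n) k \<sigma>) =
      (\<Sum>p\<le>n. (-1) ^ k * (\<phi> p (front p (singular_face (Suc n) k \<sigma>)) * \<psi> (n - p) (back_face n p (singular_face (Suc n) k \<sigma>))))"
     using face_ssx[OF True k] by (simp add: cup_def sum_distrib_left)
    also have "\<dots> = (\<Sum>p\<le>n. if k \<le> p then L p k else R p (k - p))"
     by (rule sum.cong[OF refl], rule tm) (use k in auto)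
    finally show "(-1) ^ k * cup X \<phi> \<psi> n (singular_face (Suc n) k \<sigma>) = (\<Sum>p\<le>n. if k \<le> p then L p k else R p (k - p))" .
   qed
   also have "\<dots> = (\<Sum>p\<le>n. \<Sum>k\<le>Suc n. if k \<le> p then L p k else R p (k - p))"
    by (rule sum.swap)
   also have "\<dots> = (\<Sum>p\<le>n. (\<Sum>k\<le>p. L p k) + (\<Sum>j\<in>{1..Suc (n - p)}. R p j))"
   proof (rule sum.cong[OF refl])
    fix p assume p: "p \<in> {..n}"
    have "(\<Sum>k\<le>Suc n. if k \<le> p then L p k else R p (k - p)) =
      (\<Sum>k\<in>{..p} \<union> {Suc p..Suc n}. if k \<le> p then L p k else R p (k - p))"
     by (rule sum.cong) (use p in auto)
    also have "\<dots> = (\<Sum>k\<in>{..p}. if k \<le> p then L p k else R p (k - p)) + (\<Sum>k\<in>{Suc p..Suc n}. if k \<le> p then L p k else R p (k - p))"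
     by (rule sum.union_disjoint) auto
    also have "(\<Sum>k\<in>{Suc p..Suc n}. if k \<le> p then L p k else R p (k - p)) = (\<Sum>j\<in>{1..Suc (n - p)}. R p j)"
     by (rule sum.reindex_bij_witness[where i = "\<lambda>j. j + p" and j = "\<lambda>k. k - p"]) (use p in auto)
    finally show "(\<Sum>k\<le>Suc n. if k \<le> p then L p k else R p (k - p)) = (\<Sum>k\<le>p. L p k) + (\<Sum>j\<in>{1..Suc (n - p)}. R p j)"
     by simp
   qed
   finally have lhs: "dl X (cup X \<phi> \<psi>) (Suc n) \<sigma> = (\<Sum>p\<le>n. \<Sum>k\<le>p. L p k) + (\<Sum>p\<le>n. \<Sum>j\<in>{1..Suc (n - p)}. R p j)"
    by (simp add: sum.distrib)
   have "cup X (dl X \<phi>) \<psi> (Suc n) \<sigma> = (\<Sum>p\<le>Suc n. dl X \<phi> p (front p \<sigma>) * \<psi> (Suc n - p) (back_face (Suc n) p \<sigma>))"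
    using True by (simp add: cup_def del: sum.atMost_Suc)
   also have "\<dots> = (\<Sum>p\<le>n. dl X \<phi> (Suc p) (front (Suc p) \<sigma>) * \<psi> (n - p) (back_face (Suc n) (Suc p) \<sigma>))"
    by (simp only: sum.atMost_Suc_shift) (simp add: dl_0)
   also have "\<dots> = (\<Sum>p\<le>n. \<Sum>k\<le>Suc p. L p k)"
    using front_ssx[OF True] by (intro sum.cong refl) (simp add: dl_Suc cobd_def L_def sum_distrib_right distrib_right left_diff_distrib del: sum.atMost_Suc)
   finally have r1: "cup X (dl X \<phi>) \<psi> (Suc n) \<sigma> = (\<Sum>p\<le>n. \<Sum>k\<le>p. L p k) + (\<Sum>p\<le>n. L p (Suc p))"
    by (simp add: sum.distrib)
   have "cup X (sgn_coch \<phi>) (dl X \<psi>) (Suc n) \<sigma> = (\<Sum>p\<le>Suc n. sgn_coch \<phi> p (front p \<sigma>) * dl X \<psi> (Suc n - p) (back_face (Suc n) p \<sigma>))"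
    using True by (simp add: cup_def del: sum.atMost_Suc)
   also have "\<dots> = (\<Sum>p\<le>n. sgn_coch \<phi> p (front p \<sigma>) * dl X \<psi> (Suc (n - p)) (back_face (Suc n) p \<sigma>))"
    by (simp only: sum.atMost_Suc) (simp add: dl_0, intro sum.cong refl, simp add: Suc_diff_le)
   also have "\<dots> = (\<Sum>p\<le>n. \<Sum>j\<le>Suc (n - p). R p j)"
   proof (rule sum.cong[OF refl])
    fix p assume "p \<in> {..n}"
    then have "ssx (Suc (n - p)) X (back_face (Suc n) p \<sigma>)" using back_ssx[OF True, of p] by (simp add: Suc_diff_le)
    then show "sgn_coch \<phi> p (front p \<sigma>) * dl X \<psi> (Suc (n - p)) (back_face (Suc n) p \<sigma>) = (\<Sum>j\<le>Suc (n - p). R p j)"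
     by (simp add: dl_Suc cobd_def R_def sgn_coch_def sum_distrib_left right_diff_distrib distrib_left power_add ac_simps del: sum.atMost_Suc)
   qed
   also have "\<dots> = (\<Sum>p\<le>n. R p 0 + (\<Sum>j\<in>{1..Suc (n - p)}. R p j))"
   proof (rule sum.cong[OF refl])
    fix p
    have "{..Suc (n - p)} = insert 0 {1..Suc (n - p)}" by auto
    then show "(\<Sum>j\<le>Suc (n - p). R p j) = R p 0 + (\<Sum>j\<in>{1..Suc (n - p)}. R p j)" by simp
   qed
   finally have r2: "cup X (sgn_coch \<phi>) (dl X \<psi>) (Suc n) \<sigma> = (\<Sum>p\<le>n. R p 0) + (\<Sum>p\<le>n. \<Sum>j\<in>{1..Suc (n - p)}. R p j)"
    by (simp add: sum.distrib)
   have "L p (Suc p) + R p 0 = 0" if "p \<le> n" for p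
   proof -
    have "singular_face (Suc p) (Suc p) (front (Suc p) \<sigma>) = front p \<sigma>"
     using front_face_low[of "Suc p" p n \<sigma>] front_face_high[of p "Suc p" n \<sigma>] that by simp
    moreover have "singular_face (Suc (n - p)) 0 (back_face (Suc n) p \<sigma>) = back_face (Suc n) (Suc p) \<sigma>"
     using back_face_high[of p p n \<sigma>] back_face_low[of p p n \<sigma>] that by simp
    ultimately show ?thesis by (simp add: L_def R_def)
   qed
   then have "(\<Sum>p\<le>n. L p (Suc p)) + (\<Sum>p\<le>n. R p 0) = 0"
    unfolding sum.distrib[symmetric] by (intro sum.neutral) auto
   then show ?thesis unfolding Suc lhs r1 r2 by simp
  qed
 qed
qed

section \<open>The cohomology ring of a circle\<close>

definition cocs :: "'a topology \<Rightarrow> 'a coch set" where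
 "cocs X = {\<phi> \<in> cochs X. dl X \<phi> = (\<lambda>p \<sigma>. 0)}"

definition cobs :: "'a topology \<Rightarrow> 'a coch set" where
 "cobs X = dl X ` cochs X"

lemma cocycle_ring_eq: "cocycle_ring RR X = (cochain_ring RR X)\<lparr>carrier := cocs X\<rparr>"
 by (simp add: cocycle_ring_def cocs_def dl_def cochain_ring_simps)

lemma cocycle_ring_simps:
 "carrier (cocycle_ring RR X) = cocs X" "\<phi> \<otimes>\<^bsub>cocycle_ring RR X\<^esub> \<psi> = cup X \<phi> \<psi>"
 "\<one>\<^bsub>cocycle_ring RR X\<^esub> = unit_coch X" "\<zero>\<^bsub>cocycle_ring RR X\<^esub> = (\<lambda>p \<sigma>. 0)"
 "\<phi> \<oplus>\<^bsub>cocycle_ring RR X\<^esub> \<psi> = (\<lambda>p \<sigma>. \<phi> p \<sigma> + \<psi> p \<sigma>)"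
 by (simp_all add: cocycle_ring_eq cochain_ring_simps)

lemma coboundaries_eq: "coboundaries RR X = cobs X"
 by (simp add: coboundaries_def cobs_def dl_def cochain_ring_simps)

lemma cobd_cong: "(\<And>k. k \<le> n \<Longrightarrow> \<phi> (singular_face n k \<sigma>) = \<psi> (singular_face n k \<sigma>)) \<Longrightarrow> cobd n \<phi> \<sigma> = cobd n \<psi> \<sigma>"
 unfolding cobd_def by (intro sum.cong refl) simp

lemma cobd_zero: "cobd n (\<lambda>\<sigma>. 0) \<sigma> = 0" by (simp add: cobd_def)

lemma coch_ext: "(\<And>\<sigma>. \<phi> 0 \<sigma> = \<psi> 0 \<sigma>) \<Longrightarrow> (\<And>n \<sigma>. \<phi> (Suc n) \<sigma> = \<psi> (Suc n) \<sigma>) \<Longrightarrow> \<phi> = (\<psi> :: 'a coch)"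
proof (intro ext)
 fix p \<sigma> assume "\<And>\<sigma>. \<phi> 0 \<sigma> = \<psi> 0 \<sigma>" "\<And>n \<sigma>. \<phi> (Suc n) \<sigma> = \<psi> (Suc n) \<sigma>"
 then show "\<phi> p \<sigma> = \<psi> p \<sigma>" by (cases p) simp_all
qed

lemma dl_add: "dl X (\<lambda>p \<sigma>. \<phi> p \<sigma> + \<psi> p \<sigma>) = (\<lambda>p \<sigma>. dl X \<phi> p \<sigma> + dl X \<psi> p \<sigma>)"
 by (rule coch_ext) (simp_all only: dl_0 dl_Suc cobd_def distrib_left sum.distrib, simp_all)

lemma dl_minus: "dl X (\<lambda>p \<sigma>. - \<phi> p \<sigma>) = (\<lambda>p \<sigma>. - dl X \<phi> p \<sigma>)"
 by (rule coch_ext) (simp_all only: dl_0 dl_Suc cobd_def mult_minus_right sum_negf, simp_all)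

lemma dl_scale: "dl X (\<lambda>p \<sigma>. r * \<phi> p \<sigma>) = (\<lambda>p \<sigma>. r * dl X \<phi> p \<sigma>)"
proof (rule coch_ext)
 fix n \<sigma>
 have "(\<Sum>k\<le>Suc n. (-1) ^ k * (r * \<phi> n (singular_face (Suc n) k \<sigma>))) = r * (\<Sum>k\<le>Suc n. (-1) ^ k * \<phi> n (singular_face (Suc n) k \<sigma>))"
  unfolding sum_distrib_left by (intro sum.cong refl) (rule mult.left_commute)
 then show "dl X (\<lambda>p \<sigma>. r * \<phi> p \<sigma>) (Suc n) \<sigma> = r * dl X \<phi> (Suc n) \<sigma>" by (simp only: dl_Suc cobd_def split: if_split) simp
qed (simp add: dl_0)

lemma dl_zero: "dl X (\<lambda>p \<sigma>. 0) = (\<lambda>p \<sigma>. 0)"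
 by (rule coch_ext) (simp_all add: dl_0 dl_Suc cobd_zero)

lemma dl_cochs: assumes "\<phi> \<in> cochs X" shows "dl X \<phi> \<in> cochs X"
proof -
 obtain N where N: "\<forall>p \<sigma>. N \<le> p \<longrightarrow> \<phi> p \<sigma> = 0" using finite_degrees[OF assms] ..
 show ?thesis
 proof (rule cochsI[where N = "Suc N"])
  fix p \<sigma> show "\<not> ssx p X \<sigma> \<Longrightarrow> dl X \<phi> p \<sigma> = 0" by (cases p) (simp_all add: dl_0 dl_Suc)
  assume "Suc N \<le> p"
  then obtain n where n: "p = Suc n" "N \<le> n" by (cases p) auto
  then have "\<phi> n = (\<lambda>\<sigma>. 0)" using N by auto
  then show "dl X \<phi> p \<sigma> = 0" by (simp add: n dl_Suc cobd_zero)
 qed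
qed

lemma evaluate_zero: "evaluate RR \<phi> (\<lambda>s. 0) = 0" by (simp add: evaluate_def)

lemma dl_dl: "dl X (dl X \<phi>) = (\<lambda>p \<sigma>. 0)"
proof (rule coch_ext)
 fix n \<sigma>
 show "dl X (dl X \<phi>) (Suc n) \<sigma> = 0"
 proof (cases "ssx (Suc n) X \<sigma>")
  case True
  show ?thesis
  proof (cases n)
   case 0
   then show ?thesis by (simp add: dl_Suc cobd_def dl_0)
  next
   case (Suc m)
   have s: "ssx (Suc (Suc m)) X \<sigma>" using True Suc by simp
   have ch: "rl (frag_of \<sigma>) \<in> chains (Suc (Suc m)) X" using s by (simp add: rl_chains singular_chain_of)
   have f: "finite (supp (chain_bd RR (Suc (Suc m)) (rl (frag_of \<sigma>))))"
    using chains_finite[OF chain_bd_chains[OF ch]] .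
   have "dl X (dl X \<phi>) (Suc n) \<sigma> = cobd (Suc (Suc m)) (cobd (Suc m) (\<phi> m)) \<sigma>"
    unfolding Suc dl_Suc[of _ _ "Suc m"] using s face_ssx[OF s] by (auto simp: dl_Suc intro!: cobd_cong)
   also have "\<dots> = evaluate RR (cobd (Suc (Suc m)) (cobd (Suc m) (\<phi> m))) (rl (frag_of \<sigma>))" by (rule evaluate_of[symmetric])
   also have "\<dots> = evaluate RR (cobd (Suc m) (\<phi> m)) (chain_bd RR (Suc (Suc m)) (rl (frag_of \<sigma>)))"
    by (rule evaluate_bd[OF finite_supp_rl zero_less_Suc, symmetric])
   also have "\<dots> = evaluate RR (\<phi> m) (chain_bd RR (Suc m) (chain_bd RR (Suc (Suc m)) (rl (frag_of \<sigma>))))"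
    by (rule evaluate_bd[OF f zero_less_Suc, symmetric])
   also have "\<dots> = 0" unfolding chain_bd_bd[OF ch] by (rule evaluate_zero)
   finally show ?thesis .
  qed
 qed (simp add: dl_Suc)
qed (simp add: dl_0)

lemma cup_zero: "cup X (\<lambda>p \<sigma>. 0) \<psi> = (\<lambda>p \<sigma>. 0)" "cup X \<phi> (\<lambda>p \<sigma>. 0) = (\<lambda>p \<sigma>. 0)"
 by (auto simp: cup_def fun_eq_iff)

lemma cocs_cup: assumes "\<phi> \<in> cocs X" "\<psi> \<in> cocs X" shows "cup X \<phi> \<psi> \<in> cocs X"
 using assms cup_closed[of \<phi> X \<psi>] by (simp add: cocs_def leibniz cup_zero)

lemma cochs_sgn: assumes "\<phi> \<in> cochs X" shows "sgn_coch \<phi> \<in> cochs X"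
proof -
 obtain N where N: "\<forall>p \<sigma>. N \<le> p \<longrightarrow> \<phi> p \<sigma> = 0" using finite_degrees[OF assms] ..
 show ?thesis by (rule cochsI[where N = N]) (use N assms in \<open>simp_all add: sgn_coch_def cochs_def\<close>)
qed

lemma dl_sgn: "dl X (sgn_coch \<phi>) (Suc n) \<sigma> = (-1) ^ n * dl X \<phi> (Suc n) \<sigma>"
proof -
 have "dl X (sgn_coch \<phi>) (Suc n) \<sigma> = dl X (\<lambda>p \<sigma>. (-1) ^ n * \<phi> p \<sigma>) (Suc n) \<sigma>" by (simp only: dl_Suc cobd_def sgn_coch_def)
 then show ?thesis by (simp only: dl_scale)
qed

lemma cobs_cup_left: assumes "\<phi> \<in> cocs X" "\<beta> \<in> cobs X" shows "cup X \<phi> \<beta> \<in> cobs X"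
proof -
 obtain \<eta> where \<eta>: "\<eta> \<in> cochs X" "\<beta> = dl X \<eta>" using assms(2) unfolding cobs_def by (elim imageE)
 have d: "dl X \<phi> = (\<lambda>p \<sigma>. 0)" and c: "\<phi> \<in> cochs X" using assms(1) by (simp_all add: cocs_def)
 have "dl X (sgn_coch \<phi>) = (\<lambda>p \<sigma>. 0)" by (rule coch_ext) (simp_all add: dl_0 dl_sgn d)
 moreover have "sgn_coch (sgn_coch \<phi>) = \<phi>" by (simp add: sgn_coch_def fun_eq_iff mult.assoc[symmetric] power_add[symmetric] mult_2[symmetric])
 ultimately have "cup X \<phi> \<beta> = dl X (cup X (sgn_coch \<phi>) \<eta>)" by (simp add: leibniz cup_zero \<eta>(2))
 then show ?thesis unfolding cobs_def by (rule image_eqI[OF _ cup_closed[OF cochs_sgn[OF c] \<eta>(1)]])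
qed

lemma cobs_cup_right: assumes "\<phi> \<in> cocs X" "\<beta> \<in> cobs X" shows "cup X \<beta> \<phi> \<in> cobs X"
proof -
 obtain \<eta> where \<eta>: "\<eta> \<in> cochs X" "\<beta> = dl X \<eta>" using assms(2) unfolding cobs_def by (elim imageE)
 have d: "dl X \<phi> = (\<lambda>p \<sigma>. 0)" and c: "\<phi> \<in> cochs X" using assms(1) by (simp_all add: cocs_def)
 have "cup X \<beta> \<phi> = dl X (cup X \<eta> \<phi>)" by (simp add: leibniz cup_zero \<eta>(2) d)
 then show ?thesis unfolding cobs_def by (rule image_eqI[OF _ cup_closed[OF \<eta>(1) c]])
qed

lemma unit_cocs: "unit_coch X \<in> cocs X"
proof -
 have "dl X (unit_coch X) = (\<lambda>p \<sigma>. 0)"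
 proof (rule coch_ext)
  fix n \<sigma> show "dl X (unit_coch X) (Suc n) \<sigma> = 0"
  proof (cases "n = 0 \<and> ssx (Suc 0) X \<sigma>")
   case True
   then have "ssx 0 X (singular_face (Suc 0) k \<sigma>)" if "k \<le> Suc 0" for k using face_ssx[of 0 X \<sigma> k] that by simp
   then show ?thesis using True by (simp add: dl_Suc cobd_def unit_coch_def)
  next
   case False
   show ?thesis
   proof (cases "n = 0")
    case True then show ?thesis using False by (simp add: dl_Suc)
   next
    case False
    then have "unit_coch X n = (\<lambda>\<sigma>. 0)" by (simp add: unit_coch_def fun_eq_iff)
    then show ?thesis by (simp add: dl_Suc cobd_zero)
   qed
  qed
 qed (simp add: dl_0)
 then show ?thesis by (simp add: cocs_def unit_closed)
qed

lemma cocs_minus: "\<phi> \<in> cocs X \<Longrightarrow> (\<lambda>p \<sigma>. - \<phi> p \<sigma>) \<in> cocs X"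
 by (simp add: cocs_def cochs_minus dl_minus)

lemma cocs_add: "\<phi> \<in> cocs X \<Longrightarrow> \<psi> \<in> cocs X \<Longrightarrow> (\<lambda>p \<sigma>. \<phi> p \<sigma> + \<psi> p \<sigma>) \<in> cocs X"
 by (simp add: cocs_def cochs_add dl_add)

lemma cobs_cocs: "cobs X \<subseteq> cocs X"
 unfolding cobs_def cocs_def by (auto simp: dl_cochs dl_dl)

lemma cocycle_ring_ring: "ring (cocycle_ring RR X)"
proof -
 interpret C: ring "cochain_ring RR X" by (rule cochain_ring_ring)
 have neg: "\<ominus>\<^bsub>cochain_ring RR X\<^esub> \<phi> = (\<lambda>p \<sigma>. - \<phi> p \<sigma>)" if "\<phi> \<in> cochs X" for \<phi>
  by (rule C.minus_equality) (simp_all add: cochain_ring_simps that cochs_minus)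
 have "subring (cocs X) (cochain_ring RR X)"
 proof (rule C.subringI)
  show "cocs X \<subseteq> carrier (cochain_ring RR X)" by (auto simp: cochain_ring_simps cocs_def)
  fix \<phi> assume \<phi>: "\<phi> \<in> cocs X"
  then have "\<phi> \<in> cochs X" by (simp add: cocs_def)
  then show "\<ominus>\<^bsub>cochain_ring RR X\<^esub> \<phi> \<in> cocs X" using neg cocs_minus[OF \<phi>] by simp
 qed (simp_all add: cochain_ring_simps unit_cocs cocs_cup cocs_add)
 then show ?thesis unfolding cocycle_ring_eq by (rule C.subring_is_ring)
qed

lemma cocycle_minus: "\<phi> \<in> cocs X \<Longrightarrow> \<ominus>\<^bsub>cocycle_ring RR X\<^esub> \<phi> = (\<lambda>p \<sigma>. - \<phi> p \<sigma>)"
proof -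
 interpret R: ring "cocycle_ring RR X" by (rule cocycle_ring_ring)
 show "\<phi> \<in> cocs X \<Longrightarrow> \<ominus>\<^bsub>cocycle_ring RR X\<^esub> \<phi> = (\<lambda>p \<sigma>. - \<phi> p \<sigma>)"
  by (rule R.minus_equality) (simp_all add: cocycle_ring_simps cocs_minus)
qed

text \<open>The product of a cocycle and a coboundary is a coboundary by the Leibniz rule.\<close>

lemma coboundaries_ideal: "ideal (cobs X) (cocycle_ring RR X)"
proof (rule idealI[OF cocycle_ring_ring])
 show "subgroup (cobs X) (add_monoid (cocycle_ring RR X))"
 proof (rule subgroup.intro)
  show "cobs X \<subseteq> carrier (add_monoid (cocycle_ring RR X))" using cobs_cocs by (simp add: cocycle_ring_simps)
  show "x \<otimes>\<^bsub>add_monoid (cocycle_ring RR X)\<^esub> y \<in> cobs X" if xy: "x \<in> cobs X" "y \<in> cobs X" for x y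
  proof -
   obtain a b where ab: "a \<in> cochs X" "x = dl X a" "b \<in> cochs X" "y = dl X b" using xy unfolding cobs_def by (elim imageE)
   have "(\<lambda>p \<sigma>. x p \<sigma> + y p \<sigma>) = dl X (\<lambda>p \<sigma>. a p \<sigma> + b p \<sigma>)" by (simp add: dl_add ab)
   then show ?thesis unfolding cobs_def using cochs_add[OF ab(1,3)] by (simp add: cocycle_ring_simps)
  qed
  show "\<one>\<^bsub>add_monoid (cocycle_ring RR X)\<^esub> \<in> cobs X"
   unfolding cobs_def using imageI[OF cochs_zero, of "dl X" X] by (simp add: cocycle_ring_simps dl_zero)
  show "inv\<^bsub>add_monoid (cocycle_ring RR X)\<^esub> x \<in> cobs X" if x: "x \<in> cobs X" for x
  proof -
   obtain a where a: "a \<in> cochs X" "x = dl X a" using x unfolding cobs_def by (elim imageE)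
   have "inv\<^bsub>add_monoid (cocycle_ring RR X)\<^esub> x = (\<lambda>p \<sigma>. - x p \<sigma>)"
    using cocycle_minus[OF subsetD[OF cobs_cocs x]] by (simp add: a_inv_def)
   also have "\<dots> = dl X (\<lambda>p \<sigma>. - a p \<sigma>)" by (simp add: dl_minus a)
   finally show ?thesis unfolding cobs_def using cochs_minus[OF a(1)] by simp
  qed
 qed
qed (simp_all add: cocycle_ring_simps cobs_cup_left cobs_cup_right)

lemma cohclass_eqI:
 assumes "\<phi> \<in> cocs X" "\<psi> \<in> cocs X" "\<eta> \<in> cochs X" "dl X \<eta> = (\<lambda>p \<sigma>. \<phi> p \<sigma> - \<psi> p \<sigma>)"
 shows "cohclass RR X \<phi> = cohclass RR X \<psi>"
proof -
 interpret R: ring "cocycle_ring RR X" by (rule cocycle_ring_ring)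
 have "\<phi> \<ominus>\<^bsub>cocycle_ring RR X\<^esub> \<psi> = (\<lambda>p \<sigma>. \<phi> p \<sigma> - \<psi> p \<sigma>)"
  by (simp add: a_minus_def cocycle_minus[OF assms(2)] cocycle_ring_simps)
 also have "\<dots> \<in> cobs X" unfolding cobs_def assms(4)[symmetric] by (rule imageI[OF assms(3)])
 finally show ?thesis unfolding cohclass_def coboundaries_eq
  using R.quotient_eq_iff_same_a_r_cos[OF coboundaries_ideal] assms by (simp add: cocycle_ring_simps)
qed

lemma cohomology_ring_simps:
 "carrier (cohomology_ring RR X) = cohclass RR X ` cocs X"
 "\<phi> \<in> cocs X \<Longrightarrow> \<psi> \<in> cocs X \<Longrightarrow> cohclass RR X \<phi> \<oplus>\<^bsub>cohomology_ring RR X\<^esub> cohclass RR X \<psi> = cohclass RR X (\<lambda>p \<sigma>. \<phi> p \<sigma> + \<psi> p \<sigma>)"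
 "\<phi> \<in> cocs X \<Longrightarrow> \<psi> \<in> cocs X \<Longrightarrow> cohclass RR X \<phi> \<otimes>\<^bsub>cohomology_ring RR X\<^esub> cohclass RR X \<psi> = cohclass RR X (cup X \<phi> \<psi>)"
 "ring (cohomology_ring RR X)"
proof -
 interpret I: ideal "cobs X" "cocycle_ring RR X" by (rule coboundaries_ideal)
 show "carrier (cohomology_ring RR X) = cohclass RR X ` cocs X"
  by (auto simp: cohomology_ring_def FactRing_def A_RCOSETS_def' cohclass_def coboundaries_eq cocycle_ring_simps)
 show "\<phi> \<in> cocs X \<Longrightarrow> \<psi> \<in> cocs X \<Longrightarrow> cohclass RR X \<phi> \<oplus>\<^bsub>cohomology_ring RR X\<^esub> cohclass RR X \<psi> = cohclass RR X (\<lambda>p \<sigma>. \<phi> p \<sigma> + \<psi> p \<sigma>)"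
  using I.a_rcos_sum[of \<phi> \<psi>] by (simp add: cohomology_ring_def FactRing_def cohclass_def coboundaries_eq cocycle_ring_simps)
 show "\<phi> \<in> cocs X \<Longrightarrow> \<psi> \<in> cocs X \<Longrightarrow> cohclass RR X \<phi> \<otimes>\<^bsub>cohomology_ring RR X\<^esub> cohclass RR X \<psi> = cohclass RR X (cup X \<phi> \<psi>)"
  using I.rcoset_mult_add[of \<phi> \<psi>] by (simp add: cohomology_ring_def FactRing_def cohclass_def coboundaries_eq cocycle_ring_simps)
 show "ring (cohomology_ring RR X)" unfolding cohomology_ring_def coboundaries_eq by (rule I.quotient_is_ring)
qed

lemma scalar_cocs: "scalar_cochain RR X r \<in> cocs X"
proof -
 have "cup X (scalar_cochain RR X r) (unit_coch X) = (\<lambda>p \<sigma>. r * unit_coch X p \<sigma>)" by (rule scalar_cup[OF unit_closed])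
 moreover have "scalar_cochain RR X r = (\<lambda>p \<sigma>. r * unit_coch X p \<sigma>)" by (auto simp: scalar_cochain_def unit_coch_def fun_eq_iff)
 moreover have "dl X (\<lambda>p \<sigma>. r * unit_coch X p \<sigma>) = (\<lambda>p \<sigma>. r * dl X (unit_coch X) p \<sigma>)"
  by (rule dl_scale)
 moreover have "scalar_cochain RR X r \<in> cochs X"
  by (rule cochsI[where N = 1]) (auto simp: scalar_cochain_def)
 ultimately show ?thesis using unit_cocs[of X] by (simp add: cocs_def)
qed

text \<open>A path between two points is a singular 1-simplex with these points as its two faces.\<close>

lemma zero_cocycle_constant:
 assumes pc: "path_connected_space X" and cl: "\<And>\<tau>. ssx 1 X \<tau> \<Longrightarrow> cobd 1 \<phi> \<tau> = 0"
  and s: "ssx 0 X \<sigma>" "ssx 0 X \<sigma>'"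
 shows "\<phi> \<sigma> = \<phi> \<sigma>'"
proof -
 define v where "v = (\<lambda>j::nat. if j = 0 then 1 else (0::real))"
 have S0: "standard_simplex 0 = {v}" by (simp add: standard_simplex_0 v_def)
 have "\<sigma> v \<in> topspace X" "\<sigma>' v \<in> topspace X"
  using s S0 by (auto simp: singular_simplex_def continuous_map_def)
 then obtain h where h: "pathin X h" "h 0 = \<sigma> v" "h 1 = \<sigma>' v" using pc unfolding path_connected_space_def by blast
 define \<tau> where "\<tau> = restrict (\<lambda>t. h (t 0)) (standard_simplex 1)"
 have "continuous_map (top_of_set (standard_simplex 1)) (top_of_set {0..1}) (\<lambda>t. t (0::nat) :: real)"
 proof -
  have "continuous_on (standard_simplex 1) (\<lambda>t. t (0::nat) :: real)"
   by (rule continuous_on_subset[OF continuous_on_product_coordinates subset_UNIV])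
  moreover have "(\<lambda>t. t (0::nat)) ` standard_simplex 1 \<subseteq> {0..1}" by (auto simp: standard_simplex_def)
  ultimately show ?thesis by (simp add: continuous_map_in_subtopology image_subset_iff_funcset)
 qed
 then have "continuous_map (top_of_set (standard_simplex 1)) X (h \<circ> (\<lambda>t. t 0))"
  using h(1) unfolding pathin_def by (rule continuous_map_compose)
 then have "continuous_map (top_of_set (standard_simplex 1)) X \<tau>"
  by (rule continuous_map_eq) (simp add: \<tau>_def)
 then have t: "ssx 1 X \<tau>" by (simp add: singular_simplex_def euclidean_product_topology \<tau>_def)
 have face: "singular_face 1 k \<tau> = \<rho>" if k: "k \<le> 1" and r: "ssx 0 X \<rho>" "h (simplical_face k v 0) = \<rho> v" for k \<rho>
 proof (rule extensionalityI)
  show "singular_face 1 k \<tau> \<in> extensional (standard_simplex 0)" by (simp add: singular_face_def)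
  show "\<rho> \<in> extensional (standard_simplex 0)" using r(1) by (simp add: singular_simplex_def)
  fix x assume x: "x \<in> standard_simplex 0"
  then have xv: "x = v" using S0 by simp
  have "simplical_face k v \<in> standard_simplex (Suc 0)" using face_in[of v 0 k] k S0 by simp
  then show "singular_face 1 k \<tau> x = \<rho> x" using x r(2) by (simp add: xv singular_face_def \<tau>_def)
 qed
 have "singular_face 1 0 \<tau> = \<sigma>" by (rule face) (use s(1) h in \<open>simp_all add: simplical_face_def\<close>)
 moreover have "singular_face 1 1 \<tau> = \<sigma>'" by (rule face) (use s(2) h in \<open>simp_all add: simplical_face_def v_def\<close>)
 ultimately show ?thesis using cl[OF t] by (simp add: cobd_def)
qed

lemma evaluate_bdr:
 assumes "\<And>\<sigma>. ssx (Suc p) X \<sigma> \<Longrightarrow> cobd (Suc p) \<phi> \<sigma> = 0" "b \<in> bdr p X"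
 shows "evaluate RR \<phi> b = 0"
proof -
 obtain c where c: "c \<in> chains (Suc p) X" "b = chain_bd RR (Suc p) c" using assms(2) unfolding bdr_eq by (elim imageE)
 have "evaluate RR \<phi> b = evaluate RR (cobd (Suc p) \<phi>) c" unfolding c(2) by (rule evaluate_bd[OF chains_finite[OF c(1)] zero_less_Suc])
 also have "\<dots> = (\<Sum>\<sigma>\<in>supp c. cobd (Suc p) \<phi> \<sigma> * c \<sigma>)" by (rule evaluate_eq[OF chains_finite[OF c(1)] subset_refl])
 also have "\<dots> = 0" by (rule sum.neutral) (use c(1) assms(1) in \<open>auto simp: chains_def\<close>)
 finally show ?thesis .
qed

lemma evaluate_cong:
 assumes "c \<in> chains p X" "\<And>\<sigma>. ssx p X \<sigma> \<Longrightarrow> \<phi> \<sigma> = \<psi> \<sigma>" shows "evaluate RR \<phi> c = evaluate RR \<psi> c"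
 unfolding evaluate_eq[OF chains_finite[OF assms(1)] subset_refl]
 by (rule sum.cong) (use assms in \<open>auto simp: chains_def\<close>)

text \<open>Spaces with the real homology of the circle, with a generating cycle \<open>g\<close> and a 1-cocycle that
  has the value 1 on it.\<close>

locale circle_like =
 fixes X :: "'a topology" and g \<omega> :: "('a, real) cochain"
 assumes pc: "path_connected_space X" and ne: "topspace X \<noteq> {}"
  and g: "g \<in> cyc 1 X" and line: "\<And>c. c \<in> cyc 1 X \<Longrightarrow> \<exists>r. (\<lambda>s. c s - r * g s) \<in> bdr 1 X"
  and high: "\<And>p. p \<ge> 2 \<Longrightarrow> cyc p X \<subseteq> bdr p X"
  and closed: "\<And>\<sigma>. ssx 2 X \<sigma> \<Longrightarrow> cobd 2 \<omega> \<sigma> = 0" and unit: "evaluate RR \<omega> g = 1"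
begin

definition dual :: "'a coch" where
 "dual p \<sigma> = (if p = 1 \<and> ssx 1 X \<sigma> then \<omega> \<sigma> else 0)"

lemma dual_cocs: "dual \<in> cocs X"
proof -
 have "dl X dual = (\<lambda>p \<sigma>. 0)"
 proof (rule coch_ext)
  fix n \<sigma> show "dl X dual (Suc n) \<sigma> = 0"
  proof (cases "n = 1 \<and> ssx 2 X \<sigma>")
   case True
   then have s: "ssx (Suc 1) X \<sigma>" by (simp add: numeral_2_eq_2)
   then have "cobd (Suc 1) (dual 1) \<sigma> = cobd (Suc 1) \<omega> \<sigma>"
    by (intro cobd_cong) (use face_ssx[OF s] in \<open>simp add: dual_def\<close>)
   then show ?thesis using True closed[of \<sigma>] s by (simp add: dl_Suc numeral_2_eq_2)
  next
   case False
   then show ?thesis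
   proof (cases "n = 1")
    case False
    then have "dual n = (\<lambda>\<sigma>. 0)" by (auto simp: dual_def)
    then show ?thesis by (simp add: dl_Suc cobd_zero)
   qed (simp add: dl_Suc numeral_2_eq_2)
  qed
 qed (simp add: dl_0)
 moreover have "dual \<in> cochs X" by (rule cochsI[where N = 2]) (auto simp: dual_def)
 ultimately show ?thesis by (simp add: cocs_def)
qed

lemma evaluate_dual: "c \<in> chains 1 X \<Longrightarrow> evaluate RR (dual 1) c = evaluate RR \<omega> c"
 by (rule evaluate_cong[where p = 1 and X = X]) (simp_all only: dual_def if_True simp_thms)

lemma cyc1: "c \<in> cyc 1 X \<Longrightarrow> c \<in> chains 1 X" by (simp add: cyc_eq)

lemma closed': "ssx (Suc 1) X \<sigma> \<Longrightarrow> cobd (Suc 1) \<omega> \<sigma> = 0"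
 using closed[of \<sigma>] by (simp add: numeral_2_eq_2)

lemma g_not_bdr: "g \<notin> bdr 1 X"
 using evaluate_bdr[of 1 X \<omega> g] closed' unit by auto

lemma basis: "suitable_basis RR (homology_module RR 1 X) {hclass RR 1 X g}"
 "module.span RR (homology_module RR 1 X) {hclass RR 1 X g} = carrier (homology_module RR 1 X)"
proof -
 interpret fn_quotient "cyc 1 X" "bdr 1 X" by (rule homology_quotient)
 show "suitable_basis RR (homology_module RR 1 X) {hclass RR 1 X g}"
  "module.span RR (homology_module RR 1 X) {hclass RR 1 X g} = carrier (homology_module RR 1 X)"
  unfolding homology_module_eq hclass_coset using suitable_basis_line[OF g g_not_bdr line] by blast+
qed

lemma dual_represents: "represents_dual RR X 1 {hclass RR 1 X g} (hclass RR 1 X g) dual"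
proof -
 interpret fn_quotient "cyc 1 X" "bdr 1 X" by (rule homology_quotient)
 define h where "h z = evaluate RR \<omega> (SOME c. c \<in> cyc 1 X \<and> z = coset (bdr 1 X) c)" for z
 have diff: "evaluate RR \<omega> c = evaluate RR \<omega> d" if "c \<in> cyc 1 X" "d \<in> cyc 1 X" "coset (bdr 1 X) c = coset (bdr 1 X) d" for c d
 proof -
  have "evaluate RR \<omega> (\<lambda>s. c s - d s) = 0" using that(3) unfolding coset_eq by (rule evaluate_bdr[OF closed', rotated])
  moreover have "finite (supp (\<lambda>s. c s - d s))"
   using fn_subspaceD(5)[OF chains_sub cyc1[OF that(1)] cyc1[OF that(2)]] by (rule chains_finite)
  ultimately show ?thesis
   using evaluate_add[of d "\<lambda>s. c s - d s" \<omega>] chains_finite[OF cyc1[OF that(2)]] by simp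
 qed
 have h: "h (coset (bdr 1 X) c) = evaluate RR \<omega> c" if "c \<in> cyc 1 X" for c
 proof -
  have "\<exists>d. d \<in> cyc 1 X \<and> coset (bdr 1 X) c = coset (bdr 1 X) d" using that by blast
  note s = someI_ex[OF this]
  show ?thesis unfolding h_def by (rule diff[OF conjunct1[OF s] that conjunct2[OF s, symmetric]])
 qed
 have hom: "h \<in> LinearCombinations.module_hom RR (homology_module RR 1 X) (self_module RR)"
  unfolding LinearCombinations.module_hom_def mem_Collect_eq homology_module_eq
 proof (intro conjI allI impI funcsetI)
  fix x assume "x \<in> carrier Q" then show "h x \<in> carrier (self_module RR)" by (simp add: self_module_def)
 next
  fix x y assume "x \<in> carrier Q \<and> y \<in> carrier Q"
  then obtain c d where c: "c \<in> cyc 1 X" "x = coset (bdr 1 X) c" and d: "d \<in> cyc 1 X" "y = coset (bdr 1 X) d"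
   unfolding Q_carrier by (elim conjE imageE)
  show "h (x \<oplus>\<^bsub>Q\<^esub> y) = h x \<oplus>\<^bsub>self_module RR\<^esub> h y"
   unfolding c(2) d(2) Q_add h[OF fn_subspaceD(2)[OF cyc_sub c(1) d(1)]] h[OF c(1)] h[OF d(1)]
   using evaluate_add[OF chains_finite[OF cyc1[OF c(1)]] chains_finite[OF cyc1[OF d(1)]]] by (simp add: self_module_def)
 next
  fix r x assume "r \<in> carrier RR \<and> x \<in> carrier Q"
  then obtain c where c: "c \<in> cyc 1 X" "x = coset (bdr 1 X) c" unfolding Q_carrier by (elim conjE imageE)
  show "h (r \<odot>\<^bsub>Q\<^esub> x) = r \<odot>\<^bsub>self_module RR\<^esub> h x"
   unfolding c(2) Q_smult h[OF fn_subspaceD(3)[OF cyc_sub c(1)]] h[OF c(1)]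
   using evaluate_scale[OF chains_finite[OF cyc1[OF c(1)]]] by (simp add: self_module_def)
 qed
 have "dual_respecting RR (homology_module RR 1 X) {hclass RR 1 X g} (hclass RR 1 X g) h"
  unfolding dual_respecting_def using basis(1) hom h[OF g] unit by (simp add: hclass_coset)
 moreover have "evaluate RR (dual 1) c = h (hclass RR 1 X c)" if "c \<in> cyc 1 X" for c
  unfolding hclass_coset h[OF that] by (rule evaluate_dual[OF cyc1[OF that]])
 ultimately show ?thesis unfolding represents_dual_def
  using dual_cocs by (auto simp: cocycle_ring_simps dual_def)
qed

text \<open>In degree 0 a cocycle is constant because the space is path-connected. In degree 1 subtract
  the multiple of the dual that has the same value on \<open>g\<close>; the difference vanishes on all cycles. In
  higher degrees every cycle is a boundary, so cocycles vanish on cycles. A cochain that vanishes on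
  all cycles is a coboundary, and finitely many primitives are put together to one.\<close>

lemma class_decomposition:
 assumes \<phi>: "\<phi> \<in> cocs X"
 shows "\<exists>r s. cohclass RR X \<phi> = cohclass RR X (\<lambda>p \<sigma>. scalar_cochain RR X r p \<sigma> + cup X (scalar_cochain RR X s) dual p \<sigma>)"
proof -
 have \<phi>c: "\<phi> \<in> cochs X" and \<phi>d: "dl X \<phi> = (\<lambda>p \<sigma>. 0)" using \<phi> by (simp_all add: cocs_def)
 have cl: "cobd (Suc n) (\<phi> n) \<sigma> = 0" if "ssx (Suc n) X \<sigma>" for n \<sigma>
  using fun_cong[OF fun_cong[OF \<phi>d, of "Suc n"], of \<sigma>] that by (simp add: dl_Suc)
 obtain x0 where "x0 \<in> topspace X" using ne by blast
 define \<sigma>0 where "\<sigma>0 = restrict (\<lambda>_. x0) (standard_simplex 0)"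
 have \<sigma>0: "ssx 0 X \<sigma>0"
 proof -
  have "continuous_map (top_of_set (standard_simplex 0)) X \<sigma>0"
   by (rule continuous_map_eq[of _ _ "\<lambda>_. x0"]) (simp_all add: \<sigma>0_def \<open>x0 \<in> topspace X\<close>)
  then show ?thesis by (simp add: singular_simplex_def euclidean_product_topology \<sigma>0_def)
 qed
 define r where "r = \<phi> 0 \<sigma>0"
 have deg0: "\<phi> 0 \<sigma> = r" if "ssx 0 X \<sigma>" for \<sigma>
  unfolding r_def by (rule zero_cocycle_constant[OF pc _ that \<sigma>0]) (use cl[of 0] in simp)
 define s where "s = evaluate RR (\<phi> 1) g"
 have van1: "evaluate RR (\<lambda>\<sigma>. \<phi> 1 \<sigma> + (- s) * \<omega> \<sigma>) c = 0" if c: "c \<in> cyc (Suc 0) X" for c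
 proof -
  have ev: "evaluate RR (\<lambda>\<sigma>. \<phi> 1 \<sigma> + (- s) * \<omega> \<sigma>) d = evaluate RR (\<phi> 1) d - s * evaluate RR \<omega> d" for d
   by (simp add: evaluate_def distrib_right left_diff_distrib sum_subtractf sum_distrib_left mult.assoc)
  obtain t where t: "(\<lambda>s. c s - t * g s) \<in> bdr 1 X" using line[of c] c by auto
  define b where "b = (\<lambda>s. c s - t * g s)"
  have b0: "evaluate RR (\<phi> 1) b = 0" "evaluate RR \<omega> b = 0"
   using evaluate_bdr[of 1 X "\<phi> 1" b] evaluate_bdr[of 1 X \<omega> b] cl[of 1] closed' t unfolding b_def by blast+
  have fb: "finite (supp b)" using t bdr_cyc[of 1 X] unfolding b_def by (intro chains_finite[of _ 1 X]) (auto simp: cyc_eq)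
  have fg: "finite (supp (\<lambda>s. t * g s))"
   by (rule chains_finite[OF fn_subspaceD(3)[OF chains_sub cyc1[OF g]]])
  have cb: "c = (\<lambda>s. b s + t * g s)" by (simp add: b_def)
  have "evaluate RR \<phi>' c = evaluate RR \<phi>' b + t * evaluate RR \<phi>' g" for \<phi>'
   unfolding cb evaluate_add[OF fb fg] evaluate_scale[OF chains_finite[OF cyc1[OF g]]] ..
  then show ?thesis unfolding ev using b0 unit by (simp add: s_def)
 qed
 define \<delta> where "\<delta> p \<sigma> = \<phi> p \<sigma> - (scalar_cochain RR X r p \<sigma> + cup X (scalar_cochain RR X s) dual p \<sigma>)" for p \<sigma>
 have dc: "dual \<in> cochs X" using dual_cocs by (simp add: cocs_def)
 have cs: "cup X (scalar_cochain RR X s) dual = (\<lambda>p \<sigma>. s * dual p \<sigma>)" by (rule scalar_cup[OF dc])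
 have \<delta>': "\<delta> = (\<lambda>p \<sigma>. \<phi> p \<sigma> - (scalar_cochain RR X r p \<sigma> + s * dual p \<sigma>))" by (simp add: \<delta>_def cs fun_eq_iff)
 have d0: "\<delta> 0 \<sigma> = 0" for \<sigma>
 proof (cases "ssx 0 X \<sigma>")
  case True then show ?thesis by (simp add: \<delta>' scalar_cochain_def dual_def deg0)
 next
  case False then show ?thesis using \<phi>c by (simp add: \<delta>' scalar_cochain_def dual_def cochs_def)
 qed
 have ex: "\<exists>\<psi>. \<forall>\<sigma>. ssx (Suc n) X \<sigma> \<longrightarrow> cobd (Suc n) \<psi> \<sigma> = \<delta> (Suc n) \<sigma>" for n
 proof -
  have "evaluate RR (\<delta> (Suc n)) c = 0" if c: "c \<in> cyc (Suc n) X" for c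
  proof (cases "n = 0")
   case True
   have "evaluate RR (\<delta> (Suc n)) c = evaluate RR (\<lambda>\<sigma>. \<phi> 1 \<sigma> + (- s) * \<omega> \<sigma>) c"
    by (rule evaluate_cong[where p = "Suc n" and X = X])
     (use c True in \<open>simp_all add: cyc_eq \<delta>' scalar_cochain_def dual_def\<close>)
   then show ?thesis using van1 c True by simp
  next
   case False
   have "evaluate RR (\<delta> (Suc n)) c = evaluate RR (\<phi> (Suc n)) c"
    by (rule evaluate_cong[where p = "Suc n" and X = X])
     (use c False in \<open>simp_all add: cyc_eq \<delta>' scalar_cochain_def dual_def\<close>)
   also have "\<dots> = 0" by (rule evaluate_bdr[OF cl]) (use high[of "Suc n"] c False in auto)
   finally show ?thesis .
  qed
  note van = this
  show ?thesis by (rule vanishing_cochain_is_coboundary[where \<phi> = "\<delta> (Suc n)" and p = n and X = X], erule van, rule_tac x = \<psi> in exI, simp)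
 qed
 obtain N where N: "\<forall>p \<sigma>. N \<le> p \<longrightarrow> \<phi> p \<sigma> = 0" using finite_degrees[OF \<phi>c] ..
 define \<Psi> where "\<Psi> n = (SOME \<psi>. \<forall>\<sigma>. ssx (Suc n) X \<sigma> \<longrightarrow> cobd (Suc n) \<psi> \<sigma> = \<delta> (Suc n) \<sigma>)" for n
 have \<Psi>: "cobd (Suc n) (\<Psi> n) \<sigma> = \<delta> (Suc n) \<sigma>" if "ssx (Suc n) X \<sigma>" for n \<sigma>
  using someI_ex[OF ex[of n]] that unfolding \<Psi>_def by blast
 define \<eta> where "\<eta> n \<sigma> = (if ssx n X \<sigma> \<and> n < N + 2 then \<Psi> n \<sigma> else 0)" for n \<sigma>
 have \<eta>: "\<eta> \<in> cochs X" by (rule cochsI[where N = "N + 2"]) (auto simp: \<eta>_def)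
 have "dl X \<eta> = \<delta>"
 proof (rule coch_ext)
  fix n \<sigma>
  show "dl X \<eta> (Suc n) \<sigma> = \<delta> (Suc n) \<sigma>"
  proof (cases "ssx (Suc n) X \<sigma>")
   case True
   show ?thesis
   proof (cases "n < N + 2")
    case n: True
    have "cobd (Suc n) (\<eta> n) \<sigma> = cobd (Suc n) (\<Psi> n) \<sigma>"
     by (rule cobd_cong) (use face_ssx[OF True] n in \<open>simp add: \<eta>_def\<close>)
    then show ?thesis using True \<Psi>[OF True] by (simp add: dl_Suc)
   next
    case False
    then have "\<eta> n = (\<lambda>\<sigma>. 0)" by (auto simp: \<eta>_def)
    moreover have "\<delta> (Suc n) \<sigma> = 0" using False N by (simp add: \<delta>' scalar_cochain_def dual_def)
    ultimately show ?thesis by (simp add: dl_Suc cobd_zero)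
   qed
  next
   case False
   then have "\<delta> (Suc n) \<sigma> = 0" using \<phi>c by (cases "n = 0") (simp_all add: \<delta>' scalar_cochain_def dual_def cochs_def)
   then show ?thesis using False by (simp add: dl_Suc)
  qed
 qed (simp add: dl_0 d0)
 then have "dl X \<eta> = (\<lambda>p \<sigma>. \<phi> p \<sigma> - (scalar_cochain RR X r p \<sigma> + cup X (scalar_cochain RR X s) dual p \<sigma>))"
  by (simp add: \<delta>_def fun_eq_iff)
 from cohclass_eqI[OF \<phi> cocs_add[OF scalar_cocs cocs_cup[OF scalar_cocs dual_cocs]] \<eta> this] show ?thesis by blast
qed

text \<open>Every class is a scalar plus a scalar multiple of the dual.\<close>

lemma dual_generates: "generates_cohomology RR X {cohclass RR X dual}"
 unfolding generates_cohomology_def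
proof
 let ?R = "cohomology_ring RR X"
 let ?S = "cohclass RR X ` scalar_cochain RR X ` carrier RR \<union> {cohclass RR X dual}"
 interpret R: ring ?R by (rule cohomology_ring_simps)
 have S: "?S \<subseteq> carrier ?R" unfolding cohomology_ring_simps(1) using scalar_cocs dual_cocs by blast
 show "generate_ring ?R ?S \<subseteq> carrier ?R" using R.generate_ring_in_carrier[OF S] by blast
 show "carrier ?R \<subseteq> generate_ring ?R ?S"
 proof
  fix x assume "x \<in> carrier ?R"
  then obtain \<phi> where \<phi>: "\<phi> \<in> cocs X" "x = cohclass RR X \<phi>" unfolding cohomology_ring_simps(1) by (elim imageE)
  obtain r s where "x = cohclass RR X (\<lambda>p \<sigma>. scalar_cochain RR X r p \<sigma> + cup X (scalar_cochain RR X s) dual p \<sigma>)"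
   using class_decomposition[OF \<phi>(1)] \<phi>(2) by blast
  also have "\<dots> = cohclass RR X (scalar_cochain RR X r) \<oplus>\<^bsub>?R\<^esub> (cohclass RR X (scalar_cochain RR X s) \<otimes>\<^bsub>?R\<^esub> cohclass RR X dual)"
   by (simp add: cohomology_ring_simps scalar_cocs dual_cocs cocs_cup)
  finally show "x \<in> generate_ring ?R ?S"
   by (simp only:) (intro generate_ring.eng_add generate_ring.eng_mult generate_ring.incl; simp)
 qed
qed

end

section \<open>The winding cocycle\<close>

definition edge :: "real \<Rightarrow> nat \<Rightarrow> real" where
 "edge t = (\<lambda>i. if i = 0 then 1 - t else if i = 1 then t else 0)"

definition is_lift :: "('a \<Rightarrow> complex) \<Rightarrow> ((nat \<Rightarrow> real) \<Rightarrow> 'a) \<Rightarrow> (real \<Rightarrow> complex) \<Rightarrow> bool" where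
 "is_lift \<zeta> \<sigma> L \<longleftrightarrow> continuous_on {0..1} L \<and> (\<forall>t\<in>{0..1}. exp (L t) = \<zeta> (\<sigma> (edge t)))"

text \<open>The change of the argument of \<open>\<zeta>\<close> along a path, read off from any continuous logarithm.\<close>

definition wind :: "('a \<Rightarrow> complex) \<Rightarrow> ((nat \<Rightarrow> real) \<Rightarrow> 'a) \<Rightarrow> real" where
 "wind \<zeta> \<sigma> = (let L = (SOME L. is_lift \<zeta> \<sigma> L) in Im (L 1 - L 0))"

lemma logs_of_one_discrete:
 assumes "exp u = 1" "exp v = (1::complex)" "u \<noteq> v" shows "1 \<le> norm (u - v)"
proof -
 obtain m :: int where m: "Re u = 0" "Im u = of_int (2 * m) * pi" using assms(1) unfolding exp_eq_1 by blast
 obtain n :: int where n: "Re v = 0" "Im v = of_int (2 * n) * pi" using assms(2) unfolding exp_eq_1 by blast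
 have "m \<noteq> n" using assms(3) m n by (auto simp: complex_eq_iff)
 then have "1 \<le> \<bar>of_int (m - n) :: real\<bar>" by linarith
 then have "1 * 2 \<le> \<bar>of_int (m - n)\<bar> * (2 * pi)" by (intro mult_mono) (use pi_ge_two in auto)
 also have "\<dots> = \<bar>Im (u - v)\<bar>" using m n by (simp add: abs_mult[symmetric] algebra_simps flip: abs_mult) (simp add: abs_mult abs_if algebra_simps)
 also have "\<dots> \<le> norm (u - v)" by (rule abs_Im_le_cmod)
 finally show ?thesis by simp
qed

text \<open>Two logarithms of the same function on an interval differ by a continuous function with
  discrete values, that is, by a constant.\<close>

lemma wind_eq:
 assumes L: "is_lift \<zeta> \<sigma> L" shows "wind \<zeta> \<sigma> = Im (L 1 - L 0)"
proof -
 define K where "K = (SOME L. is_lift \<zeta> \<sigma> L)"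
 have K: "is_lift \<zeta> \<sigma> K" unfolding K_def by (rule someI[of "is_lift \<zeta> \<sigma>", OF L])
 have e: "exp (K t - L t) = 1" if "t \<in> {0..1}" for t
 proof -
  have "exp (K t) = exp (L t)" using K L that by (simp add: is_lift_def)
  then show ?thesis by (simp add: exp_diff)
 qed
 have "(\<lambda>t. K t - L t) constant_on {0..1}"
 proof (rule continuous_discrete_range_constant)
  show "connected {0..1::real}" by simp
  show "continuous_on {0..1} (\<lambda>t. K t - L t)" using K L by (auto simp: is_lift_def intro!: continuous_intros)
  fix x :: real assume x: "x \<in> {0..1}"
  show "\<exists>d>0. \<forall>y. y \<in> {0..1} \<and> K y - L y \<noteq> K x - L x \<longrightarrow> d \<le> norm (K y - L y - (K x - L x))"
   by (rule exI[of _ 1]) (use logs_of_one_discrete[OF e e] x in auto)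
 qed
 then obtain d where d: "\<And>t. t \<in> {0..1} \<Longrightarrow> K t - L t = d" unfolding constant_on_def by blast
 have "K 1 - L 1 = K 0 - L 0" using d[of 0] d[of 1] by simp
 then have "K 1 - K 0 = L 1 - L 0" by (simp add: algebra_simps)
 from arg_cong[OF this, of Im] show ?thesis by (simp only: wind_def Let_def K_def[symmetric])
qed

lemma simplex_comp_continuous:
 assumes "continuous_map X euclidean \<zeta>" "ssx p X \<sigma>"
 shows "continuous_on (standard_simplex p) (\<lambda>x. \<zeta> (\<sigma> x))"
proof -
 have "continuous_map (top_of_set (standard_simplex p)) X \<sigma>"
  using assms(2) by (simp add: singular_simplex_def euclidean_product_topology)
 from continuous_map_compose[OF this assms(1)] show ?thesis by (simp add: o_def)
qed

lemma simplex_range: "ssx p X \<sigma> \<Longrightarrow> x \<in> standard_simplex p \<Longrightarrow> \<sigma> x \<in> topspace X"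
 by (auto simp: singular_simplex_def continuous_map_def)

definition tri :: "complex \<Rightarrow> nat \<Rightarrow> real" where
 "tri z = (\<lambda>i. if i = 0 then 1 - Re z - Im z else if i = 1 then Re z else if i = 2 then Im z else 0)"

text \<open>On a triangle, which is contractible, the function has a continuous logarithm. Its
  restrictions to the three sides compute the three changes of argument, and these add up to zero
  around the triangle.\<close>

lemma wind_cocycle:
 assumes \<zeta>: "continuous_map X euclidean \<zeta>" "\<And>x. x \<in> topspace X \<Longrightarrow> \<zeta> x \<noteq> 0" and \<sigma>: "ssx 2 X \<sigma>"
 shows "cobd 2 (wind \<zeta>) \<sigma> = 0"
proof -
 define T where "T = {z. 0 \<le> Re z \<and> 0 \<le> Im z \<and> Re z + Im z \<le> 1}"
 have triT: "tri z \<in> standard_simplex 2" if "z \<in> T" for z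
  by (rule standard_simplexI) (use that in \<open>auto simp: tri_def T_def eval_nat_numeral\<close>)
 have "continuous_on T tri"
 proof (rule continuous_on_coordinatewise_then_product)
  fix i show "continuous_on T (\<lambda>z. tri z i)"
   by (cases "i = 0"; cases "i = 1"; cases "i = 2") (auto simp: tri_def intro!: continuous_intros)
 qed
 then have cont: "continuous_on T (\<lambda>z. \<zeta> (\<sigma> (tri z)))"
  using continuous_on_compose2[OF simplex_comp_continuous[OF \<zeta>(1) \<sigma>]] triT by blast
 have "convex T"
  unfolding convex_def T_def
 proof (intro ballI allI impI CollectI, elim CollectE conjE, intro conjI)
  fix x y :: complex and u v :: real
  assume a: "0 \<le> u" "0 \<le> v" "u + v = 1" "0 \<le> Re x" "0 \<le> Im x" "Re x + Im x \<le> 1" "0 \<le> Re y" "0 \<le> Im y" "Re y + Im y \<le> 1"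
  show "0 \<le> Re (u *\<^sub>R x + v *\<^sub>R y)" "0 \<le> Im (u *\<^sub>R x + v *\<^sub>R y)" using a by simp_all
  have "u * (Re x + Im x) + v * (Re y + Im y) \<le> u * 1 + v * 1" using a by (intro add_mono mult_left_mono) auto
  then show "Re (u *\<^sub>R x + v *\<^sub>R y) + Im (u *\<^sub>R x + v *\<^sub>R y) \<le> 1" using a by (simp add: algebra_simps)
 qed
 then have "contractible T" by (rule convex_imp_contractible)
 then obtain G where G: "continuous_on T G" "\<And>z. z \<in> T \<Longrightarrow> \<zeta> (\<sigma> (tri z)) = exp (G z)"
  using continuous_logarithm_on_contractible[OF cont] \<zeta>(2) simplex_range[OF \<sigma> triT] by metis
 have face: "wind \<zeta> (singular_face 2 k \<sigma>) = Im (G (z 1) - G (z 0))"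
  if z: "continuous_on {0..1} z" "\<And>t. t \<in> {0..1} \<Longrightarrow> z t \<in> T \<and> tri (z t) = simplical_face k (edge t)" for k z
 proof -
  have "is_lift \<zeta> (singular_face 2 k \<sigma>) (\<lambda>t. G (z t))"
   unfolding is_lift_def
  proof (intro conjI ballI)
   show "continuous_on {0..1} (\<lambda>t. G (z t))" by (rule continuous_on_compose2[OF G(1) z(1)]) (use z(2) in blast)
   fix t :: real assume t: "t \<in> {0..1}"
   have "edge t \<in> standard_simplex 1" by (rule standard_simplexI) (use t in \<open>auto simp: edge_def\<close>)
   then have "singular_face 2 k \<sigma> (edge t) = \<sigma> (simplical_face k (edge t))" by (simp add: singular_face_def)
   then show "exp (G (z t)) = \<zeta> (singular_face 2 k \<sigma> (edge t))" using G(2)[of "z t"] z(2)[OF t] by simp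
  qed
  then show ?thesis by (rule wind_eq)
 qed
 have "wind \<zeta> (singular_face 2 0 \<sigma>) = Im (G (Complex (1 - 1) 1) - G (Complex (1 - 0) 0))"
  by (rule face[where z = "\<lambda>t. Complex (1 - t) t"])
   (auto simp: T_def tri_def simplical_face_def edge_def fun_eq_iff Complex_eq intro!: continuous_intros)
 moreover have "wind \<zeta> (singular_face 2 1 \<sigma>) = Im (G (Complex 0 1) - G (Complex 0 0))"
  by (rule face[where z = "\<lambda>t. Complex 0 t"])
   (auto simp: T_def tri_def simplical_face_def edge_def fun_eq_iff Complex_eq intro!: continuous_intros)
 moreover have "wind \<zeta> (singular_face 2 2 \<sigma>) = Im (G (Complex 1 0) - G (Complex 0 0))"
  by (rule face[where z = "\<lambda>t. Complex t 0"])
   (auto simp: T_def tri_def simplical_face_def edge_def fun_eq_iff Complex_eq intro!: continuous_intros)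
 ultimately show ?thesis by (simp add: cobd_def eval_nat_numeral)
qed

section \<open>The circle, the disk and the Moebius band\<close>

abbreviation Ftop :: "(nat \<Rightarrow> real) topology" where "Ftop \<equiv> top_of_set (band {1/2})"
abbreviation Dtop :: "(nat \<Rightarrow> real) topology" where "Dtop \<equiv> top_of_set (band {1/2..1})"
abbreviation Btop :: "(nat \<Rightarrow> real) topology" where "Btop \<equiv> top_of_set (band {0..1/2})"

lemma circle_homeo: "Ftop homeomorphic_space (nsphere 1)"
proof -
 let ?S = "{x \<in> eucl 2. (x 0)^2 + (x 1)^2 = (1::real)}"
 have ns: "nsphere 1 = top_of_set ?S"
 proof -
  have i: "(1::nat) < i \<longleftrightarrow> 2 \<le> i" for i by auto
  show ?thesis unfolding nsphere powertop_euclidean i by (simp add: conj_commute)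
 qed
 define u where "u P = tup [2 * P 4, 2 * P 5]" for P :: "nat \<Rightarrow> real"
 define v where "v x = ver (x 0 / sqrt 2) (x 1 / sqrt 2) (1 / sqrt 2)" for x :: "nat \<Rightarrow> real"
 have sq: "sqrt 2 * sqrt 2 = (2::real)" by simp
 have u: "u P \<in> ?S" "v (u P) = P" if P: "P \<in> band {1/2}" for P
 proof -
  obtain x y z where "P = ver x y z" "x^2 + y^2 + z^2 = 1" "z > 0"
   using RP2_pos(1)[of P] P by (auto simp: band_def)
  moreover from this have "z^2 = 1/2" using P by (auto simp: band_def)
  ultimately have xyz: "P = ver x y z" "x^2 + y^2 = 1/2" "z = 1 / sqrt 2"
   using real_sqrt_unique[of z "1/2"] by (simp_all add: real_sqrt_divide)
  have "(2 * (x * z))^2 + (2 * (y * z))^2 = 4 * z^2 * (x^2 + y^2)" by (simp add: power2_eq_square algebra_simps)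
  also have "\<dots> = 1" using xyz by (simp add: power_divide)
  finally show "u P \<in> ?S" unfolding u_def xyz(1) by (simp add: tup_def)
  have "2 * (x * z) / sqrt 2 = x" "2 * (y * z) / sqrt 2 = y" unfolding xyz(3) by simp_all
  then show "v (u P) = P" unfolding u_def v_def xyz(1) using xyz(3) by simp
 qed
 have v: "v x \<in> band {1/2}" "u (v x) = x" if x: "x \<in> ?S" for x
 proof -
  have "(x 0 / sqrt 2)^2 + (x 1 / sqrt 2)^2 + (1 / sqrt 2)^2 = 1" using x by (simp add: power_divide add_divide_distrib[symmetric])
  then have "v x \<in> RP2" unfolding v_def by (rule verI)
  then show "v x \<in> band {1/2}" by (simp add: band_def v_def power_divide)
  have "u (v x) = tup [x 0, x 1]" by (simp add: u_def v_def)
  also have "\<dots> = x" using eucl_2[of x] x by simp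
  finally show "u (v x) = x" .
 qed
 have cu: "continuous_on (band {1/2}) u" unfolding u_def[abs_def]
  by (intro continuous_on_tup_Cons continuous_on_tup_Nil continuous_intros continuous_on_subset[OF continuous_on_product_coordinates subset_UNIV])
 have cv: "continuous_on ?S v" unfolding v_def[abs_def] ver_def
  by (intro continuous_on_tup_Cons continuous_on_tup_Nil continuous_intros continuous_on_subset[OF continuous_on_product_coordinates subset_UNIV]) simp_all
 have "homeomorphic_maps Ftop (top_of_set ?S) u v"
  unfolding homeomorphic_maps_def using cu cv u v by (auto simp: continuous_map_in_subtopology)
 then show ?thesis unfolding ns homeomorphic_space_def by blast
qed

lemma circle_path_connected: "path_connected_space Ftop"
 unfolding path_connected_space_def
proof (intro ballI)
 fix x y assume "x \<in> topspace Ftop" "y \<in> topspace Ftop"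
 then have xy: "x \<in> RP2" "x 2 = 1/2" "y \<in> RP2" "y 2 = 1/2" by (auto simp: band_def)
 obtain a where a: "x = polar (1/2) a" using polar_surj[OF xy(1)] xy(2) by metis
 obtain b where b: "y = polar (1/2) b" using polar_surj[OF xy(3)] xy(4) by metis
 define g where "g t = polar (1/2) ((1 - t) * a + t * b)" for t :: real
 have "continuous_on {0..1} g"
  unfolding g_def[abs_def] polar_def ver_def by (intro continuous_on_tup_Cons continuous_on_tup_Nil continuous_intros)
 moreover have "g t \<in> band {1/2}" for t using polar_in[of "1/2"] by (simp add: g_def band_def)
 ultimately have "pathin Ftop g" unfolding pathin_def by (simp add: continuous_map_in_subtopology image_subset_iff_funcset)
 then show "\<exists>g. pathin Ftop g \<and> g 0 = x \<and> g 1 = y" using a b by (intro exI[of _ g]) (simp add: g_def)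
qed

text \<open>In the affine chart at the top, the part above the level is a round disk around the origin,
  which is contracted by scaling.\<close>

lemma disk_contractible: "contractible_space Dtop"
proof -
 define h where "h = (\<lambda>(s::real, P::nat \<Rightarrow> real). aff_inv 2 (tup [(1 - s) * (P 4 / P 2), (1 - s) * (P 5 / P 2)]))"
 have in_D: "h (s, P) \<in> band {1/2..1}" if s: "s \<in> {0..1}" and P: "P \<in> band {1/2..1}" for s P
 proof -
  let ?X = "P 4 / P 2" and ?Y = "P 5 / P 2"
  have PR: "P \<in> RP2" "P 2 \<ge> 1/2" using P by (auto simp: band_def)
  have e: "P = aff_inv 2 (tup [?X, ?Y])" using aff_inv_aff[OF PR(1), of 2] PR(2) by (simp add: aff_def)
  have "P 2 = aff_height 2 (tup [?X, ?Y])" using arg_cong[OF e, of "\<lambda>P. P 2"] aff_inv_height[of 2 "tup [?X, ?Y]"] by simp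
  then have "P 2 = 1 / (1 + ?X^2 + ?Y^2)" by (simp add: aff_height_def)
  moreover have "a * b = 1" if "a = 1 / b" "0 < b" for a b :: real using that by simp
  ultimately have "P 2 * (1 + ?X^2 + ?Y^2) = 1" using one_plus_pos[of ?X ?Y] by blast
  moreover have "1/2 * (1 + ?X^2 + ?Y^2) \<le> P 2 * (1 + ?X^2 + ?Y^2)" using PR(2) one_plus_pos[of ?X ?Y] by (intro mult_right_mono) simp_all
  ultimately have XY: "?X^2 + ?Y^2 \<le> 1" by simp
  have "((1 - s) * ?X)^2 + ((1 - s) * ?Y)^2 = (1 - s)^2 * (?X^2 + ?Y^2)" by (simp add: power_mult_distrib power_divide distrib_left)
  also have "\<dots> \<le> 1 * 1" using s XY by (intro mult_mono) (auto simp: power_le_one)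
  finally have le: "((1 - s) * ?X)^2 + ((1 - s) * ?Y)^2 \<le> 1" by simp
  have "h (s, P) 2 = 1 / (1 + ((1 - s) * ?X)^2 + ((1 - s) * ?Y)^2)"
   using aff_inv_height[of 2 "tup [(1 - s) * ?X, (1 - s) * ?Y]"] by (simp add: h_def aff_height_def)
  moreover have "1 / (1 + u + w) \<ge> 1/2" if "u + w \<le> 1" "0 < 1 + u + w" for u w :: real using that by (simp add: field_simps)
  ultimately have "h (s, P) 2 \<ge> 1/2" using le one_plus_pos[of "(1 - s) * ?X" "(1 - s) * ?Y"] by simp
  moreover have "h (s, P) \<in> RP2" unfolding h_def prod.case by (rule aff_inv_in)
  ultimately show ?thesis using RP2_bounds[of "h (s, P)"] by (simp add: band_def)
 qed
 have pos: "P 2 \<noteq> 0" if "P \<in> band {1/2..1}" for P using that by (auto simp: band_def)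
 have cy: "continuous_on ({0..1} \<times> band {1/2..1}) (\<lambda>z::real \<times> (nat \<Rightarrow> real). tup [(1 - fst z) * (snd z 4 / snd z 2), (1 - fst z) * (snd z 5 / snd z 2)])"
  by (intro continuous_on_tup_Cons continuous_on_tup_Nil continuous_intros
    continuous_on_compose2[OF continuous_on_product_coordinates continuous_on_snd[OF continuous_on_id] subset_UNIV])
   (use pos in auto)
 have ca: "continuous_on UNIV (aff_inv 2)" by (rule sm_isCont_vec) (rule sm_aff_inv)
 have "h = (\<lambda>z. aff_inv 2 (tup [(1 - fst z) * (snd z 4 / snd z 2), (1 - fst z) * (snd z 5 / snd z 2)]))"
  by (simp add: h_def case_prod_beta')
 then have "continuous_on ({0..1} \<times> band {1/2..1}) h" using continuous_on_compose2[OF ca cy subset_UNIV] by simp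
 then have ch: "continuous_map (prod_topology (top_of_set {0..1}) Dtop) Dtop h"
  unfolding prod_topology_subtopology_eu using in_D by (auto simp: continuous_map_in_subtopology)
 have h0: "h (0, P) = P" if "P \<in> band {1/2..1}" for P
  using aff_inv_aff[of P 2] that by (auto simp: h_def aff_def band_def)
 define Q where "Q = aff_inv 2 (tup [0, 0])"
 define k where "k = (\<lambda>(s::real, P). if s = 0 then P else h (s, P))"
 have hk: "h z = k z" if "z \<in> {0..1} \<times> band {1/2..1}" for z using that h0 by (auto simp: k_def)
 have ck: "continuous_map (prod_topology (top_of_set {0..1}) Dtop) Dtop k"
  by (rule continuous_map_eq[OF ch]) (use hk in simp)
 have "homotopic_with (\<lambda>x. True) Dtop Dtop id (\<lambda>x. Q)"
  unfolding homotopic_with_def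
  by (rule exI[of _ k]) (use ck in \<open>simp add: k_def h_def Q_def\<close>)
 then show ?thesis unfolding contractible_space_def by blast
qed

text \<open>The square of the complex number \<open>x + i y\<close>. It takes the same value at antipodal points and
  vanishes only at the top, so that it is a nowhere zero function on the Moebius band.\<close>

definition zeta :: "(nat \<Rightarrow> real) \<Rightarrow> complex" where "zeta P = Complex (P 0 - P 1) (2 * P 3)"

lemma zeta_nonzero: "P \<in> band {0..1/2} \<Longrightarrow> zeta P \<noteq> 0"
proof
 assume P: "P \<in> band {0..1/2}" and z: "zeta P = 0"
 obtain x y z where xyz: "P = ver x y z" "x^2 + y^2 + z^2 = 1" using P by (auto simp: band_def elim: RP2E)
 have "x^2 = y^2" "x * y = 0" using z by (simp_all add: zeta_def xyz complex_eq_iff)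
 then have "x = 0" "y = 0" by auto
 then show False using xyz P by (simp add: band_def)
qed

lemma continuous_zeta: "continuous_map (top_of_set S) euclidean zeta"
proof -
 have "continuous_on S zeta" unfolding zeta_def[abs_def] Complex_eq
  by (intro continuous_intros continuous_on_subset[OF continuous_on_product_coordinates subset_UNIV])
 then show ?thesis by simp
qed

lemma ssx_mono: "S \<subseteq> T \<Longrightarrow> ssx p (top_of_set S) \<sigma> \<Longrightarrow> ssx p (top_of_set T) \<sigma>"
 by (auto simp: singular_simplex_def continuous_map_in_subtopology)

lemma bdr_mono:
 assumes "S \<subseteq> T" shows "bdr p (top_of_set S) \<subseteq> bdr p (top_of_set T)"
 unfolding bdr_eq by (rule image_mono, rule chains_mono, rule ssx_mono[OF assms])

lemma FB: "band {1/2} \<subseteq> band {0..1/2}" and FD: "band {1/2} \<subseteq> band {1/2..1}"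
 by (auto simp: band_def)

lemma wind_closed: "ssx 2 Btop \<sigma> \<Longrightarrow> cobd 2 (wind zeta) \<sigma> = 0"
 by (rule wind_cocycle[OF continuous_zeta]) (use zeta_nonzero in auto)

definition loop :: "(nat \<Rightarrow> real) \<Rightarrow> nat \<Rightarrow> real" where
 "loop = restrict (\<lambda>x. polar (1/2) (2 * pi * x 1)) (standard_simplex 1)"

lemma loop_cycle: "rl (frag_of loop) \<in> cyc 1 Ftop"
proof -
 have "continuous_on (standard_simplex 1) (\<lambda>x. polar (1/2) (2 * pi * x 1))"
  unfolding polar_def ver_def
  by (intro continuous_on_tup_Cons continuous_on_tup_Nil continuous_intros continuous_on_subset[OF continuous_on_product_coordinates subset_UNIV])
 then have "continuous_map (top_of_set (standard_simplex 1)) Ftop (\<lambda>x. polar (1/2) (2 * pi * x 1))"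
  using polar_in[of "1/2"] by (auto simp: continuous_map_in_subtopology band_def)
 then have "continuous_map (top_of_set (standard_simplex 1)) Ftop loop"
  by (rule continuous_map_eq) (simp add: loop_def)
 then have s: "ssx 1 Ftop loop" by (simp add: singular_simplex_def euclidean_product_topology loop_def)
 define v where "v = (\<lambda>j::nat. if j = 0 then 1 else (0::real))"
 have S0: "standard_simplex 0 = {v}" by (simp add: standard_simplex_0 v_def)
 have "singular_face 1 0 loop = singular_face 1 1 loop"
 proof (rule extensionalityI[of _ "standard_simplex 0"])
  fix x assume x: "x \<in> standard_simplex 0"
  then have xv: "x = v" using S0 by simp
  have "simplical_face k v \<in> standard_simplex (Suc 0)" if "k \<le> 1" for k using face_in[of v 0 k] that S0 by simp
  from this[of 0] this[of 1] show "singular_face 1 0 loop x = singular_face 1 1 loop x"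
   using x by (simp add: xv singular_face_def loop_def) (simp add: simplical_face_def v_def polar_def)
 qed (simp_all add: singular_face_def)
 then have "chain_boundary 1 (frag_of loop) = 0" by (simp add: chain_boundary_of)
 then have "singular_relcycle 1 Ftop {} (frag_of loop)" using s by (simp add: singular_cycle singular_chain_of)
 then show ?thesis by (rule rl_cycle)
qed

text \<open>The loop goes once around the level circle, whose points are given by angles up to 2 \<pi>; the
  function doubles the angle.\<close>

lemma wind_loop: "wind zeta loop = 4 * pi"
proof -
 define L where "L t = Complex (ln (1/2)) (4 * pi * t)" for t :: real
 have "is_lift zeta loop L"
  unfolding is_lift_def
 proof (intro conjI ballI)
  show "continuous_on {0..1} L" unfolding L_def[abs_def] Complex_eq by (intro continuous_intros)
  fix t :: real assume t: "t \<in> {0..1}"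
  have "edge t \<in> standard_simplex 1" by (rule standard_simplexI) (use t in \<open>auto simp: edge_def\<close>)
  then have l: "loop (edge t) = polar (1/2) (2 * pi * t)" by (simp add: loop_def edge_def)
  define r where "r = sqrt (1 - 1/2 :: real)"
  define c where "c = cos (2 * pi * t)"
  define u where "u = sin (2 * pi * t)"
  have rr: "r * r = 1/2" by (simp add: r_def)
  have "zeta (loop (edge t)) = Complex ((r * c)^2 - (r * u)^2) (2 * ((r * c) * (r * u)))"
   unfolding l by (simp only: zeta_def polar_def ver_simps r_def c_def u_def)
  also have "(r * c)^2 - (r * u)^2 = (r * r) * (c^2 - u^2)" by (simp add: power2_eq_square algebra_simps)
  also have "2 * ((r * c) * (r * u)) = (r * r) * (2 * u * c)" by simp
  finally have "zeta (loop (edge t)) = Complex (1/2 * ((cos (2 * pi * t))^2 - (sin (2 * pi * t))^2)) (1/2 * (2 * sin (2 * pi * t) * cos (2 * pi * t)))"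
   unfolding rr c_def u_def .
  also have "\<dots> = Complex (1/2 * cos (2 * (2 * pi * t))) (1/2 * sin (2 * (2 * pi * t)))"
   by (simp only: cos_double sin_double)
  also have "\<dots> = exp (L t)" by (simp add: L_def complex_eq_iff Re_exp Im_exp exp_ln mult.assoc)
  finally show "exp (L t) = zeta (loop (edge t))" by simp
 qed
 from wind_eq[OF this] show ?thesis by (simp add: L_def)
qed

text \<open>The value on the loop is not zero, and the loop is a multiple of the generator up to a
  boundary, on which a cocycle vanishes.\<close>

lemma circle_generator:
 "\<exists>g. g \<in> cyc 1 Ftop \<and> (\<forall>c \<in> cyc 1 Ftop. \<exists>r. (\<lambda>s. c s - r * g s) \<in> bdr 1 Ftop) \<and> evaluate RR (wind zeta) g \<noteq> 0"
proof -
 have cg: "cyclic_group (homology_group (int 1) Ftop)" using circle_homology(1)[OF circle_homeo] by simp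
 show ?thesis
 proof (rule cyclic_homology_cycles[OF cg])
  fix z assume z: "singular_relcycle 1 Ftop {} z"
   and gen: "\<And>y. singular_relcycle 1 Ftop {} y \<Longrightarrow> \<exists>k. homologous_rel 1 Ftop {} y (frag_cmul k z)"
  have line: "\<exists>r. (\<lambda>s. c s - r * rl z s) \<in> bdr 1 Ftop" if "c \<in> cyc 1 Ftop" for c
   by (rule cyc_generated[OF gen that])
  obtain r where r: "(\<lambda>s. rl (frag_of loop) s - r * rl z s) \<in> bdr 1 Ftop" using line[OF loop_cycle] by (rule exE)
  have e0: "evaluate RR (wind zeta) (\<lambda>s. rl (frag_of loop) s - r * rl z s) = 0"
   by (rule evaluate_bdr[OF _ r]) (use wind_closed ssx_mono[OF FB] in \<open>simp add: numeral_2_eq_2\<close>)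
  have f: "finite (supp (\<lambda>s. (- r) * rl z s))" by (rule finite_subset[OF _ finite_supp_rl[of z]]) auto
  have "evaluate RR (wind zeta) (\<lambda>s. rl (frag_of loop) s + (- r) * rl z s) = wind zeta loop + (- r) * evaluate RR (wind zeta) (rl z)"
   unfolding evaluate_add[OF finite_supp_rl f] evaluate_scale[OF finite_supp_rl] evaluate_of ..
  then have "4 * pi = r * evaluate RR (wind zeta) (rl z)" using e0 by (simp add: wind_loop)
  then have "evaluate RR (wind zeta) (rl z) \<noteq> 0" by auto
  then show ?thesis using rl_cycle[OF z] line by (intro exI[of _ "rl z"]) simp
 qed
qed

lemma circle_instance: "\<exists>g. circle_like Ftop g (\<lambda>\<sigma>. wind zeta \<sigma> / evaluate RR (wind zeta) g) \<and> evaluate RR (wind zeta) g \<noteq> 0"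
proof -
 obtain g where g: "g \<in> cyc 1 Ftop" "\<forall>c \<in> cyc 1 Ftop. \<exists>r. (\<lambda>s. c s - r * g s) \<in> bdr 1 Ftop" "evaluate RR (wind zeta) g \<noteq> 0"
  using circle_generator by blast
 have "circle_like Ftop g (\<lambda>\<sigma>. wind zeta \<sigma> / evaluate RR (wind zeta) g)"
 proof
  show "path_connected_space Ftop" by (rule circle_path_connected)
  show "topspace Ftop \<noteq> {}" using band_nonempty[of "1/2" "{1/2}"] by simp
  show "cyc p Ftop \<subseteq> bdr p Ftop" if "2 \<le> p" for p
   by (rule cyc_trivial, rule trivial_homology_cycles[OF circle_homology(2)[OF circle_homeo that]])
  show "cobd 2 (\<lambda>\<sigma>. wind zeta \<sigma> / evaluate RR (wind zeta) g) \<sigma> = 0" if "ssx 2 Ftop \<sigma>" for \<sigma>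
  proof -
   have "cobd 2 (\<lambda>\<sigma>. wind zeta \<sigma> / evaluate RR (wind zeta) g) \<sigma> = cobd 2 (wind zeta) \<sigma> / evaluate RR (wind zeta) g"
    by (simp add: cobd_def sum_divide_distrib)
   then show ?thesis using wind_closed[OF ssx_mono[OF FB that]] by simp
  qed
  have "evaluate RR (\<lambda>\<sigma>. wind zeta \<sigma> / k) g = evaluate RR (wind zeta) g / k" for k
   by (simp add: evaluate_def sum_divide_distrib)
  from this[of "evaluate RR (wind zeta) g"] show "evaluate RR (\<lambda>\<sigma>. wind zeta \<sigma> / evaluate RR (wind zeta) g) g = 1" using g(3) by simp
 qed (use g in auto)
 then show ?thesis using g(3) by blast
qed

lemma inclusion_coset:
 assumes "S \<subseteq> T" shows "inclusion_hom RR d (top_of_set T) (coset (bdr d (top_of_set S)) c) = coset (bdr d (top_of_set T)) c"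
proof -
 interpret T: fn_quotient "cyc d (top_of_set T)" "bdr d (top_of_set T)" by (rule homology_quotient)
 interpret S: fn_quotient "cyc d (top_of_set S)" "bdr d (top_of_set S)" by (rule homology_quotient)
 have eq: "coset (bdr d (top_of_set T)) c' = coset (bdr d (top_of_set T)) c" if c': "c' \<in> coset (bdr d (top_of_set S)) c" for c'
 proof -
  have "(\<lambda>s. c' s - c s) \<in> bdr d (top_of_set S)" using S.mem_coset[OF c'] unfolding S.coset_eq .
  then show ?thesis unfolding T.coset_eq using bdr_mono[OF assms] by (rule subsetD[rotated])
 qed
 show ?thesis unfolding inclusion_hom_def hclass_coset
 proof (intro equalityI subsetI)
  fix y assume "y \<in> (\<Union>c'\<in>coset (bdr d (top_of_set S)) c. coset (bdr d (top_of_set T)) c')"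
  then obtain c' where c': "c' \<in> coset (bdr d (top_of_set S)) c" "y \<in> coset (bdr d (top_of_set T)) c'" by (rule UN_E)
  from c'(2) show "y \<in> coset (bdr d (top_of_set T)) c" unfolding eq[OF c'(1)] .
 qed (rule UN_I[OF S.coset_self])
qed

lemma zero_hom_carrier:
 assumes "cyc d X \<subseteq> bdr d X" shows "carrier (homology_module RR d X) = {\<zero>\<^bsub>homology_module RR d X\<^esub>}"
proof -
 interpret fn_quotient "cyc d X" "bdr d X" by (rule homology_quotient)
 have eq: "coset (bdr d X) c = bdr d X" if "c \<in> cyc d X" for c
  unfolding coset_eq_zero using assms that by (rule subsetD)
 have z: "(\<lambda>_. 0) \<in> cyc d X" by (rule fn_subspaceD(1)[OF cyc_sub])
 show ?thesis unfolding homology_module_eq Q_carrier Q_zero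
 proof (intro equalityI subsetI)
  fix y assume "y \<in> coset (bdr d X) ` cyc d X"
  then obtain c where c: "y = coset (bdr d X) c" "c \<in> cyc d X" by (rule imageE)
  show "y \<in> {coset (bdr d X) (\<lambda>s. 0)}" unfolding c(1) eq[OF c(2)] eq[OF z] by simp
 next
  fix y assume "y \<in> {coset (bdr d X) (\<lambda>s. 0)}"
  then have "y = coset (bdr d X) (\<lambda>s. 0)" by simp
  then show "y \<in> coset (bdr d X) ` cyc d X" using z by (rule image_eqI)
 qed
qed

lemma homology_zero: "\<zero>\<^bsub>homology_module RR d X\<^esub> = bdr d X"
 by (simp add: homology_module_eq quotient_module_def)

lemma homology_carrier: "carrier (homology_module RR d X) = coset (bdr d X) ` cyc d X"
proof -
 interpret fn_quotient "cyc d X" "bdr d X" by (rule homology_quotient)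
 show ?thesis unfolding homology_module_eq by (rule Q_carrier)
qed

lemma homology_span_empty: "module.span RR (homology_module RR d X) {} = {\<zero>\<^bsub>homology_module RR d X\<^esub>}"
proof -
 interpret fn_quotient "cyc d X" "bdr d X" by (rule homology_quotient)
 show ?thesis unfolding homology_module_eq by (rule span_empty)
qed

lemma homology_coset:
 "coset (bdr d X) c = coset (bdr d X) c' \<longleftrightarrow> (\<lambda>s. c s - c' s) \<in> bdr d X"
 "coset (bdr d X) c = bdr d X \<longleftrightarrow> c \<in> bdr d X" "coset (bdr d X) (\<lambda>s. 0) = bdr d X"
proof -
 interpret fn_quotient "cyc d X" "bdr d X" by (rule homology_quotient)
 show "coset (bdr d X) c = coset (bdr d X) c' \<longleftrightarrow> (\<lambda>s. c s - c' s) \<in> bdr d X"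
  by (rule coset_eq)
 show "coset (bdr d X) c = bdr d X \<longleftrightarrow> c \<in> bdr d X" by (rule coset_eq_zero)
 show "coset (bdr d X) (\<lambda>s. 0) = bdr d X" by (rule coset_zero)
qed

section \<open>The counterexample\<close>

lemma height_connected_fibres: "\<forall>p\<in>mfd_boundary Wm. connectedin (mtop Mm) (preimage_mfd Mm ht {p})"
proof
 fix p assume "p \<in> mfd_boundary Wm"
 then obtain b where b: "p = coord b" "b \<in> {0, 1}" by (auto simp: W_boundary)
 have "preimage_mfd Mm ht {p} = band {b}" using preimage_ht[of "{b}"] b(1) by simp
 moreover have "connected (band {b})" by (rule connected_band) (use b in auto)
 ultimately show "connectedin (mtop Mm) (preimage_mfd Mm ht {p})"
  using band_sub by (simp add: connectedin_subtopology)
qed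

text \<open>For \<open>s = 1\<close> the curve that ends under the disk, for \<open>s = -1\<close> the one that ends under the core
  of the Moebius band.\<close>

definition cone :: "real \<Rightarrow> real \<Rightarrow> nat \<Rightarrow> real" where "cone s t = coord (1/2 + s * t / 2)"

lemma ref_spaces:
 "ref_fibre Mm ht (coord (1/2)) = Ftop" "ref_target Mm ht (cone 1) = Dtop" "ref_target Mm ht (cone (-1)) = Btop"
proof -
 have c: "cone 1 ` {0..1} = coord ` {1/2..1}" "cone (-1) ` {0..1} = coord ` {0..1/2}"
 proof -
  have "cone 1 ` {0..1} = coord ` (\<lambda>t. 1/2 + t / 2) ` {0..1}" by (simp add: cone_def image_image)
  also have "(\<lambda>t. 1/2 + t / 2) ` {0..1} = {1/2..1::real}"
  proof (intro equalityI subsetI)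
   fix x :: real assume "x \<in> {1/2..1}" then show "x \<in> (\<lambda>t. 1/2 + t / 2) ` {0..1}" by (intro image_eqI[of _ _ "2 * x - 1"]) (auto simp: diff_divide_distrib)
  qed auto
  finally show "cone 1 ` {0..1} = coord ` {1/2..1}" .
  have "cone (-1) ` {0..1} = coord ` (\<lambda>t. 1/2 - t / 2) ` {0..1}" by (simp add: cone_def image_image)
  also have "(\<lambda>t. 1/2 - t / 2) ` {0..1} = {0..1/2::real}"
  proof (intro equalityI subsetI)
   fix x :: real assume "x \<in> {0..1/2}" then show "x \<in> (\<lambda>t. 1/2 - t / 2) ` {0..1}" by (intro image_eqI[of _ _ "1 - 2 * x"]) (auto simp: diff_divide_distrib)
  qed auto
  finally show "cone (-1) ` {0..1} = coord ` {0..1/2}" .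
 qed
 have sub: "subtopology (mtop Mm) (band I) = top_of_set (band I)" for I
  using band_sub by (simp add: subtopology_subtopology Int_absorb1)
 show "ref_fibre Mm ht (coord (1/2)) = Ftop" unfolding ref_fibre_def using preimage_ht[of "{1/2}"] sub by (simp only: image_insert image_empty)
 show "ref_target Mm ht (cone 1) = Dtop" "ref_target Mm ht (cone (-1)) = Btop"
  unfolding ref_target_def c preimage_ht by (rule sub)+
qed

text \<open>The disk kills the generator, so it generates the kernel along the first curve, and its dual
  generates the cohomology ring of the circle. Along the second curve the kernel is zero, since the
  winding cocycle extends to the Moebius band; it is generated by the empty set, which adds no
  condition on duals. So the homomorphism along the second curve is not zero.\<close>

theorem theorem4:
 shows "\<not> (\<forall>(A :: real ring)
   (M :: (nat \<Rightarrow> real) smfd) (N :: (nat \<Rightarrow> real) smfd) f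
   (W :: (nat \<Rightarrow> real) smfd) fbar q (F :: (nat \<Rightarrow> real) smfd) w0 \<alpha>s G S \<phi>.
   principal_domain A \<and>
   sgl_structure M N f W fbar q F \<and> mdim N < mdim M \<and>
   connected_mfd F \<and>
   (\<forall>p \<in> mfd_boundary W. connectedin (mtop M) (preimage_mfd M q {p})) \<and>
   w0 \<in> mfd_interior W \<and> (\<forall>\<alpha> \<in> set \<alpha>s. reference_curve W w0 \<alpha>) \<and>
   kernel_generators_with_duals A M q w0 \<alpha>s G S \<phi> \<and>
   duals_generate_cohomology A M q w0 \<alpha>s G \<phi> \<longrightarrow>
   (\<forall>\<alpha> \<in> set \<alpha>s. \<forall>d\<ge>1. \<forall>z \<in> carrier (homology_module A d (ref_fibre M q w0)).
    reference_hom A M q \<alpha> d z = \<zero>\<^bsub>homology_module A d (ref_target M q \<alpha>)\<^esub>))"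
proof (rule notI, goal_cases)
 case 1
 obtain g where g: "circle_like Ftop g (\<lambda>\<sigma>. wind zeta \<sigma> / evaluate RR (wind zeta) g)" "evaluate RR (wind zeta) g \<noteq> 0"
  using circle_instance by blast
 interpret C: circle_like Ftop g "\<lambda>\<sigma>. wind zeta \<sigma> / evaluate RR (wind zeta) g" by (rule g(1))
 define e where "e = hclass RR 1 Ftop g"
 define G where "G i d = (if i = 0 \<and> d = 1 then {e} else {})" for i d :: nat
 define as where "as = [cone 1, cone (-1)]"
 define \<phi> where "\<phi> = (\<lambda>(d::nat) (x::(nat \<Rightarrow> real, real) cochain set). C.dual)"
 have as_nth: "as ! 0 = cone 1" "as ! 1 = cone (-1)" "length as = 2" by (simp_all add: as_def)
 note ref = ref_spaces
 have e_coset: "e = coset (bdr 1 Ftop) g" by (simp add: e_def hclass_coset)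
 have e_car: "e \<in> carrier (homology_module RR 1 Ftop)" unfolding e_coset homology_carrier using C.g by blast
 have Dzero: "inclusion_hom RR d Dtop z = \<zero>\<^bsub>homology_module RR d Dtop\<^esub>" if d: "1 \<le> d" and zc: "z \<in> carrier (homology_module RR d Ftop)" for d z
 proof -
  obtain c where c: "c \<in> cyc d Ftop" "z = coset (bdr d Ftop) c" using zc unfolding homology_carrier by (elim imageE)
  have "cyc d Ftop \<subseteq> cyc d Dtop" using chains_mono[of d Ftop Dtop] ssx_mono[OF FD] by (auto simp: cyc_eq)
  then have "c \<in> bdr d Dtop" using contractible_cycles[OF disk_contractible d] c(1) by blast
  then show ?thesis unfolding c(2) inclusion_coset[OF FD] homology_zero homology_coset(2) .
 qed
 have Binj: "r = 0" if "inclusion_hom RR 1 Btop (coset (bdr 1 Ftop) (\<lambda>s. r * g s)) = \<zero>\<^bsub>homology_module RR 1 Btop\<^esub>" for r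
 proof -
  have "(\<lambda>s. r * g s) \<in> bdr 1 Btop" using that unfolding inclusion_coset[OF FB] homology_zero homology_coset(2) .
  then have "evaluate RR (wind zeta) (\<lambda>s. r * g s) = 0"
   by (intro evaluate_bdr[of 1 Btop]) (use wind_closed in \<open>simp_all add: numeral_2_eq_2\<close>)
  then show "r = 0" using g(2) evaluate_scale[OF chains_finite[OF C.cyc1[OF C.g]], of "wind zeta" r] by simp
 qed
 have high: "carrier (homology_module RR d Ftop) = {\<zero>\<^bsub>homology_module RR d Ftop\<^esub>}" if "2 \<le> d" for d
  by (rule zero_hom_carrier[OF C.high[OF that]])
 have zero_in: "\<zero>\<^bsub>homology_module RR d Ftop\<^esub> \<in> carrier (homology_module RR d Ftop)"
  and zero_to: "inclusion_hom RR d Btop \<zero>\<^bsub>homology_module RR d Ftop\<^esub> = \<zero>\<^bsub>homology_module RR d Btop\<^esub>" for d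
 proof -
  have z: "bdr d Ftop = coset (bdr d Ftop) (\<lambda>s. 0)" by (rule homology_coset(3)[symmetric])
  show "\<zero>\<^bsub>homology_module RR d Ftop\<^esub> \<in> carrier (homology_module RR d Ftop)"
   unfolding homology_zero homology_carrier by (rule image_eqI, rule z, rule fn_subspaceD(1)[OF cyc_sub])
  show "inclusion_hom RR d Btop \<zero>\<^bsub>homology_module RR d Ftop\<^esub> = \<zero>\<^bsub>homology_module RR d Btop\<^esub>"
   unfolding homology_zero by (rule inclusion_coset[OF FB, of d "\<lambda>s. 0", unfolded homology_coset(3)])
 qed
 have allD: "{z \<in> carrier (homology_module RR d Ftop). inclusion_hom RR d Dtop z = \<zero>\<^bsub>homology_module RR d Dtop\<^esub>} = carrier (homology_module RR d Ftop)"
  if "1 \<le> d" for d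
 proof (intro equalityI subsetI)
  fix z assume "z \<in> carrier (homology_module RR d Ftop)"
  then show "z \<in> {z \<in> carrier (homology_module RR d Ftop). inclusion_hom RR d Dtop z = \<zero>\<^bsub>homology_module RR d Dtop\<^esub>}"
   by (intro CollectI conjI Dzero[OF that])
 qed (simp only: mem_Collect_eq)
 have B1: "z = \<zero>\<^bsub>homology_module RR 1 Ftop\<^esub>"
  if z: "z \<in> carrier (homology_module RR 1 Ftop)" "inclusion_hom RR 1 Btop z = \<zero>\<^bsub>homology_module RR 1 Btop\<^esub>" for z
 proof -
  obtain c where c: "c \<in> cyc 1 Ftop" "z = coset (bdr 1 Ftop) c" using z(1) unfolding homology_carrier by (elim imageE)
  obtain r where "(\<lambda>s. c s - r * g s) \<in> bdr 1 Ftop" using C.line[OF c(1)] by (rule exE)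
  then have zr: "z = coset (bdr 1 Ftop) (\<lambda>s. r * g s)" unfolding c(2) homology_coset(1) .
  have r0: "r = 0" by (rule Binj) (rule z(2)[unfolded zr])
  show ?thesis unfolding zr homology_zero r0 mult_zero_left by (rule homology_coset(3))
 qed
 have allB: "{z \<in> carrier (homology_module RR d Ftop). inclusion_hom RR d Btop z = \<zero>\<^bsub>homology_module RR d Btop\<^esub>} = {\<zero>\<^bsub>homology_module RR d Ftop\<^esub>}"
  if d: "1 \<le> d" for d
 proof (intro equalityI subsetI)
  fix z assume "z \<in> {z \<in> carrier (homology_module RR d Ftop). inclusion_hom RR d Btop z = \<zero>\<^bsub>homology_module RR d Btop\<^esub>}"
  then have z: "z \<in> carrier (homology_module RR d Ftop)" "inclusion_hom RR d Btop z = \<zero>\<^bsub>homology_module RR d Btop\<^esub>"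
   by (simp_all only: mem_Collect_eq)
  show "z \<in> {\<zero>\<^bsub>homology_module RR d Ftop\<^esub>}"
  proof (cases "d = 1")
   case True
   have "z = \<zero>\<^bsub>homology_module RR d Ftop\<^esub>" using z unfolding True by (rule B1)
   then show ?thesis by (simp only: singleton_iff)
  next
   case False
   then have d2: "2 \<le> d" using d by simp
   from z(1) show ?thesis unfolding high[OF d2] .
  qed
 next
  fix z assume "z \<in> {\<zero>\<^bsub>homology_module RR d Ftop\<^esub>}"
  then have z0: "z = \<zero>\<^bsub>homology_module RR d Ftop\<^esub>" by (rule singletonD)
  show "z \<in> {z \<in> carrier (homology_module RR d Ftop). inclusion_hom RR d Btop z = \<zero>\<^bsub>homology_module RR d Btop\<^esub>}"
   unfolding z0 by (intro CollectI conjI zero_in zero_to)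
 qed
 have kernels: "kernel_generators_with_duals RR Mm ht (coord (1/2)) as G (\<lambda>d. {e}) \<phi>"
  unfolding kernel_generators_with_duals_def Let_def ref(1) reference_hom_def
 proof (intro allI impI conjI ballI)
  fix i d :: nat assume i: "i < length as" and d: "1 \<le> d"
  show "G i d \<subseteq> carrier (homology_module RR d Ftop)" using e_car by (simp add: G_def)
  show "represents_dual RR Ftop d {e} x (\<phi> d x)" if x: "x \<in> G i d" for x
  proof -
   have "d = 1" "x = e" using x by (simp_all add: G_def split: if_splits)
   then show ?thesis using C.dual_represents by (simp only: \<phi>_def e_def)
  qed
  show "module.span RR (homology_module RR d Ftop) (G i d) =
    {z \<in> carrier (homology_module RR d Ftop). inclusion_hom RR d (ref_target Mm ht (as ! i)) z = \<zero>\<^bsub>homology_module RR d (ref_target Mm ht (as ! i))\<^esub>}"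
  proof (cases "i = 0")
   case True
   have tgt: "ref_target Mm ht (as ! i) = Dtop" unfolding True as_nth by (rule ref(2))
   show ?thesis unfolding tgt allD[OF d]
   proof (cases "d = 1")
    case d1: True
    have "G i d = {hclass RR 1 Ftop g}" using True d1 by (simp add: G_def e_def)
    then show "module.span RR (homology_module RR d Ftop) (G i d) = carrier (homology_module RR d Ftop)"
     using C.basis(2) d1 by (simp only:)
   next
    case False
    then have d2: "2 \<le> d" using d by simp
    have "G i d = {}" using False by (simp add: G_def)
    then show "module.span RR (homology_module RR d Ftop) (G i d) = carrier (homology_module RR d Ftop)"
     by (simp only: homology_span_empty high[OF d2])
   qed
  next
   case False
   then have i1: "i = 1" using i as_nth(3) by simp
   have tgt: "ref_target Mm ht (as ! i) = Btop" unfolding i1 as_nth by (rule ref(3))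
   have "G i d = {}" using False by (simp add: G_def)
   then show ?thesis unfolding tgt allB[OF d] by (simp only: homology_span_empty)
  qed
 qed
 have gen: "duals_generate_cohomology RR Mm ht (coord (1/2)) as G \<phi>"
 proof -
  have eq: "{cohclass RR Ftop (\<phi> d x) | i d x. i < length as \<and> 1 \<le> d \<and> x \<in> G i d} = {cohclass RR Ftop C.dual}"
  proof (intro equalityI subsetI)
   fix y assume "y \<in> {cohclass RR Ftop (\<phi> d x) | i d x. i < length as \<and> 1 \<le> d \<and> x \<in> G i d}"
   then have "\<exists>i d x. y = cohclass RR Ftop (\<phi> d x) \<and> i < length as \<and> 1 \<le> d \<and> x \<in> G i d" by (rule CollectD)
   then show "y \<in> {cohclass RR Ftop C.dual}" by (elim exE conjE) (simp only: \<phi>_def singleton_iff)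
  next
   fix y assume "y \<in> {cohclass RR Ftop C.dual}"
   then have y: "y = cohclass RR Ftop (\<phi> 1 e)" by (simp only: \<phi>_def singleton_iff)
   have f: "0 < length as" "1 \<le> (1::nat)" "e \<in> G 0 1" by (simp_all add: as_nth(3) G_def)
   show "y \<in> {cohclass RR Ftop (\<phi> d x) | i d x. i < length as \<and> 1 \<le> d \<and> x \<in> G i d}"
    by (rule CollectI, rule exI[of _ 0], rule exI[of _ 1], rule exI[of _ e], intro conjI, rule y, rule f(1), rule f(2), rule f(3))
  qed
  show ?thesis unfolding duals_generate_cohomology_def ref(1) eq by (rule C.dual_generates)
 qed
 have conn: "connected_mfd (circ (1/2))"
  using connected_band[of "{1/2}"] band_nonempty[of "1/2" "{1/2}"]
  by (simp add: connected_mfd_def connected_space_subtopology flip: connectedin_def)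
 have curves: "\<forall>a\<in>set as. reference_curve Wm (coord (1/2)) a"
  using height_curve[of 1] height_curve[of "-1"] by (simp add: as_def cone_def[abs_def])
 have w0: "coord (1/2) \<in> mfd_interior Wm" by (simp add: W_interior Wset_iff)
 have nz: "reference_hom RR Mm ht (cone (-1)) 1 e \<noteq> \<zero>\<^bsub>homology_module RR 1 (ref_target Mm ht (cone (-1)))\<^esub>"
  unfolding reference_hom_def ref
 proof
  assume a: "inclusion_hom RR 1 Btop e = \<zero>\<^bsub>homology_module RR 1 Btop\<^esub>"
  have "(\<lambda>s. 1 * g s) = g" by (simp only: mult_1_left)
  then have "inclusion_hom RR 1 Btop (coset (bdr 1 Ftop) (\<lambda>s. 1 * g s)) = \<zero>\<^bsub>homology_module RR 1 Btop\<^esub>"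
   using a unfolding e_coset by (simp only:)
  then have "(1::real) = 0" by (rule Binj)
  then show False by simp
 qed
 have sgl: "sgl_structure Mm (euclid_mfd 1) ht Wm id ht (circ (1/2))"
  by (rule height_sgl[OF disk_subpolyhedron mob_subpolyhedron])
 have dims: "mdim (euclid_mfd 1) < mdim Mm" by (simp add: euclid_mfd_def)
 note H = 1[THEN spec[where x = RR], THEN spec[where x = Mm], THEN spec[where x = "euclid_mfd 1"], THEN spec[where x = ht],
  THEN spec[where x = Wm], THEN spec[where x = id], THEN spec[where x = ht], THEN spec[where x = "circ (1/2)"],
  THEN spec[where x = "coord (1/2)"], THEN spec[where x = as], THEN spec[where x = G],
  THEN spec[where x = "\<lambda>d. {e}"], THEN spec[where x = \<phi>]]
 have c: "\<forall>\<alpha> \<in> set as. \<forall>d\<ge>1. \<forall>z \<in> carrier (homology_module RR d (ref_fibre Mm ht (coord (1/2)))).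
   reference_hom RR Mm ht \<alpha> d z = \<zero>\<^bsub>homology_module RR d (ref_target Mm ht \<alpha>)\<^esub>"
  by (rule H[THEN mp], intro conjI)
   (rule principal_domain_RR, rule sgl, rule dims, rule conn, rule height_connected_fibres, rule w0,
    rule curves, rule kernels, rule gen)
 have m: "cone (-1) \<in> set as" by (simp add: as_def)
 have "e \<in> carrier (homology_module RR 1 (ref_fibre Mm ht (coord (1/2))))" unfolding ref(1) by (rule e_car)
 from c[rule_format, OF m order_refl this] nz show False by contradiction
qed

end
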